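(* Let $n,s\ge 0$ be integers and let $\xi=(n+s,s,\dots,s)$ (a partition with $r$ entries). Then $W(\xi)\cong V(\xi)$ as $\mathfrak{g}_r$-modules.
   Context: $\mathfrak{g}_r=\mathfrak{gl}_r\otimes\mathbb{C}[x,y]$, with matrix units $E_{ij}$. Weyl module: $W(\xi)$ is the maximal finite-dimensional $\mathfrak{g}_r$-module generated by a vector $v_\xi$ such that for all $P\in\mathbb{C}[x,y]$: $(E_{ii}\otimes P)v_\xi=\xi_iP(0,0)v_\xi$ for all $i$, and $(E_{ij}\otimes P)v_\xi=0$ for $1\le i<j\le r$. Module $V(\xi)$ (for a partition $\xi$): $\mathbb{C}\langle\mathcal{X},\mathcal{Y}\rangle$ is the associative algebra generated by $\mathcal{X},\mathcal{Y}$ with $\mathcal{Y}\mathcal{X}-\mathcal{X}\mathcal{Y}=\mathcal{X}$; it acts on $\mathbb{C}[x,x^{-1}]$ by $\mathcal{X}=x$, $\mathcal{Y}=x\,\partial/\partial x$, preserving each $x^N\mathbb{C}[x]$. $\mathcal{G}_r=\mathfrak{gl}_r\otimes\mathbb{C}\langle\mathcal{X},\mathcal{Y}\rangle$ (Lie algebra of matrices with the commutator). $V_r=\mathbb{C}^r$ with basis $u_1,\dots,u_r$; $V_r^{(N)}=V_r\otimes(\mathbb{C}[x,x^{-1}]/x^N\mathbb{C}[x])$ is a $\mathcal{G}_r$-module with basis $u_j^i=u_j\otimes x^i$, $i<N$. $v_\xi^{(N)}=\bigwedge_{j=1}^r\bigwedge_{i=N-\xi_j}^{N-1}u_j^i\in\bigwedge^{|\xi|}V_r^{(N)}$,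 $\mathcal{V}(\xi,N)=U(\mathcal{G}_r)v_\xi^{(N)}$. $F^n\mathcal{G}_r$ is the span of $g\otimes\mathcal{X}^i\mathcal{Y}^j$ with $g\in\mathfrak{gl}_r$, $j\le n$, so $\operatorname{gr}\mathcal{G}_r=\mathfrak{g}_r$; $U^{\le m}(\mathcal{G}_r)$ is the span of products $a_1\cdots a_k$ with $a_i\in F^{m_i}\mathcal{G}_r$, $\sum m_i\le m$; $F^m\mathcal{V}(\xi,N)=U^{\le m}(\mathcal{G}_r)v_\xi^{(N)}$. Then $V(\xi)=\bigoplus_mF^m\mathcal{V}(\xi,N)/F^{m-1}\mathcal{V}(\xi,N)$, a $\mathfrak{g}_r$-module which up to isomorphism does not depend on the integer $N$. *)

theory Defs
  imports
    "Jordan_Normal_Form.VS_Connect"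
    "HOL-Library.Poly_Mapping"
    "HOL-Library.Set_Algebras"
begin

section \<open>Finitely supported functions\<close>

definition pm_scale :: "complex \<Rightarrow> ('k \<Rightarrow>\<^sub>0 complex) \<Rightarrow> ('k \<Rightarrow>\<^sub>0 complex)" where
  "pm_scale c p = Poly_Mapping.map ((*) c) p"

text \<open>The linear map on the free vector space with basis \<open>'w\<close> that takes the
  values \<open>\<phi>\<close> on the basis.\<close>

definition lin_ext :: "('w \<Rightarrow> ('k \<Rightarrow>\<^sub>0 complex)) \<Rightarrow> ('w \<Rightarrow>\<^sub>0 complex) \<Rightarrow> ('k \<Rightarrow>\<^sub>0 complex)" where
  "lin_ext \<phi> p = (\<Sum>w\<in>Poly_Mapping.keys p. pm_scale (Poly_Mapping.lookup p w) (\<phi> w))"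

lemma lookup_pm_scale [simp]:
  "Poly_Mapping.lookup (pm_scale c p) k = c * Poly_Mapping.lookup p k"
  by (simp add: pm_scale_def Poly_Mapping.map.rep_eq when_def)

lemma pm_scale_simps [simp]:
  "pm_scale c 0 = 0" "pm_scale 0 p = 0" "pm_scale 1 p = p"
  "pm_scale c (pm_scale d p) = pm_scale (c * d) p"
  "pm_scale c (Poly_Mapping.single k d) = Poly_Mapping.single k (c * d)"
  by (rule poly_mapping_eqI; simp add: lookup_single when_def)+

lemma pm_scale_add_right: "pm_scale c (p + q) = pm_scale c p + pm_scale c q"
  by (rule poly_mapping_eqI) (simp add: lookup_add algebra_simps)

lemma pm_scale_add_left: "pm_scale (c + d) p = pm_scale c p + pm_scale d p"
  by (rule poly_mapping_eqI) (simp add: lookup_add algebra_simps)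

lemma pm_scale_diff_right: "pm_scale c (p - q) = pm_scale c p - pm_scale c q"
  by (rule poly_mapping_eqI) (simp add: lookup_minus algebra_simps)

lemma pm_scale_sum: "pm_scale c (sum f S) = (\<Sum>x\<in>S. pm_scale c (f x))"
  by (induction S rule: infinite_finite_induct) (auto simp: pm_scale_add_right)

lemma pm_induct [case_names zero single add]:
  fixes p :: "'k \<Rightarrow>\<^sub>0 complex"
  assumes "P 0" "\<And>k c. P (Poly_Mapping.single k c)" "\<And>p q. P p \<Longrightarrow> P q \<Longrightarrow> P (p + q)"
  shows "P p"
proof -
  have *: "p = (\<Sum>k\<in>Poly_Mapping.keys p. Poly_Mapping.single k (Poly_Mapping.lookup p k))"
    by (rule poly_mapping_eqI)
       (auto simp: lookup_sum lookup_single when_def in_keys_iff sum.delta)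
  have "P (\<Sum>k\<in>S. Poly_Mapping.single k (Poly_Mapping.lookup p k))" if "finite S" for S
    using that by induction (auto intro: assms)
  with * show ?thesis by (metis finite_keys)
qed

lemma lin_ext_superset:
  assumes "finite S" "Poly_Mapping.keys p \<subseteq> S"
  shows "lin_ext \<phi> p = (\<Sum>w\<in>S. pm_scale (Poly_Mapping.lookup p w) (\<phi> w))"
  unfolding lin_ext_def using assms
  by (intro sum.mono_neutral_left) (auto simp: in_keys_iff)

lemma lin_ext_0 [simp]: "lin_ext \<phi> 0 = 0"
  by (simp add: lin_ext_def)

lemma lin_ext_single [simp]: "lin_ext \<phi> (Poly_Mapping.single w c) = pm_scale c (\<phi> w)"
  by (subst lin_ext_superset[of "{w}"]) auto

lemma lin_ext_add: "lin_ext \<phi> (p + q) = lin_ext \<phi> p + lin_ext \<phi> q"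
proof -
  let ?S = "Poly_Mapping.keys p \<union> Poly_Mapping.keys q"
  have "Poly_Mapping.keys (p + q) \<subseteq> ?S" by (rule keys_add)
  then show ?thesis
    by (simp add: lin_ext_superset[of ?S] lookup_add pm_scale_add_left sum.distrib)
qed

lemma lin_ext_scale: "lin_ext \<phi> (pm_scale c p) = pm_scale c (lin_ext \<phi> p)"
proof -
  have "Poly_Mapping.keys (pm_scale c p) \<subseteq> Poly_Mapping.keys p"
    by (auto simp: in_keys_iff)
  then show ?thesis
    by (simp add: lin_ext_superset[of "Poly_Mapping.keys p"] pm_scale_sum)
qed

lemma lin_ext_diff: "lin_ext \<phi> (p - q) = lin_ext \<phi> p - lin_ext \<phi> q"
  using lin_ext_add[of \<phi> "p - q" q] by simp

lemma lin_ext_fun_add: "lin_ext (\<lambda>w. \<phi> w + \<psi> w) p = lin_ext \<phi> p + lin_ext \<psi> p"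
  by (simp add: lin_ext_def pm_scale_add_right sum.distrib)

lemma lin_ext_fun_scale: "lin_ext (\<lambda>w. pm_scale c (\<phi> w)) p = pm_scale c (lin_ext \<phi> p)"
  by (simp add: lin_ext_def pm_scale_sum mult.commute)


section \<open>Free algebras and two-sided ideals\<close>

datatype 'a free_monoid = FMon (letters: "'a list")

instantiation free_monoid :: (type) monoid_add
begin

definition "0 = FMon []"

definition "u + v = FMon (letters u @ letters v)"

instance
  by standard (auto simp: zero_free_monoid_def plus_free_monoid_def)

end

lemma letters_simps [simp]: "letters 0 = []" "letters (u + v) = letters u @ letters v"
  by (auto simp: zero_free_monoid_def plus_free_monoid_def)

type_synonym 'a free_alg = "'a free_monoid \<Rightarrow>\<^sub>0 complex"

definition letter :: "'a \<Rightarrow> 'a free_alg" where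
  "letter a = Poly_Mapping.single (FMon [a]) 1"

lemma pm_scale_eq_mult:
  fixes p :: "('k::monoid_add) \<Rightarrow>\<^sub>0 complex"
  shows "pm_scale c p = Poly_Mapping.single 0 c * p"
  by (induction p rule: pm_induct) (auto simp: mult_single pm_scale_add_right algebra_simps)

lemma pm_scale_mult_left:
  fixes p :: "('k::monoid_add) \<Rightarrow>\<^sub>0 complex"
  shows "pm_scale c p * q = pm_scale c (p * q)"
  by (simp add: pm_scale_eq_mult mult.assoc)

lemma pm_scale_mult_right:
  fixes p :: "('k::monoid_add) \<Rightarrow>\<^sub>0 complex"
  shows "p * pm_scale c q = pm_scale c (p * q)"
proof -
  have "p * Poly_Mapping.single 0 c = Poly_Mapping.single 0 c * p"
    by (induction p rule: pm_induct) (auto simp: mult_single algebra_simps)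
  then show ?thesis
    by (simp add: pm_scale_eq_mult flip: mult.assoc)
qed

inductive_set two_sided_ideal :: "'a::ring_1 set \<Rightarrow> 'a set" for S where
  zero: "0 \<in> two_sided_ideal S"
| step: "x \<in> two_sided_ideal S \<Longrightarrow> s \<in> S \<Longrightarrow> x + a * s * b \<in> two_sided_ideal S"

lemma two_sided_ideal_add:
  assumes "x \<in> two_sided_ideal S" "y \<in> two_sided_ideal S"
  shows "x + y \<in> two_sided_ideal S"
  using assms(2,1)
  by induction (auto simp flip: add.assoc intro: two_sided_ideal.intros)

lemma two_sided_ideal_mult:
  assumes "x \<in> two_sided_ideal S"
  shows "c * x * d \<in> two_sided_ideal S"
  using assms
proof induction
  case zero
  show ?case by (simp add: two_sided_ideal.zero)
next
  case (step x s a b)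
  have "c * (x + a * s * b) * d = c * x * d + (c * a) * s * (b * d)"
    by (simp add: algebra_simps)
  with step show ?case by (metis two_sided_ideal.step)
qed

lemma two_sided_ideal_mult_left: "x \<in> two_sided_ideal S \<Longrightarrow> c * x \<in> two_sided_ideal S"
  using two_sided_ideal_mult[of x S c 1] by simp

lemma two_sided_ideal_mult_right: "x \<in> two_sided_ideal S \<Longrightarrow> x * c \<in> two_sided_ideal S"
  using two_sided_ideal_mult[of x S 1 c] by simp

lemma two_sided_ideal_uminus: "x \<in> two_sided_ideal S \<Longrightarrow> - x \<in> two_sided_ideal S"
  using two_sided_ideal_mult_left[of x S "-1"] by simp

lemma two_sided_ideal_base: "s \<in> S \<Longrightarrow> s \<in> two_sided_ideal S"
  using two_sided_ideal.step[OF two_sided_ideal.zero, of s S 1 1] by simp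

definition ideal_cong :: "'a::ring_1 set \<Rightarrow> 'a \<Rightarrow> 'a \<Rightarrow> bool" where
  "ideal_cong S p q \<longleftrightarrow> p - q \<in> two_sided_ideal S"

lemma equivp_ideal_cong: "equivp (ideal_cong S)"
proof (rule equivpI)
  show "reflp (ideal_cong S)"
    by (simp add: reflp_def ideal_cong_def two_sided_ideal.zero)
  show "symp (ideal_cong S)"
    unfolding symp_def ideal_cong_def
    by (metis minus_diff_eq two_sided_ideal_uminus)
  show "transp (ideal_cong S)"
    unfolding transp_def ideal_cong_def
    by (metis diff_add_cancel add_diff_eq two_sided_ideal_add)
qed

lemma ideal_cong_add:
  "ideal_cong S p p' \<Longrightarrow> ideal_cong S q q' \<Longrightarrow> ideal_cong S (p + q) (p' + q')"
  unfolding ideal_cong_def using two_sided_ideal_add[of "p - p'" S "q - q'"]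
  by (simp add: algebra_simps)

lemma ideal_cong_uminus: "ideal_cong S p p' \<Longrightarrow> ideal_cong S (- p) (- p')"
  unfolding ideal_cong_def using two_sided_ideal_uminus[of "p - p'" S] by simp

lemma ideal_cong_diff:
  "ideal_cong S p p' \<Longrightarrow> ideal_cong S q q' \<Longrightarrow> ideal_cong S (p - q) (p' - q')"
  using ideal_cong_add[of S p p' "- q" "- q'"] ideal_cong_uminus[of S q q'] by simp

lemma ideal_cong_mult:
  assumes "ideal_cong S p p'" "ideal_cong S q q'"
  shows "ideal_cong S (p * q) (p' * q')"
proof -
  have "p * q - p' * q' = (p - p') * q + p' * (q - q')"
    by (simp add: algebra_simps)
  then show ?thesis
    using assms unfolding ideal_cong_def
    by (simp add: two_sided_ideal_add two_sided_ideal_mult_left two_sided_ideal_mult_right)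
qed

lemma ideal_cong_scale:
  fixes S :: "('k::monoid_add \<Rightarrow>\<^sub>0 complex) set"
  shows "ideal_cong S p q \<Longrightarrow> ideal_cong S (pm_scale c p) (pm_scale c q)"
  unfolding ideal_cong_def
  by (simp add: pm_scale_eq_mult two_sided_ideal_mult_left flip: right_diff_distrib)


section \<open>The algebra generated by \<open>X\<close> and \<open>Y\<close> with \<open>Y X - X Y = X\<close>\<close>

datatype xy = gen_X | gen_Y

definition xy_relations :: "xy free_alg set" where
  "xy_relations =
     {letter gen_Y * letter gen_X - letter gen_X * letter gen_Y - letter gen_X}"

text \<open>Laurent polynomials are the group algebra of the integers; \<open>single i 1\<close> is the
  monomial of exponent \<open>i\<close>.  The letter \<open>X\<close> acts as multiplication by the variable and
  \<open>Y\<close> as the Euler operator \<open>x d/dx\<close>.\<close>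

type_synonym laurent = "int \<Rightarrow>\<^sub>0 complex"

fun letter_act :: "xy \<Rightarrow> laurent \<Rightarrow> laurent" where
  "letter_act gen_X f = Poly_Mapping.single 1 1 * f"
| "letter_act gen_Y f = lin_ext (\<lambda>i. Poly_Mapping.single i (of_int i)) f"

definition free_laurent_act :: "xy free_alg \<Rightarrow> laurent \<Rightarrow> laurent" where
  "free_laurent_act p f = lin_ext (\<lambda>w. foldr letter_act (letters w) f) p"

lemma letter_act_linear:
  "letter_act a (f + g) = letter_act a f + letter_act a g"
  "letter_act a (pm_scale c f) = pm_scale c (letter_act a f)"
  "letter_act a 0 = 0"
  by (cases a; simp add: lin_ext_add lin_ext_scale pm_scale_mult_right distrib_left)+

lemma word_act_linear:
  "foldr letter_act w (f + g) = foldr letter_act w f + foldr letter_act w g"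
  "foldr letter_act w (pm_scale c f) = pm_scale c (foldr letter_act w f)"
  "foldr letter_act w 0 = 0"
  by (induction w) (auto simp: letter_act_linear)

lemma free_laurent_act_linear:
  "free_laurent_act p (f + g) = free_laurent_act p f + free_laurent_act p g"
  "free_laurent_act p (pm_scale c f) = pm_scale c (free_laurent_act p f)"
  "free_laurent_act p 0 = 0"
  "free_laurent_act (p + q) f = free_laurent_act p f + free_laurent_act q f"
  "free_laurent_act (p - q) f = free_laurent_act p f - free_laurent_act q f"
  "free_laurent_act (pm_scale c p) f = pm_scale c (free_laurent_act p f)"
  "free_laurent_act 0 f = 0"
  by (simp_all add: free_laurent_act_def word_act_linear lin_ext_fun_add lin_ext_fun_scale
      lin_ext_add lin_ext_diff lin_ext_scale)
     (simp add: lin_ext_def)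

lemma free_laurent_act_letter: "free_laurent_act (letter a) f = letter_act a f"
  by (simp add: free_laurent_act_def letter_def)

lemma free_laurent_act_1: "free_laurent_act 1 f = f"
  unfolding single_one[symmetric] free_laurent_act_def by (simp del: single_one)

lemma free_laurent_act_mult:
  "free_laurent_act (p * q) f = free_laurent_act p (free_laurent_act q f)"
proof (induction p rule: pm_induct)
  case (single u c)
  show ?case
  proof (induction q rule: pm_induct)
    case (single v d)
    then show ?case
      by (simp add: mult_single free_laurent_act_def word_act_linear)
  qed (auto simp: free_laurent_act_linear distrib_left)
qed (auto simp: free_laurent_act_linear distrib_right)

lemma free_laurent_act_relation:
  assumes "p \<in> xy_relations" shows "free_laurent_act p f = 0"
proof -
  have "letter_act gen_Y (letter_act gen_X f) - letter_act gen_X (letter_act gen_Y f)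
          - letter_act gen_X f = 0"
  proof (induction f rule: pm_induct)
    case (single i c)
    have "Poly_Mapping.single (1 + i) (c * of_int (1 + i)) =
      Poly_Mapping.single (1 + i) (c * of_int i) + Poly_Mapping.single (1 + i) c"
      by (simp flip: single_add) (simp add: algebra_simps)
    then show ?case by (simp add: mult_single)
  next
    case (add f g)
    then show ?case by (simp only: letter_act_linear) (simp add: algebra_simps)
  qed simp
  with assms show ?thesis
    by (simp add: xy_relations_def free_laurent_act_linear free_laurent_act_mult
        free_laurent_act_letter)
qed

lemma free_laurent_act_ideal:
  "p \<in> two_sided_ideal xy_relations \<Longrightarrow> free_laurent_act p f = 0"
  by (induction rule: two_sided_ideal.induct)
     (simp_all add: free_laurent_act_linear free_laurent_act_mult free_laurent_act_relation)

quotient_type xy_alg = "xy free_alg" / "ideal_cong xy_relations"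
  by (rule equivp_ideal_cong)

instantiation xy_alg :: ring_1
begin

lift_definition zero_xy_alg :: xy_alg is 0 .
lift_definition one_xy_alg :: xy_alg is 1 .
lift_definition plus_xy_alg :: "xy_alg \<Rightarrow> xy_alg \<Rightarrow> xy_alg" is "(+)"
  by (rule ideal_cong_add)
lift_definition uminus_xy_alg :: "xy_alg \<Rightarrow> xy_alg" is uminus
  by (rule ideal_cong_uminus)
lift_definition minus_xy_alg :: "xy_alg \<Rightarrow> xy_alg \<Rightarrow> xy_alg" is "(-)"
  by (rule ideal_cong_diff)
lift_definition times_xy_alg :: "xy_alg \<Rightarrow> xy_alg \<Rightarrow> xy_alg" is "(*)"
  by (rule ideal_cong_mult)

instance
proof
  show "(0 :: xy_alg) \<noteq> 1"
  proof (transfer, rule notI)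
    assume "ideal_cong xy_relations 0 1"
    then have "free_laurent_act (0 - 1) (Poly_Mapping.single 0 1) = 0"
      unfolding ideal_cong_def by (rule free_laurent_act_ideal)
    then show False
      by (simp only: free_laurent_act_linear free_laurent_act_1) simp
  qed
qed (transfer; simp add: algebra_simps ideal_cong_def two_sided_ideal.zero)+

end

lift_definition xy_scale :: "complex \<Rightarrow> xy_alg \<Rightarrow> xy_alg" is pm_scale
  by (rule ideal_cong_scale)

lemma vector_space_xy_scale: "vector_space xy_scale"
  by unfold_locales
     (transfer; simp add: pm_scale_add_left pm_scale_add_right ideal_cong_def
        two_sided_ideal.zero)+

lift_definition X_elem :: xy_alg is "letter gen_X" .

lift_definition Y_elem :: xy_alg is "letter gen_Y" .

lemma XY_relation: "Y_elem * X_elem - X_elem * Y_elem = X_elem"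
  by transfer (simp add: ideal_cong_def xy_relations_def two_sided_ideal_base)

lift_definition laurent_act :: "xy_alg \<Rightarrow> laurent \<Rightarrow> laurent" is free_laurent_act
  unfolding ideal_cong_def
  using free_laurent_act_ideal free_laurent_act_linear(5) by fastforce

lemma laurent_act_linear:
  "laurent_act P (f + g) = laurent_act P f + laurent_act P g"
  "laurent_act P (pm_scale c f) = pm_scale c (laurent_act P f)"
  "laurent_act (P + Q) f = laurent_act P f + laurent_act Q f"
  "laurent_act (xy_scale c P) f = pm_scale c (laurent_act P f)"
  by (transfer; simp add: free_laurent_act_linear)+

lemma laurent_act_mult: "laurent_act (P * Q) f = laurent_act P (laurent_act Q f)"
  by transfer (rule free_laurent_act_mult)

lemma laurent_act_1: "laurent_act 1 f = f"
  by transfer (rule free_laurent_act_1)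

lemma laurent_act_generators:
  "laurent_act X_elem f = Poly_Mapping.single 1 1 * f"
  "laurent_act Y_elem (Poly_Mapping.single i c) = Poly_Mapping.single i (c * of_int i)"
  by (transfer; simp add: free_laurent_act_letter)+


text \<open>The action preserves \<open>x\<^sup>N C[x]\<close>.\<close>

lemma keys_pm_scale: "Poly_Mapping.keys (pm_scale c p) \<subseteq> Poly_Mapping.keys p"
  by (auto simp: in_keys_iff)

lemma keys_sum_subset:
  "(\<And>x. x \<in> S \<Longrightarrow> Poly_Mapping.keys (f x) \<subseteq> T) \<Longrightarrow> Poly_Mapping.keys (sum f S) \<subseteq> T"
proof (induction S rule: infinite_finite_induct)
  case (insert x S)
  then show ?case
    using subset_trans[OF keys_add[of "f x" "sum f S"]] by simp
qed auto

lemma keys_lin_ext_subset: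
  "(\<And>w. w \<in> Poly_Mapping.keys p \<Longrightarrow> Poly_Mapping.keys (\<phi> w) \<subseteq> T) \<Longrightarrow>
    Poly_Mapping.keys (lin_ext \<phi> p) \<subseteq> T"
  unfolding lin_ext_def by (rule keys_sum_subset) (rule subset_trans[OF keys_pm_scale])

lemma letter_act_preserves:
  assumes "Poly_Mapping.keys f \<subseteq> {N..}" shows "Poly_Mapping.keys (letter_act a f) \<subseteq> {N..}"
proof (cases a)
  case gen_X
  have "Poly_Mapping.keys (Poly_Mapping.single 1 1 * f) \<subseteq> {N..}"
  proof
    fix e assume "e \<in> Poly_Mapping.keys (Poly_Mapping.single 1 1 * f)"
    then obtain d where "e = 1 + d" "d \<in> Poly_Mapping.keys f"
      using keys_mult[of "Poly_Mapping.single (1::int) (1::complex)" f] by auto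
    with assms show "e \<in> {N..}" by force
  qed
  with gen_X show ?thesis by simp
next
  case gen_Y
  with assms show ?thesis
    by (simp, intro keys_lin_ext_subset) (auto simp: subset_iff)
qed

lemma laurent_act_preserves:
  assumes "Poly_Mapping.keys f \<subseteq> {N..}" shows "Poly_Mapping.keys (laurent_act P f) \<subseteq> {N..}"
proof (transfer fixing: f N)
  fix p :: "xy free_alg"
  have "Poly_Mapping.keys (foldr letter_act w f) \<subseteq> {N..}" for w
  proof (induction w)
    case (Cons a w)
    then show ?case by (simp only: foldr_Cons o_apply) (rule letter_act_preserves)
  qed (simp add: assms)
  then show "Poly_Mapping.keys (free_laurent_act p f) \<subseteq> {N..}"
    unfolding free_laurent_act_def by (rule keys_lin_ext_subset)
qed


section \<open>Exterior algebras\<close>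

text \<open>The exterior algebra of the vector space with basis \<open>'a\<close>: the quotient of the tensor
  algebra by the squares of the elements of degree one.\<close>

definition degree_one :: "('a \<Rightarrow>\<^sub>0 complex) \<Rightarrow> 'a free_alg" where
  "degree_one v = lin_ext letter v"

definition ext_relations :: "'a free_alg set" where
  "ext_relations = {degree_one v * degree_one v | v. True}"

lemma lookup_mult_0:
  fixes p q :: "'a free_alg"
  shows "Poly_Mapping.lookup (p * q) 0 = Poly_Mapping.lookup p 0 * Poly_Mapping.lookup q 0"
proof (induction p rule: pm_induct)
  case (single u c)
  show ?case
  proof (induction q rule: pm_induct)
    case (single v d)
    have "u + v = 0 \<longleftrightarrow> u = 0 \<and> v = 0"
      by (cases u; cases v) (auto simp: zero_free_monoid_def plus_free_monoid_def)
    then show ?case by (auto simp: mult_single lookup_single when_def)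
  qed (auto simp: distrib_left lookup_add)
qed (auto simp: distrib_right lookup_add)

lemma lookup_degree_one_0: "Poly_Mapping.lookup (degree_one v) 0 = 0"
proof (induction v rule: pm_induct)
  case (single a c)
  then show ?case
    by (simp add: degree_one_def letter_def lookup_single when_def zero_free_monoid_def)
qed (auto simp: degree_one_def lin_ext_add lookup_add)

lemma lookup_ext_ideal_0:
  "p \<in> two_sided_ideal ext_relations \<Longrightarrow> Poly_Mapping.lookup p 0 = 0"
  by (induction rule: two_sided_ideal.induct)
     (auto simp: ext_relations_def lookup_add lookup_mult_0 lookup_degree_one_0)

quotient_type 'a ext_alg = "'a free_alg" / "ideal_cong (ext_relations :: 'a free_alg set)"
  by (rule equivp_ideal_cong)

instantiation ext_alg :: (type) ring_1
begin

lift_definition zero_ext_alg :: "'a ext_alg" is 0 .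
lift_definition one_ext_alg :: "'a ext_alg" is 1 .
lift_definition plus_ext_alg :: "'a ext_alg \<Rightarrow> 'a ext_alg \<Rightarrow> 'a ext_alg" is "(+)"
  by (rule ideal_cong_add)
lift_definition uminus_ext_alg :: "'a ext_alg \<Rightarrow> 'a ext_alg" is uminus
  by (rule ideal_cong_uminus)
lift_definition minus_ext_alg :: "'a ext_alg \<Rightarrow> 'a ext_alg \<Rightarrow> 'a ext_alg" is "(-)"
  by (rule ideal_cong_diff)
lift_definition times_ext_alg :: "'a ext_alg \<Rightarrow> 'a ext_alg \<Rightarrow> 'a ext_alg" is "(*)"
  by (rule ideal_cong_mult)

instance
proof
  show "(0 :: 'a ext_alg) \<noteq> 1"
    by transfer (auto simp: ideal_cong_def dest: lookup_ext_ideal_0)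
qed (transfer; simp add: algebra_simps ideal_cong_def two_sided_ideal.zero)+

end

lift_definition ext_scale :: "complex \<Rightarrow> 'a ext_alg \<Rightarrow> 'a ext_alg" is pm_scale
  by (rule ideal_cong_scale)

lemma vector_space_ext_scale: "vector_space ext_scale"
  by unfold_locales
     (transfer; simp add: pm_scale_add_left pm_scale_add_right ideal_cong_def
        two_sided_ideal.zero)+

lift_definition ext_gen :: "'a \<Rightarrow> 'a ext_alg" is letter .

text \<open>A linear operator \<open>T\<close>, given by its values on the basis, acts on the exterior algebra
  as the derivation extending it: on a word it is applied to one letter at a time.\<close>

fun word_derivation :: "('a \<Rightarrow> ('a \<Rightarrow>\<^sub>0 complex)) \<Rightarrow> 'a list \<Rightarrow> 'a free_alg" where
  "word_derivation T [] = 0"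
| "word_derivation T (a # w) =
     degree_one (T a) * Poly_Mapping.single (FMon w) 1 + letter a * word_derivation T w"

definition free_derivation :: "('a \<Rightarrow> ('a \<Rightarrow>\<^sub>0 complex)) \<Rightarrow> 'a free_alg \<Rightarrow> 'a free_alg" where
  "free_derivation T p = lin_ext (\<lambda>w. word_derivation T (letters w)) p"

lemma word_derivation_append:
  "word_derivation T (u @ v) =
     word_derivation T u * Poly_Mapping.single (FMon v) 1 +
     Poly_Mapping.single (FMon u) 1 * word_derivation T v"
proof (induction u)
  case Nil
  have "Poly_Mapping.single (FMon []) 1 = (1 :: 'a free_alg)"
    by (metis single_one zero_free_monoid_def)
  then show ?case by simp
next
  case (Cons a u)
  have *: "Poly_Mapping.single (FMon (u @ v)) 1 =
      Poly_Mapping.single (FMon u) 1 * (Poly_Mapping.single (FMon v) 1 :: 'a free_alg)"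
    and **: "Poly_Mapping.single (FMon (a # u)) 1 =
      letter a * (Poly_Mapping.single (FMon u) 1 :: 'a free_alg)"
    by (simp_all add: letter_def mult_single plus_free_monoid_def)
  show ?case
    by (simp add: Cons.IH * ** algebra_simps)
qed

lemma free_derivation_linear:
  "free_derivation T (p + q) = free_derivation T p + free_derivation T q"
  "free_derivation T (p - q) = free_derivation T p - free_derivation T q"
  "free_derivation T (pm_scale c p) = pm_scale c (free_derivation T p)"
  "free_derivation T 0 = 0"
  by (simp_all add: free_derivation_def lin_ext_add lin_ext_diff lin_ext_scale)

lemma free_derivation_mult:
  "free_derivation T (p * q) = free_derivation T p * q + p * free_derivation T q"
proof (induction p rule: pm_induct)
  case (single u c)
  show ?case
  proof (induction q rule: pm_induct)
    case (single v d)
    have *: "Poly_Mapping.single w e = pm_scale e (Poly_Mapping.single (FMon (letters w)) 1)"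
      for w :: "'a free_monoid" and e
      by simp
    have "free_derivation T (Poly_Mapping.single u c * Poly_Mapping.single v d) =
      pm_scale (c * d) (word_derivation T (letters u @ letters v))"
      by (simp add: mult_single free_derivation_def)
    also have "\<dots> = pm_scale (c * d)
       (word_derivation T (letters u) * Poly_Mapping.single v 1 +
        Poly_Mapping.single u 1 * word_derivation T (letters v))"
      by (simp add: word_derivation_append)
    also have "\<dots> = pm_scale c (word_derivation T (letters u)) * pm_scale d (Poly_Mapping.single v 1) +
        pm_scale c (Poly_Mapping.single u 1) * pm_scale d (word_derivation T (letters v))"
      by (simp add: pm_scale_mult_left pm_scale_mult_right pm_scale_add_right mult.commute
          del: pm_scale_simps(5))
    finally show ?case
      by (simp add: free_derivation_def)
  qed (auto simp: free_derivation_linear algebra_simps)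
qed (auto simp: free_derivation_linear algebra_simps)

lemma free_derivation_degree_one:
  "free_derivation T (degree_one v) = degree_one (lin_ext T v)"
proof (induction v rule: pm_induct)
  case (single a c)
  have "Poly_Mapping.single (FMon []) 1 = (1 :: 'a free_alg)"
    by (metis single_one zero_free_monoid_def)
  then show ?case
    by (simp add: degree_one_def free_derivation_linear lin_ext_scale)
       (simp add: free_derivation_def letter_def degree_one_def)
qed (auto simp: degree_one_def free_derivation_linear lin_ext_add)

lemma free_derivation_ideal:
  assumes "p \<in> two_sided_ideal ext_relations"
  shows "free_derivation T p \<in> two_sided_ideal ext_relations"
  using assms
proof induction
  case zero
  show ?case by (simp add: free_derivation_linear two_sided_ideal.zero)
next
  case (step x s a b)
  then obtain v where s: "s = degree_one v * degree_one v"
    by (auto simp: ext_relations_def)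
  let ?I = "two_sided_ideal ext_relations"
  let ?w = "lin_ext T v"
  have sq: "degree_one u * degree_one u \<in> ?I" for u :: "'a \<Rightarrow>\<^sub>0 complex"
    by (rule two_sided_ideal_base) (auto simp: ext_relations_def)
  have "free_derivation T s =
      degree_one (v + ?w) * degree_one (v + ?w) +
      (- (degree_one v * degree_one v) + - (degree_one ?w * degree_one ?w))"
    unfolding s free_derivation_mult free_derivation_degree_one
    by (simp add: degree_one_def lin_ext_add algebra_simps)
  then have ds: "free_derivation T s \<in> ?I"
    by (simp only:) (intro two_sided_ideal_add two_sided_ideal_uminus sq)
  have "free_derivation T (x + a * s * b) = free_derivation T x +
      (free_derivation T a * s * b + (a * free_derivation T s * b + a * s * free_derivation T b))"
    by (simp add: free_derivation_linear free_derivation_mult algebra_simps)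
  moreover have "s \<in> ?I" using step by (intro two_sided_ideal_base)
  ultimately show ?case
    using step.IH ds by (simp only:) (intro two_sided_ideal_add two_sided_ideal_mult)
qed

lift_definition ext_derivation ::
  "('a \<Rightarrow> ('a \<Rightarrow>\<^sub>0 complex)) \<Rightarrow> 'a ext_alg \<Rightarrow> 'a ext_alg" is free_derivation
  unfolding ideal_cong_def using free_derivation_ideal
  by (metis free_derivation_linear(2))

lemma ext_derivation_mult:
  "ext_derivation T (p * q) = ext_derivation T p * q + p * ext_derivation T q"
  by transfer (simp add: free_derivation_mult ideal_cong_def two_sided_ideal.zero)


section \<open>Modules over \<open>gl\<^sub>r \<otimes> C[x,y]\<close>\<close>

text \<open>An element of \<open>C[x,y]\<close> is a polynomial in \<open>y\<close> whose coefficients are polynomials in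
  \<open>x\<close>, and \<open>gl\<^sub>r \<otimes> C[x,y]\<close> consists of the \<open>r \<times> r\<close> matrices over it, with the commutator.
  Rows and columns are numbered from 0.\<close>

type_synonym poly_xy = "complex poly poly"

record 'v gxy_module = "(complex, 'v) module" +
  act :: "poly_xy mat \<Rightarrow> 'v \<Rightarrow> 'v"

definition is_gxy_module :: "nat \<Rightarrow> 'v gxy_module \<Rightarrow> bool" where
  "is_gxy_module r M \<longleftrightarrow>
     vectorspace class_ring M \<and>
     (\<forall>A \<in> carrier_mat r r. act M A \<in> LinearCombinations.module_hom class_ring M M) \<and>
     (\<forall>A \<in> carrier_mat r r. \<forall>B \<in> carrier_mat r r. \<forall>v \<in> carrier M.
        act M (A + B) v = act M A v \<oplus>\<^bsub>M\<^esub> act M B v) \<and>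
     (\<forall>c. \<forall>A \<in> carrier_mat r r. \<forall>v \<in> carrier M.
        act M ([:[:c:]:] \<cdot>\<^sub>m A) v = c \<odot>\<^bsub>M\<^esub> act M A v) \<and>
     (\<forall>A \<in> carrier_mat r r. \<forall>B \<in> carrier_mat r r. \<forall>v \<in> carrier M.
        act M (A * B - B * A) v = act M A (act M B v) \<ominus>\<^bsub>M\<^esub> act M B (act M A v))"

definition gxy_hom :: "nat \<Rightarrow> 'v gxy_module \<Rightarrow> 'w gxy_module \<Rightarrow> ('v \<Rightarrow> 'w) set" where
  "gxy_hom r M N =
     {f \<in> LinearCombinations.module_hom class_ring M N.
        \<forall>A \<in> carrier_mat r r. \<forall>v \<in> carrier M. f (act M A v) = act N A (f v)}"

definition gxy_isomorphic :: "nat \<Rightarrow> 'v gxy_module \<Rightarrow> 'w gxy_module \<Rightarrow> bool" where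
  "gxy_isomorphic r M N \<longleftrightarrow>
     is_gxy_module r M \<and> is_gxy_module r N \<and>
     (\<exists>f \<in> gxy_hom r M N. bij_betw f (carrier M) (carrier N))"

definition gxy_generated_by :: "nat \<Rightarrow> 'v gxy_module \<Rightarrow> 'v \<Rightarrow> bool" where
  "gxy_generated_by r M v \<longleftrightarrow>
     (\<forall>S. VectorSpace.subspace class_ring S M \<and> v \<in> S \<and>
          (\<forall>A \<in> carrier_mat r r. \<forall>u \<in> S. act M A u \<in> S) \<longrightarrow> S = carrier M)"


section \<open>The Weyl module\<close>

definition E_tensor :: "nat \<Rightarrow> nat \<Rightarrow> nat \<Rightarrow> poly_xy \<Rightarrow> poly_xy mat" where
  "E_tensor r i j P = mat r r (\<lambda>(k, l). if k = i \<and> l = j then P else 0)"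

definition weyl_candidate :: "nat \<Rightarrow> nat list \<Rightarrow> 'v gxy_module \<Rightarrow> 'v \<Rightarrow> bool" where
  "weyl_candidate r \<xi> M v \<longleftrightarrow>
     is_gxy_module r M \<and> vectorspace.fin_dim class_ring M \<and>
     v \<in> carrier M \<and> gxy_generated_by r M v \<and>
     (\<forall>P. \<forall>i<r. act M (E_tensor r i i P) v =
        (of_nat (\<xi> ! i) * poly (poly P 0) 0) \<odot>\<^bsub>M\<^esub> v) \<and>
     (\<forall>P i j. i < j \<and> j < r \<longrightarrow> act M (E_tensor r i j P) v = \<zero>\<^bsub>M\<^esub>)"

text \<open>Maximality: every finite-dimensional module generated by such a vector is a quotient.
  Every finite-dimensional complex vector space is isomorphic to one whose elements are of type
  \<^typ>\<open>complex vec\<close>, so it is enough to quantify over these.\<close>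

definition is_weyl_module :: "nat \<Rightarrow> nat list \<Rightarrow> 'v gxy_module \<Rightarrow> 'v \<Rightarrow> bool" where
  "is_weyl_module r \<xi> W v \<longleftrightarrow>
     weyl_candidate r \<xi> W v \<and>
     (\<forall>(M :: complex vec gxy_module) m.
        weyl_candidate r \<xi> M m \<longrightarrow> (\<exists>f \<in> gxy_hom r W M. f v = m))"


section \<open>The module \<open>V(\<xi>)\<close>\<close>

text \<open>The pair \<open>(j, i)\<close> stands for the basis vector \<open>u\<^sub>j \<otimes> x\<^sup>i\<close>, with \<open>j < r\<close> and \<open>i < N\<close>.
  The matrix \<open>A\<close> sends \<open>u\<^sub>j \<otimes> f\<close> to the sum of the \<open>u\<^sub>k \<otimes> A\<^sub>k\<^sub>j f\<close>; discarding the exponents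
  \<open>\<ge> N\<close> is reduction modulo \<open>x\<^sup>N C[x]\<close>.  Pairs with \<open>j \<ge> r\<close> or \<open>i \<ge> N\<close> do not belong to the
  module and get the value 0.\<close>

definition V_act :: "nat \<Rightarrow> int \<Rightarrow> xy_alg mat \<Rightarrow> nat \<times> int \<Rightarrow> (nat \<times> int \<Rightarrow>\<^sub>0 complex)" where
  "V_act r N A = (\<lambda>(j, i).
     if j < r \<and> i < N then
       (\<Sum>k<r. lin_ext (\<lambda>e. if e < N then Poly_Mapping.single (k, e) 1 else 0)
          (laurent_act (A $$ (k, j)) (Poly_Mapping.single i 1)))
     else 0)"

lemma V_act_mult:
  assumes "A \<in> carrier_mat r r" "B \<in> carrier_mat r r"
  shows "lin_ext (V_act r N A) (V_act r N B (j, i)) = V_act r N (A * B) (j, i)"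
proof (cases "j < r \<and> i < N")
  case True
  define \<tau> where "\<tau> k = lin_ext (\<lambda>e. if e < N then Poly_Mapping.single (k, e) 1 else 0)"
    for k :: nat
  have \<tau>_sum: "\<tau> k (sum g S) = (\<Sum>x\<in>S. \<tau> k (g x))" for k and g :: "nat \<Rightarrow> laurent" and S
    by (induction S rule: infinite_finite_induct) (auto simp: \<tau>_def lin_ext_add)
  have \<tau>_0: "\<tau> k f = 0" if "Poly_Mapping.keys f \<subseteq> {N..}" for k f
    using that unfolding \<tau>_def lin_ext_def by (intro sum.neutral) auto
  have lin_sum: "lin_ext \<phi> (sum g S) = (\<Sum>x\<in>S. lin_ext \<phi> (g x))"
    for \<phi> :: "nat \<times> int \<Rightarrow> (nat \<times> int \<Rightarrow>\<^sub>0 complex)" and g :: "nat \<Rightarrow> _" and S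
    by (induction S rule: infinite_finite_induct) (auto simp: lin_ext_add)
  have act_sum: "laurent_act (sum g S) f = (\<Sum>x\<in>S. laurent_act (g x) f)"
    for g :: "nat \<Rightarrow> xy_alg" and S f
  proof -
    have "laurent_act 0 f = 0"
      using laurent_act_linear(3)[of 0 0 f] by simp
    then show ?thesis
      by (induction S rule: infinite_finite_induct) (simp_all add: laurent_act_linear)
  qed
  have step: "lin_ext (V_act r N A) (\<tau> l f) = (\<Sum>k<r. \<tau> k (laurent_act (A $$ (k, l)) f))"
    if "l < r" for l f
  proof (induction f rule: pm_induct)
    case zero
    have "laurent_act P 0 = 0" for P
      by transfer (simp add: free_laurent_act_linear)
    then show ?case by (simp add: \<tau>_def)
  next
    case (single e c)
    have sc: "laurent_act P (Poly_Mapping.single e c) =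
        pm_scale c (laurent_act P (Poly_Mapping.single e 1))" for P
      by (simp flip: laurent_act_linear(2))
    show ?case
    proof (cases "e < N")
      case True
      then have "lin_ext (V_act r N A) (\<tau> l (Poly_Mapping.single e c)) =
          pm_scale c (V_act r N A (l, e))"
        by (simp add: \<tau>_def)
      also have "\<dots> = (\<Sum>k<r. \<tau> k (laurent_act (A $$ (k, l)) (Poly_Mapping.single e c)))"
        unfolding sc using True that
        by (simp add: V_act_def pm_scale_sum lin_ext_scale \<tau>_def)
      finally show ?thesis .
    next
      case False
      then have "Poly_Mapping.keys (laurent_act P (Poly_Mapping.single e c)) \<subseteq> {N..}" for P
        by (intro laurent_act_preserves) auto
      then have "(\<Sum>k<r. \<tau> k (laurent_act (A $$ (k, l)) (Poly_Mapping.single e c))) = 0"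
        by (intro sum.neutral) (auto intro: \<tau>_0)
      moreover have "\<tau> l (Poly_Mapping.single e c) = 0"
        using False by (simp add: \<tau>_def)
      ultimately show ?thesis by simp
    qed
  next
    case (add p q)
    then show ?case
      by (simp add: \<tau>_def lin_ext_add laurent_act_linear sum.distrib)
  qed
  let ?x = "Poly_Mapping.single i (1::complex)"
  have "lin_ext (V_act r N A) (V_act r N B (j, i)) =
      (\<Sum>l<r. lin_ext (V_act r N A) (\<tau> l (laurent_act (B $$ (l, j)) ?x)))"
    using True by (simp add: V_act_def lin_sum \<tau>_def)
  also have "\<dots> = (\<Sum>l<r. \<Sum>k<r. \<tau> k (laurent_act (A $$ (k, l)) (laurent_act (B $$ (l, j)) ?x)))"
    by (intro sum.cong) (auto simp: step)
  also have "\<dots> = (\<Sum>k<r. \<Sum>l<r. \<tau> k (laurent_act (A $$ (k, l) * B $$ (l, j)) ?x))"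
    by (subst sum.swap) (simp add: laurent_act_mult)
  also have "\<dots> = (\<Sum>k<r. \<tau> k (laurent_act ((A * B) $$ (k, j)) ?x))"
    using assms True
    by (intro sum.cong)
       (auto simp: scalar_prod_def act_sum \<tau>_sum atLeast0LessThan)
  also have "\<dots> = V_act r N (A * B) (j, i)"
    using True by (simp add: V_act_def \<tau>_def)
  finally show ?thesis .
qed (auto simp: V_act_def)

type_synonym wedge = "(nat \<times> int) ext_alg"

definition wedge_act :: "nat \<Rightarrow> int \<Rightarrow> xy_alg mat \<Rightarrow> wedge \<Rightarrow> wedge" where
  "wedge_act r N A = ext_derivation (V_act r N A)"

definition v_xi :: "nat \<Rightarrow> nat list \<Rightarrow> int \<Rightarrow> wedge" where
  "v_xi r \<xi> N = prod_list [ext_gen (j, i). j \<leftarrow> [0..<r], i \<leftarrow> [N - int (\<xi> ! j) .. N - 1]]"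

definition filt_G :: "nat \<Rightarrow> nat \<Rightarrow> xy_alg mat set" where
  "filt_G r n =
     {A \<in> carrier_mat r r. \<forall>i<r. \<forall>j<r.
        A $$ (i, j) \<in> Modules.module.span xy_scale {X_elem ^ a * Y_elem ^ b | a b. b \<le> n}}"

text \<open>The factors of the products spanning the \<open>m\<close>-th filtration step of the enveloping algebra.\<close>

definition U_factors :: "nat \<Rightarrow> nat \<Rightarrow> xy_alg mat list set" where
  "U_factors r m = {as. \<exists>ds. list_all2 (\<lambda>a d. a \<in> filt_G r d) as ds \<and> sum_list ds \<le> m}"

definition filt_V :: "nat \<Rightarrow> nat list \<Rightarrow> int \<Rightarrow> nat \<Rightarrow> wedge set" where
  "filt_V r \<xi> N m =
     Modules.module.span ext_scale
       ((\<lambda>as. foldr (wedge_act r N) as (v_xi r \<xi> N)) ` U_factors r m)"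

definition filt_V_pred :: "nat \<Rightarrow> nat list \<Rightarrow> int \<Rightarrow> nat \<Rightarrow> wedge set" where
  "filt_V_pred r \<xi> N m = (case m of 0 \<Rightarrow> {0} | Suc k \<Rightarrow> filt_V r \<xi> N k)"

text \<open>The element of degree \<open>b\<close> (in \<open>Y\<close>) whose symbol is the part of \<open>P\<close> of degree \<open>b\<close> in \<open>y\<close>.\<close>

definition symbol_lift :: "nat \<Rightarrow> poly_xy \<Rightarrow> xy_alg" where
  "symbol_lift b P =
     (\<Sum>a\<le>degree (coeff P b). xy_scale (coeff (coeff P b) a) (X_elem ^ a * Y_elem ^ b))"

text \<open>An element of the associated graded space is a family of cosets, the \<open>m\<close>-th one in
  \<open>filt_V m / filt_V (m - 1)\<close>, almost all of them zero.  The part of degree \<open>b\<close> in \<open>y\<close> of a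
  matrix maps the component of degree \<open>m - b\<close> to that of degree \<open>m\<close>.  Sums of sets are
  elementwise; adding \<open>filt_V_pred m\<close> to a set of representatives completes it to a coset.\<close>

definition V_module :: "nat \<Rightarrow> nat list \<Rightarrow> int \<Rightarrow> (nat \<Rightarrow> wedge set) gxy_module" where
  "V_module r \<xi> N =
     \<lparr>carrier = {f. (\<forall>m. \<exists>u \<in> filt_V r \<xi> N m. f m = u +o filt_V_pred r \<xi> N m) \<and>
                    finite {m. f m \<noteq> filt_V_pred r \<xi> N m}},
      mult = undefined,
      one = undefined,
      zero = (\<lambda>m. filt_V_pred r \<xi> N m),
      add = (\<lambda>f g m. f m + g m),
      smult = (\<lambda>c f m. ext_scale c ` f m + filt_V_pred r \<xi> N m),
      act = (\<lambda>A f m.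
        (\<Sum>b\<le>m. wedge_act r N (map_mat (symbol_lift b) A) ` f (m - b))
          + filt_V_pred r \<xi> N m)\<rparr>"

end

theory Submission
  imports Defs "HOL-Combinatorics.Permutations" "HOL-Library.Product_Plus"
begin

text \<open>
  The character \<open>A \<mapsto> s tr A(0, 0)\<close> twists every candidate for the Weyl module into one of highest
  weight \<open>(n, 0, \<dots>, 0)\<close>, and in \<open>V(\<xi>)\<close> it is the contribution of the \<open>s\<close> completely filled rows of
  exponents.  After the twist both modules are quotients of the \<open>n\<close>-th tensor power of
  \<open>C\<^sup>r \<otimes> C[x, y]\<close>.  A letter \<open>(i, a, b)\<close> stands for the basis vector \<open>e\<^sub>i x\<^sup>a y\<^sup>b\<close>, and the words of \<open>n\<close>
  letters form a basis of the tensor power (\<open>word_space\<close>, \<open>word_action\<close>).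

  On the side of \<open>V(\<xi>)\<close>, the vector \<open>v\<^sub>\<xi>\<close> is a full layer wedged with \<open>n\<close> further particles, that is,
  with a Vandermonde determinant.  Acting on it only moves these particles: a word becomes the sum,
  over the permutations \<open>\<sigma>\<close>, of the states in which particle \<open>k\<close> has colour \<open>i\<^sub>k\<close> and has been moved
  from the exponent \<open>base + \<sigma> k\<close> to \<open>base + \<sigma> k + a\<^sub>k\<close>, with a coefficient
  that is \<open>sgn \<sigma>\<close> times the product of the \<open>b\<^sub>k\<close>-th powers of the eigenvalues \<open>base + \<sigma> k\<close> of \<open>Y\<close>.  The total \<open>y\<close>-degree of the words describes
  the filtration (\<open>filt_V_eq_level\<close>), so \<open>V(\<xi>)\<close> is the quotient of the word space by the
  combinations of words whose homogeneous parts fall into lower filtration steps (\<open>V_module_presented\<close>).  It is itself a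
  candidate (\<open>presented_weyl_candidate\<close>).

  On the side of an arbitrary candidate, a word is sent to the normally ordered product of the
  \<open>E\<^sub>i\<^sub>0 x\<^sup>a y\<^sup>b\<close> applied to the generator.  Such a product does not depend on the order of its factors
  (\<open>word_value_mset\<close>).  The \<open>(n+1)\<close>-st power of \<open>E\<^sub>1\<^sub>0\<close> kills the generator of a finite-dimensional
  module, which implies that all normally ordered products of \<open>n + 1\<close> factors vanish
  (\<open>normal_prod_vanishes\<close>).  Therefore the map is equivariant (\<open>act_word_value\<close>) and kills the multiples
  of the power sums \<open>\<Sum>\<^sub>k x\<^sub>k\<^sup>\<alpha> y\<^sub>k\<^sup>\<beta>\<close> with \<open>\<alpha> + \<beta> > 0\<close> (\<open>word_value_power_sum\<close>).

  It remains to see that a relation between words that holds in \<open>V(\<xi>)\<close> holds in every candidate.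
  After separating the colours this becomes a statement on polynomials in \<open>2n\<close> variables
  (\<open>orbit_kernel_vanishing\<close>): a polynomial, homogeneous in the \<open>y\<^sub>k\<close>, that acts on the Vandermonde
  vector as an element of lower degree is killed by every linear map that kills the multiples of the power sums.  The quotient by
  the power sums, the ring of diagonal coinvariants, is controlled by elementary means.  Explicit
  standard elements span it (\<open>standard_elements_span\<close>).  They are indexed by pairs \<open>(a, k)\<close> that are
  determined by the positions \<open>\<tau> i \<mapsto> i + k\<^sub>i\<close> (\<open>shifted_position_inj\<close>), and each such list of positions
  is a monomial that occurs in the orbit of the Vandermonde vector.  Counting dimensions, the values
  of the standard elements on this vector are linearly independent (\<open>orbit_values_independent\<close>), so
  nothing is lost in passing from the coinvariants to \<open>V(\<xi>)\<close>.
\<close>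

text \<open>Vectors are finitely supported functions throughout.\<close>

abbreviation single where "single \<equiv> Poly_Mapping.single"
abbreviation lookup where "lookup \<equiv> Poly_Mapping.lookup"
abbreviation keys where "keys \<equiv> Poly_Mapping.keys"

section \<open>Polynomial subalgebras and Hessenberg systems\<close>

text \<open>
  A commutative ring with a ring homomorphism \<open>sc\<close> from the complex numbers; it
  will be a polynomial ring, written as a space of finitely supported functions.
\<close>

locale complex_algebra =
  fixes sc :: "complex \<Rightarrow> 'a::comm_ring_1"
  assumes sc_1: "sc 1 = 1"
    and sc_add: "sc (c + d) = sc c + sc d"
    and sc_mult: "sc (c * d) = sc c * sc d"
begin

lemma sc_0: "sc 0 = 0"
  using sc_add[of 0 0] by simp

lemma sc_uminus: "sc (- c) = - sc c"
  using sc_add[of c "- c"] by (simp add: sc_0 eq_neg_iff_add_eq_0 add.commute)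

lemma sc_of_nat: "sc (of_nat k) = of_nat k"
  by (induction k) (auto simp: sc_0 sc_1 sc_add)

definition lin_subspace :: "'a set \<Rightarrow> bool" where
  "lin_subspace T \<longleftrightarrow> 0 \<in> T \<and> (\<forall>f\<in>T. \<forall>g\<in>T. f + g \<in> T) \<and> (\<forall>c. \<forall>f\<in>T. sc c * f \<in> T)"

lemma lin_subspaceD:
  assumes "lin_subspace T"
  shows "0 \<in> T" "f \<in> T \<Longrightarrow> g \<in> T \<Longrightarrow> f + g \<in> T" "f \<in> T \<Longrightarrow> sc c * f \<in> T"
    "f \<in> T \<Longrightarrow> - f \<in> T" "f \<in> T \<Longrightarrow> g \<in> T \<Longrightarrow> f - g \<in> T"
proof -
  have m: "- f \<in> T" if "f \<in> T" for f
    using assms that sc_uminus[of 1] unfolding lin_subspace_def sc_1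
    by (metis mult_minus1)
  show "0 \<in> T" "f \<in> T \<Longrightarrow> g \<in> T \<Longrightarrow> f + g \<in> T" "f \<in> T \<Longrightarrow> sc c * f \<in> T" "f \<in> T \<Longrightarrow> - f \<in> T"
    using assms m by (auto simp: lin_subspace_def)
  show "f \<in> T \<Longrightarrow> g \<in> T \<Longrightarrow> f - g \<in> T"
    using assms m[of g] unfolding lin_subspace_def by (metis uminus_add_conv_diff add.commute)
qed

lemma lin_subspace_sum:
  assumes "lin_subspace T" "\<And>i. i \<in> A \<Longrightarrow> f i \<in> T" shows "sum f A \<in> T"
  using assms(2) by (induction A rule: infinite_finite_induct) (auto intro: lin_subspaceD[OF assms(1)])

lemma lin_subspace_comap: "lin_subspace T \<Longrightarrow> lin_subspace {f. g * f \<in> T}"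
  unfolding lin_subspace_def by (auto simp: distrib_left mult.left_commute[of g])

lemma lin_subspace_cancel:
  assumes "lin_subspace T" "sc c * f \<in> T" "c \<noteq> 0" shows "f \<in> T"
proof -
  have "sc (1 / c) * (sc c * f) = f"
    using assms(3) by (simp add: sc_1 flip: sc_mult mult.assoc)
  then show ?thesis using lin_subspaceD(3)[OF assms(1,2), of "1 / c"] by simp
qed

inductive_set polys :: "'a set \<Rightarrow> 'a set" for S where
  const: "sc c \<in> polys S"
| gen: "s \<in> S \<Longrightarrow> s \<in> polys S"
| add: "p \<in> polys S \<Longrightarrow> q \<in> polys S \<Longrightarrow> p + q \<in> polys S"
| mult: "p \<in> polys S \<Longrightarrow> q \<in> polys S \<Longrightarrow> p * q \<in> polys S"

lemma polys_0: "0 \<in> polys S" and polys_1: "1 \<in> polys S"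
  using polys.const[of 0] polys.const[of 1] by (simp_all add: sc_0 sc_1)

lemma polys_diff: "p \<in> polys S \<Longrightarrow> q \<in> polys S \<Longrightarrow> p - q \<in> polys S"
  using polys.add[OF _ polys.mult[OF polys.const[of "-1"], of q]] by (simp add: sc_uminus sc_1)

lemma polys_sum: "(\<And>i. i \<in> A \<Longrightarrow> f i \<in> polys S) \<Longrightarrow> sum f A \<in> polys S"
  by (induction A rule: infinite_finite_induct) (auto intro: polys_0 polys.add)

lemma polys_prod: "(\<And>i. i \<in> A \<Longrightarrow> f i \<in> polys S) \<Longrightarrow> prod f A \<in> polys S"
  by (induction A rule: infinite_finite_induct) (auto intro: polys_1 polys.mult)

lemma polys_power: "p \<in> polys S \<Longrightarrow> p ^ k \<in> polys S"
  by (induction k) (auto intro: polys_1 polys.mult)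

lemma polys_mono: "S \<subseteq> S' \<Longrightarrow> polys S \<subseteq> polys S'"
proof
  fix p assume "S \<subseteq> S'" "p \<in> polys S"
  from this(2,1) show "p \<in> polys S'" by induction (auto intro: polys.intros)
qed

text \<open>Division of \<open>p\<close> by \<open>s - t\<close>, with \<open>p\<close> regarded as a polynomial in \<open>s\<close>.\<close>

lemma polys_remainder:
  assumes "p \<in> polys (insert s S)" "t \<in> polys S"
  shows "\<exists>p'\<in>polys S. \<exists>p''\<in>polys (insert s S). p = p' + (s - t) * p''"
  using assms(1)
proof induction
  case (const c)
  show ?case
    by (rule bexI[of _ "sc c"], rule bexI[of _ 0]) (auto intro: polys.const polys_0)
next
  case (gen u)
  show ?case
  proof (cases "u = s")
    case True
    with assms(2) show ?thesis
      by (intro bexI[of _ t] bexI[of _ 1]) (auto intro: polys_1)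
  next
    case False
    with gen show ?thesis
      by (intro bexI[of _ u] bexI[of _ 0]) (auto intro: polys.gen polys_0)
  qed
next
  case (add p q)
  then obtain p' p'' q' q'' where
    "p' \<in> polys S" "q' \<in> polys S" "p'' \<in> polys (insert s S)" "q'' \<in> polys (insert s S)"
    "p = p' + (s - t) * p''" "q = q' + (s - t) * q''" by blast
  then show ?case
    by (intro bexI[of _ "p' + q'"] bexI[of _ "p'' + q''"])
       (auto intro: polys.add simp: distrib_left add_ac)
next
  case (mult p q)
  then obtain p' p'' q' q'' where *:
    "p' \<in> polys S" "q' \<in> polys S" "p'' \<in> polys (insert s S)" "q'' \<in> polys (insert s S)"
    "p = p' + (s - t) * p''" "q = q' + (s - t) * q''" by blast
  have "q' \<in> polys (insert s S)" using *(2) polys_mono[of S "insert s S"] by blast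
  then have "p'' * q' + p * q'' \<in> polys (insert s S)"
    using * mult.hyps by (intro polys.add polys.mult)
  moreover have "p * q = p' * q' + (s - t) * (p'' * q' + p * q'')"
    using *(5,6) by (simp add: ring_distribs)
  ultimately show ?case using *(1,2) polys.mult by blast
qed

lemma polys_prod_diff:
  assumes "finite A" "s \<in> polys S" "t \<in> polys S" "\<And>l. l \<in> A \<Longrightarrow> z l \<in> polys S"
  shows "\<exists>d\<in>polys S. (\<Prod>l\<in>A. s - z l) - (\<Prod>l\<in>A. t - z l) = (s - t) * d"
  using assms(1,4)
proof (induction A)
  case empty
  show ?case by (intro bexI[of _ 0]) (auto intro: polys_0)
next
  case (insert a A)
  then obtain d where d: "d \<in> polys S" "(\<Prod>l\<in>A. s - z l) - (\<Prod>l\<in>A. t - z l) = (s - t) * d"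
    by auto
  have e: "(\<Prod>l\<in>A. s - z l) = (\<Prod>l\<in>A. t - z l) + (s - t) * d" using d(2) by (simp add: algebra_simps)
  have "(\<Prod>l\<in>A. t - z l) + (s - z a) * d \<in> polys S"
    using insert assms d by (intro polys.add polys.mult polys_prod polys_diff) auto
  then show ?case
    using insert.hyps by (intro bexI) (auto simp: e algebra_simps)
qed

text \<open>
  Think of \<open>T\<close> as an ideal of relations.  For each \<open>i\<close> there is one relation, the sum of the values of
  the monic polynomial \<open>\<Prod>l. z - X l\<close>, with \<open>l\<close> in the window \<open>{i<..h i}\<close>, at the points \<open>X j, \<dots>, X i\<close>.
  If the weights \<open>m k\<close> were concentrated on the last point, the relations would say that \<open>X i\<close> is a
  root of a monic polynomial of degree \<open>h i - i\<close>, and the products in the last hypothesis would be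
  the usual basis of the quotient.  In general one eliminates \<open>X j\<close> first.  Modulo \<open>T\<close>, a multiple of
  \<open>\<Prod>l=j+1..j+t. X j - X l\<close> allows to put \<open>X j\<close> equal to \<open>X (j + t + 1)\<close>, up to a multiple
  of the next such product.  Then the value at \<open>X j\<close> merges with the value at \<open>X (j + t + 1)\<close> and the
  weights \<open>m\<close> add up.  Hence the lemma is proved for arbitrary positive weights.
\<close>

lemma hessenberg_spanning:
  fixes X :: "nat \<Rightarrow> 'a" and h :: "nat \<Rightarrow> nat"
  assumes X_n: "X n = 0"
    and mono: "\<And>i i'. i \<le> i' \<Longrightarrow> i' < n \<Longrightarrow> h i \<le> h i'"
    and h_le: "\<And>i. i < n \<Longrightarrow> i \<le> h i \<and> h i \<le> n"
  shows "j \<le> n \<Longrightarrow> (\<And>i. i < n \<Longrightarrow> (m i :: nat) > 0) \<Longrightarrow> lin_subspace T \<Longrightarrow>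
    (\<And>i r. j \<le> i \<Longrightarrow> i < n \<Longrightarrow> r \<in> polys (X ` {j..<n}) \<Longrightarrow>
       r * (\<Sum>k=j..i. sc (of_nat (m k)) * (\<Prod>l=Suc i..h i. X k - X l)) \<in> T) \<Longrightarrow>
    (\<And>k. (\<And>i. i < n \<Longrightarrow> k i < h i - i \<or> i < j) \<Longrightarrow>
       (\<Prod>i=j..<n. \<Prod>l=Suc i..i + k i. X i - X l) \<in> T) \<Longrightarrow>
    p \<in> polys (X ` {j..<n}) \<Longrightarrow> p \<in> T"
proof (induction "n - j" arbitrary: j m T p)
  case 0
  then have j: "j = n" by simp
  have one: "1 \<in> T" using "0.prems"(5)[of "\<lambda>_. 0"] j by simp
  from \<open>p \<in> polys _\<close> have "p \<in> range sc"
    unfolding j by induction (auto simp flip: sc_add sc_mult)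
  then obtain c where "p = sc c * 1" by auto
  then show ?case using lin_subspaceD(3)[OF "0.prems"(3) one] by simp
next
  case (Suc d)
  then have j: "j < n" by simp
  have ins: "{j..<n} = insert j {Suc j..<n}" using j by auto
  define P where "P t = (\<Prod>l=Suc j..j + t. X j - X l)" for t
  have inner: "\<And>p. p \<in> polys (X ` {j..<n}) \<Longrightarrow> P t * p \<in> T" if "t \<le> h j - j" for t
    using that
  proof (induction rule: inc_induct)
    case base
    have "p * (sc (of_nat (m j)) * P (h j - j)) \<in> T"
      using Suc.prems(4)[of j p] base j h_le[of j] by (simp add: P_def)
    then have "sc (of_nat (m j)) * (P (h j - j) * p) \<in> T" by (simp add: algebra_simps)
    then show ?case
      using Suc.prems(2)[of j] j by (auto intro: lin_subspace_cancel[OF Suc.prems(3)])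
  next
    case (step t)
    define t' where "t' = Suc (j + t)"
    have t'h: "t' \<le> h j" using step by (simp add: t'_def)
    have t'n: "t' \<le> n" using t'h h_le[of j] j by linarith
    have PS: "P (Suc t) = P t * (X j - X t')"
      by (simp add: P_def t'_def prod.nat_ivl_Suc' mult.commute)
    \<comment> \<open>\<open>X j\<close> is identified with \<open>X t'\<close>, which takes over its weight\<close>
    define m' where "m' = m(t' := m t' + m j)"
    let ?T = "{f. P t * f \<in> T}"
    have Xt': "X t' \<in> polys (X ` {Suc j..<n})"
      using t'n X_n polys_0 polys.gen by (cases "t' = n") (auto simp: t'_def)
    obtain p' p'' where p: "p' \<in> polys (X ` {Suc j..<n})" "p'' \<in> polys (X ` {j..<n})"
      "p = p' + (X j - X t') * p''"
      using polys_remainder[of p "X j" "X ` {Suc j..<n}" "X t'"] step.prems Xt' unfolding ins by auto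
    have sub: "polys (X ` {Suc j..<n}) \<subseteq> polys (X ` {j..<n})" by (rule polys_mono) auto
    have "p' \<in> ?T"
    proof (rule Suc.hyps(1)[of "Suc j" m'])
      show "d = n - Suc j" "Suc j \<le> n" using Suc.hyps(2) j by auto
      show "m' i > 0" if "i < n" for i using Suc.prems(2)[OF that] by (auto simp: m'_def)
      show "lin_subspace ?T" by (rule lin_subspace_comap) fact
      show "p' \<in> polys (X ` {Suc j..<n})" by fact
      show "(\<Prod>i=Suc j..<n. \<Prod>l=Suc i..i + k i. X i - X l) \<in> ?T"
        if k: "\<And>i. i < n \<Longrightarrow> k i < h i - i \<or> i < Suc j" for k
      proof -
        have "(\<Prod>i=j..<n. \<Prod>l=Suc i..i + (k(j := t)) i. X i - X l) \<in> T"
          using k step(1) j by (intro Suc.prems(5)) (metis Suc_lessI fun_upd_apply less_Suc_eq step.hyps(2))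
        also have "(\<Prod>i=j..<n. \<Prod>l=Suc i..i + (k(j := t)) i. X i - X l) =
            P t * (\<Prod>i=Suc j..<n. \<Prod>l=Suc i..i + k i. X i - X l)"
          unfolding ins by (auto simp: P_def intro!: arg_cong2[where f="(*)"] prod.cong)
        finally show ?thesis by simp
      qed
      show "r * (\<Sum>k=Suc j..i. sc (of_nat (m' k)) * (\<Prod>l=Suc i..h i. X k - X l)) \<in> ?T"
        if i: "Suc j \<le> i" "i < n" and r: "r \<in> polys (X ` {Suc j..<n})" for i r
      proof -
        let ?q = "\<lambda>z. \<Prod>l=Suc i..h i. z - X l"
        have hi: "h j \<le> h i" "h i \<le> n" using mono[of j i] h_le[of i] i by auto
        have Xl: "X l \<in> polys (X ` {j..<n})" if "j \<le> l" "l \<le> n" for l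
          using that X_n polys_0 polys.gen[of "X l"] by (cases "l = n") auto
        obtain e where e: "e \<in> polys (X ` {j..<n})" "?q (X j) - ?q (X t') = (X j - X t') * e"
          using polys_prod_diff[of "{Suc i..h i}" "X j" "X ` {j..<n}" "X t'" X] Xl j i hi t'n
          by (auto simp: t'_def)
        have qt': "?q (X t') = 0" if "i < t'"
          using that t'h hi by (intro prod_zero) auto
        have "(\<Sum>k=Suc j..i. sc (of_nat (m' k)) * ?q (X k)) =
            (\<Sum>k=Suc j..i. sc (of_nat (m k)) * ?q (X k) +
               (if k = t' then sc (of_nat (m j)) * ?q (X t') else 0))"
          by (intro sum.cong) (auto simp: m'_def sc_add algebra_simps)
        also have "\<dots> = (\<Sum>k=Suc j..i. sc (of_nat (m k)) * ?q (X k)) + sc (of_nat (m j)) * ?q (X t')"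
          using qt' by (cases "t' \<le> i") (auto simp: sum.distrib t'_def not_le)
        finally have 1: "(\<Sum>k=Suc j..i. sc (of_nat (m' k)) * ?q (X k)) =
            (\<Sum>k=j..i. sc (of_nat (m k)) * ?q (X k)) - sc (of_nat (m j)) * ((X j - X t') * e)"
          using i by (simp add: sum.atLeast_Suc_atMost[of j i] e(2)[symmetric] right_diff_distrib)
        have "P t \<in> polys (X ` {j..<n})"
          unfolding P_def using step(2) h_le[of j] j by (intro polys_prod polys_diff Xl) auto
        then have 2: "(P t * r) * (\<Sum>k=j..i. sc (of_nat (m k)) * ?q (X k)) \<in> T"
          using i r sub by (intro Suc.prems(4)) (auto intro: polys.mult)
        have "P (Suc t) * (sc (of_nat (m j)) * e * r) \<in> T"
          using e r sub by (intro step.IH) (auto intro!: polys.mult polys.const)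
        from lin_subspaceD(5)[OF Suc.prems(3) 2 this] show ?thesis
          unfolding 1 by (simp add: PS algebra_simps)
      qed
    qed
    moreover have "P (Suc t) * p'' \<in> T" using step.IH p(2) .
    moreover have "P t * p = P t * p' + P (Suc t) * p''"
      by (simp add: p(3) PS distrib_left mult.assoc)
    ultimately show ?case
      using lin_subspaceD(2)[OF Suc.prems(3), of "P t * p'"] by simp
  qed
  from inner[of 0] \<open>p \<in> _\<close> show ?case by (simp add: P_def)
qed

end

section \<open>Relations modulo power sums in two sets of variables\<close>

locale two_variable_sets = complex_algebra sc for sc :: "complex \<Rightarrow> 'a::comm_ring_1" +
  fixes n :: nat and x y :: "nat \<Rightarrow> 'a"
begin

definition y_monom :: "(nat \<Rightarrow> nat) \<Rightarrow> 'a" where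
  "y_monom a = (\<Prod>k<n. y k ^ a k)"

abbreviation x_polys :: "'a set" where
  "x_polys \<equiv> polys (x ` {..<n})"

text \<open>The part of \<open>y\<close>-degree \<open>m\<close> of the ideal generated by the power sums lies in \<open>T\<close>.\<close>

definition contains_power_sums :: "nat \<Rightarrow> 'a set \<Rightarrow> bool" where
  "contains_power_sums m T \<longleftrightarrow> (\<forall>p\<in>x_polys. \<forall>d \<alpha> \<beta>. (\<Sum>k<n. d k) + \<beta> = m \<longrightarrow> \<alpha> + \<beta> > 0 \<longrightarrow>
     p * y_monom d * (\<Sum>k<n. x k ^ \<alpha> * y k ^ \<beta>) \<in> T)"

text \<open>
  Expanding the product over \<open>W\<close> by powers of \<open>x k\<close> leads back to ordinary power sums; the
  factors \<open>c l\<close> do not depend on \<open>k\<close>.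
\<close>

lemma contains_weighted_power_sums:
  assumes T: "lin_subspace T" "contains_power_sums m T"
    and W: "finite W" "\<And>l. l \<in> W \<Longrightarrow> c l \<in> x_polys"
    and d: "(\<Sum>k<n. d k) + \<beta> = m"
  shows "\<alpha> + \<beta> > 0 \<Longrightarrow> p \<in> x_polys \<Longrightarrow>
    p * y_monom d * (\<Sum>k<n. x k ^ \<alpha> * (\<Prod>l\<in>W. x k - c l) * y k ^ \<beta>) \<in> T"
  using W
proof (induction W arbitrary: \<alpha> p)
  case empty
  then show ?case
    using T(2)[unfolded contains_power_sums_def, rule_format, of p d \<beta> \<alpha>] d by simp
next
  case (insert w W)
  let ?S = "\<lambda>\<alpha>. \<Sum>k<n. x k ^ \<alpha> * (\<Prod>l\<in>W. x k - c l) * y k ^ \<beta>"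
  have eq: "(\<Sum>k<n. x k ^ \<alpha> * (\<Prod>l\<in>insert w W. x k - c l) * y k ^ \<beta>) =
      ?S (Suc \<alpha>) - c w * ?S \<alpha>"
    using insert.hyps unfolding sum_distrib_left sum_subtractf[symmetric]
    by (intro sum.cong) (auto simp: algebra_simps)
  have "p * y_monom d * (\<Sum>k<n. x k ^ \<alpha> * (\<Prod>l\<in>insert w W. x k - c l) * y k ^ \<beta>) =
      p * y_monom d * ?S (Suc \<alpha>) - (p * c w) * y_monom d * ?S \<alpha>"
    unfolding eq by (simp only: right_diff_distrib mult_ac)
  moreover have "p * y_monom d * ?S (Suc \<alpha>) \<in> T" "(p * c w) * y_monom d * ?S \<alpha> \<in> T"
    using insert.prems by (intro insert.IH; auto intro: polys.mult)+
  ultimately show ?case using lin_subspaceD(5)[OF T(1)] by simp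
qed

definition subsets_of_size :: "nat \<Rightarrow> nat set \<Rightarrow> nat set set" where
  "subsets_of_size i U = {C. C \<subseteq> U \<and> card C = i}"

definition y_esym :: "nat \<Rightarrow> nat set \<Rightarrow> 'a" where
  "y_esym i U = (\<Sum>C\<in>subsets_of_size i U. \<Prod>c\<in>C. y c)"

lemma finite_subsets_of_size: "finite U \<Longrightarrow> finite (subsets_of_size i U)"
  by (simp add: subsets_of_size_def)

lemma subsets_of_size_0: "finite U \<Longrightarrow> subsets_of_size 0 U = {{}}"
  by (auto simp: subsets_of_size_def dest: finite_subset)

lemma sum_subsets_of_size_insert:
  fixes f :: "nat set \<Rightarrow> 'b::comm_monoid_add"
  assumes "finite V" "k \<notin> V"
  shows "(\<Sum>C\<in>subsets_of_size (Suc i) (insert k V). f C) =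
    (\<Sum>C\<in>subsets_of_size (Suc i) V. f C) + (\<Sum>C\<in>subsets_of_size i V. f (insert k C))"
proof -
  have fin: "finite C" if "C \<subseteq> insert k V" for C using that assms(1) finite_subset by blast
  have un: "subsets_of_size (Suc i) (insert k V) =
      subsets_of_size (Suc i) V \<union> insert k ` subsets_of_size i V"
  proof (intro equalityI subsetI)
    fix C assume C: "C \<in> subsets_of_size (Suc i) (insert k V)"
    show "C \<in> subsets_of_size (Suc i) V \<union> insert k ` subsets_of_size i V"
    proof (cases "k \<in> C")
      case True
      then have "C = insert k (C - {k})" "C - {k} \<in> subsets_of_size i V"
        using C fin[of C] by (auto simp: subsets_of_size_def)
      then show ?thesis by blast
    qed (use C in \<open>auto simp: subsets_of_size_def\<close>)
  next
    fix C assume "C \<in> subsets_of_size (Suc i) V \<union> insert k ` subsets_of_size i V"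
    then show "C \<in> subsets_of_size (Suc i) (insert k V)"
      using assms finite_subset[OF _ assms(1)]
      by (auto simp: subsets_of_size_def card_insert_if)
  qed
  have inj: "inj_on (insert k) (subsets_of_size i V)"
    using assms(2) by (auto simp: inj_on_def subsets_of_size_def)
  have "subsets_of_size (Suc i) V \<inter> insert k ` subsets_of_size i V = {}"
    using assms(2) by (auto simp: subsets_of_size_def)
  then show ?thesis
    unfolding un using assms(1)
    by (subst sum.union_disjoint) (auto simp: finite_subsets_of_size sum.reindex[OF inj])
qed

lemma y_esym_insert:
  assumes "finite V" "k \<notin> V"
  shows "y_esym (Suc i) (insert k V) = y_esym (Suc i) V + y k * y_esym i V"
proof -
  have "(\<Prod>c\<in>insert k C. y c) = y k * (\<Prod>c\<in>C. y c)" if "C \<in> subsets_of_size i V" for C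
    using that assms finite_subset[of C V] by (subst prod.insert) (auto simp: subsets_of_size_def)
  then show ?thesis
    using assms by (simp add: y_esym_def sum_subsets_of_size_insert sum_distrib_left)
qed

text \<open>Division of the generating function \<open>\<Prod>c\<in>U. 1 + y c t\<close> by \<open>1 + y k t\<close>.\<close>

lemma y_esym_remove:
  assumes "finite U" "k \<in> U"
  shows "y_esym i (U - {k}) = (\<Sum>j\<le>i. (- y k) ^ j * y_esym (i - j) U)"
proof (induction i)
  case 0
  then show ?case using assms by (simp add: y_esym_def subsets_of_size_0)
next
  case (Suc i)
  have "insert k (U - {k}) = U" using assms by blast
  then have "y_esym (Suc i) (U - {k}) = y_esym (Suc i) U - y k * y_esym i (U - {k})"
    using y_esym_insert[of "U - {k}" k i] assms by simp
  also have "y k * y_esym i (U - {k}) = - (\<Sum>j\<le>i. (- y k) ^ Suc j * y_esym (i - j) U)"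
    by (simp add: Suc sum_distrib_left sum_negf algebra_simps)
  finally show ?case
    by (simp only: sum.atMost_Suc_shift[of "\<lambda>j. (- y k) ^ j * y_esym (Suc i - j) U"]) simp
qed

lemma sum_subsets_weighted:
  assumes "finite U"
  shows "(\<Sum>C\<in>subsets_of_size (Suc i) U. (\<Sum>k\<in>C. q k) * (\<Prod>c\<in>C. y c)) =
    (\<Sum>k\<in>U. q k * y k * y_esym i (U - {k}))"
proof -
  have "(\<Sum>C\<in>subsets_of_size (Suc i) U. (\<Sum>k\<in>C. q k) * (\<Prod>c\<in>C. y c)) =
      (\<Sum>C\<in>subsets_of_size (Suc i) U. \<Sum>k\<in>U. if k \<in> C then q k * (\<Prod>c\<in>C. y c) else 0)"
  proof (rule sum.cong[OF refl])
    fix C assume "C \<in> subsets_of_size (Suc i) U"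
    then have "U \<inter> C = C" by (auto simp: subsets_of_size_def)
    then show "(\<Sum>k\<in>C. q k) * (\<Prod>c\<in>C. y c) = (\<Sum>k\<in>U. if k \<in> C then q k * (\<Prod>c\<in>C. y c) else 0)"
      using assms by (simp add: sum.If_cases sum_distrib_right Collect_mem_eq Int_def)
  qed
  also have "\<dots> = (\<Sum>k\<in>U. \<Sum>C\<in>subsets_of_size (Suc i) U. if k \<in> C then q k * (\<Prod>c\<in>C. y c) else 0)"
    by (rule sum.swap)
  also have "\<dots> = (\<Sum>k\<in>U. q k * y k * y_esym i (U - {k}))"
  proof (rule sum.cong[OF refl])
    fix k assume k: "k \<in> U"
    then have U: "insert k (U - {k}) = U" by blast
    have "(\<Sum>C\<in>subsets_of_size (Suc i) (insert k (U - {k})). if k \<in> C then q k * (\<Prod>c\<in>C. y c) else 0) =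
      (\<Sum>C\<in>subsets_of_size i (U - {k}). q k * (\<Prod>c\<in>insert k C. y c))"
      using assms by (subst sum_subsets_of_size_insert) (auto simp: subsets_of_size_def intro!: sum.neutral)
    also have "\<dots> = (\<Sum>C\<in>subsets_of_size i (U - {k}). q k * y k * (\<Prod>c\<in>C. y c))"
    proof (rule sum.cong[OF refl])
      fix C assume "C \<in> subsets_of_size i (U - {k})"
      then have "finite C" "k \<notin> C" using assms finite_subset by (auto simp: subsets_of_size_def)
      then show "q k * (\<Prod>c\<in>insert k C. y c) = q k * y k * (\<Prod>c\<in>C. y c)" by (simp add: mult.assoc)
    qed
    finally show "(\<Sum>C\<in>subsets_of_size (Suc i) U. if k \<in> C then q k * (\<Prod>c\<in>C. y c) else 0) =
        q k * y k * y_esym i (U - {k})"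
      unfolding U by (simp only: y_esym_def sum_distrib_left)
  qed
  finally show ?thesis .
qed

lemma y_monom_mult_subset:
  assumes "C \<subseteq> {..<n}"
  shows "y_monom d * (\<Prod>c\<in>C. y c) = y_monom (\<lambda>k. d k + of_bool (k \<in> C))"
proof -
  have "(\<Prod>c\<in>C. y c) = (\<Prod>k<n. y k ^ of_bool (k \<in> C))"
    using assms by (intro prod.mono_neutral_cong_left) auto
  then show ?thesis by (simp add: y_monom_def power_add prod.distrib)
qed

text \<open>
  The weights \<open>q k = \<Prod>l. x k - x l\<close>, with \<open>l\<close> outside \<open>U\<close>, vanish outside \<open>U\<close>, so a sum over \<open>U\<close> of the
  \<open>q k y k\<^sup>j\<close> is a sum over all \<open>k\<close> and gives a weighted power sum.  The elementary symmetric functions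
  reduce the sum over subsets to such sums:
  \<open>\<Sum>C. (\<Sum>k\<in>C. q k) y\<^sup>C = \<Sum>j. (-1)\<^sup>j e\<^sub>i\<^sub>-\<^sub>j(U) (\<Sum>k. q k y k\<^sup>j\<^sup>+\<^sup>1)\<close>, where \<open>C\<close> has \<open>i + 1\<close> elements.
\<close>

lemma subset_relation:
  assumes T: "lin_subspace T" "contains_power_sums m T"
    and U: "U \<subseteq> {..<n}" and d: "(\<Sum>k<n. d k) + Suc i = m" and p: "p \<in> x_polys"
  shows "(\<Sum>C\<in>subsets_of_size (Suc i) U.
     p * (\<Sum>k\<in>C. \<Prod>l\<in>{..<n} - U. x k - x l) * y_monom (\<lambda>k. d k + of_bool (k \<in> C))) \<in> T"
proof -
  define q where "q k = (\<Prod>l\<in>{..<n} - U. x k - x l)" for k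
  have fU: "finite U" using U finite_subset by blast
  have q0: "q k = 0" if "k \<in> {..<n} - U" for k
    unfolding q_def using that by (intro prod_zero) auto
  have "(\<Sum>C\<in>subsets_of_size (Suc i) U. p * (\<Sum>k\<in>C. q k) * y_monom (\<lambda>k. d k + of_bool (k \<in> C))) =
      p * y_monom d * (\<Sum>C\<in>subsets_of_size (Suc i) U. (\<Sum>k\<in>C. q k) * (\<Prod>c\<in>C. y c))"
    unfolding sum_distrib_left[where A = "subsets_of_size (Suc i) U"]
  proof (rule sum.cong[OF refl])
    fix C assume "C \<in> subsets_of_size (Suc i) U"
    then have "C \<subseteq> {..<n}" using U by (auto simp: subsets_of_size_def)
    then show "p * (\<Sum>k\<in>C. q k) * y_monom (\<lambda>k. d k + of_bool (k \<in> C)) =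
        p * y_monom d * ((\<Sum>k\<in>C. q k) * (\<Prod>c\<in>C. y c))"
      by (simp add: y_monom_mult_subset[symmetric] mult_ac)
  qed
  also have "(\<Sum>C\<in>subsets_of_size (Suc i) U. (\<Sum>k\<in>C. q k) * (\<Prod>c\<in>C. y c)) =
      (\<Sum>k\<in>U. \<Sum>j\<le>i. (- 1) ^ j * y_esym (i - j) U * (q k * y k ^ Suc j))"
    unfolding sum_subsets_weighted[OF fU]
  proof (rule sum.cong[OF refl])
    fix k assume "k \<in> U"
    then show "q k * y k * y_esym i (U - {k}) =
        (\<Sum>j\<le>i. (- 1) ^ j * y_esym (i - j) U * (q k * y k ^ Suc j))"
      unfolding y_esym_remove[OF fU \<open>k \<in> U\<close>] sum_distrib_left
      by (intro sum.cong refl) (simp add: power_minus[of "y k"])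
  qed
  also have "\<dots> = (\<Sum>j\<le>i. \<Sum>k\<in>U. (- 1) ^ j * y_esym (i - j) U * (q k * y k ^ Suc j))"
    by (rule sum.swap)
  also have "p * y_monom d * \<dots> =
      (\<Sum>j\<le>i. (- 1) ^ j * (p * y_monom d * y_esym (i - j) U * (\<Sum>k\<in>U. q k * y k ^ Suc j)))"
    unfolding sum_distrib_left by (intro sum.cong refl) (simp only: mult_ac)
  also have "\<dots> = (\<Sum>j\<le>i. (- 1) ^ j * (\<Sum>C\<in>subsets_of_size (i - j) U.
      p * y_monom (\<lambda>k. d k + of_bool (k \<in> C)) * (\<Sum>k<n. x k ^ 0 * q k * y k ^ Suc j)))"
  proof (rule sum.cong[OF refl])
    fix j
    have "(\<Sum>k\<in>U. q k * y k ^ Suc j) = (\<Sum>k<n. x k ^ 0 * q k * y k ^ Suc j)"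
      using U q0 by (intro sum.mono_neutral_cong_left) auto
    then have "p * y_monom d * y_esym (i - j) U * (\<Sum>k\<in>U. q k * y k ^ Suc j) =
       (\<Sum>C\<in>subsets_of_size (i - j) U. p * (y_monom d * (\<Prod>c\<in>C. y c)) *
          (\<Sum>k<n. x k ^ 0 * q k * y k ^ Suc j))"
      unfolding y_esym_def sum_distrib_left[where A = "subsets_of_size (i - j) U"]
        sum_distrib_right[where A = "subsets_of_size (i - j) U"]
      by (simp only: mult.assoc)
    also have "\<dots> = (\<Sum>C\<in>subsets_of_size (i - j) U.
        p * y_monom (\<lambda>k. d k + of_bool (k \<in> C)) * (\<Sum>k<n. x k ^ 0 * q k * y k ^ Suc j))"
      using U by (intro sum.cong) (auto simp: y_monom_mult_subset subsets_of_size_def)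
    finally show "(- 1) ^ j * (p * y_monom d * y_esym (i - j) U * (\<Sum>k\<in>U. q k * y k ^ Suc j)) =
        (- 1) ^ j * (\<Sum>C\<in>subsets_of_size (i - j) U.
          p * y_monom (\<lambda>k. d k + of_bool (k \<in> C)) * (\<Sum>k<n. x k ^ 0 * q k * y k ^ Suc j))"
      by (rule arg_cong)
  qed
  also have "\<dots> \<in> T"
  proof (rule lin_subspace_sum[OF T(1)])
    fix j assume j: "j \<in> {..i}"
    have "(\<Sum>C\<in>subsets_of_size (i - j) U.
      p * y_monom (\<lambda>k. d k + of_bool (k \<in> C)) * (\<Sum>k<n. x k ^ 0 * q k * y k ^ Suc j)) \<in> T"
    proof (rule lin_subspace_sum[OF T(1)])
      fix C assume C: "C \<in> subsets_of_size (i - j) U"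
      have "C \<inter> {..<n} = C" using C U by (auto simp: subsets_of_size_def)
      then have "(\<Sum>k<n. of_bool (k \<in> C)) = card C" by (simp add: Int_commute)
      then have "(\<Sum>k<n. d k + of_bool (k \<in> C)) + Suc j = m"
        using C d j by (auto simp: sum.distrib subsets_of_size_def)
      then show "p * y_monom (\<lambda>k. d k + of_bool (k \<in> C)) * (\<Sum>k<n. x k ^ 0 * q k * y k ^ Suc j) \<in> T"
        unfolding q_def using T p
        by (intro contains_weighted_power_sums) (auto intro: polys.gen)
    qed
    then show "(- 1) ^ j * (\<Sum>C\<in>subsets_of_size (i - j) U.
      p * y_monom (\<lambda>k. d k + of_bool (k \<in> C)) * (\<Sum>k<n. x k ^ 0 * q k * y k ^ Suc j)) \<in> T"
      using lin_subspaceD(4)[OF T(1)] by (cases "even j") auto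
  qed
  finally show ?thesis unfolding q_def .
qed

end

section \<open>Sorted exponent vectors and their windows\<close>

text \<open>Weakly decreasing order of the exponents, with ties broken by the labels.\<close>

definition sorts :: "nat \<Rightarrow> (nat \<Rightarrow> nat) \<Rightarrow> (nat \<Rightarrow> nat) \<Rightarrow> bool" where
  "sorts n a \<tau> \<longleftrightarrow> bij_betw \<tau> {..<n} {..<n} \<and>
     (\<forall>i j. i < j \<longrightarrow> j < n \<longrightarrow> a (\<tau> j) < a (\<tau> i) \<or> (a (\<tau> j) = a (\<tau> i) \<and> \<tau> i < \<tau> j))"

definition sorting :: "nat \<Rightarrow> (nat \<Rightarrow> nat) \<Rightarrow> nat \<Rightarrow> nat" where
  "sorting n a = (SOME \<tau>. sorts n a \<tau>)"

lemma sorts_exists: "\<exists>\<tau>. sorts n a \<tau>"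
proof -
  define M where "M = (\<Sum>k<n. a k)"
  define f where "f k = (M - a k) * n + k" for k
  have aM: "a k \<le> M" if "k < n" for k
    unfolding M_def using that by (intro member_le_sum) auto
  have lt: "a l < a k \<or> (a l = a k \<and> k < l)" if "f k < f l" "k < n" "l < n" for k l
  proof (rule ccontr)
    assume "\<not> ?thesis"
    then consider "a k < a l" | "a k = a l" "l \<le> k" by linarith
    then show False
    proof cases
      case 1
      then have "M - a l + 1 \<le> M - a k" using aM[of l] that by linarith
      then have "(M - a l + 1) * n \<le> (M - a k) * n" by (rule mult_le_mono1)
      then show False using that unfolding f_def by simp
    next
      case 2
      then show False using that unfolding f_def by simp
    qed
  qed
  have inj: "inj_on f {..<n}"
  proof (rule inj_onI)
    fix k l assume kl: "k \<in> {..<n}" "l \<in> {..<n}" "f k = f l"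
    have "f k mod n = k" "f l mod n = l" using kl(1,2) by (auto simp: f_def)
    then show "k = l" using kl(3) by metis
  qed
  have "finite (f ` {..<n})" "card (f ` {..<n}) = n" using card_image[OF inj] by auto
  then obtain g where g: "bij_betw g {..<n} (f ` {..<n})" "strict_mono_on {..<n} g"
    using ex_bij_betw_strict_mono_card[of "f ` {..<n}"] by auto
  let ?\<tau> = "\<lambda>i. the_inv_into {..<n} f (g i)"
  have "bij_betw (the_inv_into {..<n} f \<circ> g) {..<n} {..<n}"
    using g(1) bij_betw_the_inv_into[OF inj_on_imp_bij_betw[OF inj]] by (rule bij_betw_trans)
  then have bij: "bij_betw ?\<tau> {..<n} {..<n}" by (simp add: comp_def)
  have f\<tau>: "f (?\<tau> i) = g i" if "i < n" for i
    using that g(1) by (intro f_the_inv_into_f[OF inj]) (auto simp: bij_betw_def)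
  have "a (?\<tau> j) < a (?\<tau> i) \<or> (a (?\<tau> j) = a (?\<tau> i) \<and> ?\<tau> i < ?\<tau> j)" if "i < j" "j < n" for i j
  proof (rule lt)
    show "f (?\<tau> i) < f (?\<tau> j)"
      using that g(2) by (simp add: f\<tau> strict_mono_on_def)
    show "?\<tau> i < n" "?\<tau> j < n" using bij that by (auto simp: bij_betw_def)
  qed
  with bij show ?thesis unfolding sorts_def by blast
qed

lemma sorts_sorting: "sorts n a (sorting n a)"
  unfolding sorting_def using sorts_exists by (rule someI_ex)

text \<open>The position \<open>n\<close> behind all entries acts as an entry of exponent \<open>0\<close> with the largest label.\<close>

definition in_window :: "nat \<Rightarrow> (nat \<Rightarrow> nat) \<Rightarrow> (nat \<Rightarrow> nat) \<Rightarrow> nat \<Rightarrow> nat \<Rightarrow> bool" where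
  "in_window n a \<tau> i l \<longleftrightarrow> i < l \<and> l \<le> n \<and>
     (if l = n then a (\<tau> i) = 0
      else a (\<tau> l) = a (\<tau> i) \<or> (Suc (a (\<tau> l)) = a (\<tau> i) \<and> \<tau> l < \<tau> i))"

definition window_end :: "nat \<Rightarrow> (nat \<Rightarrow> nat) \<Rightarrow> (nat \<Rightarrow> nat) \<Rightarrow> nat \<Rightarrow> nat" where
  "window_end n a \<tau> i = Max (insert i {l. in_window n a \<tau> i l})"

lemma in_window_down:
  assumes "sorts n a \<tau>" "in_window n a \<tau> i l" "i < l'" "l' \<le> l"
  shows "in_window n a \<tau> i l'"
proof (cases "l' = l")
  case False
  then have l': "l' < l" "l' < n" using assms by (auto simp: in_window_def)
  have 1: "a (\<tau> l') < a (\<tau> i) \<or> (a (\<tau> l') = a (\<tau> i) \<and> \<tau> i < \<tau> l')"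
    using assms l' by (auto simp: sorts_def)
  show ?thesis
  proof (cases "l = n")
    case True
    then show ?thesis using assms l' 1 by (auto simp: in_window_def)
  next
    case l: False
    then have 2: "a (\<tau> l) < a (\<tau> l') \<or> (a (\<tau> l) = a (\<tau> l') \<and> \<tau> l' < \<tau> l)"
      using assms(1,2) l' by (auto simp: sorts_def in_window_def)
    have w: "a (\<tau> l) = a (\<tau> i) \<or> (Suc (a (\<tau> l)) = a (\<tau> i) \<and> \<tau> l < \<tau> i)"
      using assms(2) l by (auto simp: in_window_def)
    have "a (\<tau> l') = a (\<tau> i) \<or> (Suc (a (\<tau> l')) = a (\<tau> i) \<and> \<tau> l' < \<tau> i)"
      using 1 2 w by linarith
    then show ?thesis using assms(3) l' by (auto simp: in_window_def)
  qed
qed (use assms in simp)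

lemma finite_in_window: "finite {l. in_window n a \<tau> i l}"
  by (rule finite_subset[of _ "{..n}"]) (auto simp: in_window_def)

lemma window_end_bounds: "i \<le> n \<Longrightarrow> i \<le> window_end n a \<tau> i \<and> window_end n a \<tau> i \<le> n"
proof -
  assume i: "i \<le> n"
  have "window_end n a \<tau> i \<in> insert i {l. in_window n a \<tau> i l}"
    unfolding window_end_def using finite_in_window by (intro Max_in) auto
  then show ?thesis using i by (auto simp: in_window_def)
qed

lemma in_window_iff:
  assumes "sorts n a \<tau>"
  shows "in_window n a \<tau> i l \<longleftrightarrow> i < l \<and> l \<le> window_end n a \<tau> i"
proof
  assume l: "in_window n a \<tau> i l"
  then have "l \<le> window_end n a \<tau> i"
    unfolding window_end_def using finite_in_window by (intro Max_ge) auto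
  then show "i < l \<and> l \<le> window_end n a \<tau> i" using l by (simp add: in_window_def)
next
  assume l: "i < l \<and> l \<le> window_end n a \<tau> i"
  have "window_end n a \<tau> i \<in> insert i {l. in_window n a \<tau> i l}"
    unfolding window_end_def using finite_in_window by (intro Max_in) auto
  with l have "in_window n a \<tau> i (window_end n a \<tau> i)" by auto
  from in_window_down[OF assms this] l show "in_window n a \<tau> i l" by auto
qed

lemma window_end_mono:
  assumes s: "sorts n a \<tau>" and "i \<le> i'" "i' < n"
  shows "window_end n a \<tau> i \<le> window_end n a \<tau> i'"
proof (rule ccontr)
  assume less: "\<not> ?thesis"
  define l where "l = window_end n a \<tau> i"
  have i': "i' \<le> window_end n a \<tau> i'" using window_end_bounds assms by simp
  then have l: "i' < l" "i < i'" using less assms(2) by (auto simp: l_def le_less)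
  then have w: "in_window n a \<tau> i l" using in_window_iff[OF s] by (auto simp: l_def)
  have 1: "a (\<tau> i') < a (\<tau> i) \<or> (a (\<tau> i') = a (\<tau> i) \<and> \<tau> i < \<tau> i')"
    using assms l by (auto simp: sorts_def)
  have "in_window n a \<tau> i' l"
  proof (cases "l = n")
    case True
    then show ?thesis using w 1 l by (auto simp: in_window_def)
  next
    case False
    then have "a (\<tau> l) < a (\<tau> i') \<or> (a (\<tau> l) = a (\<tau> i') \<and> \<tau> i' < \<tau> l)"
      using s l w by (auto simp: sorts_def in_window_def)
    moreover have "a (\<tau> l) = a (\<tau> i) \<or> (Suc (a (\<tau> l)) = a (\<tau> i) \<and> \<tau> l < \<tau> i)"
      using w False by (auto simp: in_window_def)
    ultimately have "a (\<tau> l) = a (\<tau> i') \<or> (Suc (a (\<tau> l)) = a (\<tau> i') \<and> \<tau> l < \<tau> i')"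
      using 1 by linarith
    then show ?thesis using False w l by (auto simp: in_window_def)
  qed
  then have "l \<le> window_end n a \<tau> i'" using in_window_iff[OF s] by blast
  then show False using less by (simp add: l_def)
qed

lemma sum_two_sets:
  fixes f g :: "nat \<Rightarrow> 'b::comm_monoid_add"
  assumes "A \<subseteq> {..<n}" "C \<subseteq> {..<n}"
  shows "(\<Sum>k<n. f k) = (\<Sum>k\<in>A - C. f k) + (\<Sum>k\<in>C - A. f k) + (\<Sum>k\<in>{..<n} - (A - C) - (C - A). f k)"
proof -
  have "(\<Sum>k<n. f k) = (\<Sum>k\<in>A - C. f k) + (\<Sum>k\<in>{..<n} - (A - C). f k)"
    using assms by (intro sum.subset_diff[THEN trans]) (auto simp: add.commute)
  also have "(\<Sum>k\<in>{..<n} - (A - C). f k) = (\<Sum>k\<in>C - A. f k) + (\<Sum>k\<in>{..<n} - (A - C) - (C - A). f k)"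
    using assms by (intro sum.subset_diff[THEN trans]) (auto simp: add.commute)
  finally show ?thesis by (simp add: add.assoc)
qed

text \<open>
  Replacing the factor \<open>y\<^sup>A\<close> of a monomial \<open>y\<^sup>a\<close> by \<open>y\<^sup>C\<close> moves one unit from each entry of \<open>A - C\<close> to an
  entry of \<open>C - A\<close>.  As the entries of \<open>A\<close> are at least \<open>b\<close> and those of \<open>C - A\<close> are below \<open>b\<close>, the sum of
  squares drops, unless the entries of \<open>A - C\<close> are all equal to \<open>b\<close> and those of \<open>C - A\<close> to \<open>b - 1\<close>.
  In this case the tie condition makes the second component of the order drop.
\<close>

lemma exchange_lowers:
  fixes a :: "nat \<Rightarrow> nat"
  assumes AC: "A \<subseteq> {..<n}" "C \<subseteq> {..<n}" "card A = card C" "A \<noteq> C"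
    and A: "\<And>s. s \<in> A \<Longrightarrow> b \<le> a s" and b: "b > 0"
    and C: "\<And>k. k \<in> C - A \<Longrightarrow> a k < b"
    and tie: "\<And>s k. s \<in> A - C \<Longrightarrow> k \<in> C - A \<Longrightarrow> a s = b \<Longrightarrow> Suc (a k) = b \<Longrightarrow> s < k"
  defines "a' \<equiv> \<lambda>k. a k - of_bool (k \<in> A) + of_bool (k \<in> C)"
  shows "(\<Sum>k<n. a' k) = (\<Sum>k<n. a k)"
    and "(a', a) \<in> measures [\<lambda>a. \<Sum>k<n. a k ^ 2, \<lambda>a. \<Sum>k<n. (n - k) * a k]"
proof -
  have fin: "finite A" "finite C" using AC finite_subset by blast+
  have cAC: "card (A - C) = card (C - A)"
    using card_Diff_subset_Int[of A C] card_Diff_subset_Int[of C A] fin AC(3)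
    by (simp add: Int_commute)
  have ne: "A - C \<noteq> {}" "C - A \<noteq> {}"
    using AC(3,4) fin cAC by (auto simp: card_eq_0_iff dest: card_subset_eq)
  have pos: "a s \<ge> 1" if "s \<in> A" for s using A[OF that] b by simp
  have a'A: "a' s = a s - 1" if "s \<in> A - C" for s using that by (auto simp: a'_def)
  have a'C: "a' s = a s + 1" if "s \<in> C - A" for s using that by (auto simp: a'_def)
  have a'R: "a' s = a s" if "s \<notin> A - C" "s \<notin> C - A" for s
    using that pos[of s] by (cases "s \<in> A"; cases "s \<in> C") (auto simp: a'_def)
  have split: "(\<Sum>k<n. int (w k (a' k))) - (\<Sum>k<n. int (w k (a k))) =
     (\<Sum>k\<in>A - C. int (w k (a k - 1)) - int (w k (a k))) + (\<Sum>k\<in>C - A. int (w k (a k + 1)) - int (w k (a k)))"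
    for w :: "nat \<Rightarrow> nat \<Rightarrow> nat"
  proof -
    have "(\<Sum>k<n. int (w k (a' k))) - (\<Sum>k<n. int (w k (a k))) = (\<Sum>k<n. int (w k (a' k)) - int (w k (a k)))"
      by (simp add: sum_subtractf)
    also have "\<dots> = (\<Sum>k\<in>A - C. int (w k (a' k)) - int (w k (a k))) +
        (\<Sum>k\<in>C - A. int (w k (a' k)) - int (w k (a k))) + 0"
      unfolding sum_two_sets[OF AC(1,2)]
      by (intro arg_cong2[of _ _ _ _ "(+)"] refl sum.neutral) (auto simp: a'R)
    finally show ?thesis by (simp add: a'A a'C)
  qed
  have "(\<Sum>k<n. int (a' k)) - (\<Sum>k<n. int (a k)) = (\<Sum>k\<in>A - C. - 1) + (\<Sum>k\<in>C - A. 1)"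
    unfolding split[of "\<lambda>_ v. v"]
    by (intro arg_cong2[of _ _ _ _ "(+)"] sum.cong refl) (use pos in \<open>auto simp: of_nat_diff\<close>)
  then show "(\<Sum>k<n. a' k) = (\<Sum>k<n. a k)"
    using cAC by (simp flip: of_nat_sum)
  define c where "c = int (card (A - C))"
  have sqA: "int ((a k - 1) ^ 2) - int (a k ^ 2) \<le> 1 - 2 * int b" if "k \<in> A - C" for k
  proof -
    have "int ((a k - 1) ^ 2) - int (a k ^ 2) = 1 - 2 * int (a k)"
      using that pos[of k] by (cases "a k") (auto simp: power2_eq_square algebra_simps)
    then show ?thesis using A[of k] that by simp
  qed
  have sqC: "int ((a k + 1) ^ 2) - int (a k ^ 2) \<le> 2 * int b - 1" if "k \<in> C - A" for k
    using C[OF that] by (simp add: power2_eq_square algebra_simps)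
  have dA: "(\<Sum>k\<in>A - C. int ((a k - 1) ^ 2) - int (a k ^ 2)) \<le> c * (1 - 2 * int b)"
    unfolding c_def using sqA by (intro sum_bounded_above[THEN order_trans]) auto
  have dC: "(\<Sum>k\<in>C - A. int ((a k + 1) ^ 2) - int (a k ^ 2)) \<le> c * (2 * int b - 1)"
    unfolding c_def cAC using sqC by (intro sum_bounded_above[THEN order_trans]) auto
  have sq: "(\<Sum>k<n. int (a' k ^ 2)) - (\<Sum>k<n. int (a k ^ 2)) =
      (\<Sum>k\<in>A - C. int ((a k - 1) ^ 2) - int (a k ^ 2)) + (\<Sum>k\<in>C - A. int ((a k + 1) ^ 2) - int (a k ^ 2))"
    by (rule split[of "\<lambda>_ v. v ^ 2"])
  have c0: "c * (1 - 2 * int b) + c * (2 * int b - 1) = 0" by (simp add: algebra_simps)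
  have le: "(\<Sum>k<n. int (a' k ^ 2)) \<le> (\<Sum>k<n. int (a k ^ 2))"
    using sq dA dC c0 by linarith
  show "(a', a) \<in> measures [\<lambda>a. \<Sum>k<n. a k ^ 2, \<lambda>a. \<Sum>k<n. (n - k) * a k]"
  proof (cases "(\<Sum>k<n. int (a' k ^ 2)) = (\<Sum>k<n. int (a k ^ 2))")
    case False
    then have "(\<Sum>k<n. int (a' k ^ 2)) < (\<Sum>k<n. int (a k ^ 2))" using le by linarith
    then have "(\<Sum>k<n. a' k ^ 2) < (\<Sum>k<n. a k ^ 2)"
      by (simp only: of_nat_sum[symmetric] of_nat_less_iff)
    then show ?thesis by simp
  next
    case True
    then have eqs: "(\<Sum>k\<in>A - C. int ((a k - 1) ^ 2) - int (a k ^ 2)) = c * (1 - 2 * int b)"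
      "(\<Sum>k\<in>C - A. int ((a k + 1) ^ 2) - int (a k ^ 2)) = c * (2 * int b - 1)"
      using sq dA dC c0 by linarith+
    have eqA: "a s = b" if "s \<in> A - C" for s
    proof (rule ccontr)
      assume "a s \<noteq> b"
      then have "int ((a s - 1) ^ 2) - int (a s ^ 2) < 1 - 2 * int b"
        using A[of s] that pos[of s] by (cases "a s") (auto simp: power2_eq_square algebra_simps)
      then have "(\<Sum>k\<in>A - C. int ((a k - 1) ^ 2) - int (a k ^ 2)) < (\<Sum>k\<in>A - C. 1 - 2 * int b)"
        using fin that sqA by (intro sum_strict_mono_ex1) auto
      then show False using eqs(1) by (simp add: c_def)
    qed
    have eqC: "Suc (a k) = b" if "k \<in> C - A" for k
    proof (rule ccontr)
      assume "Suc (a k) \<noteq> b"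
      then have "int ((a k + 1) ^ 2) - int (a k ^ 2) < 2 * int b - 1"
        using C[OF that] by (simp add: power2_eq_square algebra_simps)
      then have "(\<Sum>k\<in>C - A. int ((a k + 1) ^ 2) - int (a k ^ 2)) < (\<Sum>k\<in>C - A. 2 * int b - 1)"
        using fin that sqC by (intro sum_strict_mono_ex1) auto
      then show False using eqs(2) by (simp add: c_def cAC)
    qed
    define M where "M = Max (A - C)"
    have M: "M \<in> A - C" "\<And>s. s \<in> A - C \<Longrightarrow> s \<le> M"
      unfolding M_def using ne fin by (auto intro!: Max_in Max_ge simp del: Diff_iff)
    have MC: "M < k" if "k \<in> C - A" for k using tie[OF M(1) that eqA[OF M(1)] eqC[OF that]] .
    have nn: "\<And>k. k \<in> A \<Longrightarrow> k < n" "\<And>k. k \<in> C \<Longrightarrow> k < n" using AC by auto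
    have "(\<Sum>k<n. int ((n - k) * a' k)) - (\<Sum>k<n. int ((n - k) * a k)) =
        (\<Sum>k\<in>A - C. int ((n - k) * (a k - 1)) - int ((n - k) * a k)) +
        (\<Sum>k\<in>C - A. int ((n - k) * (a k + 1)) - int ((n - k) * a k))"
      by (rule split[of "\<lambda>k v. (n - k) * v"])
    also have "\<dots> = (\<Sum>k\<in>A - C. - int (n - k)) + (\<Sum>k\<in>C - A. int (n - k))"
    proof (intro arg_cong2[of _ _ _ _ "(+)"] sum.cong refl)
      fix k assume "k \<in> A - C"
      then have "int (a k - 1) = int (a k) - 1" using pos[of k] by auto
      then show "int ((n - k) * (a k - 1)) - int ((n - k) * a k) = - int (n - k)"
        by (simp only: of_nat_mult) (simp add: right_diff_distrib)
    qed (simp add: of_nat_diff distrib_left)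
    also have "(\<Sum>k\<in>A - C. - int (n - k)) \<le> c * (- int (n - M))"
      unfolding c_def using M(2) by (intro sum_bounded_above) (auto intro!: diff_le_mono2)
    also have "(\<Sum>k\<in>C - A. int (n - k)) < (\<Sum>k\<in>C - A. int (n - M))"
    proof (rule sum_strict_mono)
      fix k assume "k \<in> C - A"
      then have "M < k" "k < n" using MC nn by auto
      then show "int (n - k) < int (n - M)" by simp
    qed (use ne fin in auto)
    also have "(\<Sum>k\<in>C - A. int (n - M)) = c * int (n - M)" by (simp add: c_def cAC)
    finally have "(\<Sum>k<n. int ((n - k) * a' k)) < (\<Sum>k<n. int ((n - k) * a k))" by simp
    then have 2: "(\<Sum>k<n. (n - k) * a' k) < (\<Sum>k<n. (n - k) * a k)"
      by (simp only: of_nat_sum[symmetric] of_nat_less_iff)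
    from True have 1: "(\<Sum>k<n. a' k ^ 2) = (\<Sum>k<n. a k ^ 2)"
      by (simp only: of_nat_sum[symmetric] of_nat_eq_iff)
    from 1 2 show ?thesis by simp
  qed
qed

section \<open>Standard elements span modulo the power sums\<close>

context two_variable_sets begin

text \<open>The variables in sorted order; the value \<open>0\<close> at \<open>n\<close> belongs to the sentinel of the windows.\<close>

definition sorted_x :: "(nat \<Rightarrow> nat) \<Rightarrow> nat \<Rightarrow> 'a" where
  "sorted_x a i = (if i < n then x (sorting n a i) else 0)"

definition standard_element :: "(nat \<Rightarrow> nat) \<Rightarrow> (nat \<Rightarrow> nat) \<Rightarrow> 'a" where
  "standard_element a k =
     y_monom a * (\<Prod>i<n. \<Prod>l=Suc i..i + k i. sorted_x a i - sorted_x a l)"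

text \<open>
  Apply \<open>subset_relation\<close> to the complement \<open>U\<close> of the window, to the set \<open>A\<close> of the first \<open>i + 1\<close> labels
  and to \<open>y\<^sup>a / y\<^sup>A\<close>.  The subset \<open>A\<close> contributes the stated element, and by \<open>exchange_lowers\<close> all other
  subsets contribute monomials that are lower than \<open>y\<^sup>a\<close>.  If the exponent at position \<open>i\<close> is zero, the
  window reaches \<open>n\<close> and a power sum with \<open>\<beta> = 0\<close> suffices.
\<close>

lemma window_relation:
  assumes T: "lin_subspace T" "contains_power_sums m T"
    and lower: "\<And>b p. (\<Sum>k<n. b k) = m \<Longrightarrow>
      (b, a) \<in> measures [\<lambda>a. \<Sum>k<n. a k ^ 2, \<lambda>a. \<Sum>k<n. (n - k) * a k] \<Longrightarrow>
      p \<in> x_polys \<Longrightarrow> p * y_monom b \<in> T"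
    and a: "(\<Sum>k<n. a k) = m" and i: "i < n" and p: "p \<in> x_polys"
  shows "p * (\<Sum>k=0..i. \<Prod>l=Suc i..window_end n a (sorting n a) i. sorted_x a k - sorted_x a l) *
    y_monom a \<in> T"
proof -
  define \<tau> where "\<tau> = sorting n a"
  define h where "h = window_end n a \<tau> i"
  have s: "sorts n a \<tau>" unfolding \<tau>_def by (rule sorts_sorting)
  have bij: "bij_betw \<tau> {..<n} {..<n}" using s by (simp add: sorts_def)
  have inj: "inj_on \<tau> S" if "S \<subseteq> {..<n}" for S
    using bij that by (auto simp: bij_betw_def intro: inj_on_subset)
  have \<tau>n: "\<tau> k < n" if "k < n" for k using bij that by (auto simp: bij_betw_def)
  have h: "i \<le> h" "h \<le> n" using window_end_bounds[of i n a \<tau>] i by (auto simp: h_def)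
  have win: "in_window n a \<tau> i l \<longleftrightarrow> i < l \<and> l \<le> h" for l
    using in_window_iff[OF s] by (simp add: h_def)
  have ord: "a (\<tau> l) < a (\<tau> k) \<or> (a (\<tau> l) = a (\<tau> k) \<and> \<tau> k < \<tau> l)" if "k < l" "l < n" for k l
    using s that by (auto simp: sorts_def)
  let ?A = "\<tau> ` {0..i}" and ?W = "\<tau> ` {Suc i..<min n (Suc h)}"
  have reW: "(\<Prod>l=Suc i..<min n (Suc h). z - sorted_x a l) = (\<Prod>l\<in>?W. z - x l)" for z
    using i by (subst prod.reindex[OF inj]) (auto intro!: prod.cong simp: sorted_x_def \<tau>_def)
  have reA: "(\<Sum>k=0..i. f (sorted_x a k)) = (\<Sum>k\<in>?A. f (x k))" for f :: "'a \<Rightarrow> 'a"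
    using i by (subst sum.reindex[OF inj]) (auto intro!: sum.cong simp: sorted_x_def \<tau>_def)
  have cA: "card ?A = Suc i" using i by (subst card_image[OF inj]) auto
  show ?thesis
  proof (cases "a (\<tau> i) = 0")
    case True
    then have "in_window n a \<tau> i n" using i by (simp add: in_window_def)
    then have hn: "h = n" using win h by auto
    have "p * y_monom a * (\<Sum>k<n. x k ^ 1 * (\<Prod>l\<in>?W. x k - x l) * y k ^ 0) \<in> T"
      using T p a \<tau>n by (intro contains_weighted_power_sums) (auto intro!: polys.gen)
    also have "(\<Sum>k<n. x k ^ 1 * (\<Prod>l\<in>?W. x k - x l) * y k ^ 0) =
        (\<Sum>k\<in>?A. x k * (\<Prod>l\<in>?W. x k - x l))"
    proof (simp, rule sum.mono_neutral_right)
      show "?A \<subseteq> {..<n}" using \<tau>n i by auto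
      show "\<forall>k\<in>{..<n} - ?A. x k * (\<Prod>l\<in>\<tau> ` {Suc i..<min n (Suc h)}. x k - x l) = 0"
      proof
        fix k assume k: "k \<in> {..<n} - ?A"
        then obtain l where l: "l < n" "k = \<tau> l" using bij by (auto simp: bij_betw_def)
        then have "k \<in> ?W" using k hn by (cases "l \<le> i") auto
        then have "(\<Prod>l\<in>?W. x k - x l) = 0" by (intro prod_zero) auto
        then show "x k * (\<Prod>l\<in>\<tau> ` {Suc i..<min n (Suc h)}. x k - x l) = 0" by simp
      qed
    qed simp
    also have "\<dots> = (\<Sum>k=0..i. sorted_x a k * (\<Prod>l=Suc i..<min n (Suc h). sorted_x a k - sorted_x a l))"
      by (simp only: reW reA[of "\<lambda>z. z * (\<Prod>l\<in>?W. z - x l)"])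
    also have "\<dots> = (\<Sum>k=0..i. \<Prod>l=Suc i..h. sorted_x a k - sorted_x a l)"
    proof (rule sum.cong[OF refl])
      fix k
      have "{Suc i..h} = insert n {Suc i..<min n (Suc h)}" using hn i by auto
      then show "sorted_x a k * (\<Prod>l=Suc i..<min n (Suc h). sorted_x a k - sorted_x a l) =
          (\<Prod>l=Suc i..h. sorted_x a k - sorted_x a l)"
        by (simp add: sorted_x_def[of a n])
    qed
    finally show ?thesis by (simp add: h_def \<tau>_def mult_ac)
  next
    case False
    \<comment> \<open>the threshold for \<open>exchange_lowers\<close>\<close>
    define b where "b = a (\<tau> i)"
    have hn: "h < n" using win[of n] False i h by (auto simp: in_window_def le_less)
    define U where "U = {..<n} - ?W"
    have W: "?W = \<tau> ` {Suc i..h}" using hn by (intro arg_cong[where f = "image \<tau>"]) auto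
    have WU: "{..<n} - U = ?W" using \<tau>n hn by (auto simp: U_def)
    have AU: "?A \<subseteq> U"
      unfolding U_def using i \<tau>n inj_onD[OF inj[OF order_refl]] by (fastforce simp: W)
    define d where "d k = a k - of_bool (k \<in> ?A)" for k
    have Ab: "b \<le> a k" if k: "k \<in> ?A" for k
    proof -
      obtain j where j: "j \<le> i" "k = \<tau> j" using k by auto
      then show ?thesis using ord[of j i] i by (cases "j = i") (auto simp: b_def)
    qed
    have b0: "b > 0" using False by (simp add: b_def)
    have dA: "d k + of_bool (k \<in> ?A) = a k" for k
      using Ab[of k] b0 by (auto simp: d_def)
    have "(\<Sum>k<n. a k) = (\<Sum>k<n. d k) + (\<Sum>k<n. of_bool (k \<in> ?A))"
      by (simp only: dA flip: sum.distrib)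
    also have "(\<Sum>k<n. of_bool (k \<in> ?A)) = card ?A"
    proof -
      have "?A \<inter> {..<n} = ?A" using AU by (auto simp: U_def)
      then show ?thesis by (simp add: Int_commute)
    qed
    finally have d: "(\<Sum>k<n. d k) + Suc i = m" using a cA by simp
    let ?q = "\<lambda>C. \<Sum>k\<in>C. \<Prod>l\<in>?W. x k - x l"
    have "(\<Sum>C\<in>subsets_of_size (Suc i) U. p * ?q C * y_monom (\<lambda>k. d k + of_bool (k \<in> C))) \<in> T"
      using subset_relation[OF T _ d p, of U] by (simp add: WU) (simp add: U_def)
    also have "(\<Sum>C\<in>subsets_of_size (Suc i) U. p * ?q C * y_monom (\<lambda>k. d k + of_bool (k \<in> C))) =
      p * ?q ?A * y_monom (\<lambda>k. d k + of_bool (k \<in> ?A)) +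
      (\<Sum>C\<in>subsets_of_size (Suc i) U - {?A}. p * ?q C * y_monom (\<lambda>k. d k + of_bool (k \<in> C)))"
      using AU cA by (intro sum.remove) (auto simp: subsets_of_size_def U_def)
    finally have *: "p * ?q ?A * y_monom a +
      (\<Sum>C\<in>subsets_of_size (Suc i) U - {?A}. p * ?q C * y_monom (\<lambda>k. d k + of_bool (k \<in> C))) \<in> T"
      by (simp only: dA)
    have "(\<Sum>C\<in>subsets_of_size (Suc i) U - {?A}. p * ?q C * y_monom (\<lambda>k. d k + of_bool (k \<in> C))) \<in> T"
    proof (rule lin_subspace_sum[OF T(1)])
      fix C assume C: "C \<in> subsets_of_size (Suc i) U - {?A}"
      then have CU: "C \<subseteq> U" and cC: "card ?A = card C" and AC: "?A \<noteq> C"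
        using cA by (auto simp: subsets_of_size_def)
      have R: "a k < b \<and> (Suc (a k) = b \<longrightarrow> (\<forall>s\<in>?A. a s = b \<longrightarrow> s < k))" if k: "k \<in> C - ?A" for k
      proof -
        have "k < n" using k CU by (auto simp: U_def)
        then have "k \<in> \<tau> ` {..<n}" using bij by (simp add: bij_betw_def)
        then obtain l where l: "l < n" "k = \<tau> l" by auto
        have "l > h" using l k CU by (cases "l \<le> i"; cases "l \<le> h") (auto simp: U_def W)
        then have nw: "\<not> in_window n a \<tau> i l" using win by auto
        then have "a (\<tau> l) < a (\<tau> i)" "Suc (a (\<tau> l)) = a (\<tau> i) \<longrightarrow> \<tau> l \<ge> \<tau> i"
          using ord[of i l] \<open>l > h\<close> h l by (auto simp: in_window_def)
        moreover have "\<tau> l \<noteq> \<tau> i" using inj_onD[OF inj[OF order_refl], of l i] l \<open>l > h\<close> h i by auto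
        ultimately have 1: "a k < b" "Suc (a k) = b \<longrightarrow> \<tau> i < k" using l by (auto simp: b_def)
        have "s \<le> \<tau> i" if s: "s \<in> ?A" "a s = b" for s
        proof -
          obtain j where j: "j \<le> i" "s = \<tau> j" using s by auto
          then show ?thesis using ord[of j i] i s(2) by (cases "j = i") (auto simp: b_def)
        qed
        with 1 show ?thesis by fastforce
      qed
      have bb: "(\<lambda>k. d k + of_bool (k \<in> C)) = (\<lambda>k. a k - of_bool (k \<in> ?A) + of_bool (k \<in> C))"
        by (simp add: d_def)
      have An: "?A \<subseteq> {..<n}" "C \<subseteq> {..<n}" using AU CU by (auto simp: U_def)
      have low: "(\<Sum>k<n. d k + of_bool (k \<in> C)) = (\<Sum>k<n. a k)"
        "((\<lambda>k. d k + of_bool (k \<in> C)), a) \<in> measures [\<lambda>a. \<Sum>k<n. a k ^ 2, \<lambda>a. \<Sum>k<n. (n - k) * a k]"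
        unfolding bb
        by (rule exchange_lowers[OF An cC AC Ab b0]; use R in blast)+
      have "x k \<in> x_polys" if "k < n" for k using that by (intro polys.gen) auto
      then have "?q C \<in> x_polys"
        using An(2) \<tau>n hn by (intro polys_sum polys_prod polys_diff) auto
      then have "p * ?q C \<in> x_polys" by (rule polys.mult[OF p])
      then show "p * ?q C * y_monom (\<lambda>k. d k + of_bool (k \<in> C)) \<in> T"
        using low a by (intro lower) auto
    qed
    from lin_subspaceD(5)[OF T(1) * this] have "p * ?q ?A * y_monom a \<in> T" by simp
    also have "?q ?A = (\<Sum>k=0..i. \<Prod>l=Suc i..<min n (Suc h). sorted_x a k - sorted_x a l)"
      by (simp only: reW reA[of "\<lambda>z. (\<Prod>l\<in>?W. z - x l)"])
    also have "{Suc i..<min n (Suc h)} = {Suc i..h}" using hn by auto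
    finally show ?thesis by (simp add: h_def \<tau>_def)
  qed
qed

text \<open>
  Induct over the order of \<open>exchange_lowers\<close>.  If some window is empty, \<open>window_relation\<close> makes
  \<open>i + 1\<close> times the element a combination of lower ones.  Otherwise these relations form a Hessenberg
  system with all weights equal to one.
\<close>

theorem standard_elements_span:
  assumes T: "lin_subspace T" "contains_power_sums m T"
    and std: "\<And>a k. (\<forall>i\<ge>n. a i = 0) \<Longrightarrow> (\<Sum>k<n. a k) = m \<Longrightarrow> (\<And>i. i < n \<Longrightarrow> i < window_end n a (sorting n a) i) \<Longrightarrow>
      (\<forall>i<n. k i < window_end n a (sorting n a) i - i) \<Longrightarrow> standard_element a k \<in> T"
  shows "(\<Sum>k<n. a k) = m \<Longrightarrow> p \<in> x_polys \<Longrightarrow> p * y_monom a \<in> T"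
proof (induction a arbitrary: p
    rule: wf_induct_rule[OF wf_measures[of "[\<lambda>a. \<Sum>k<n. a k ^ 2, \<lambda>a. \<Sum>k<n. (n - k) * a k]"]])
  case (1 a' p)
  define a where "a = (\<lambda>k. if k < n then a' k else 0)"
  have ya: "y_monom a' = y_monom a" by (simp add: y_monom_def a_def)
  have m: "(b, a) \<in> measures [\<lambda>a. \<Sum>k<n. a k ^ 2, \<lambda>a. \<Sum>k<n. (n - k) * a k] \<longleftrightarrow>
    (b, a') \<in> measures [\<lambda>a. \<Sum>k<n. a k ^ 2, \<lambda>a. \<Sum>k<n. (n - k) * a k]" for b
    by (simp add: a_def)
  have sm: "(\<Sum>k<n. a k) = m" using 1(2) by (simp add: a_def)
  define h where "h = window_end n a (sorting n a)"
  have lower: "q * y_monom b \<in> T" if "(\<Sum>k<n. b k) = m"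
    "(b, a) \<in> measures [\<lambda>a. \<Sum>k<n. a k ^ 2, \<lambda>a. \<Sum>k<n. (n - k) * a k]" "q \<in> x_polys" for b q
    using 1(1)[of b q] that m by blast
  have rel: "q * (\<Sum>k=0..i. \<Prod>l=Suc i..h i. sorted_x a k - sorted_x a l) * y_monom a \<in> T"
    if "i < n" "q \<in> x_polys" for i q
    unfolding h_def using T lower sm that by (intro window_relation) auto
  have hb: "i \<le> h i \<and> h i \<le> n" if "i < n" for i
    using window_end_bounds[of i n] that by (simp add: h_def)
  have "p * y_monom a \<in> T"
  proof (cases "\<forall>i<n. i < h i")
    case False
    then obtain i where i: "i < n" "h i = i" using hb by (metis le_less)
    have "p * (\<Sum>k=0..i. 1) * y_monom a \<in> T"
      using rel[OF i(1) 1(3)] i(2) by simp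
    moreover have "(\<Sum>k=0..i. 1) = sc (of_nat (Suc i))"
      by (simp add: sc_of_nat del: of_nat_Suc)
    ultimately have "sc (of_nat (Suc i)) * (p * y_monom a) \<in> T" by (simp add: mult_ac)
    then show ?thesis by (rule lin_subspace_cancel[OF T(1)]) (simp del: of_nat_Suc)
  next
    case True
    have xs: "sorted_x a ` {0..<n} = x ` {..<n}"
    proof -
      have "bij_betw (sorting n a) {..<n} {..<n}" using sorts_sorting by (simp add: sorts_def)
      then have "x ` sorting n a ` {..<n} = x ` {..<n}" by (simp add: bij_betw_def)
      moreover have "sorted_x a ` {0..<n} = (\<lambda>i. x (sorting n a i)) ` {..<n}"
        by (rule image_cong) (auto simp: sorted_x_def)
      ultimately show ?thesis by (simp add: image_image)
    qed
    have "p \<in> {f. y_monom a * f \<in> T}"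
    proof (rule hessenberg_spanning[of "sorted_x a" n h 0 "\<lambda>_. 1"])
      show "sorted_x a n = 0" by (simp add: sorted_x_def)
      show "h i \<le> h i'" if "i \<le> i'" "i' < n" for i i'
        unfolding h_def using that by (intro window_end_mono sorts_sorting)
      show "i \<le> h i \<and> h i \<le> n" if "i < n" for i using hb that .
      show "lin_subspace {f. y_monom a * f \<in> T}" using T(1) by (rule lin_subspace_comap)
      show "r * (\<Sum>k=0..i. sc (of_nat 1) * (\<Prod>l=Suc i..h i. sorted_x a k - sorted_x a l))
          \<in> {f. y_monom a * f \<in> T}" if "i < n" "r \<in> polys (sorted_x a ` {0..<n})" for i r
        using rel[of i r] that by (simp add: xs sc_1 mult_ac)
      show "(\<Prod>i=0..<n. \<Prod>l=Suc i..i + k i. sorted_x a i - sorted_x a l) \<in> {f. y_monom a * f \<in> T}"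
        if "\<And>i. i < n \<Longrightarrow> k i < h i - i \<or> i < 0" for k
        using std[of a k] sm True that
        by (simp add: standard_element_def h_def a_def atLeast0LessThan)
      show "p \<in> polys (sorted_x a ` {0..<n})" using 1(3) by (simp add: xs)
    qed auto
    then show ?thesis by (simp add: mult.commute)
  qed
  then show ?case by (simp add: ya)
qed

end

section \<open>Standard elements are determined by their positions\<close>

definition standard_index :: "nat \<Rightarrow> ((nat \<Rightarrow> nat) \<times> (nat \<Rightarrow> nat)) set" where
  "standard_index n = {(a, k). (\<forall>i\<ge>n. a i = 0 \<and> k i = 0) \<and>
     (\<forall>i<n. i < window_end n a (sorting n a) i \<and> k i < window_end n a (sorting n a) i - i)}"

text \<open>The entry with label \<open>c\<close>, at position \<open>i\<close> after sorting, is moved \<open>k i\<close> steps to the right.\<close>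

definition shifted_position :: "nat \<Rightarrow> (nat \<Rightarrow> nat) \<times> (nat \<Rightarrow> nat) \<Rightarrow> nat \<Rightarrow> nat" where
  "shifted_position n = (\<lambda>(a, k) c. let i = the_inv_into {..<n} (sorting n a) c in i + k i)"

lemma shifted_position_sorting:
  assumes "i < n" shows "shifted_position n (a, k) (sorting n a i) = i + k i"
proof -
  have "inj_on (sorting n a) {..<n}" using sorts_sorting[of n a] by (simp add: sorts_def bij_betw_def)
  then show ?thesis using assms by (simp add: shifted_position_def the_inv_into_f_f)
qed

lemma shifted_position_less:
  assumes "(a, k) \<in> standard_index n" "c < n"
  shows "shifted_position n (a, k) c < n"
proof -
  have "sorting n a ` {..<n} = {..<n}" using sorts_sorting[of n a] by (simp add: sorts_def bij_betw_def)
  then obtain i where i: "i < n" "c = sorting n a i" using assms(2) by (metis imageE lessThan_iff)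
  have "window_end n a (sorting n a) i \<le> n" using window_end_bounds[of i n] i by simp
  moreover have "k i < window_end n a (sorting n a) i - i" using assms(1) i by (auto simp: standard_index_def)
  ultimately show ?thesis using i by (simp add: shifted_position_sorting)
qed

text \<open>
  Call the entry at position \<open>i + k i + 1\<close> the parent of the entry at position \<open>i\<close>.  It lies in the
  window of \<open>i\<close>, so the exponent of the entry is the one of the parent, increased by one if the label
  of the parent is smaller.  The sorted list is therefore reconstructed from its end: among the labels
  that have not been placed yet and whose parent is known, the last one in the order comes next.
\<close>

lemma shifted_position_inj:
  assumes ak: "(a, k) \<in> standard_index n" and ak': "(a', k') \<in> standard_index n"
    and eq: "\<And>c. c < n \<Longrightarrow> shifted_position n (a, k) c = shifted_position n (a', k') c"
  shows "a = a' \<and> k = k'"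
proof -
  define \<tau> \<tau>' where "\<tau> = sorting n a" and "\<tau>' = sorting n a'"
  have s: "sorts n a \<tau>" "sorts n a' \<tau>'" unfolding \<tau>_def \<tau>'_def by (rule sorts_sorting)+
  have order: "a (\<sigma> j) < a (\<sigma> i) \<or> (a (\<sigma> j) = a (\<sigma> i) \<and> \<sigma> i < \<sigma> j)"
    if "sorts n a \<sigma>" "i < j" "j < n" for a \<sigma> i j
    using that by (simp add: sorts_def)
  have bij: "bij_betw \<tau> {..<n} {..<n}" "bij_betw \<tau>' {..<n} {..<n}" using s by (auto simp: sorts_def)
  have \<tau>n: "\<tau> i < n" "\<tau>' i < n" if "i < n" for i using bij that by (auto simp: bij_betw_def)
  have parent: "a (\<sigma> i) = (if l = n then 0 else a (\<sigma> l) + of_bool (\<sigma> l < \<sigma> i)) \<and> l \<le> n"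
    if "(a, k) \<in> standard_index n" "\<sigma> = sorting n a" "i < n" "l = Suc (i + k i)" for a k \<sigma> i l
  proof -
    have s: "sorts n a \<sigma>" unfolding that(2) by (rule sorts_sorting)
    have "k i < window_end n a \<sigma> i - i" using that by (auto simp: standard_index_def)
    then have w: "in_window n a \<sigma> i l" using in_window_iff[OF s] that by auto
    then have ln: "i < l" "l \<le> n" by (auto simp: in_window_def)
    have "l < n \<Longrightarrow> a (\<sigma> l) < a (\<sigma> i) \<or> (a (\<sigma> l) = a (\<sigma> i) \<and> \<sigma> i < \<sigma> l)"
      using s ln by (auto simp: sorts_def)
    then show ?thesis using w ln by (auto simp: in_window_def)
  qed
  have main: "\<forall>i. j \<le> i \<and> i < n \<longrightarrow> \<tau> i = \<tau>' i \<and> a (\<tau> i) = a' (\<tau>' i)" if "j \<le> n" for j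
    using that
  proof (induction rule: inc_induct)
    case base
    show ?case by simp
  next
    case (step j)
    \<comment> \<open>an entry whose parent lies beyond \<open>j\<close> has a known exponent; \<open>\<rho>\<close> is either sorting\<close>
    have same: "a c = a' c"
      if c: "c = \<rho> i" and i: "i < n" "i \<le> j" and \<rho>: "\<rho> = \<tau>" "\<rho>' = \<tau>'" and b: "b = a" "b' = a'" "m = k" "m' = k'"
        and pos: "shifted_position n (b, m) c \<ge> j" 
      for c \<rho> \<rho>' i b b' m m'
    proof -
      have cn: "c < n" using \<tau>n i c \<rho> by auto
      have p: "i + k i \<ge> j" using pos i c \<rho> b by (simp add: shifted_position_sorting \<tau>_def)
      have "c \<in> \<tau>' ` {..<n}" using bij cn by (simp add: bij_betw_def)
      then obtain i' where i': "i' < n" "c = \<tau>' i'" by auto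
      have p': "i' + k' i' = i + k i"
        using eq[OF cn] i i' c \<rho> shifted_position_sorting[of i n a k]
          shifted_position_sorting[of i' n a' k'] by (simp add: \<tau>_def \<tau>'_def)
      define l where "l = Suc (i + k i)"
      have 1: "a c = (if l = n then 0 else a (\<tau> l) + of_bool (\<tau> l < c))" "l \<le> n"
        using parent[OF ak \<tau>_def i(1), of l] c \<rho> by (auto simp: l_def)
      have 2: "a' c = (if l = n then 0 else a' (\<tau>' l) + of_bool (\<tau>' l < c))"
        using parent[OF ak' \<tau>'_def i'(1), of l] i' p' by (auto simp: l_def)
      have "l < n \<Longrightarrow> \<tau> l = \<tau>' l \<and> a (\<tau> l) = a' (\<tau>' l)" using step.IH p by (auto simp: l_def)
      then show ?thesis using 1 2 by auto
    qed
    have j: "j < n" using step by simp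
    have pre: "\<exists>i. i < n \<and> i \<le> j \<and> \<tau>' j = \<tau> i"
    proof -
      have "\<tau>' j \<in> \<tau> ` {..<n}" using bij \<tau>n j by (simp add: bij_betw_def)
      then obtain i where i: "i < n" "\<tau>' j = \<tau> i" by auto
      have "i \<le> j"
      proof (rule ccontr)
        assume "\<not> i \<le> j"
        then have "\<tau> i = \<tau>' i" using step.IH i by auto
        then have "\<tau>' j = \<tau>' i" using i by simp
        then show False using bij(2) i j \<open>\<not> i \<le> j\<close> by (auto simp: bij_betw_def inj_on_def)
      qed
      with i show ?thesis by auto
    qed
    have pre': "\<exists>i. i < n \<and> i \<le> j \<and> \<tau> j = \<tau>' i"
    proof -
      have "\<tau> j \<in> \<tau>' ` {..<n}" using bij \<tau>n j by (simp add: bij_betw_def)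
      then obtain i where i: "i < n" "\<tau> j = \<tau>' i" by auto
      have "i \<le> j"
      proof (rule ccontr)
        assume "\<not> i \<le> j"
        then have "\<tau> i = \<tau>' i" using step.IH i by auto
        then have "\<tau> j = \<tau> i" using i by simp
        then show False using bij(1) i j \<open>\<not> i \<le> j\<close> by (auto simp: bij_betw_def inj_on_def)
      qed
      with i show ?thesis by auto
    qed
    obtain i where i: "i < n" "i \<le> j" "\<tau>' j = \<tau> i" using pre by blast
    obtain i' where i': "i' < n" "i' \<le> j" "\<tau> j = \<tau>' i'" using pre' by blast
    have aj: "a (\<tau> j) = a' (\<tau> j)"
      using j by (intro same[of _ \<tau> j \<tau>' a a' k k']) (auto simp: shifted_position_sorting \<tau>_def)
    have posd: "shifted_position n (a, k) (\<tau>' j) \<ge> j"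
      using eq[of "\<tau>' j"] \<tau>n[of j] j by (simp add: shifted_position_sorting \<tau>'_def)
    have aj': "a (\<tau>' j) = a' (\<tau>' j)"
      using i posd by (intro same[of _ \<tau> i \<tau>' a a' k k']) auto
    \<comment> \<open>both labels have known exponents, so the two sorted orders compare them alike\<close>
    have "\<tau> j = \<tau>' j"
    proof (rule ccontr)
      assume ne: "\<tau> j \<noteq> \<tau>' j"
      then have "i < j" "i' < j" using i i' by (auto simp: le_less)
      then have "a (\<tau> j) < a (\<tau>' j) \<or> (a (\<tau> j) = a (\<tau>' j) \<and> \<tau>' j < \<tau> j)"
        "a' (\<tau>' j) < a' (\<tau> j) \<or> (a' (\<tau>' j) = a' (\<tau> j) \<and> \<tau> j < \<tau>' j)"
        using order[OF s(1) \<open>i < j\<close> j] order[OF s(2) \<open>i' < j\<close> j] by (simp_all only: i(3) i'(3))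
      then show False using aj aj' by linarith
    qed
    then have top: "\<tau> j = \<tau>' j \<and> a (\<tau> j) = a' (\<tau>' j)" using aj by simp
    show ?case
    proof (intro allI impI)
      fix l assume l: "j \<le> l \<and> l < n"
      show "\<tau> l = \<tau>' l \<and> a (\<tau> l) = a' (\<tau>' l)"
      proof (cases "l = j")
        case True
        show ?thesis unfolding True by (rule top)
      next
        case False
        then have "Suc j \<le> l \<and> l < n" using l by linarith
        then show ?thesis using step.IH by blast
      qed
    qed
  qed
  have \<tau>\<tau>': "\<tau> i = \<tau>' i" "a (\<tau> i) = a' (\<tau> i)" if "i < n" for i using main[of 0] that by auto
  have "a c = a' c" for c
  proof (cases "c < n")
    case True
    then have "c \<in> \<tau> ` {..<n}" using bij by (simp add: bij_betw_def)
    then show ?thesis using \<tau>\<tau>' by auto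
  qed (use ak ak' in \<open>auto simp: standard_index_def\<close>)
  moreover have "k i = k' i" for i
  proof (cases "i < n")
    case True
    then show ?thesis
      using eq[of "\<tau> i"] \<tau>n \<tau>\<tau>'(1)[OF True] shifted_position_sorting[of i n a k]
        shifted_position_sorting[of i n a' k'] by (simp add: \<tau>_def \<tau>'_def)
  qed (use ak ak' in \<open>auto simp: standard_index_def\<close>)
  ultimately show ?thesis by blast
qed

lemma finite_standard_index: "finite (standard_index n)"
proof (rule finite_imageD)
  let ?f = "\<lambda>i. map (shifted_position n i) [0..<n]"
  have "?f ` standard_index n \<subseteq> {xs. set xs \<subseteq> {..<n} \<and> length xs = n}"
  proof (rule image_subsetI)
    fix i assume "i \<in> standard_index n"
    then have "shifted_position n i c < n" if "c < n" for c
      using shifted_position_less[of "fst i" "snd i" n c] that by simp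
    then show "?f i \<in> {xs. set xs \<subseteq> {..<n} \<and> length xs = n}" by auto
  qed
  then show "finite (?f ` standard_index n)"
    by (rule finite_subset) (simp add: finite_lists_length_eq)
  show "inj_on ?f (standard_index n)"
  proof (rule inj_onI)
    fix i i' assume i: "i \<in> standard_index n" "i' \<in> standard_index n" "?f i = ?f i'"
    have "shifted_position n i c = shifted_position n i' c" if "c < n" for c
      using i(3) that by simp
    then show "i = i'"
      using shifted_position_inj[of "fst i" "snd i" n "fst i'" "snd i'"] i(1,2) by (auto simp: prod_eq_iff)
  qed
qed

section \<open>Polynomials in two sets of variables\<close>

interpretation pm: vector_space "pm_scale :: complex \<Rightarrow> ('k \<Rightarrow>\<^sub>0 complex) \<Rightarrow> ('k \<Rightarrow>\<^sub>0 complex)"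
  by unfold_locales (auto simp: pm_scale_add_left pm_scale_add_right)

lemma lin_ext_sum: "lin_ext \<phi> (sum f A) = (\<Sum>i\<in>A. lin_ext \<phi> (f i))"
  by (induction A rule: infinite_finite_induct) (auto simp: lin_ext_add)

type_synonym poly_n = "(nat \<Rightarrow>\<^sub>0 nat) \<times> (nat \<Rightarrow>\<^sub>0 nat) \<Rightarrow>\<^sub>0 complex"

definition poly_const :: "complex \<Rightarrow> poly_n" where "poly_const c = single 0 c"
definition poly_x :: "nat \<Rightarrow> poly_n" where
  "poly_x k = single (single k 1, 0) 1"
definition poly_y :: "nat \<Rightarrow> poly_n" where
  "poly_y k = single (0, single k 1) 1"

interpretation poly_n: two_variable_sets poly_const n poly_x poly_y for n
  by unfold_locales
     (auto simp: poly_const_def mult_single zero_prod_def single_add simp flip: single_one)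

lemma poly_const_mult: "poly_const c * f = pm_scale c f"
  by (simp add: poly_const_def pm_scale_eq_mult)

lemma poly_n_lin_subspace: "poly_n.lin_subspace T \<longleftrightarrow> pm.subspace T"
  by (auto simp: poly_n.lin_subspace_def pm.subspace_def poly_const_mult)

lemma poly_x_power: "poly_x k ^ c = single (single k c, 0) 1"
  by (induction c) (auto simp: poly_x_def mult_single single_add[symmetric] zero_prod_def[symmetric]
    simp flip: single_one)

lemma poly_y_power: "poly_y k ^ c = single (0, single k c) 1"
  by (induction c) (auto simp: poly_y_def mult_single single_add[symmetric] zero_prod_def[symmetric]
    simp flip: single_one)

definition exponents :: "nat \<Rightarrow> (nat \<Rightarrow> nat) \<Rightarrow> (nat \<Rightarrow>\<^sub>0 nat)" where
  "exponents n c = (\<Sum>k<n. single k (c k))"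

lemma lookup_exponents: "lookup (exponents n c) k = (if k < n then c k else 0)"
  by (simp add: exponents_def lookup_sum lookup_single when_def)

lemma y_monom_exponents: "poly_n.y_monom n d = single (0, exponents n d) 1"
proof -
  have "(\<Prod>k\<in>A. poly_y k ^ d k) = single (0, \<Sum>k\<in>A. single k (d k)) 1" if "finite A" for A
    using that by (induction A) (auto simp: poly_y_power mult_single zero_prod_def[symmetric] simp flip: single_one)
  then show ?thesis by (simp add: poly_n.y_monom_def exponents_def)
qed

definition monomial :: "nat \<Rightarrow> (nat \<Rightarrow> nat) \<Rightarrow> (nat \<Rightarrow> nat) \<Rightarrow> poly_n" where
  "monomial n c d = single (exponents n c, exponents n d) 1"

lemma monomial_in_x_polys: "\<exists>p \<in> polys. p * poly_n.y_monom n d = monomial n c d" if "polys = poly_n.polys (poly_x ` {..<n})"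
proof -
  have "(\<Prod>k\<in>A. poly_x k ^ c k) = single (\<Sum>k\<in>A. single k (c k), 0) 1" if "finite A" for A
    using that by (induction A) (auto simp: poly_x_power mult_single zero_prod_def[symmetric] simp flip: single_one)
  then have "(\<Prod>k<n. poly_x k ^ c k) * poly_n.y_monom n d = monomial n c d"
    by (simp add: y_monom_exponents mult_single monomial_def exponents_def)
  moreover have "(\<Prod>k<n. poly_x k ^ c k) \<in> polys"
    unfolding that by (intro poly_n.polys_prod poly_n.polys_power poly_n.polys.gen) auto
  ultimately show ?thesis by blast
qed

lemma x_polys_keys:
  assumes "p \<in> poly_n.polys (poly_x ` {..<n})" "w \<in> keys p"
  shows "snd w = 0"
  using assms
proof (induction arbitrary: w)
  case (const c)
  then show ?case by (auto simp: poly_const_def zero_prod_def split: if_splits)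
next
  case (gen s)
  then show ?case by (auto simp: poly_x_def)
next
  case (add p q)
  then show ?case using keys_add[of p q] by blast
next
  case (mult p q)
  then show ?case using keys_mult[of p q] by (fastforce simp: plus_prod_def)
qed

text \<open>
  The linear map that is \<open>\<theta> c d\<close> on the monomial \<open>x\<^sup>c y\<^sup>d\<close>.  Functions of exponents are defined on all
  of \<open>nat \<Rightarrow> nat\<close>, and \<open>local_to n\<close> says that only the values below \<open>n\<close> matter.
\<close>

definition evaluate :: "((nat \<Rightarrow> nat) \<Rightarrow> (nat \<Rightarrow> nat) \<Rightarrow> ('t \<Rightarrow>\<^sub>0 complex)) \<Rightarrow> poly_n \<Rightarrow> ('t \<Rightarrow>\<^sub>0 complex)" where
  "evaluate \<theta> = lin_ext (\<lambda>(u, v). \<theta> (lookup u) (lookup v))"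

definition local_to :: "nat \<Rightarrow> ((nat \<Rightarrow> nat) \<Rightarrow> (nat \<Rightarrow> nat) \<Rightarrow> 'b) \<Rightarrow> bool" where
  "local_to n \<theta> \<longleftrightarrow> (\<forall>c d c' d'. (\<forall>k<n. c k = c' k \<and> d k = d' k) \<longrightarrow> \<theta> c d = \<theta> c' d')"

lemma evaluate_linear:
  "evaluate \<theta> 0 = 0" "evaluate \<theta> (f + g) = evaluate \<theta> f + evaluate \<theta> g"
  "evaluate \<theta> (f - g) = evaluate \<theta> f - evaluate \<theta> g"
  "evaluate \<theta> (pm_scale a f) = pm_scale a (evaluate \<theta> f)"
  "evaluate \<theta> (sum h A) = (\<Sum>i\<in>A. evaluate \<theta> (h i))"
  by (simp_all add: evaluate_def lin_ext_add lin_ext_diff lin_ext_scale lin_ext_sum)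

lemma evaluate_monomial: "local_to n \<theta> \<Longrightarrow> evaluate \<theta> (monomial n c d) = \<theta> c d"
  by (simp add: evaluate_def monomial_def local_to_def lookup_exponents)

lemma evaluate_power_sum:
  "evaluate \<theta> (single (u, v) a * (\<Sum>k<n. poly_x k ^ \<alpha> * poly_y k ^ \<beta>)) =
    pm_scale a (\<Sum>k<n. \<theta> ((lookup u)(k := lookup u k + \<alpha>))
                  ((lookup v)(k := lookup v k + \<beta>)))"
proof -
  have upd: "lookup (u + single k \<alpha>) =
      (lookup u)(k := lookup u k + \<alpha>)" for u :: "nat \<Rightarrow>\<^sub>0 nat" and k \<alpha>
    by (auto simp: lookup_add lookup_single when_def)
  show ?thesis
    by (simp add: sum_distrib_left evaluate_linear poly_x_power poly_y_power mult_single
        pm_scale_sum) (simp add: evaluate_def upd)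
qed

section \<open>The orbit of the Vandermonde vector\<close>

text \<open>The monomial of exponents \<open>q\<close> in the truncated polynomial ring \<open>C[t]/t\<^sup>n\<close> in \<open>n\<close> variables.\<close>

definition truncated_monom :: "nat \<Rightarrow> (nat \<Rightarrow> nat) \<Rightarrow> (nat list \<Rightarrow>\<^sub>0 complex)" where
  "truncated_monom n q = (if \<forall>k<n. q k < n then single (map q [0..<n]) 1 else 0)"

text \<open>A weighted Vandermonde determinant multiplied by \<open>x\<^sup>c\<close>.\<close>

definition alternating :: "nat \<Rightarrow> (nat \<Rightarrow> nat) \<Rightarrow> ((nat \<Rightarrow> nat) \<Rightarrow> complex) \<Rightarrow> (nat list \<Rightarrow>\<^sub>0 complex)" where
  "alternating n c \<phi> = (\<Sum>\<sigma> | \<sigma> permutes {..<n}.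
     pm_scale (of_int (sign \<sigma>) * \<phi> \<sigma>) (truncated_monom n (\<lambda>k. \<sigma> k + c k)))"

definition euler_power :: "nat \<Rightarrow> complex \<Rightarrow> (nat \<Rightarrow> nat) \<Rightarrow> (nat \<Rightarrow> nat) \<Rightarrow> complex" where
  "euler_power n z d \<sigma> = (\<Prod>k<n. (z + of_nat (\<sigma> k)) ^ d k)"

text \<open>
  The monomial \<open>x\<^sup>c y\<^sup>d\<close> applied to the Vandermonde determinant, where \<open>y k\<close> acts as the Euler
  operator \<open>x d/dx\<close> of the \<open>k\<close>-th variable, shifted by \<open>z\<close>, and the \<open>x\<^sup>c\<close> acts after the \<open>y\<^sup>d\<close>.
\<close>

definition vandermonde_orbit :: "nat \<Rightarrow> complex \<Rightarrow> (nat \<Rightarrow> nat) \<Rightarrow> (nat \<Rightarrow> nat) \<Rightarrow> (nat list \<Rightarrow>\<^sub>0 complex)" where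
  "vandermonde_orbit n z c d = alternating n c (euler_power n z d)"

definition orbit_filtration :: "nat \<Rightarrow> complex \<Rightarrow> nat \<Rightarrow> (nat list \<Rightarrow>\<^sub>0 complex) set" where
  "orbit_filtration n z m = pm.span {vandermonde_orbit n z c d | c d. (\<Sum>k<n. d k) < m}"

lemma truncated_monom_cong: "(\<And>k. k < n \<Longrightarrow> q k = q' k) \<Longrightarrow> truncated_monom n q = truncated_monom n q'"
  by (auto simp: truncated_monom_def intro!: arg_cong2[of _ _ _ _ single])

lemma alternating_linear:
  "alternating n c (\<lambda>\<sigma>. \<phi> \<sigma> + \<psi> \<sigma>) = alternating n c \<phi> + alternating n c \<psi>"
  "alternating n c (\<lambda>\<sigma>. \<phi> \<sigma> - \<psi> \<sigma>) = alternating n c \<phi> - alternating n c \<psi>"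
  "alternating n c (\<lambda>\<sigma>. a * \<phi> \<sigma>) = pm_scale a (alternating n c \<phi>)"
  "alternating n c (\<lambda>\<sigma>. \<Sum>i\<in>A. f i \<sigma>) = (\<Sum>i\<in>A. alternating n c (f i))"
proof -
  show 1: "alternating n c (\<lambda>\<sigma>. \<phi> \<sigma> + \<psi> \<sigma>) = alternating n c \<phi> + alternating n c \<psi>" for \<phi> \<psi>
    by (simp add: alternating_def distrib_left pm_scale_add_left sum.distrib)
  show 3: "alternating n c (\<lambda>\<sigma>. a * \<phi> \<sigma>) = pm_scale a (alternating n c \<phi>)" for a \<phi>
    by (simp add: alternating_def pm_scale_sum mult.left_commute)
  show "alternating n c (\<lambda>\<sigma>. \<phi> \<sigma> - \<psi> \<sigma>) = alternating n c \<phi> - alternating n c \<psi>"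
    using 1[of "\<lambda>\<sigma>. \<phi> \<sigma> - \<psi> \<sigma>" \<psi>] by simp
  show "alternating n c (\<lambda>\<sigma>. \<Sum>i\<in>A. f i \<sigma>) = (\<Sum>i\<in>A. alternating n c (f i))"
  proof (induction A rule: infinite_finite_induct)
    case (insert x A)
    then show ?case using 1[of "f x"] by simp
  qed (use 3[of 0 "\<lambda>_. 0"] in auto)
qed

lemma alternating_cong:
  assumes "\<And>k. k < n \<Longrightarrow> c k = c' k" "\<And>\<sigma>. \<sigma> permutes {..<n} \<Longrightarrow> \<phi> \<sigma> = \<psi> \<sigma>"
  shows "alternating n c \<phi> = alternating n c' \<psi>"
  unfolding alternating_def using assms
  by (intro sum.cong arg_cong2[of _ _ _ _ pm_scale] truncated_monom_cong) auto

lemma local_to_vandermonde_orbit: "local_to n (vandermonde_orbit n z)"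
  unfolding local_to_def vandermonde_orbit_def
  by (intro allI impI alternating_cong) (auto simp: euler_power_def)

lemma euler_power_upd:
  assumes "k < n"
  shows "euler_power n z (d(k := e)) \<sigma> = (\<Prod>j\<in>{..<n} - {k}. (z + of_nat (\<sigma> j)) ^ d j) * (z + of_nat (\<sigma> k)) ^ e"
proof -
  have "euler_power n z (d(k := e)) \<sigma> =
    (z + of_nat (\<sigma> k)) ^ e * (\<Prod>j\<in>{..<n} - {k}. (z + of_nat (\<sigma> j)) ^ (d(k := e)) j)"
    unfolding euler_power_def using assms by (subst prod.remove[of _ k]) auto
  also have "(\<Prod>j\<in>{..<n} - {k}. (z + of_nat (\<sigma> j)) ^ (d(k := e)) j) =
      (\<Prod>j\<in>{..<n} - {k}. (z + of_nat (\<sigma> j)) ^ d j)"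
    by (intro prod.cong) auto
  finally show ?thesis by (simp only: mult.commute)
qed

lemma vandermonde_orbit_sum_upd_y:
  "(\<Sum>k<n. vandermonde_orbit n z c (d(k := d k + \<beta>))) =
    pm_scale (\<Sum>k<n. (z + of_nat k) ^ \<beta>) (vandermonde_orbit n z c d)"
  unfolding vandermonde_orbit_def alternating_linear(3,4)[symmetric]
proof (rule alternating_cong)
  fix \<sigma> assume \<sigma>: "\<sigma> permutes {..<n}"
  have "(\<Sum>k<n. (z + of_nat (\<sigma> k)) ^ \<beta>) = (\<Sum>k<n. (z + of_nat k) ^ \<beta>)"
    by (rule sum.permute[OF \<sigma>, of "\<lambda>k. (z + of_nat k) ^ \<beta>", unfolded comp_def, symmetric])
  moreover have "euler_power n z (d(k := d k + \<beta>)) \<sigma> = (z + of_nat (\<sigma> k)) ^ \<beta> * euler_power n z d \<sigma>" if "k < n" for k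
    using euler_power_upd[OF that, of z d "d k"] euler_power_upd[OF that, of z d "d k + \<beta>"]
    by (simp add: power_add mult_ac)
  ultimately show "(\<Sum>k<n. euler_power n z (d(k := d k + \<beta>)) \<sigma>) =
      (\<Sum>k<n. (z + of_nat k) ^ \<beta>) * euler_power n z d \<sigma>"
    by (simp add: sum_distrib_right[symmetric])
qed simp

text \<open>
  The terms cancel in pairs.  If the exponent \<open>\<sigma> k\<close> is raised to \<open>\<sigma> k + \<alpha>\<close>, either the
  term is truncated or this value is already taken by another variable \<open>l\<close>.  Exchanging \<open>k\<close> and \<open>l\<close> changes the sign and nothing else.
\<close>

lemma alternating_shift_cancel:
  assumes \<alpha>: "\<alpha> > 0"
  shows "(\<Sum>k<n. alternating n (c(k := c k + \<alpha>))
     (\<lambda>\<sigma>. F (\<sigma>(k := \<sigma> k + \<alpha>)) * G (\<sigma> k))) = 0"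
proof -
  define P where "P = {(k, \<sigma>). k < n \<and> \<sigma> permutes {..<n} \<and> \<sigma> k + \<alpha> < n}"
  define t where "t = (\<lambda>(k, \<sigma>). pm_scale (of_int (sign \<sigma>) * (F (\<sigma>(k := \<sigma> k + \<alpha>)) * G (\<sigma> k)))
     (truncated_monom n (\<lambda>j. (\<sigma>(k := \<sigma> k + \<alpha>)) j + c j)))"
  \<comment> \<open>\<open>l\<close> is the variable that already has the raised exponent\<close>
  define partner where "partner = (\<lambda>(k :: nat, \<sigma> :: nat \<Rightarrow> nat). let l = inv_into UNIV \<sigma> (\<sigma> k + \<alpha>) in (l, \<sigma> \<circ> transpose k l))"
  let ?Q = "{..<n} \<times> {\<sigma>. \<sigma> permutes {..<n}}"
  have fin: "finite ?Q" by (simp add: finite_permutations)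
  have "(\<Sum>k<n. alternating n (c(k := c k + \<alpha>)) (\<lambda>\<sigma>. F (\<sigma>(k := \<sigma> k + \<alpha>)) * G (\<sigma> k))) =
      (\<Sum>k<n. \<Sum>\<sigma> | \<sigma> permutes {..<n}. t (k, \<sigma>))"
  proof (intro sum.cong refl)
    fix k
    have "(\<lambda>j. \<sigma> j + (c(k := c k + \<alpha>)) j) = (\<lambda>j. (\<sigma>(k := \<sigma> k + \<alpha>)) j + c j)" for \<sigma> :: "nat \<Rightarrow> nat"
      by auto
    then show "alternating n (c(k := c k + \<alpha>)) (\<lambda>\<sigma>. F (\<sigma>(k := \<sigma> k + \<alpha>)) * G (\<sigma> k)) =
        (\<Sum>\<sigma> | \<sigma> permutes {..<n}. t (k, \<sigma>))"
      by (simp only: alternating_def t_def prod.case)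
  qed
  also have "\<dots> = sum t ?Q" by (simp add: sum.cartesian_product)
  also have "\<dots> = sum t P"
  proof (rule sum.mono_neutral_right[OF fin])
    show "P \<subseteq> ?Q" by (auto simp: P_def)
    show "\<forall>i\<in>?Q - P. t i = 0"
    proof
      fix i assume i: "i \<in> ?Q - P"
      obtain k \<sigma> where [simp]: "i = (k, \<sigma>)" by (cases i)
      have "k < n" "\<not> (\<sigma>(k := \<sigma> k + \<alpha>)) k + c k < n" using i by (auto simp: P_def)
      then have "truncated_monom n (\<lambda>j. (\<sigma>(k := \<sigma> k + \<alpha>)) j + c j) = 0"
        unfolding truncated_monom_def by metis
      then show "t i = 0" by (simp add: t_def)
    qed
  qed
  finally have sum_t: "(\<Sum>k<n. alternating n (c(k := c k + \<alpha>)) (\<lambda>\<sigma>. F (\<sigma>(k := \<sigma> k + \<alpha>)) * G (\<sigma> k))) = sum t P" .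
  have neg: "sum t P = - sum t P"
  proof -
    have pr: "partner i \<in> P \<and> partner (partner i) = i \<and> t (partner i) = - t i" if "i \<in> P" for i
    proof -
      obtain k \<sigma> where i: "i = (k, \<sigma>)" by (cases i)
      have k: "k < n" "\<sigma> permutes {..<n}" "\<sigma> k + \<alpha> < n" using that i by (auto simp: P_def)
      define l where "l = inv_into UNIV \<sigma> (\<sigma> k + \<alpha>)"
      have \<sigma>l: "\<sigma> l = \<sigma> k + \<alpha>" using k(2) by (simp add: l_def permutes_inverses)
      have ln: "l < n" using k permutes_in_image[OF permutes_inv[OF k(2)], of "\<sigma> k + \<alpha>"] by (simp add: l_def)
      have kl: "k \<noteq> l" using \<sigma>l \<alpha> by auto
      define \<rho> where "\<rho> = \<sigma> \<circ> transpose k l"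
      have pi: "partner i = (l, \<rho>)" by (simp add: partner_def i Let_def l_def \<rho>_def)
      have \<rho>: "\<rho> permutes {..<n}"
        unfolding \<rho>_def using k ln by (intro permutes_compose permutes_swap_id) auto
      have \<rho>kl: "\<rho> l = \<sigma> k" "\<rho> k = \<sigma> l" by (auto simp: \<rho>_def)
      have "inv_into UNIV \<rho> (\<rho> l + \<alpha>) = k" using \<rho> \<rho>kl \<sigma>l by (metis permutes_inverses(2))
      moreover have "\<rho> \<circ> transpose l k = \<sigma>" by (auto simp: \<rho>_def fun_eq_iff transpose_def)
      ultimately have pp: "partner (partner i) = i"
        unfolding pi by (simp add: partner_def i)
      have sgn: "sign \<rho> = - sign \<sigma>"
        unfolding \<rho>_def using k kl
        by (subst sign_compose) (auto simp: sign_swap_id permutes_imp_permutation[OF finite_lessThan] permutation_swap_id)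
      have same: "\<rho>(l := \<rho> l + \<alpha>) = \<sigma>(k := \<sigma> k + \<alpha>)"
        using \<rho>kl \<sigma>l kl by (auto simp: \<rho>_def fun_eq_iff transpose_def)
      have "t (l, \<rho>) = - t (k, \<sigma>)"
        unfolding t_def prod.case same by (simp add: \<rho>kl sgn)
      then have "t (partner i) = - t i" by (simp only: pi[unfolded i] i)
      then show ?thesis using pp \<rho> ln k \<rho>kl by (simp add: pi P_def)
    qed
    have "sum t P = sum (\<lambda>i. - t i) P"
      by (rule sum.reindex_bij_witness[of _ partner partner]) (use pr in auto)
    then show ?thesis by (simp add: sum_negf)
  qed
  have "pm_scale 2 (sum t P) = sum t P + sum t P"
    using pm_scale_add_left[of 1 1 "sum t P"] by simp
  also have "\<dots> = 0" using neg by (metis add.right_inverse)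
  finally have "sum t P = 0" by (simp add: pm.scale_eq_0_iff)
  then show ?thesis using sum_t by simp
qed

lemma sum_upd:
  fixes d :: "nat \<Rightarrow> nat"
  assumes "k < n" shows "(\<Sum>j<n. (d(k := e)) j) + d k = (\<Sum>j<n. d j) + e"
proof -
  have "(\<Sum>j<n. (d(k := e)) j) = e + (\<Sum>j\<in>{..<n} - {k}. (d(k := e)) j)"
    using assms by (subst sum.remove[of _ k]) auto
  also have "(\<Sum>j\<in>{..<n} - {k}. (d(k := e)) j) = (\<Sum>j\<in>{..<n} - {k}. d j)"
    by (intro sum.cong) auto
  finally show ?thesis using assms by (simp add: sum.remove[of "{..<n}" k d])
qed

lemma orbit_filtration_subspace: "pm.subspace (orbit_filtration n z m)"
  by (simp add: orbit_filtration_def)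

lemma vandermonde_orbit_in_filtration:
  "(\<Sum>k<n. d k) < m \<Longrightarrow> vandermonde_orbit n z c d \<in> orbit_filtration n z m"
  unfolding orbit_filtration_def by (rule pm.span_base) blast

text \<open>
  For \<open>\<alpha> = 0\<close> the power sum acts on the Vandermonde vector as a scalar.  For \<open>\<alpha> > 0\<close>, write the power
  of the Euler factor with respect to the shifted exponent \<open>\<sigma> k + \<alpha>\<close>.  The leading terms then cancel
  by \<open>alternating_shift_cancel\<close>.
\<close>

lemma orbit_power_sum_in_filtration:
  assumes "\<alpha> + \<beta> > 0"
  shows "(\<Sum>k<n. vandermonde_orbit n z (c(k := c k + \<alpha>)) (d(k := d k + \<beta>)))
    \<in> orbit_filtration n z ((\<Sum>k<n. d k) + \<beta>)"
proof (cases "\<alpha> = 0")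
  case True
  then show ?thesis
    using assms by (auto simp: vandermonde_orbit_sum_upd_y intro!: vandermonde_orbit_in_filtration
        pm.subspace_scale[OF orbit_filtration_subspace])
next
  case False
  let ?coef = "\<lambda>k t. of_nat (d k choose t) * of_nat \<alpha> ^ (d k - t) :: complex"
  define F where "F v = (\<Prod>j<n. (z + of_nat (v j)) ^ d j)" for v :: "nat \<Rightarrow> nat"
  define G where "G m = (z + of_nat m) ^ \<beta>" for m :: nat
  have expand: "F (\<sigma>(k := \<sigma> k + \<alpha>)) * G (\<sigma> k) = euler_power n z (d(k := d k + \<beta>)) \<sigma> +
      (\<Sum>t<d k. ?coef k t * euler_power n z (d(k := t + \<beta>)) \<sigma>)" if "k < n" for k and \<sigma> :: "nat \<Rightarrow> nat"
  proof -
    let ?R = "\<Prod>j\<in>{..<n} - {k}. (z + of_nat (\<sigma> j)) ^ d j" and ?w = "z + of_nat (\<sigma> k)"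
    have "F (\<sigma>(k := \<sigma> k + \<alpha>)) = (?w + of_nat \<alpha>) ^ d k *
        (\<Prod>j\<in>{..<n} - {k}. (z + of_nat ((\<sigma>(k := \<sigma> k + \<alpha>)) j)) ^ d j)"
      unfolding F_def using that by (subst prod.remove[of _ k]) (auto simp: add.assoc)
    also have "(\<Prod>j\<in>{..<n} - {k}. (z + of_nat ((\<sigma>(k := \<sigma> k + \<alpha>)) j)) ^ d j) = ?R"
      by (intro prod.cong) auto
    also have "(?w + of_nat \<alpha>) ^ d k = (\<Sum>t\<le>d k. ?coef k t * ?w ^ t)"
      by (simp add: binomial_ring mult_ac)
    also have "\<dots> = ?w ^ d k + (\<Sum>t<d k. ?coef k t * ?w ^ t)"
      by (simp add: lessThan_Suc_atMost[symmetric])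
    finally have F_eq: "F (\<sigma>(k := \<sigma> k + \<alpha>)) = (?w ^ d k + (\<Sum>t<d k. ?coef k t * ?w ^ t)) * ?R" .
    show ?thesis
      unfolding F_eq euler_power_upd[OF that] G_def
      by (simp add: power_add distrib_left distrib_right sum_distrib_left sum_distrib_right mult_ac)
  qed
  have "(\<Sum>k<n. vandermonde_orbit n z (c(k := c k + \<alpha>)) (d(k := d k + \<beta>))) +
      (\<Sum>k<n. \<Sum>t<d k. pm_scale (?coef k t) (vandermonde_orbit n z (c(k := c k + \<alpha>)) (d(k := t + \<beta>)))) =
      (\<Sum>k<n. alternating n (c(k := c k + \<alpha>)) (\<lambda>\<sigma>. F (\<sigma>(k := \<sigma> k + \<alpha>)) * G (\<sigma> k)))"
    unfolding sum.distrib[symmetric] vandermonde_orbit_def alternating_linear(1,3,4)[symmetric]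
    by (intro sum.cong refl alternating_cong) (simp_all add: expand)
  also have "\<dots> = 0" using False by (intro alternating_shift_cancel) simp
  finally have "(\<Sum>k<n. vandermonde_orbit n z (c(k := c k + \<alpha>)) (d(k := d k + \<beta>))) =
      - (\<Sum>k<n. \<Sum>t<d k. pm_scale (?coef k t) (vandermonde_orbit n z (c(k := c k + \<alpha>)) (d(k := t + \<beta>))))"
    by (simp only: eq_neg_iff_add_eq_0)
  also have "\<dots> \<in> orbit_filtration n z ((\<Sum>k<n. d k) + \<beta>)"
  proof (intro pm.subspace_neg pm.subspace_sum pm.subspace_scale orbit_filtration_subspace
      vandermonde_orbit_in_filtration)
    fix k t assume "k \<in> {..<n}" "t \<in> {..<d k}"
    then show "(\<Sum>j<n. (d(k := t + \<beta>)) j) < (\<Sum>k<n. d k) + \<beta>"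
      using sum_upd[of k n d "t + \<beta>"] by simp
  qed
  finally show ?thesis .
qed

text \<open>
  Polynomials in the Euler operators separate the permutations: the product \<open>sep\<close> vanishes at all
  permutations except \<open>\<rho>\<close>, so it isolates a single term of the determinant.
\<close>

lemma truncated_monom_in_orbit_span:
  assumes "\<rho> permutes {..<n}"
  shows "truncated_monom n (\<lambda>k. \<rho> k + c k) \<in> pm.span (range (\<lambda>d. vandermonde_orbit n z c d))"
proof -
  let ?V = "pm.span (range (\<lambda>d. vandermonde_orbit n z c d))"
  define \<Sigma> where "\<Sigma> = {\<sigma>. \<sigma> permutes {..<n}} - {\<rho>}"
  have fin: "finite \<Sigma>" by (simp add: \<Sigma>_def finite_permutations)
  have "\<exists>j<n. \<sigma> j \<noteq> \<rho> j" if "\<sigma> \<in> \<Sigma>" for \<sigma>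
  proof (rule ccontr)
    assume "\<not> ?thesis"
    then have "\<sigma> j = \<rho> j" for j
      using that assms by (cases "j < n") (auto simp: \<Sigma>_def permutes_def)
    then show False using that by (auto simp: \<Sigma>_def)
  qed
  then obtain J where J: "\<And>\<sigma>. \<sigma> \<in> \<Sigma> \<Longrightarrow> J \<sigma> < n \<and> \<sigma> (J \<sigma>) \<noteq> \<rho> (J \<sigma>)" by metis
  \<comment> \<open>it vanishes on \<open>S\<close> but not at \<open>\<rho>\<close>, and is a polynomial in the Euler factors\<close>
  define sep :: "(nat \<Rightarrow> nat) set \<Rightarrow> (nat \<Rightarrow> nat) \<Rightarrow> complex" where
    "sep S \<sigma> = (\<Prod>\<sigma>'\<in>S. of_nat (\<sigma> (J \<sigma>')) - of_nat (\<sigma>' (J \<sigma>')))" for S \<sigma>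
  have "alternating n c (\<lambda>\<sigma>. euler_power n z d \<sigma> * sep S \<sigma>) \<in> ?V" if "finite S" "S \<subseteq> \<Sigma>" for S d
    using that
  proof (induction S arbitrary: d)
    case empty
    show ?case by (auto simp: sep_def simp flip: vandermonde_orbit_def intro: pm.span_base)
  next
    case (insert \<sigma>' S)
    let ?j = "J \<sigma>'"
    have j: "?j < n" using J insert.prems by auto
    have "euler_power n z d \<sigma> * sep (insert \<sigma>' S) \<sigma> =
       euler_power n z (d(?j := Suc (d ?j))) \<sigma> * sep S \<sigma> -
       (z + of_nat (\<sigma>' ?j)) * (euler_power n z d \<sigma> * sep S \<sigma>)" for \<sigma>
      using euler_power_upd[OF j, of z d "d ?j" \<sigma>] euler_power_upd[OF j, of z d "Suc (d ?j)" \<sigma>] insert.hyps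
      by (simp add: sep_def algebra_simps)
    then have "alternating n c (\<lambda>\<sigma>. euler_power n z d \<sigma> * sep (insert \<sigma>' S) \<sigma>) =
      alternating n c (\<lambda>\<sigma>. euler_power n z (d(?j := Suc (d ?j))) \<sigma> * sep S \<sigma>) -
      pm_scale (z + of_nat (\<sigma>' ?j)) (alternating n c (\<lambda>\<sigma>. euler_power n z d \<sigma> * sep S \<sigma>))"
      by (simp only: alternating_linear(2,3))
    then show ?case
      using insert.IH insert.prems by (simp add: pm.span_diff pm.span_scale)
  qed
  from this[OF fin order_refl, of "\<lambda>_. 0"]
  have "alternating n c (sep \<Sigma>) \<in> ?V" by (simp add: euler_power_def)
  also have "alternating n c (sep \<Sigma>) =
      pm_scale (of_int (sign \<rho>) * sep \<Sigma> \<rho>) (truncated_monom n (\<lambda>k. \<rho> k + c k))"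
  proof -
    have "sep \<Sigma> \<sigma> = 0" if "\<sigma> \<in> \<Sigma>" for \<sigma>
      unfolding sep_def using fin that by (intro prod_zero) auto
    then have "alternating n c (sep \<Sigma>) = (\<Sum>\<sigma>\<in>{\<rho>}. pm_scale (of_int (sign \<sigma>) * sep \<Sigma> \<sigma>)
        (truncated_monom n (\<lambda>k. \<sigma> k + c k)))"
      unfolding alternating_def using assms
      by (intro sum.mono_neutral_right) (auto simp: finite_permutations \<Sigma>_def)
    then show ?thesis by simp
  qed
  finally have *: "pm_scale (of_int (sign \<rho>) * sep \<Sigma> \<rho>) (truncated_monom n (\<lambda>k. \<rho> k + c k)) \<in> ?V" .
  have "\<forall>\<sigma>\<in>\<Sigma>. \<rho> (J \<sigma>) \<noteq> \<sigma> (J \<sigma>)" using J by metis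
  then have "sep \<Sigma> \<rho> \<noteq> 0" unfolding sep_def using fin by simp
  then have "of_int (sign \<rho>) * sep \<Sigma> \<rho> \<noteq> 0" by (simp add: sign_def)
  with pm.span_scale[OF *, of "1 / (of_int (sign \<rho>) * sep \<Sigma> \<rho>)"] show ?thesis by simp
qed

section \<open>Polynomials of lower degree on the Vandermonde vector\<close>

lemma contains_power_sumsI:
  assumes T: "pm.subspace T"
    and "\<And>u v \<alpha> \<beta>. (\<Sum>k<n. lookup v k) + \<beta> = m \<Longrightarrow> \<alpha> + \<beta> > 0 \<Longrightarrow>
      single (u, v) 1 * (\<Sum>k<n. poly_x k ^ \<alpha> * poly_y k ^ \<beta>) \<in> T"
  shows "poly_n.contains_power_sums n m T"
  unfolding poly_n.contains_power_sums_def
proof (intro ballI allI impI)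
  fix p :: poly_n and d and \<alpha> \<beta> :: nat
  assume p: "p \<in> poly_n.x_polys n" and d: "(\<Sum>k<n. d k) + \<beta> = m" "\<alpha> + \<beta> > 0"
  let ?S = "\<Sum>k<n. poly_x k ^ \<alpha> * poly_y k ^ \<beta>"
  have "p = (\<Sum>w\<in>keys p. single w (lookup p w))"
    by (rule poly_mapping_eqI)
       (auto simp: lookup_sum lookup_single when_def in_keys_iff sum.delta)
  then have "p * poly_n.y_monom n d * ?S = (\<Sum>w\<in>keys p.
      single w (lookup p w)) * poly_n.y_monom n d * ?S" by simp
  also have "\<dots> = (\<Sum>w\<in>keys p. pm_scale (lookup p w)
      (single (fst w, exponents n d) 1 * ?S))"
    unfolding sum_distrib_right
  proof (rule sum.cong[OF refl])
    fix w assume "w \<in> keys p"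
    then have "w = (fst w, 0)" using x_polys_keys[OF p] by (simp add: prod_eq_iff)
    then have "single w (lookup p w) * poly_n.y_monom n d =
        pm_scale (lookup p w) (single (fst w, exponents n d) 1)"
      by (metis (no_types, lifting) add.right_neutral add_0 add_Pair mult_single mult.right_neutral
          pm_scale_simps(5) y_monom_exponents)
    then show "single w (lookup p w) * poly_n.y_monom n d * ?S =
        pm_scale (lookup p w) (single (fst w, exponents n d) 1 * ?S)"
      by (simp only: pm_scale_mult_left)
  qed
  also have "\<dots> \<in> T"
    using d by (intro pm.subspace_sum pm.subspace_scale T assms(2)) (simp_all add: lookup_exponents)
  finally show "p * poly_n.y_monom n d * ?S \<in> T" .
qed

definition standard_poly :: "nat \<Rightarrow> (nat \<Rightarrow> nat) \<times> (nat \<Rightarrow> nat) \<Rightarrow> poly_n" where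
  "standard_poly n i = poly_n.standard_element n (fst i) (snd i)"

definition y_degree :: "nat \<Rightarrow> (nat \<Rightarrow> nat) \<times> (nat \<Rightarrow> nat) \<Rightarrow> nat" where
  "y_degree n i = (\<Sum>k<n. fst i k)"

theorem monomial_in_subspaceI:
  assumes T: "pm.subspace T"
    and sums: "\<And>u v \<alpha> \<beta>. (\<Sum>k<n. lookup v k) + \<beta> = m \<Longrightarrow> \<alpha> + \<beta> > 0 \<Longrightarrow>
      single (u, v) 1 * (\<Sum>k<n. poly_x k ^ \<alpha> * poly_y k ^ \<beta>) \<in> T"
    and std: "\<And>i. i \<in> standard_index n \<Longrightarrow> y_degree n i = m \<Longrightarrow> standard_poly n i \<in> T"
    and d: "(\<Sum>k<n. d k) = m"
  shows "monomial n c d \<in> T"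
proof -
  obtain p where p: "p \<in> poly_n.x_polys n" "p * poly_n.y_monom n d = monomial n c d"
    using monomial_in_x_polys[OF refl] by blast
  have "p * poly_n.y_monom n d \<in> T"
  proof (rule poly_n.standard_elements_span[of T n m])
    show "poly_n.lin_subspace T" using T by (simp add: poly_n_lin_subspace)
    show "poly_n.contains_power_sums n m T" using T sums by (rule contains_power_sumsI)
    show "poly_n.standard_element n a k \<in> T"
      if a: "\<forall>i\<ge>n. a i = 0" "(\<Sum>k<n. a k) = m" "\<And>i. i < n \<Longrightarrow> i < window_end n a (sorting n a) i"
        "\<forall>i<n. k i < window_end n a (sorting n a) i - i" for a k
    proof -
      let ?k = "\<lambda>i. if i < n then k i else 0"
      have "(a, ?k) \<in> standard_index n" using a by (auto simp: standard_index_def)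
      then have "standard_poly n (a, ?k) \<in> T" using a by (intro std) (auto simp: y_degree_def)
      then show ?thesis by (simp add: standard_poly_def poly_n.standard_element_def)
    qed
  qed (use d p in auto)
  then show ?thesis by (simp add: p)
qed

definition orbit_value :: "nat \<Rightarrow> complex \<Rightarrow> (nat \<Rightarrow> nat) \<times> (nat \<Rightarrow> nat) \<Rightarrow> (nat list \<Rightarrow>\<^sub>0 complex)" where
  "orbit_value n z i = evaluate (vandermonde_orbit n z) (standard_poly n i)"

lemma evaluate_power_sum_in_filtration:
  assumes "(\<Sum>k<n. lookup v k) + \<beta> = m" "\<alpha> + \<beta> > 0"
  shows "evaluate (vandermonde_orbit n z) (single (u, v) 1 *
      (\<Sum>k<n. poly_x k ^ \<alpha> * poly_y k ^ \<beta>)) \<in> orbit_filtration n z m"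
  using orbit_power_sum_in_filtration[OF assms(2), of n z "lookup u" "lookup v"] assms(1)
  by (simp add: evaluate_power_sum)

lemma subspace_vimage:
  "pm.subspace V \<Longrightarrow> pm.subspace {f. evaluate \<theta> f \<in> V}"
  by (simp add: pm.subspace_def evaluate_linear)

text \<open>
  By \<open>monomial_in_subspaceI\<close> and induction on the degree, since the multiples of power sums act as
  elements of smaller degree.
\<close>

lemma orbit_filtration_standard:
  "orbit_filtration n z m \<subseteq> pm.span (orbit_value n z ` {i \<in> standard_index n. y_degree n i < m})"
proof (induction m)
  case 0
  show ?case by (simp add: orbit_filtration_def)
next
  case (Suc m)
  let ?B = "\<lambda>m. orbit_value n z ` {i \<in> standard_index n. y_degree n i < m}"
  have mono: "pm.span (?B m) \<subseteq> pm.span (?B (Suc m))" by (intro pm.span_mono image_mono) auto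
  show ?case
    unfolding orbit_filtration_def
  proof (intro pm.span_minimal pm.subspace_span subsetI, clarify)
    fix c d assume d: "(\<Sum>k<n. d k) < Suc m"
    show "vandermonde_orbit n z c d \<in> pm.span (?B (Suc m))"
    proof (cases "(\<Sum>k<n. d k) < m")
      case True
      then have "vandermonde_orbit n z c d \<in> orbit_filtration n z m"
        by (rule vandermonde_orbit_in_filtration)
      then show ?thesis using Suc mono by blast
    next
      case False
      have "monomial n c d \<in> {f. evaluate (vandermonde_orbit n z) f \<in> pm.span (?B (Suc m))}"
      proof (rule monomial_in_subspaceI)
        show "(\<Sum>k<n. d k) = m" using d False by simp
        show "pm.subspace {f. evaluate (vandermonde_orbit n z) f \<in> pm.span (?B (Suc m))}"
          by (intro subspace_vimage pm.subspace_span)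
        show "single (u, v) 1 * (\<Sum>k<n. poly_x k ^ \<alpha> * poly_y k ^ \<beta>)
            \<in> {f. evaluate (vandermonde_orbit n z) f \<in> pm.span (?B (Suc m))}"
          if "(\<Sum>k<n. lookup v k) + \<beta> = m" "\<alpha> + \<beta> > 0" for u v \<alpha> \<beta>
          using evaluate_power_sum_in_filtration[OF that] Suc mono by blast
        show "standard_poly n i \<in> {f. evaluate (vandermonde_orbit n z) f \<in> pm.span (?B (Suc m))}"
          if "i \<in> standard_index n" "y_degree n i = m" for i
          using that by (auto simp flip: orbit_value_def intro: pm.span_base)
      qed
      then show ?thesis by (simp add: evaluate_monomial[OF local_to_vandermonde_orbit])
    qed
  qed
qed

lemma single_one_inj: "single k (1 :: complex) = single l 1 \<longleftrightarrow> k = l"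
  by (metis lookup_single_eq lookup_single_not_eq zero_neq_one)

lemma independent_singles: "pm.independent ((\<lambda>k. single k (1 :: complex)) ` K)"
  unfolding pm.independent_explicit_module
proof (intro allI impI)
  fix t :: "('a \<Rightarrow>\<^sub>0 complex) set" and u v
  assume t: "finite t" "t \<subseteq> (\<lambda>k. single k (1 :: complex)) ` K"
    and 0: "(\<Sum>v\<in>t. pm_scale (u v) v) = 0" and v: "v \<in> t"
  obtain k where k: "v = single k 1" using v t by auto
  have "0 = lookup (\<Sum>v\<in>t. pm_scale (u v) v) k" using 0 by simp
  also have "\<dots> = (\<Sum>w\<in>t. if w = v then u v else 0)"
    unfolding lookup_sum
  proof (rule sum.cong[OF refl])
    fix w assume "w \<in> t"
    then obtain l where "w = single l 1" using t by auto
    then show "lookup (pm_scale (u w) w) k = (if w = v then u v else 0)"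
      by (auto simp: k lookup_single when_def single_one_inj)
  qed
  also have "\<dots> = u v" using v t by simp
  finally show "u v = 0" by simp
qed

text \<open>
  The shifted positions are \<open>\<rho> + c\<close> for the permutation \<open>\<rho>\<close> inverse to the sorting, hence occur in
  the orbit.
\<close>

lemma truncated_monom_shifted_position:
  assumes i: "i \<in> standard_index n"
  shows "truncated_monom n (shifted_position n i) = single (map (shifted_position n i) [0..<n]) 1"
    and "truncated_monom n (shifted_position n i) \<in> pm.span {vandermonde_orbit n z c d | c d. True}"
proof -
  obtain a k where ak: "i = (a, k)" by (cases i)
  show "truncated_monom n (shifted_position n i) = single (map (shifted_position n i) [0..<n]) 1"
    using shifted_position_less i by (auto simp: truncated_monom_def ak)
  have bij: "bij_betw (sorting n a) {..<n} {..<n}" using sorts_sorting by (simp add: sorts_def)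
  define \<rho> where "\<rho> c = (if c < n then the_inv_into {..<n} (sorting n a) c else c)" for c
  have "bij_betw \<rho> {..<n} {..<n}"
    using bij_betw_the_inv_into[OF bij] by (rule bij_betw_cong[THEN iffD1, rotated]) (simp add: \<rho>_def)
  then have "\<rho> permutes {..<n}" by (rule bij_imp_permutes) (auto simp: \<rho>_def)
  moreover have "truncated_monom n (shifted_position n i) = truncated_monom n (\<lambda>c. \<rho> c + k (\<rho> c))"
    by (rule truncated_monom_cong) (simp add: ak shifted_position_def \<rho>_def Let_def)
  ultimately have "truncated_monom n (shifted_position n i) \<in>
      pm.span (range (\<lambda>d. vandermonde_orbit n z (\<lambda>c. k (\<rho> c)) d))"
    using truncated_monom_in_orbit_span[of \<rho> n "\<lambda>c. k (\<rho> c)" z] by simp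
  then show "truncated_monom n (shifted_position n i) \<in> pm.span {vandermonde_orbit n z c d | c d. True}"
    using pm.span_mono[of "range (\<lambda>d. vandermonde_orbit n z (\<lambda>c. k (\<rho> c)) d)"
      "{vandermonde_orbit n z c d | c d. True}"] by blast
qed

text \<open>
  The orbit is spanned by the values of the standard elements and contains as many distinct monomials,
  those given by the shifted positions.
\<close>

theorem orbit_values_independent:
  "inj_on (orbit_value n z) (standard_index n) \<and> pm.independent (orbit_value n z ` standard_index n)"
proof -
  let ?B = "orbit_value n z ` standard_index n"
  let ?V = "{vandermonde_orbit n z c d | c d. True}"
  have fin: "finite (standard_index n)" by (rule finite_standard_index)
  have VB: "?V \<subseteq> pm.span ?B"
  proof clarify
    fix c d
    have "vandermonde_orbit n z c d \<in> orbit_filtration n z (Suc (\<Sum>k<n. d k))"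
      by (rule vandermonde_orbit_in_filtration) simp
    also have "\<dots> \<subseteq> pm.span (orbit_value n z ` {i \<in> standard_index n. y_degree n i < Suc (\<Sum>k<n. d k)})"
      by (rule orbit_filtration_standard)
    also have "\<dots> \<subseteq> pm.span ?B" by (intro pm.span_mono image_mono) auto
    finally show "vandermonde_orbit n z c d \<in> pm.span ?B" .
  qed
  let ?q = "\<lambda>i. map (shifted_position n i) [0..<n]"
  let ?Q = "(\<lambda>i. single (?q i) (1 :: complex)) ` standard_index n"
  have inj: "inj_on (\<lambda>i. single (?q i) (1 :: complex)) (standard_index n)"
  proof (rule inj_onI)
    fix i i' assume i: "i \<in> standard_index n" "i' \<in> standard_index n"
      and "single (?q i) (1 :: complex) = single (?q i') 1"
    then have "?q i = ?q i'" by (simp add: single_one_inj)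
    then have "shifted_position n i c = shifted_position n i' c" if "c < n" for c
      using that by simp
    then show "i = i'"
      using shifted_position_inj[of "fst i" "snd i" n "fst i'" "snd i'"] i by (auto simp: prod_eq_iff)
  qed
  obtain C where C: "C \<subseteq> ?B" "pm.independent C" "?B \<subseteq> pm.span C"
    using pm.maximal_independent_subset[of ?B] by blast
  have Qspan: "?Q \<subseteq> pm.span C"
  proof (rule image_subsetI)
    fix i assume i: "i \<in> standard_index n"
    have "single (?q i) 1 \<in> pm.span ?V"
      using truncated_monom_shifted_position[OF i] by simp
    also have "\<dots> \<subseteq> pm.span ?B" using VB by (rule pm.span_minimal) (rule pm.subspace_span)
    also have "\<dots> \<subseteq> pm.span C" using C(3) by (rule pm.span_minimal) (rule pm.subspace_span)
    finally show "single (?q i) 1 \<in> pm.span C" .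
  qed
  have "pm.independent ?Q"
    using independent_singles[of "?q ` standard_index n"] by (simp add: image_image)
  moreover have finC: "finite C" using C(1) fin finite_subset by blast
  ultimately have "card ?Q \<le> card C" using pm.independent_span_bound[OF finC _ Qspan] by blast
  moreover have "card ?Q = card (standard_index n)" using inj by (rule card_image)
  moreover have "card C \<le> card ?B" using C(1) fin by (intro card_mono) auto
  moreover have "card ?B \<le> card (standard_index n)" using fin by (rule card_image_le)
  ultimately have "card C = card ?B" "card ?B = card (standard_index n)" by linarith+
  then have "C = ?B" "inj_on (orbit_value n z) (standard_index n)"
    using card_subset_eq[OF finite_imageI[OF fin] C(1)] eq_card_imp_inj_on[OF fin] by auto
  then show ?thesis using C(2) by simp
qed

lemma span_image_sum:
  assumes "finite I" "w \<in> pm.span (v ` I)"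
  shows "\<exists>c. w = (\<Sum>i\<in>I. pm_scale (c i) (v i))"
  using assms(2)
proof (induction rule: pm.span_induct_alt)
  case base
  show ?case by (rule exI[of _ "\<lambda>_. 0"]) simp
next
  case (step a x y)
  then obtain c i where c: "y = (\<Sum>i\<in>I. pm_scale (c i) (v i))" and i: "i \<in> I" "x = v i" by auto
  have "pm_scale a x + y = (\<Sum>j\<in>I. pm_scale ((c(i := c i + a)) j) (v j))"
    using assms(1) i by (simp add: c sum.remove[of I i] pm_scale_add_left add_ac)
  then show ?case by blast
qed

text \<open>
  Modulo multiples of power sums, which both \<open>\<theta>\<close> and the graded orbit do not see, \<open>f\<close> is a combination
  of standard elements of degree \<open>m\<close>.  Its value on the Vandermonde vector is a combination of values
  of standard elements of smaller degree, so by \<open>orbit_values_independent\<close> all coefficients vanish.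
\<close>

theorem orbit_kernel_vanishing:
  fixes \<theta> :: "(nat \<Rightarrow> nat) \<Rightarrow> (nat \<Rightarrow> nat) \<Rightarrow> ('t \<Rightarrow>\<^sub>0 complex)"
  assumes loc: "local_to n \<theta>"
    and kills: "\<And>c d \<alpha> \<beta>. \<alpha> + \<beta> > 0 \<Longrightarrow> (\<Sum>k<n. \<theta> (c(k := c k + \<alpha>)) (d(k := d k + \<beta>))) = 0"
    and f: "f \<in> pm.span {monomial n c d | c d. (\<Sum>k<n. d k) = m}"
    and low: "evaluate (vandermonde_orbit n z) f \<in> orbit_filtration n z m"
  shows "evaluate \<theta> f = 0"
proof -
  let ?I = "{i \<in> standard_index n. y_degree n i = m}"
  let ?J = "{i \<in> standard_index n. y_degree n i < m}"
  let ?E = "evaluate (vandermonde_orbit n z)"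
  let ?g = "\<lambda>c. \<Sum>i\<in>?I. pm_scale (c i) (standard_poly n i)"
  have fin: "finite (standard_index n)" by (rule finite_standard_index)
  \<comment> \<open>the elements that neither map distinguishes from a combination of standard elements\<close>
  let ?T = "{f. \<exists>c. evaluate \<theta> (f - ?g c) = 0 \<and> ?E (f - ?g c) \<in> orbit_filtration n z m}"
  have subT: "pm.subspace ?T"
  proof (rule pm.subspaceI)
    show "0 \<in> ?T"
      by (rule CollectI, rule exI[of _ "\<lambda>_. 0"])
         (simp add: evaluate_linear pm.subspace_0[OF orbit_filtration_subspace])
  next
    fix f f' assume "f \<in> ?T" "f' \<in> ?T"
    then obtain c c' where c: "evaluate \<theta> (f - ?g c) = 0" "?E (f - ?g c) \<in> orbit_filtration n z m"
      "evaluate \<theta> (f' - ?g c') = 0" "?E (f' - ?g c') \<in> orbit_filtration n z m" by blast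
    have e: "f + f' - ?g (\<lambda>i. c i + c' i) = (f - ?g c) + (f' - ?g c')"
      by (simp add: pm_scale_add_left sum.distrib)
    show "f + f' \<in> ?T"
      by (rule CollectI, rule exI[of _ "\<lambda>i. c i + c' i"], unfold e)
         (use c in \<open>simp add: evaluate_linear(2) pm.subspace_add[OF orbit_filtration_subspace]\<close>)
  next
    fix a f assume "f \<in> ?T"
    then obtain c where c: "evaluate \<theta> (f - ?g c) = 0" "?E (f - ?g c) \<in> orbit_filtration n z m" by blast
    have e: "pm_scale a f - ?g (\<lambda>i. a * c i) = pm_scale a (f - ?g c)"
      by (simp add: pm_scale_diff_right pm_scale_sum)
    show "pm_scale a f \<in> ?T"
      by (rule CollectI, rule exI[of _ "\<lambda>i. a * c i"], unfold e)
         (use c in \<open>simp add: evaluate_linear(4) pm.subspace_scale[OF orbit_filtration_subspace]\<close>)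
  qed
  have "{monomial n c d | c d. (\<Sum>k<n. d k) = m} \<subseteq> ?T"
  proof (rule subsetI)
    fix w assume "w \<in> {monomial n c d | c d. (\<Sum>k<n. d k) = m}"
    then obtain c d where w: "w = monomial n c d" and d: "(\<Sum>k<n. d k) = m" by blast
    have "monomial n c d \<in> ?T"
    proof (rule monomial_in_subspaceI[OF subT _ _ d])
      fix u v \<alpha> \<beta> assume uv: "(\<Sum>k<n. lookup v k) + \<beta> = m" "\<alpha> + \<beta> > 0"
      show "single (u, v) 1 * (\<Sum>k<n. poly_x k ^ \<alpha> * poly_y k ^ \<beta>) \<in> ?T"
        using evaluate_power_sum_in_filtration[OF uv, of z u] kills[OF uv(2)]
        by (intro CollectI exI[of _ "\<lambda>_. 0"]) (simp add: evaluate_power_sum)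
    next
      fix i assume i: "i \<in> standard_index n" "y_degree n i = m"
      have "?g (\<lambda>j. if j = i then 1 else 0) = (\<Sum>j\<in>{i}. pm_scale 1 (standard_poly n j))"
        using fin i by (intro sum.mono_neutral_cong_right) auto
      then have "standard_poly n i - ?g (\<lambda>j. if j = i then 1 else 0) = 0" by simp
      then show "standard_poly n i \<in> ?T"
        by (intro CollectI exI[of _ "\<lambda>j. if j = i then 1 else 0"])
           (simp add: evaluate_linear(1) pm.subspace_0[OF orbit_filtration_subspace])
    qed
    then show "w \<in> ?T" by (simp only: w)
  qed
  then have "f \<in> ?T" using f pm.span_minimal[OF _ subT] by blast
  then obtain c where c: "evaluate \<theta> (f - ?g c) = 0" "?E (f - ?g c) \<in> orbit_filtration n z m" by blast
  have "?E (?g c) \<in> orbit_filtration n z m"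
    using pm.subspace_diff[OF orbit_filtration_subspace low c(2)] by (simp add: evaluate_linear(3))
  then have "?E (?g c) \<in> pm.span (orbit_value n z ` ?J)" using orbit_filtration_standard by blast
  then obtain b where b: "?E (?g c) = (\<Sum>i\<in>?J. pm_scale (b i) (orbit_value n z i))"
    using span_image_sum[of ?J] fin by auto
  \<comment> \<open>the linear relation between the values of the standard elements\<close>
  define e where "e i = (if y_degree n i = m then c i else if y_degree n i < m then - b i else 0)" for i
  have "(\<Sum>i\<in>standard_index n. pm_scale (e i) (orbit_value n z i)) =
    (\<Sum>i\<in>?I \<union> ?J. pm_scale (e i) (orbit_value n z i))"
    using fin by (intro sum.mono_neutral_right) (auto simp: e_def)
  also have "\<dots> = (\<Sum>i\<in>?I. pm_scale (e i) (orbit_value n z i)) + (\<Sum>i\<in>?J. pm_scale (e i) (orbit_value n z i))"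
    using fin by (intro sum.union_disjoint) auto
  also have "(\<Sum>i\<in>?I. pm_scale (e i) (orbit_value n z i)) = ?E (?g c)"
    unfolding evaluate_linear(5) by (intro sum.cong) (auto simp: e_def evaluate_linear(4) orbit_value_def)
  also have "(\<Sum>i\<in>?J. pm_scale (e i) (orbit_value n z i)) = (\<Sum>i\<in>?J. - pm_scale (b i) (orbit_value n z i))"
    by (intro sum.cong) (auto simp: e_def pm.scale_minus_left)
  finally have 0: "(\<Sum>i\<in>standard_index n. pm_scale (e i) (orbit_value n z i)) = 0"
    by (simp add: b sum_negf)
  have inj: "inj_on (orbit_value n z) (standard_index n)"
    and ind: "pm.independent (orbit_value n z ` standard_index n)"
    using orbit_values_independent by auto
  have e0: "e i = 0" if i: "i \<in> standard_index n" for i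
  proof -
    let ?inv = "the_inv_into (standard_index n) (orbit_value n z)"
    have "(\<Sum>w\<in>orbit_value n z ` standard_index n. pm_scale (e (?inv w)) w) = 0"
      using 0 by (simp add: sum.reindex[OF inj] the_inv_into_f_f[OF inj])
    from pm.independentD[OF ind _ order_refl this imageI[OF i]] fin
    show ?thesis by (simp add: the_inv_into_f_f[OF inj i])
  qed
  have "c i = 0" if "i \<in> ?I" for i using that e0[of i] by (simp add: e_def)
  then have "?g c = 0" by (intro sum.neutral) auto
  then show ?thesis using c(1) by simp
qed

section \<open>Normally ordered products\<close>

lemma double_sum_exchange:
  fixes F G :: "nat \<Rightarrow> nat \<Rightarrow> 'b::ab_group_add"
  assumes "\<And>k l. k < m \<Longrightarrow> l < m \<Longrightarrow> k \<noteq> l \<Longrightarrow> F k l = G l k"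
  shows "(\<Sum>k<m. \<Sum>l<m. F k l) = (\<Sum>k<m. \<Sum>l<m. G k l) + (\<Sum>k<m. F k k - G k k)"
proof -
  have "(\<Sum>k<m. \<Sum>l<m. F k l) - (\<Sum>k<m. \<Sum>l<m. G l k) = (\<Sum>k<m. \<Sum>l<m. F k l - G l k)"
    by (simp add: sum_subtractf)
  also have "\<dots> = (\<Sum>k<m. \<Sum>l<m. if l = k then F k k - G k k else 0)"
    using assms by (intro sum.cong refl) auto
  also have "\<dots> = (\<Sum>k<m. F k k - G k k)" by simp
  finally have "(\<Sum>k<m. \<Sum>l<m. F k l) = (\<Sum>k<m. F k k - G k k) + (\<Sum>k<m. \<Sum>l<m. G l k)"
    by (simp only: diff_eq_eq)
  then show ?thesis by (simp only: sum.swap[of G] add.commute)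
qed

lemma swap_invariant_mset:
  assumes swap: "\<And>xs A B ys. f (xs @ A # B # ys) = f (xs @ B # A # ys)"
    and "mset As = mset Bs"
  shows "f As = f Bs"
proof -
  have move: "f (pre @ xs @ A # ys) = f (pre @ A # xs @ ys)" for pre xs A ys
  proof (induction xs arbitrary: pre)
    case (Cons B xs)
    have "f (pre @ (B # xs) @ A # ys) = f ((pre @ [B]) @ A # xs @ ys)"
      using Cons[of "pre @ [B]"] by simp
    also have "\<dots> = f (pre @ A # (B # xs) @ ys)" using swap[of pre B A "xs @ ys"] by simp
    finally show ?case .
  qed simp
  have "f (pre @ As) = f (pre @ Bs)" for pre
    using assms(2)
  proof (induction As arbitrary: Bs pre)
    case (Cons A As)
    then have "A \<in> set Bs" by (metis list.set_intros(1) set_mset_mset)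
    then obtain xs ys where Bs: "Bs = xs @ A # ys" by (meson split_list)
    then have "mset As = mset (xs @ ys)" using Cons.prems by simp
    then have "f ((pre @ [A]) @ As) = f ((pre @ [A]) @ xs @ ys)" by (rule Cons.IH)
    then show ?case using move[of pre xs A ys] by (simp add: Bs)
  qed simp
  from this[of "[]"] show ?thesis by simp
qed

text \<open>
  A representation of \<open>gl\<^sub>r \<otimes> C[x, y]\<close> on a space of finitely supported functions.  Every
  finite-dimensional module embeds into one.
\<close>

locale current_rep =
  fixes r :: nat and act :: "poly_xy mat \<Rightarrow> ('k \<Rightarrow>\<^sub>0 complex) \<Rightarrow> ('k \<Rightarrow>\<^sub>0 complex)"
  assumes act_add_vec: "A \<in> carrier_mat r r \<Longrightarrow> act A (p + q) = act A p + act A q"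
    and act_scale_vec: "A \<in> carrier_mat r r \<Longrightarrow> act A (pm_scale c p) = pm_scale c (act A p)"
    and act_add: "A \<in> carrier_mat r r \<Longrightarrow> B \<in> carrier_mat r r \<Longrightarrow> act (A + B) p = act A p + act B p"
    and act_scale: "A \<in> carrier_mat r r \<Longrightarrow> act ([:[:c:]:] \<cdot>\<^sub>m A) p = pm_scale c (act A p)"
    and act_bracket: "A \<in> carrier_mat r r \<Longrightarrow> B \<in> carrier_mat r r \<Longrightarrow>
      act (A * B - B * A) p = act A (act B p) - act B (act A p)"
begin

lemma act_0: "A \<in> carrier_mat r r \<Longrightarrow> act A 0 = 0"
  using act_scale_vec[of A 0 0] by simp

lemma act_diff_vec: "A \<in> carrier_mat r r \<Longrightarrow> act A (p - q) = act A p - act A q"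
  using act_add_vec[of A "p - q" q] by (simp add: algebra_simps)

lemma act_sum_vec: "A \<in> carrier_mat r r \<Longrightarrow> act A (sum f S) = (\<Sum>i\<in>S. act A (f i))"
  by (induction S rule: infinite_finite_induct) (auto simp: act_0 act_add_vec)

lemma act_diff:
  assumes "A \<in> carrier_mat r r" "B \<in> carrier_mat r r"
  shows "act (A - B) p = act A p - act B p"
proof -
  have "A - B + B = A" using assms by (intro eq_matI) auto
  then show ?thesis using act_add[of "A - B" B p] assms by (metis add_diff_cancel minus_carrier_mat)
qed

text \<open>
  The normally ordered product, in which the factors \<open>A \<otimes> B\<close> act on different tensor positions: the
  naive product minus the terms in which the new factor is multiplied into an old one.
\<close>

fun normal_prod :: "poly_xy mat list \<Rightarrow> ('k \<Rightarrow>\<^sub>0 complex) \<Rightarrow> ('k \<Rightarrow>\<^sub>0 complex)" where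
  "normal_prod [] p = p"
| "normal_prod (A # As) p = act A (normal_prod As p) - (\<Sum>k<length As. normal_prod (As[k := A * As ! k]) p)"

abbreviation mats :: "poly_xy mat list \<Rightarrow> bool" where
  "mats As \<equiv> set As \<subseteq> carrier_mat r r"

lemma mats_update: "mats As \<Longrightarrow> A \<in> carrier_mat r r \<Longrightarrow> mats (As[k := A])"
  by (meson insert_subset set_update_subset_insert subset_trans)

lemma mats_nth: "mats As \<Longrightarrow> k < length As \<Longrightarrow> As ! k \<in> carrier_mat r r"
  by (meson nth_mem subsetD)

lemma mats_update_mult:
  assumes "mats As" "A \<in> carrier_mat r r" "k < length As"
  shows "mats (As[k := A * As ! k])" "mats (As[k := As ! k * A])"
proof -
  have "As ! k \<in> carrier_mat r r" using assms(1,3) by (rule mats_nth)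
  then show "mats (As[k := A * As ! k])" "mats (As[k := As ! k * A])"
    using assms(2) by (intro mats_update[OF assms(1)] mult_carrier_mat; simp)+
qed

lemma normal_prod_0: "mats As \<Longrightarrow> normal_prod As 0 = 0"
proof (induction "length As" arbitrary: As)
  case (Suc m)
  obtain A As' where As: "As = A # As'" using Suc(2) by (cases As) auto
  have A: "A \<in> carrier_mat r r" "mats As'" using Suc.prems by (auto simp: As)
  have u: "mats (As'[k := A * As' ! k])" if "k < length As'" for k
    using A that by (intro mats_update_mult)
  show ?case using Suc(1)[of As'] Suc(1)[OF _ u] Suc(2) A by (simp add: As act_0)
qed simp

lemma normal_prod_linear:
  assumes "mats As" "k < length As" "B \<in> carrier_mat r r" "C \<in> carrier_mat r r"
  shows "normal_prod (As[k := [:[:c:]:] \<cdot>\<^sub>m B + C]) p =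
    pm_scale c (normal_prod (As[k := B]) p) + normal_prod (As[k := C]) p"
  using assms
proof (induction "length As" arbitrary: As k B C)
  case (Suc m)
  let ?D = "\<lambda>B C. [:[:c:]:] \<cdot>\<^sub>m B + C"
  obtain A As' where As: "As = A # As'" using Suc(2) by (cases As) auto
  have A: "A \<in> carrier_mat r r" "mats As'" "m = length As'" using Suc by (auto simp: As)
  have nth: "As' ! l \<in> carrier_mat r r" if "l < length As'" for l using A that by (auto intro: mats_nth)
  show ?case
  proof (cases k)
    case 0
    have "normal_prod (As'[l := ?D B C * As' ! l]) p =
        pm_scale c (normal_prod (As'[l := B * As' ! l]) p) + normal_prod (As'[l := C * As' ! l]) p"
      if "l < length As'" for l
      using Suc(1)[OF A(3,2) that, of "B * As' ! l" "C * As' ! l"] Suc.prems nth[OF that]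
      by (simp add: add_mult_distrib_mat[of _ r r] mult_smult_assoc_mat[of _ r r])
    then show ?thesis using Suc.prems
      by (simp add: As 0 act_add act_scale sum.distrib pm_scale_sum pm_scale_diff_right)
  next
    case (Suc k')
    then have k': "k' < length As'" using Suc.prems by (simp add: As)
    have IH: "normal_prod (Bs[k' := ?D B C]) p = pm_scale c (normal_prod (Bs[k' := B]) p) + normal_prod (Bs[k' := C]) p"
      if "mats Bs" "length Bs = length As'" for Bs
      using Suc.hyps(1)[of Bs k' B C] that A k' Suc.prems by simp
    have "normal_prod ((As'[k' := ?D B C])[l := A * As'[k' := ?D B C] ! l]) p =
        pm_scale c (normal_prod ((As'[k' := B])[l := A * As'[k' := B] ! l]) p) +
        normal_prod ((As'[k' := C])[l := A * As'[k' := C] ! l]) p"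
      if l: "l < length As'" for l
    proof (cases "l = k'")
      case True
      have "A * ?D B C = ?D (A * B) (A * C)"
        using A Suc.prems by (subst mult_add_distrib_mat[of A r r _ r C]) (auto simp: mult_smult_distrib[of A r r B r])
      then show ?thesis
        using Suc.hyps(1)[OF A(3,2) k', of "A * B" "A * C"] Suc.prems A k' by (simp add: True)
    next
      case False
      have "mats (As'[l := A * As' ! l])" using A nth[OF l] by (intro mats_update) auto
      from IH[OF this] show ?thesis using False by (simp add: list_update_swap)
    qed
    then show ?thesis using IH[OF A(2)] A
      by (simp add: As Suc act_add_vec act_scale_vec sum.distrib pm_scale_sum pm_scale_diff_right)
  qed
qed simp

lemma normal_prod_add:
  assumes "mats As" "k < length As" "B \<in> carrier_mat r r" "C \<in> carrier_mat r r"
  shows "normal_prod (As[k := B + C]) p = normal_prod (As[k := B]) p + normal_prod (As[k := C]) p"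
proof -
  have "[:[:1:]:] \<cdot>\<^sub>m B = B" using assms by (intro eq_matI) (auto simp flip: one_pCons)
  then show ?thesis using normal_prod_linear[OF assms, of 1 p] by simp
qed

lemma normal_prod_zero_entry:
  assumes "mats As" "k < length As"
  shows "normal_prod (As[k := 0\<^sub>m r r]) p = 0"
  using normal_prod_add[OF assms, of "0\<^sub>m r r" "0\<^sub>m r r" p] by simp

lemma normal_prod_scale:
  assumes "mats As" "k < length As" "B \<in> carrier_mat r r"
  shows "normal_prod (As[k := [:[:c:]:] \<cdot>\<^sub>m B]) p = pm_scale c (normal_prod (As[k := B]) p)"
  using normal_prod_linear[OF assms, of "0\<^sub>m r r" c p] assms normal_prod_zero_entry[OF assms(1,2)] by simp

text \<open>Acting by \<open>C\<close> is a derivation with respect to the normally ordered product.\<close>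

lemma normal_prod_commutator:
  assumes "mats As" "C \<in> carrier_mat r r"
  shows "act C (normal_prod As p) - normal_prod As (act C p) =
    (\<Sum>k<length As. normal_prod (As[k := C * As ! k]) p - normal_prod (As[k := As ! k * C]) p)"
  using assms
proof (induction "length As" arbitrary: As)
  case (Suc m)
  obtain A As' where As: "As = A # As'" using Suc(2) by (cases As) auto
  have A: "A \<in> carrier_mat r r" "mats As'" "m = length As'" and C: "C \<in> carrier_mat r r"
    using Suc by (auto simp: As)
  have nth: "As' ! l \<in> carrier_mat r r" if "l < m" for l using A that by (auto intro: mats_nth)
  note IH = Suc(1)
  have u: "mats (As'[k := B * As' ! k])" "mats (As'[k := As' ! k * B])" if "k < m" "B \<in> carrier_mat r r" for k B
    by (rule mats_update_mult; use A that in simp)+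
  let ?N = "\<lambda>As. normal_prod As p"
  let ?l = "\<lambda>B k. As'[k := B * As' ! k]" and ?r = "\<lambda>B k. As'[k := As' ! k * B]"
  \<comment> \<open>two matrices that are multiplied into different factors may be exchanged\<close>
  have dl: "(\<Sum>k<m. \<Sum>l<m. ?N ((?l A k)[l := C * (?l A k) ! l])) =
      (\<Sum>k<m. \<Sum>l<m. ?N ((?l C k)[l := A * (?l C k) ! l])) +
      (\<Sum>k<m. ?N ((?l A k)[k := C * (?l A k) ! k]) - ?N ((?l C k)[k := A * (?l C k) ! k]))"
    by (rule double_sum_exchange) (simp add: list_update_swap)
  have dr: "(\<Sum>k<m. \<Sum>l<m. ?N ((?l A k)[l := (?l A k) ! l * C])) =
      (\<Sum>k<m. \<Sum>l<m. ?N ((?r C k)[l := A * (?r C k) ! l])) +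
      (\<Sum>k<m. ?N ((?l A k)[k := (?l A k) ! k * C]) - ?N ((?r C k)[k := A * (?r C k) ! k]))"
    by (rule double_sum_exchange) (simp add: list_update_swap)
  have IH1: "act C (?N As') - normal_prod As' (act C p) = (\<Sum>k<m. ?N (?l C k) - ?N (?r C k))"
    using IH[OF A(3,2) C] A(3) by simp
  have IH2: "act C (?N (?l A k)) - normal_prod (?l A k) (act C p) =
      (\<Sum>l<m. ?N ((?l A k)[l := C * (?l A k) ! l]) - ?N ((?l A k)[l := (?l A k) ! l * C]))" if "k < m" for k
    using IH[of "?l A k"] u(1)[OF that A(1)] C A(3) by simp
  have "act C (?N As) - normal_prod As (act C p) =
     (act C (act A (?N As')) - act A (act C (?N As'))) +
     act A (act C (?N As') - normal_prod As' (act C p)) -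
     (\<Sum>k<m. act C (?N (?l A k)) - normal_prod (?l A k) (act C p))"
    using A C by (simp add: As act_diff_vec act_sum_vec sum_subtractf)
  also have "act C (act A (?N As')) - act A (act C (?N As')) = act (C * A) (?N As') - act (A * C) (?N As')"
    using A C by (simp flip: act_bracket add: act_diff)
  also have "act A (act C (?N As') - normal_prod As' (act C p)) =
     (\<Sum>k<m. act A (?N (?l C k)) - act A (?N (?r C k)))"
    unfolding IH1 using A by (simp add: act_sum_vec act_diff_vec)
  also have "(\<Sum>k<m. act C (?N (?l A k)) - normal_prod (?l A k) (act C p)) =
      (\<Sum>k<m. \<Sum>l<m. ?N ((?l A k)[l := C * (?l A k) ! l])) -
      (\<Sum>k<m. \<Sum>l<m. ?N ((?l A k)[l := (?l A k) ! l * C]))"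
    using IH2 by (simp add: sum_subtractf)
  also have "\<dots> = ((\<Sum>k<m. \<Sum>l<m. ?N ((?l C k)[l := A * (?l C k) ! l])) -
       (\<Sum>k<m. \<Sum>l<m. ?N ((?r C k)[l := A * (?r C k) ! l]))) +
      (\<Sum>k<m. ?N (?l (C * A) k) - ?N (?l (A * C) k))"
  proof -
    have "(\<Sum>k<m. ?N ((?l A k)[k := C * (?l A k) ! k]) - ?N ((?l C k)[k := A * (?l C k) ! k])) -
       (\<Sum>k<m. ?N ((?l A k)[k := (?l A k) ! k * C]) - ?N ((?r C k)[k := A * (?r C k) ! k])) =
       (\<Sum>k<m. ?N (?l (C * A) k) - ?N (?l (A * C) k))"
      unfolding sum_subtractf[symmetric]
    proof (rule sum.cong[OF refl])
      fix k assume "k \<in> {..<m}"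
      then have k: "k < m" by simp
      have "C * (A * As' ! k) = C * A * As' ! k" "A * (C * As' ! k) = A * C * As' ! k"
        "A * As' ! k * C = A * (As' ! k * C)"
        using nth[OF k] A C by (auto simp: assoc_mult_mat[of _ r r _ r _ r])
      then show "?N ((?l A k)[k := C * (?l A k) ! k]) - ?N ((?l C k)[k := A * (?l C k) ! k]) -
         (?N ((?l A k)[k := (?l A k) ! k * C]) - ?N ((?r C k)[k := A * (?r C k) ! k])) =
         ?N (?l (C * A) k) - ?N (?l (A * C) k)"
        using k A(3) by simp
    qed
    then show ?thesis unfolding dl dr by (simp add: algebra_simps)
  qed
  finally have "act C (?N As) - normal_prod As (act C p) =
     (act (C * A) (?N As') - (\<Sum>k<m. ?N (?l (C * A) k))) - (act (A * C) (?N As') - (\<Sum>k<m. ?N (?l (A * C) k))) +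
     ((\<Sum>k<m. act A (?N (?l C k)) - (\<Sum>l<m. ?N ((?l C k)[l := A * (?l C k) ! l]))) -
      (\<Sum>k<m. act A (?N (?r C k)) - (\<Sum>l<m. ?N ((?r C k)[l := A * (?r C k) ! l]))))"
    by (simp add: sum_subtractf algebra_simps)
  then show ?case
    using A(3) by (simp add: As sum.lessThan_Suc_shift sum_subtractf del: sum.lessThan_Suc)
qed simp

lemma normal_prod_snoc:
  assumes "mats As" "B \<in> carrier_mat r r"
  shows "normal_prod (As @ [B]) p =
    normal_prod As (act B p) - (\<Sum>k<length As. normal_prod (As[k := As ! k * B]) p)"
  using assms
proof (induction "length As" arbitrary: As B)
  case (Suc m)
  obtain A As' where As: "As = A # As'" using Suc(2) by (cases As) auto
  have A: "A \<in> carrier_mat r r" "mats As'" "m = length As'" and B: "B \<in> carrier_mat r r"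
    using Suc by (auto simp: As)
  have nth: "As' ! l \<in> carrier_mat r r" if "l < m" for l using A that by (auto intro: mats_nth)
  note IH = Suc(1)
  have u: "mats (As'[k := A * As' ! k])" if "k < m" for k
    by (rule mats_update_mult; use A that in simp)+
  let ?N = "\<lambda>As. normal_prod As p"
  let ?l = "\<lambda>B k. As'[k := B * As' ! k]" and ?r = "\<lambda>B k. As'[k := As' ! k * B]"
  have IH1: "?N (As' @ [C]) = normal_prod As' (act C p) - (\<Sum>k<m. ?N (?r C k))" if "C \<in> carrier_mat r r" for C
    using IH[OF A(3,2) that] A(3) by simp
  have IH2: "?N (?l A k @ [B]) = normal_prod (?l A k) (act B p) - (\<Sum>l<m. ?N ((?l A k)[l := (?l A k) ! l * B]))"
    if "k < m" for k
    using IH[of "?l A k"] u[OF that] B A(3) by simp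
  have d: "(\<Sum>k<m. \<Sum>l<m. ?N ((?l A k)[l := (?l A k) ! l * B])) =
      (\<Sum>k<m. \<Sum>l<m. ?N ((?r B k)[l := A * (?r B k) ! l])) +
      (\<Sum>k<m. ?N ((?l A k)[k := (?l A k) ! k * B]) - ?N ((?r B k)[k := A * (?r B k) ! k]))"
    by (rule double_sum_exchange) (simp add: list_update_swap)
  also have "(\<Sum>k<m. ?N ((?l A k)[k := (?l A k) ! k * B]) - ?N ((?r B k)[k := A * (?r B k) ! k])) = 0"
  proof (rule sum.neutral, rule ballI)
    fix k assume "k \<in> {..<m}"
    then have k: "k < m" by simp
    have "A * As' ! k * B = A * (As' ! k * B)" using nth[OF k] A B by (auto simp: assoc_mult_mat[of _ r r _ r _ r])
    then show "?N ((?l A k)[k := (?l A k) ! k * B]) - ?N ((?r B k)[k := A * (?r B k) ! k]) = 0"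
      using k A(3) by simp
  qed
  finally have d': "(\<Sum>k<m. \<Sum>l<m. ?N ((?l A k)[l := (?l A k) ! l * B])) =
      (\<Sum>k<m. \<Sum>l<m. ?N ((?r B k)[l := A * (?r B k) ! l]))" by simp
  have AB: "A * B \<in> carrier_mat r r" using A B by simp
  have comm: "normal_prod As' (act (A * B) p) - (\<Sum>k<m. ?N (?r (A * B) k)) =
      act (A * B) (?N As') - (\<Sum>k<m. ?N (?l (A * B) k))"
    using normal_prod_commutator[OF A(2) AB, of p] A(3) by (simp add: sum_subtractf algebra_simps)
  have upd: "(\<Sum>k<Suc m. ?N ((As' @ [B])[k := A * (As' @ [B]) ! k])) =
      (\<Sum>k<m. ?N (?l A k @ [B])) + ?N (As' @ [A * B])"
    using A(3) by (simp add: nth_append list_update_append)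
  have "?N (As @ [B]) = act A (?N (As' @ [B])) - (\<Sum>k<m. ?N (?l A k @ [B])) - ?N (As' @ [A * B])"
    using upd A(3) by (simp add: As del: sum.lessThan_Suc)
  also have "\<dots> = act A (normal_prod As' (act B p)) - (\<Sum>k<m. act A (?N (?r B k))) -
      ((\<Sum>k<m. normal_prod (?l A k) (act B p)) - (\<Sum>k<m. \<Sum>l<m. ?N ((?l A k)[l := (?l A k) ! l * B]))) -
      (act (A * B) (?N As') - (\<Sum>k<m. ?N (?l (A * B) k)))"
    using IH1[OF B] IH1[OF AB] IH2 comm A by (simp add: act_diff_vec act_sum_vec sum_subtractf)
  also have "\<dots> = normal_prod As (act B p) - (?N (A * B # As') + (\<Sum>k<m. ?N (A # ?r B k)))"
    unfolding d' using A(3) by (simp add: As sum_subtractf)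
  finally show ?case
    using A(3) by (simp add: As sum.lessThan_Suc_shift del: sum.lessThan_Suc)
qed simp

text \<open>Compare the recursion for a first factor with \<open>normal_prod_snoc\<close> through \<open>normal_prod_commutator\<close>.\<close>

lemma normal_prod_rotate:
  assumes "mats As" "A \<in> carrier_mat r r"
  shows "normal_prod (A # As) p = normal_prod (As @ [A]) p"
proof -
  let ?L = "\<Sum>k<length As. normal_prod (As[k := A * As ! k]) p"
    and ?R = "\<Sum>k<length As. normal_prod (As[k := As ! k * A]) p"
  have "act A (normal_prod As p) = ?L - ?R + normal_prod As (act A p)"
    using normal_prod_commutator[OF assms, of p] by (simp only: diff_eq_eq sum_subtractf)
  then show ?thesis unfolding normal_prod_snoc[OF assms] by simp
qed

text \<open>
  Expanding both factors leaves the difference of the two orders, which is the commutator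
  \<open>A * B - B * A\<close>, and the correction terms, which are symmetric except for this commutator.
\<close>

lemma normal_prod_swap_head:
  assumes "mats As" "A \<in> carrier_mat r r" "B \<in> carrier_mat r r"
  shows "normal_prod (A # B # As) p = normal_prod (B # A # As) p"
proof -
  let ?m = "length As"
  let ?N = "\<lambda>As. normal_prod As p"
  let ?l = "\<lambda>B k. As[k := B * As ! k]"
  have nth: "As ! l \<in> carrier_mat r r" if "l < ?m" for l using assms that by (auto intro: mats_nth)
  have d: "(\<Sum>k<?m. \<Sum>l<?m. ?N ((?l A k)[l := B * (?l A k) ! l])) =
      (\<Sum>k<?m. \<Sum>l<?m. ?N ((?l B k)[l := A * (?l B k) ! l])) +
      (\<Sum>k<?m. ?N ((?l A k)[k := B * (?l A k) ! k]) - ?N ((?l B k)[k := A * (?l B k) ! k]))"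
    by (rule double_sum_exchange) (simp add: list_update_swap)
  also have "(\<Sum>k<?m. ?N ((?l A k)[k := B * (?l A k) ! k]) - ?N ((?l B k)[k := A * (?l B k) ! k])) =
      (\<Sum>k<?m. ?N (?l (B * A) k) - ?N (?l (A * B) k))"
  proof (rule sum.cong[OF refl])
    fix k assume "k \<in> {..<?m}"
    then have k: "k < ?m" by simp
    have "B * (A * As ! k) = B * A * As ! k" "A * (B * As ! k) = A * B * As ! k"
      using nth[OF k] assms by (auto simp: assoc_mult_mat[of _ r r _ r _ r])
    then show "?N ((?l A k)[k := B * (?l A k) ! k]) - ?N ((?l B k)[k := A * (?l B k) ! k]) =
        ?N (?l (B * A) k) - ?N (?l (A * B) k)" using k by simp
  qed
  finally have d': "(\<Sum>k<?m. \<Sum>l<?m. ?N ((?l A k)[l := B * (?l A k) ! l])) =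
      (\<Sum>k<?m. \<Sum>l<?m. ?N ((?l B k)[l := A * (?l B k) ! l])) +
      (\<Sum>k<?m. ?N (?l (B * A) k)) - (\<Sum>k<?m. ?N (?l (A * B) k))" by (simp add: sum_subtractf)
  have exp: "?N (A # B # As) = act A (act B (?N As)) - (\<Sum>k<?m. act A (?N (?l B k))) -
     (act (A * B) (?N As) - (\<Sum>k<?m. ?N (?l (A * B) k))) -
     ((\<Sum>k<?m. act B (?N (?l A k))) - (\<Sum>k<?m. \<Sum>l<?m. ?N ((?l A k)[l := B * (?l A k) ! l])))"
    if "A \<in> carrier_mat r r" for A B
    using that by (simp add: act_diff_vec act_sum_vec sum.lessThan_Suc_shift sum_subtractf del: sum.lessThan_Suc)
  have br: "act A (act B (?N As)) - act B (act A (?N As)) = act (A * B) (?N As) - act (B * A) (?N As)"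
    using assms by (simp flip: act_bracket add: act_diff)
  show ?thesis
    unfolding exp[OF assms(2)] exp[OF assms(3)] d' using br by (simp add: algebra_simps)
qed

end

section \<open>Highest weight vectors and normally ordered products\<close>

lemma E_tensor_carrier [simp]: "E_tensor r i j P \<in> carrier_mat r r"
  by (simp add: E_tensor_def)

lemma E_tensor_index [simp]:
  "k < r \<Longrightarrow> l < r \<Longrightarrow> E_tensor r i j P $$ (k, l) = (if k = i \<and> l = j then P else 0)"
  by (simp add: E_tensor_def)

lemma E_tensor_dim [simp]: "dim_row (E_tensor r i j P) = r" "dim_col (E_tensor r i j P) = r"
  by (simp_all add: E_tensor_def)

lemma E_tensor_add: "E_tensor r i j (P + Q) = E_tensor r i j P + E_tensor r i j Q"
  by (rule eq_matI) auto

lemma E_tensor_scale: "E_tensor r i j ([:[:c:]:] * P) = [:[:c:]:] \<cdot>\<^sub>m E_tensor r i j P"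
  by (rule eq_matI) auto

lemma E_tensor_zero: "E_tensor r i j 0 = 0\<^sub>m r r"
  by (rule eq_matI) auto

lemma E_tensor_mult:
  assumes "l < r" "j < r"
  shows "E_tensor r i j P * E_tensor r l m Q = E_tensor r i m (if j = l then P * Q else 0)"
proof (rule eq_matI)
  fix a b assume "a < dim_row (E_tensor r i m (if j = l then P * Q else 0))"
    "b < dim_col (E_tensor r i m (if j = l then P * Q else 0))"
  then have ab: "a < r" "b < r" by simp_all
  have "(E_tensor r i j P * E_tensor r l m Q) $$ (a, b) =
      (\<Sum>c<r. E_tensor r i j P $$ (a, c) * E_tensor r l m Q $$ (c, b))"
    using ab by (simp add: scalar_prod_def atLeast0LessThan)
  also have "\<dots> = (\<Sum>c<r. if c = j then (if a = i \<and> j = l \<and> b = m then P * Q else 0) else 0)"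
    using ab by (intro sum.cong refl) auto
  also have "\<dots> = E_tensor r i m (if j = l then P * Q else 0) $$ (a, b)"
    using ab assms by auto
  finally show "(E_tensor r i j P * E_tensor r l m Q) $$ (a, b) =
      E_tensor r i m (if j = l then P * Q else 0) $$ (a, b)" .
qed simp_all

definition xy_monom :: "nat \<Rightarrow> nat \<Rightarrow> poly_xy" where
  "xy_monom \<alpha> \<beta> = monom (monom 1 \<alpha>) \<beta>"

lemma xy_monom_mult: "xy_monom \<alpha> \<beta> * xy_monom \<gamma> \<delta> = xy_monom (\<alpha> + \<gamma>) (\<beta> + \<delta>)"
  by (simp add: xy_monom_def mult_monom)

lemma xy_monom_0: "xy_monom 0 0 = 1"
  by (simp add: xy_monom_def)

lemma poly_xy_expand:
  fixes P :: poly_xy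
  shows "P = (\<Sum>b\<le>degree P. \<Sum>a\<le>degree (coeff P b). [:[:coeff (coeff P b) a:]:] * xy_monom a b)"
proof -
  have e: "[:[:c:]:] * xy_monom a b = monom (monom c a) b" for c :: complex and a b
    by (simp add: xy_monom_def smult_monom)
  have mon: "monom (\<Sum>a\<in>A. f a) b = (\<Sum>a\<in>A. monom (f a) b)" for f :: "nat \<Rightarrow> complex poly" and A b
    by (induction A rule: infinite_finite_induct) (auto simp: add_monom[symmetric])
  have "(\<Sum>b\<le>degree P. \<Sum>a\<le>degree (coeff P b). [:[:coeff (coeff P b) a:]:] * xy_monom a b) =
      (\<Sum>b\<le>degree P. monom (\<Sum>a\<le>degree (coeff P b). monom (coeff (coeff P b) a) a) b)"
    by (simp only: e mon)
  also have "\<dots> = P" by (simp add: poly_as_sum_of_monoms)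
  finally show ?thesis by simp
qed

lemma poly_xy_linear_expand:
  fixes f :: "poly_xy \<Rightarrow> ('k \<Rightarrow>\<^sub>0 complex)"
  assumes add: "\<And>P Q. f (P + Q) = f P + f Q" and scale: "\<And>c P. f ([:[:c:]:] * P) = pm_scale c (f P)"
  shows "f P = (\<Sum>b\<le>degree P. \<Sum>a\<le>degree (coeff P b). pm_scale (coeff (coeff P b) a) (f (xy_monom a b)))"
proof -
  have 0: "f 0 = 0" using scale[of 0 0] by simp
  have sum: "f (sum g A) = (\<Sum>i\<in>A. f (g i))" for g :: "nat \<Rightarrow> poly_xy" and A
    by (induction A rule: infinite_finite_induct) (auto simp: 0 add)
  show ?thesis by (subst poly_xy_expand) (simp only: sum scale)
qed

context current_rep
begin

lemma normal_prod_swap: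
  assumes "mats (xs @ A # B # ys)"
  shows "normal_prod (xs @ A # B # ys) p = normal_prod (xs @ B # A # ys) p"
proof -
  have rot: "normal_prod (xs @ zs) p = normal_prod (zs @ xs) p" if "mats (xs @ zs)" for xs zs
    using that
  proof (induction xs arbitrary: zs)
    case (Cons C xs)
    have "normal_prod (C # xs @ zs) p = normal_prod ((xs @ zs) @ [C]) p"
      using Cons.prems by (intro normal_prod_rotate) auto
    also have "\<dots> = normal_prod ((zs @ [C]) @ xs) p"
      using Cons.IH[of "zs @ [C]"] Cons.prems by simp
    finally show ?case by simp
  qed simp
  have "normal_prod (xs @ A # B # ys) p = normal_prod (A # B # ys @ xs) p"
    using rot[of xs "A # B # ys"] assms by simp
  also have "\<dots> = normal_prod (B # A # ys @ xs) p" using assms by (intro normal_prod_swap_head) auto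
  also have "\<dots> = normal_prod (xs @ B # A # ys) p" using rot[of "B # A # ys" xs] assms by simp
  finally show ?thesis .
qed

lemma normal_prod_mset:
  assumes "mats As" "mset As = mset Bs"
  shows "normal_prod As p = normal_prod Bs p"
proof -
  let ?f = "\<lambda>As. if mats As then normal_prod As p else 0"
  have "?f As = ?f Bs"
  proof (rule swap_invariant_mset[OF _ assms(2)])
    fix xs A B ys
    show "?f (xs @ A # B # ys) = ?f (xs @ B # A # ys)"
      using normal_prod_swap[of xs A B ys p] by auto
  qed
  moreover have "mats Bs" using assms by (metis set_mset_mset)
  ultimately show ?thesis using assms(1) by simp
qed

lemma normal_prod_expand_column:
  assumes "mats As" "k < length As"
  shows "normal_prod (As[k := mat r r (\<lambda>(i, l). if l = 0 then f i else 0)]) p =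
    (\<Sum>i<r. normal_prod (As[k := E_tensor r i 0 (f i)]) p)"
proof -
  let ?C = "\<lambda>m. mat r r (\<lambda>(i, l). if l = 0 \<and> i < m then f i else 0)"
  have "normal_prod (As[k := ?C m]) p = (\<Sum>i<m. normal_prod (As[k := E_tensor r i 0 (f i)]) p)" for m
  proof (induction m)
    case 0
    have C0: "?C 0 = 0\<^sub>m r r" by (rule eq_matI) auto
    show ?case unfolding C0 using normal_prod_zero_entry[OF assms] by simp
  next
    case (Suc m)
    have "?C (Suc m) = ?C m + E_tensor r m 0 (f m)" by (rule eq_matI) (auto simp: less_Suc_eq)
    then show ?case using normal_prod_add[OF assms, of "?C m" "E_tensor r m 0 (f m)"] Suc by simp
  qed
  moreover have "mat r r (\<lambda>(i, l). if l = 0 then f i else 0) = ?C r" by (rule eq_matI) auto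
  ultimately show ?thesis by simp
qed

end

text \<open>
  The situation after the twist, with the highest weight \<open>(n, 0, \<dots>, 0)\<close>: all columns but the first
  act as zero on \<open>v\<close>.
\<close>

locale highest_weight_rep = current_rep r act
  for r :: nat and act :: "poly_xy mat \<Rightarrow> ('k \<Rightarrow>\<^sub>0 complex) \<Rightarrow> ('k \<Rightarrow>\<^sub>0 complex)" +
  fixes n :: nat and v :: "'k \<Rightarrow>\<^sub>0 complex"
  assumes r_pos: "r \<ge> 1"
    and kills: "\<And>A. A \<in> carrier_mat r r \<Longrightarrow> (\<And>i. i < r \<Longrightarrow> A $$ (i, 0) = 0) \<Longrightarrow> act A v = 0"
    and weight: "\<And>P. act (E_tensor r 0 0 P) v = pm_scale (of_nat n * poly (poly P 0) 0) v"
    and lowering_power: "r \<ge> 2 \<Longrightarrow> (act (E_tensor r 1 0 1) ^^ Suc n) v = 0"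
begin

text \<open>
  A factor with vanishing first column can be moved to the right, where it meets \<open>v\<close>.  The correction
  terms have one factor less and again contain a factor of this kind.
\<close>

lemma normal_prod_kills:
  assumes "mats As" "B \<in> set As" "\<And>i. i < r \<Longrightarrow> B $$ (i, 0) = 0"
  shows "normal_prod As v = 0"
  using assms
proof (induction "length As" arbitrary: As B)
  case (Suc m)
  obtain xs ys where As: "As = xs @ B # ys" using Suc.prems(2) by (meson split_list)
  define Cs where "Cs = xs @ ys"
  have Cs: "mats Cs" "length Cs = m" and B: "B \<in> carrier_mat r r"
    using Suc by (auto simp: As Cs_def)
  have "normal_prod As v = normal_prod (Cs @ [B]) v"
    using Suc.prems by (intro normal_prod_mset) (auto simp: As Cs_def)
  also have "\<dots> = normal_prod Cs (act B v) - (\<Sum>k<length Cs. normal_prod (Cs[k := Cs ! k * B]) v)"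
    using Cs B by (intro normal_prod_snoc)
  also have "act B v = 0" using B Suc.prems by (intro kills)
  also have "(\<Sum>k<length Cs. normal_prod (Cs[k := Cs ! k * B]) v) = 0"
  proof (rule sum.neutral, rule ballI)
    fix k assume k: "k \<in> {..<length Cs}"
    then have Ck: "Cs ! k \<in> carrier_mat r r" using Cs by (auto intro: mats_nth)
    show "normal_prod (Cs[k := Cs ! k * B]) v = 0"
    proof (rule Suc.hyps(1))
      show "m = length (Cs[k := Cs ! k * B])" using Cs by simp
      show "mats (Cs[k := Cs ! k * B])" using Cs B k by (intro mats_update_mult) auto
      show "Cs ! k * B \<in> set (Cs[k := Cs ! k * B])" using k by (simp add: set_update_memI)
      show "(Cs ! k * B) $$ (i, 0) = 0" if "i < r" for i
        using that Ck B r_pos Suc.prems(3) by (simp add: scalar_prod_def)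
    qed
  qed
  finally show ?case using Cs by (simp add: normal_prod_0)
qed simp

text \<open>The product with \<open>B\<close> as an additional factor vanishes by \<open>normal_prod_kills\<close>.\<close>

lemma raising_action:
  assumes "mats As" "B \<in> carrier_mat r r" "\<And>i. i < r \<Longrightarrow> B $$ (i, 0) = 0"
  shows "act B (normal_prod As v) = (\<Sum>k<length As. normal_prod (As[k := B * As ! k]) v)"
proof -
  have "act B v = 0" using assms by (intro kills)
  moreover have "normal_prod (As[k := As ! k * B]) v = 0" if "k < length As" for k
  proof (rule normal_prod_kills)
    show "mats (As[k := As ! k * B])" using assms that by (intro mats_update_mult)
    show "As ! k * B \<in> set (As[k := As ! k * B])" using that by (simp add: set_update_memI)
    show "(As ! k * B) $$ (i, 0) = 0" if "i < r" for i
      using that mats_nth[OF assms(1) \<open>k < length As\<close>] assms r_pos by (simp add: scalar_prod_def)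
  qed
  ultimately show ?thesis
    using normal_prod_commutator[OF assms(1,2), of v] assms(1) by (simp add: normal_prod_0)
qed

definition letter_mat :: "nat \<times> poly_xy \<Rightarrow> poly_xy mat" where
  "letter_mat = (\<lambda>(i, P). E_tensor r i 0 P)"

lemma letter_mat_carrier [simp]: "letter_mat L \<in> carrier_mat r r"
  by (simp add: letter_mat_def split: prod.split)

lemma normal_prod_lowering_power:
  assumes "r \<ge> 2"
  shows "normal_prod (replicate m (E_tensor r 1 0 1)) v = (act (E_tensor r 1 0 1) ^^ m) v"
proof (induction m)
  case (Suc m)
  let ?F = "E_tensor r 1 0 1"
  have "normal_prod ((replicate m ?F)[k := ?F * (replicate m ?F) ! k]) v = 0" if "k < m" for k
    using that assms normal_prod_zero_entry[of "replicate m ?F" k v]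
    by (simp add: E_tensor_mult E_tensor_zero)
  then show ?case using Suc by simp
qed simp

text \<open>
  Start from \<open>n + 1\<close> factors \<open>E\<^sub>1\<^sub>0\<close>, where the product is the power of the lowering operator.  Applying
  \<open>E\<^sub>i\<^sub>1 R\<close> replaces one factor \<open>E\<^sub>1\<^sub>0\<close> after the other by \<open>E\<^sub>i\<^sub>0 R\<close>; the terms in which it meets another letter
  vanish by induction.
\<close>

lemma normal_prod_letters_vanish:
  assumes r: "r \<ge> 2"
  shows "length L + c = Suc n \<Longrightarrow> (\<forall>l\<in>set L. fst l < r) \<Longrightarrow>
    normal_prod (map letter_mat L @ replicate c (E_tensor r 1 0 1)) v = 0"
proof (induction "length L" arbitrary: L c)
  case 0
  then have "L = []" "c = Suc n" by auto
  then show ?case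
    using lowering_power[OF r] normal_prod_lowering_power[OF r, of "Suc n"]
    by (simp only: list.map append_Nil)
next
  case (Suc m)
  let ?F = "E_tensor r 1 0 1"
  obtain i R L' where L: "L = (i, R) # L'" using Suc(2) by (cases L) auto
  have i: "i < r" and L': "\<forall>l\<in>set L'. fst l < r" "length L' = m" using Suc by (auto simp: L)
  let ?B = "E_tensor r i 1 R"
  let ?As = "map letter_mat L' @ replicate (Suc c) ?F"
  have m: "mats ?As" by (auto simp: letter_mat_def)
  have IH: "normal_prod (map letter_mat K @ replicate (Suc c) ?F) v = 0"
    if "length K = m" "\<forall>l\<in>set K. fst l < r" for K
    using Suc.hyps(1)[of K "Suc c"] that Suc.prems L' by (simp add: L)
  have "0 = act ?B (normal_prod ?As v)" using IH[OF L'(2,1)] by (simp add: act_0)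
  also have "\<dots> = (\<Sum>k<length ?As. normal_prod (?As[k := ?B * ?As ! k]) v)"
    using r by (intro raising_action[OF m]) auto
  also have "\<dots> = (\<Sum>k<length ?As. if m \<le> k then normal_prod (map letter_mat L @ replicate c ?F) v else 0)"
  proof (rule sum.cong[OF refl])
    fix k assume "k \<in> {..<length ?As}"
    then have k: "k < m + Suc c" using L' by simp
    show "normal_prod (?As[k := ?B * ?As ! k]) v =
        (if m \<le> k then normal_prod (map letter_mat L @ replicate c ?F) v else 0)"
    proof (cases "m \<le> k")
      case False
      then have k: "k < m" by simp
      obtain i' P where Lk: "L' ! k = (i', P)" by (cases "L' ! k")
      have i': "i' < r" using L' k Lk by (metis fst_conv nth_mem)
      have Ak: "?As ! k = E_tensor r i' 0 P" using k L' Lk by (simp add: nth_append letter_mat_def)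
      let ?K = "L'[k := (i, if 1 = i' then R * P else 0)]"
      have "?As[k := ?B * ?As ! k] = map letter_mat ?K @ replicate (Suc c) ?F"
        unfolding Ak using k L' i' r by (simp add: E_tensor_mult list_update_append map_update letter_mat_def)
      moreover have "\<forall>l\<in>set ?K. fst l < r"
        using L'(1) i set_update_subset_insert[of L' k] by fastforce
      ultimately show ?thesis using IH[of ?K] k L' by simp
    next
      case True
      have Ak: "?As ! k = ?F" using True k L' by (simp add: nth_append del: replicate_Suc)
      have "?B * ?F = letter_mat (i, R)" using r by (simp add: E_tensor_mult letter_mat_def)
      then have eq: "?As[k := ?B * ?As ! k] = map letter_mat L' @ (replicate (Suc c) ?F)[k - m := letter_mat (i, R)]"
        unfolding Ak using True L' by (simp add: list_update_append del: replicate_Suc)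
      have km: "k - m < Suc c" using True k by linarith
      have "(replicate (Suc c) ?F) ! (k - m) = ?F" using km by (simp del: replicate_Suc)
      moreover have "k - m < length (replicate (Suc c) ?F)" using km by simp
      ultimately have "mset ((replicate (Suc c) ?F)[k - m := letter_mat (i, R)]) =
          add_mset (letter_mat (i, R)) (mset (replicate c ?F))"
        by (simp only: mset_update) simp
      then have "normal_prod (?As[k := ?B * ?As ! k]) v = normal_prod (map letter_mat L @ replicate c ?F) v"
        unfolding eq
        by (intro normal_prod_mset)
           (auto simp: L simp del: replicate_Suc dest!: subsetD[OF set_update_subset_insert])
      then show ?thesis using True by simp
    qed
  qed
  also have "\<dots> = (\<Sum>k\<in>{m..<m + Suc c}. normal_prod (map letter_mat L @ replicate c ?F) v)"
    using L'(2) by (intro sum.mono_neutral_cong_right) auto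
  also have "\<dots> = pm_scale (of_nat (Suc c)) (normal_prod (map letter_mat L @ replicate c ?F) v)"
    by (simp add: pm.sum_constant_scale del: of_nat_Suc)
  finally show ?case by (simp add: pm.scale_eq_0_iff del: of_nat_Suc)
qed

end

context highest_weight_rep
begin

text \<open>
  Each new factor acts on \<open>v\<close> as \<open>n P(0, 0)\<close>, and each of the \<open>m\<close> corrections subtracts \<open>P(0, 0)\<close>; this
  gives the falling factorial.  In particular \<open>n + 1\<close> factors give zero.
\<close>

lemma normal_prod_E00:
  "normal_prod (map (\<lambda>P. E_tensor r 0 0 P) Ps) v =
    pm_scale ((\<Prod>t<length Ps. of_nat n - of_nat t) * (\<Prod>k<length Ps. poly (poly (Ps ! k) 0) 0)) v"
proof (induction "length Ps" arbitrary: Ps)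
  case (Suc m)
  obtain P Qs where Ps: "Ps = P # Qs" using Suc(2) by (cases Ps) auto
  have m: "m = length Qs" using Suc(2) by (simp add: Ps)
  let ?e = "\<lambda>P :: poly_xy. poly (poly P 0) 0"
  let ?c = "\<Prod>t<m. of_nat n - of_nat t :: complex"
  have upd: "normal_prod ((map (E_tensor r 0 0) Qs)[k := E_tensor r 0 0 P * (map (E_tensor r 0 0) Qs) ! k]) v =
      pm_scale (?c * (?e P * (\<Prod>k<m. ?e (Qs ! k)))) v" if k: "k < m" for k
  proof -
    have "(map (E_tensor r 0 0) Qs)[k := E_tensor r 0 0 P * (map (E_tensor r 0 0) Qs) ! k] =
        map (E_tensor r 0 0) (Qs[k := P * Qs ! k])"
      using k m r_pos by (simp add: E_tensor_mult map_update)
    moreover have "(\<Prod>l<m. ?e ((Qs[k := P * Qs ! k]) ! l)) = ?e P * (\<Prod>l<m. ?e (Qs ! l))"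
    proof -
      have "(\<Prod>l<m. ?e ((Qs[k := P * Qs ! k]) ! l)) =
          ?e ((Qs[k := P * Qs ! k]) ! k) * (\<Prod>l\<in>{..<m} - {k}. ?e ((Qs[k := P * Qs ! k]) ! l))"
        using k by (intro prod.remove) auto
      also have "(\<Prod>l\<in>{..<m} - {k}. ?e ((Qs[k := P * Qs ! k]) ! l)) = (\<Prod>l\<in>{..<m} - {k}. ?e (Qs ! l))"
        by (intro prod.cong) auto
      moreover have "(\<Prod>l<m. ?e (Qs ! l)) = ?e (Qs ! k) * (\<Prod>l\<in>{..<m} - {k}. ?e (Qs ! l))"
        using k by (intro prod.remove) auto
      ultimately show ?thesis using k m by simp
    qed
    ultimately show ?thesis using Suc(1)[of "Qs[k := P * Qs ! k]"] m by simp
  qed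
  have "normal_prod (map (E_tensor r 0 0) Ps) v =
      act (E_tensor r 0 0 P) (pm_scale (?c * (\<Prod>k<m. ?e (Qs ! k))) v) -
      (\<Sum>k<m. pm_scale (?c * (?e P * (\<Prod>k<m. ?e (Qs ! k)))) v)"
    using Suc(1)[OF m] upd m by (simp add: Ps)
  also have "\<dots> = pm_scale (?c * (\<Prod>k<m. ?e (Qs ! k)) * (of_nat n * ?e P) -
      of_nat m * (?c * (?e P * (\<Prod>k<m. ?e (Qs ! k))))) v"
    by (simp add: act_scale_vec weight pm.sum_constant_scale pm.scale_left_diff_distrib)
  also have "?c * (\<Prod>k<m. ?e (Qs ! k)) * (of_nat n * ?e P) - of_nat m * (?c * (?e P * (\<Prod>k<m. ?e (Qs ! k)))) =
     (\<Prod>t<Suc m. of_nat n - of_nat t) * (\<Prod>k<Suc m. ?e (Ps ! k))"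
  proof -
    have "(\<Prod>k<Suc m. ?e (Ps ! k)) = ?e P * (\<Prod>k<m. ?e (Qs ! k))"
      by (simp add: prod.lessThan_Suc_shift Ps del: prod.lessThan_Suc)
    then show ?thesis by (simp add: algebra_simps)
  qed
  finally show ?case using m by (simp add: Ps del: prod.lessThan_Suc)
qed simp

text \<open>
  Split every factor into its first column and the rest.  The rest gives zero by \<open>normal_prod_kills\<close>,
  and only products of letters remain.  For \<open>r = 1\<close> these are covered by \<open>normal_prod_E00\<close>.
\<close>

lemma normal_prod_vanishes:
  assumes "mats As" "length As = Suc n"
  shows "normal_prod As v = 0"
proof -
  have "normal_prod (map letter_mat L @ As) v = 0"
    if "mats As" "length L + length As = Suc n" "\<forall>l\<in>set L. fst l < r" for L As
    using that
  proof (induction As arbitrary: L)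
    case Nil
    show ?case
    proof (cases "r \<ge> 2")
      case True
      then show ?thesis using normal_prod_letters_vanish[OF True, of L 0] Nil by simp
    next
      case False
      then have r1: "r = 1" using r_pos by simp
      then have "\<forall>l\<in>set L. fst l = 0" using Nil by auto
      then have E00: "map letter_mat L = map (\<lambda>P. E_tensor r 0 0 P) (map snd L)"
        by (auto simp: letter_mat_def)
      have "normal_prod (map letter_mat L) v = 0"
        unfolding E00 normal_prod_E00 using Nil by simp
      then show ?thesis by simp
    qed
  next
    case (Cons A As)
    let ?C = "mat r r (\<lambda>(i, l). if l = 0 then A $$ (i, 0) else 0)"
    let ?L = "map letter_mat L @ A # As"
    have A: "A \<in> carrier_mat r r" and m: "mats ?L" and k: "length L < length ?L" using Cons.prems by auto
    have upd: "?L[length L := B] = map letter_mat L @ B # As" for B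
      by (simp add: list_update_append)
    have "normal_prod (map letter_mat L @ A # As) v = normal_prod (?L[length L := (A - ?C) + ?C]) v"
    proof -
      have "(A - ?C) + ?C = A" using A by (intro eq_matI) auto
      then show ?thesis by (simp add: list_update_append)
    qed
    also have "\<dots> = normal_prod (?L[length L := A - ?C]) v + normal_prod (?L[length L := ?C]) v"
      using A by (intro normal_prod_add[OF m k]) auto
    also have "normal_prod (?L[length L := A - ?C]) v = 0"
    proof (rule normal_prod_kills)
      show "mats (?L[length L := A - ?C])" using A by (intro mats_update m) auto
      show "A - ?C \<in> set (?L[length L := A - ?C])" using k by (simp add: set_update_memI)
    qed (use A r_pos in auto)
    also have "normal_prod (?L[length L := ?C]) v =
        (\<Sum>i<r. normal_prod (?L[length L := E_tensor r i 0 (A $$ (i, 0))]) v)"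
      by (rule normal_prod_expand_column[OF m k])
    also have "\<dots> = 0"
    proof (rule sum.neutral, rule ballI)
      fix i assume "i \<in> {..<r}"
      then have "normal_prod (map letter_mat (L @ [(i, A $$ (i, 0))]) @ As) v = 0"
        using Cons.prems by (intro Cons.IH) auto
      then show "normal_prod (?L[length L := E_tensor r i 0 (A $$ (i, 0))]) v = 0"
        unfolding upd by (simp add: letter_mat_def)
    qed
    finally show ?case by simp
  qed
  from this[of As "[]"] assms show ?thesis by simp
qed

definition monom_mat :: "nat \<times> nat \<times> nat \<Rightarrow> poly_xy mat" where
  "monom_mat = (\<lambda>(i, \<alpha>, \<beta>). E_tensor r i 0 (xy_monom \<alpha> \<beta>))"

definition word_value :: "(nat \<times> nat \<times> nat) list \<Rightarrow> ('k \<Rightarrow>\<^sub>0 complex)" where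
  "word_value u = normal_prod (map monom_mat u) v"

lemma mats_monom: "mats (map monom_mat u)"
  by (auto simp: monom_mat_def)

lemma word_value_mset: "mset u = mset u' \<Longrightarrow> word_value u = word_value u'"
  unfolding word_value_def by (rule normal_prod_mset[OF mats_monom]) simp

end

text \<open>Multiplication of the vector \<open>e\<^sub>i x\<^sup>\<alpha> y\<^sup>\<beta>\<close> by the matrix \<open>A\<close>, in terms of letters.\<close>

definition letter_action :: "nat \<Rightarrow> poly_xy mat \<Rightarrow> nat \<times> nat \<times> nat \<Rightarrow> (nat \<times> nat \<times> nat \<Rightarrow>\<^sub>0 complex)" where
  "letter_action r A = (\<lambda>(i, \<alpha>, \<beta>). \<Sum>i'<r. \<Sum>b\<le>degree (A $$ (i', i)). \<Sum>a\<le>degree (coeff (A $$ (i', i)) b).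
     single (i', \<alpha> + a, \<beta> + b) (coeff (coeff (A $$ (i', i)) b) a))"

context highest_weight_rep
begin

text \<open>The product of the \<open>n + 1\<close> factors \<open>A\<close> and the letters of \<open>u\<close> vanishes; its recursion is the claim.\<close>

lemma act_word_value:
  assumes A: "A \<in> carrier_mat r r" and u: "length u = n" "\<And>l. l \<in> set u \<Longrightarrow> fst l < r"
  shows "act A (word_value u) = (\<Sum>k<n. lin_ext (\<lambda>c. word_value (u[k := c])) (letter_action r A (u ! k)))"
proof -
  let ?As = "map monom_mat u"
  have m: "mats ?As" by (rule mats_monom)
  have "normal_prod (A # ?As) v = 0" using A m u by (intro normal_prod_vanishes) auto
  then have "act A (word_value u) = (\<Sum>k<n. normal_prod (?As[k := A * ?As ! k]) v)"
    using u(1) by (simp add: word_value_def)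
  also have "\<dots> = (\<Sum>k<n. lin_ext (\<lambda>c. word_value (u[k := c])) (letter_action r A (u ! k)))"
  proof (rule sum.cong[OF refl])
    fix k assume "k \<in> {..<n}"
    then have k: "k < length u" "k < length ?As" using u by auto
    obtain i \<alpha> \<beta> where uk: "u ! k = (i, \<alpha>, \<beta>)" by (cases "u ! k") auto
    have i: "i < r" using u(2) k uk by (metis fst_conv nth_mem)
    let ?Q = "xy_monom \<alpha> \<beta>"
    have "A * ?As ! k = mat r r (\<lambda>(i', l). if l = 0 then A $$ (i', i) * ?Q else 0)"
    proof (rule eq_matI)
      fix a b assume "a < dim_row (mat r r (\<lambda>(i', l). if l = 0 then A $$ (i', i) * ?Q else 0))"
        "b < dim_col (mat r r (\<lambda>(i', l). if l = 0 then A $$ (i', i) * ?Q else 0))"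
      then have ab: "a < r" "b < r" by auto
      have "(A * ?As ! k) $$ (a, b) = (\<Sum>c<r. A $$ (a, c) * (E_tensor r i 0 ?Q) $$ (c, b))"
        using ab A k uk by (simp add: monom_mat_def scalar_prod_def atLeast0LessThan)
      also have "\<dots> = (\<Sum>c<r. if c = i then (if b = 0 then A $$ (a, i) * ?Q else 0) else 0)"
        using ab by (intro sum.cong) auto
      finally show "(A * ?As ! k) $$ (a, b) = mat r r (\<lambda>(i', l). if l = 0 then A $$ (i', i) * ?Q else 0) $$ (a, b)"
        using ab i by simp
    qed (use A k uk in \<open>auto simp: monom_mat_def\<close>)
    then have "normal_prod (?As[k := A * ?As ! k]) v =
        (\<Sum>i'<r. normal_prod (?As[k := E_tensor r i' 0 (A $$ (i', i) * ?Q)]) v)"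
      using normal_prod_expand_column[OF m k(2), of "\<lambda>i'. A $$ (i', i) * ?Q" v] by simp
    also have "\<dots> = (\<Sum>i'<r. \<Sum>b\<le>degree (A $$ (i', i)). \<Sum>a\<le>degree (coeff (A $$ (i', i)) b).
        pm_scale (coeff (coeff (A $$ (i', i)) b) a) (word_value (u[k := (i', \<alpha> + a, \<beta> + b)])))"
    proof (rule sum.cong[OF refl])
      fix i'
      let ?f = "\<lambda>P. normal_prod (?As[k := E_tensor r i' 0 (P * ?Q)]) v"
      have "?f (A $$ (i', i)) = (\<Sum>b\<le>degree (A $$ (i', i)). \<Sum>a\<le>degree (coeff (A $$ (i', i)) b).
          pm_scale (coeff (coeff (A $$ (i', i)) b) a) (?f (xy_monom a b)))"
        by (rule poly_xy_linear_expand)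
           (simp_all only: distrib_right mult.assoc E_tensor_add E_tensor_scale E_tensor_carrier
             normal_prod_add[OF m k(2)] normal_prod_scale[OF m k(2)])
      also have "\<dots> = (\<Sum>b\<le>degree (A $$ (i', i)). \<Sum>a\<le>degree (coeff (A $$ (i', i)) b).
        pm_scale (coeff (coeff (A $$ (i', i)) b) a) (word_value (u[k := (i', \<alpha> + a, \<beta> + b)])))"
        using k by (simp add: word_value_def map_update monom_mat_def xy_monom_mult add.commute)
      finally show "?f (A $$ (i', i)) = (\<Sum>b\<le>degree (A $$ (i', i)). \<Sum>a\<le>degree (coeff (A $$ (i', i)) b).
        pm_scale (coeff (coeff (A $$ (i', i)) b) a) (word_value (u[k := (i', \<alpha> + a, \<beta> + b)])))" .
    qed
    also have "\<dots> = lin_ext (\<lambda>c. word_value (u[k := c])) (letter_action r A (u ! k))"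
      by (simp add: uk letter_action_def lin_ext_sum)
    finally show "normal_prod (?As[k := A * ?As ! k]) v =
        lin_ext (\<lambda>c. word_value (u[k := c])) (letter_action r A (u ! k))" .
  qed
  finally show ?thesis .
qed

text \<open>
  Append the scalar matrix \<open>x\<^sup>\<alpha> y\<^sup>\<beta>\<close> as a last factor.  The product of \<open>n + 1\<close> factors vanishes, and this
  matrix acts on \<open>v\<close> by the value of \<open>x\<^sup>\<alpha> y\<^sup>\<beta>\<close> at the origin.
\<close>

lemma word_value_power_sum:
  assumes u: "length u = n" "\<And>l. l \<in> set u \<Longrightarrow> fst l < r" and ab: "\<alpha> + \<beta> > 0"
  shows "(\<Sum>k<n. word_value (u[k := (case u ! k of (i, a, b) \<Rightarrow> (i, a + \<alpha>, b + \<beta>))])) = 0"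
proof -
  let ?As = "map monom_mat u" and ?Q = "xy_monom \<alpha> \<beta>"
  let ?B = "?Q \<cdot>\<^sub>m 1\<^sub>m r"
  have m: "mats ?As" by (rule mats_monom)
  have B: "?B \<in> carrier_mat r r" by simp
  have "0 = normal_prod (?As @ [?B]) v" using m B u by (intro normal_prod_vanishes[symmetric]) auto
  also have "\<dots> = normal_prod ?As (act ?B v) - (\<Sum>k<n. normal_prod (?As[k := ?As ! k * ?B]) v)"
    using normal_prod_snoc[OF m B] u by simp
  also have "act ?B v = 0"
  proof -
    have "?B = (?B - E_tensor r 0 0 ?Q) + E_tensor r 0 0 ?Q" by (intro eq_matI) auto
    then have "act ?B v = act (?B - E_tensor r 0 0 ?Q) v + act (E_tensor r 0 0 ?Q) v"
      using act_add[of "?B - E_tensor r 0 0 ?Q" "E_tensor r 0 0 ?Q" v] by (simp add: minus_carrier_mat)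
    also have "act (?B - E_tensor r 0 0 ?Q) v = 0"
      using r_pos by (intro kills) (auto simp: minus_carrier_mat)
    also have "act (E_tensor r 0 0 ?Q) v = 0"
      using ab by (simp add: weight xy_monom_def poly_monom)
    finally show ?thesis by simp
  qed
  also have "normal_prod ?As 0 = 0" by (rule normal_prod_0[OF m])
  also have "(\<Sum>k<n. normal_prod (?As[k := ?As ! k * ?B]) v) =
      (\<Sum>k<n. word_value (u[k := (case u ! k of (i, a, b) \<Rightarrow> (i, a + \<alpha>, b + \<beta>))]))"
  proof (rule sum.cong[OF refl])
    fix k assume "k \<in> {..<n}"
    then have k: "k < length u" using u by auto
    obtain i a b where uk: "u ! k = (i, a, b)" by (cases "u ! k") auto
    have "?As ! k * ?B = ?Q \<cdot>\<^sub>m (E_tensor r i 0 (xy_monom a b) * 1\<^sub>m r)"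
      using k uk by (simp add: monom_mat_def mult_smult_distrib[of _ r r _ r])
    also have "\<dots> = E_tensor r i 0 (xy_monom (a + \<alpha>) (b + \<beta>))"
      using right_mult_one_mat[of "E_tensor r i 0 (xy_monom a b)" r r]
      by (intro eq_matI) (auto simp: xy_monom_mult add.commute)
    finally show "normal_prod (?As[k := ?As ! k * ?B]) v =
        word_value (u[k := (case u ! k of (i, a, b) \<Rightarrow> (i, a + \<alpha>, b + \<beta>))])"
      using k by (simp add: uk word_value_def map_update monom_mat_def)
  qed
  finally show ?thesis by simp
qed

end

section \<open>Linear extension and permutations in the exterior algebra\<close>

interpretation extv: vector_space "ext_scale :: complex \<Rightarrow> 'a ext_alg \<Rightarrow> 'a ext_alg"
  by (rule vector_space_ext_scale)

lemma ext_scale_mult: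
  fixes p q :: "'a ext_alg"
  shows "ext_scale c p * q = ext_scale c (p * q)" "p * ext_scale c q = ext_scale c (p * q)"
  by (transfer; simp add: pm_scale_mult_left pm_scale_mult_right ideal_cong_def two_sided_ideal.zero)+

definition ext_extend :: "('k \<Rightarrow> 'a ext_alg) \<Rightarrow> ('k \<Rightarrow>\<^sub>0 complex) \<Rightarrow> 'a ext_alg" where
  "ext_extend \<phi> p = (\<Sum>w\<in>keys p. ext_scale (lookup p w) (\<phi> w))"

lemma ext_extend_superset:
  assumes "finite S" "keys p \<subseteq> S"
  shows "ext_extend \<phi> p = (\<Sum>w\<in>S. ext_scale (lookup p w) (\<phi> w))"
  unfolding ext_extend_def using assms
  by (intro sum.mono_neutral_left) (auto simp: in_keys_iff)

lemma ext_extend_linear: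
  "ext_extend \<phi> 0 = 0"
  "ext_extend \<phi> (single w c) = ext_scale c (\<phi> w)"
  "ext_extend \<phi> (p + q) = ext_extend \<phi> p + ext_extend \<phi> q"
  "ext_extend \<phi> (pm_scale c p) = ext_scale c (ext_extend \<phi> p)"
proof -
  show "ext_extend \<phi> 0 = 0" by (simp add: ext_extend_def)
  show "ext_extend \<phi> (single w c) = ext_scale c (\<phi> w)"
    by (subst ext_extend_superset[of "{w}"]) auto
  let ?S = "keys p \<union> keys q"
  have "keys (p + q) \<subseteq> ?S" by (rule keys_add)
  then show "ext_extend \<phi> (p + q) = ext_extend \<phi> p + ext_extend \<phi> q"
    by (simp add: ext_extend_superset[of ?S] lookup_add extv.scale_left_distrib sum.distrib)
  have "keys (pm_scale c p) \<subseteq> keys p"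
    by (auto simp: in_keys_iff)
  then show "ext_extend \<phi> (pm_scale c p) = ext_scale c (ext_extend \<phi> p)"
    by (simp add: ext_extend_superset[of "keys p"] extv.scale_sum_right)
qed

lemma ext_extend_diff: "ext_extend \<phi> (p - q) = ext_extend \<phi> p - ext_extend \<phi> q"
  using ext_extend_linear(3)[of \<phi> "p - q" q] by simp

lemma ext_extend_sum: "ext_extend \<phi> (sum f A) = (\<Sum>i\<in>A. ext_extend \<phi> (f i))"
  by (induction A rule: infinite_finite_induct) (auto simp: ext_extend_linear)

lemma ext_extend_cong:
  "(\<And>w. w \<in> keys p \<Longrightarrow> \<phi> w = \<psi> w) \<Longrightarrow> ext_extend \<phi> p = ext_extend \<psi> p"
  by (simp add: ext_extend_def)

lemma ext_extend_lin_ext: "ext_extend \<phi> (lin_ext \<psi> p) = ext_extend (\<lambda>w. ext_extend \<phi> (\<psi> w)) p"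
  by (induction p rule: pm_induct) (auto simp: ext_extend_linear lin_ext_add)

lemma ext_extend_mult_left: "x * ext_extend \<phi> p = ext_extend (\<lambda>w. x * \<phi> w) p"
  by (simp add: ext_extend_def sum_distrib_left ext_scale_mult)

lemma ext_extend_mult_right: "ext_extend \<phi> p * x = ext_extend (\<lambda>w. \<phi> w * x) p"
  by (simp add: ext_extend_def sum_distrib_right ext_scale_mult)

lemma ext_extend_in_span: "(\<And>w. w \<in> keys p \<Longrightarrow> \<phi> w \<in> extv.span S) \<Longrightarrow> ext_extend \<phi> p \<in> extv.span S"
  unfolding ext_extend_def by (intro extv.span_sum extv.span_scale)

lift_definition ext_vector :: "('a \<Rightarrow>\<^sub>0 complex) \<Rightarrow> 'a ext_alg" is degree_one .

lemma ext_vector_extend: "ext_vector v = ext_extend ext_gen v"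
proof (induction v rule: pm_induct)
  case zero
  show ?case unfolding ext_extend_linear by transfer (simp add: degree_one_def ideal_cong_def two_sided_ideal.zero)
next
  case (single k c)
  show ?case unfolding ext_extend_linear by transfer (simp add: degree_one_def ideal_cong_def two_sided_ideal.zero)
next
  case (add p q)
  have "ext_vector (p + q) = ext_vector p + ext_vector q"
    by transfer (simp add: degree_one_def lin_ext_add ideal_cong_def two_sided_ideal.zero)
  then show ?case by (simp add: add ext_extend_linear)
qed

lemma ext_vector_square: "ext_vector v * ext_vector v = 0"
  by transfer (auto simp: ideal_cong_def ext_relations_def intro!: two_sided_ideal_base)

lemma ext_gen_square: "ext_gen a * ext_gen a = 0"
  using ext_vector_square[of "single a 1"] by (simp add: ext_vector_extend ext_extend_linear)

lemma ext_gen_anticommute: "ext_gen a * ext_gen b = - (ext_gen b * ext_gen a)"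
proof -
  have "(ext_gen a + ext_gen b) * (ext_gen a + ext_gen b) = 0"
    using ext_vector_square[of "single a 1 + single b 1"]
    by (simp add: ext_vector_extend ext_extend_linear)
  then show ?thesis by (simp add: algebra_simps ext_gen_square eq_neg_iff_add_eq_0)
qed

lemma ext_derivation_linear:
  "ext_derivation T (p + q) = ext_derivation T p + ext_derivation T q"
  "ext_derivation T (ext_scale c p) = ext_scale c (ext_derivation T p)"
  "ext_derivation T 0 = 0"
  by (transfer; simp add: free_derivation_linear ideal_cong_def two_sided_ideal.zero)+

lemma ext_derivation_sum: "ext_derivation T (sum f A) = (\<Sum>i\<in>A. ext_derivation T (f i))"
  by (induction A rule: infinite_finite_induct) (auto simp: ext_derivation_linear)

lemma ext_derivation_extend: "ext_derivation T (ext_extend \<phi> p) = ext_extend (\<lambda>w. ext_derivation T (\<phi> w)) p"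
  by (simp add: ext_extend_def ext_derivation_sum ext_derivation_linear)

lemma ext_derivation_gen: "ext_derivation T (ext_gen a) = ext_extend ext_gen (T a)"
proof -
  have "single (FMon []) 1 = (1 :: 'a free_alg)"
    by (metis single_one zero_free_monoid_def)
  then have "free_derivation T (letter a) = degree_one (T a)" by (simp add: free_derivation_def letter_def)
  then have "ext_derivation T (ext_gen a) = ext_vector (T a)"
    by transfer (simp add: ideal_cong_def two_sided_ideal.zero)
  then show ?thesis by (simp add: ext_vector_extend)
qed

lemma ext_derivation_1: "ext_derivation T 1 = 0"
  using ext_derivation_mult[of T 1 1] by simp

definition wedge_list :: "'a list \<Rightarrow> 'a ext_alg" where
  "wedge_list cs = prod_list (map ext_gen cs)"

lemma wedge_list_simps [simp]:
  "wedge_list [] = 1" "wedge_list (c # cs) = ext_gen c * wedge_list cs"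
  "wedge_list (cs @ ds) = wedge_list cs * wedge_list ds"
  by (simp_all add: wedge_list_def)

lemma ext_derivation_wedge_list:
  "ext_derivation T (wedge_list cs) =
    (\<Sum>k<length cs. ext_extend (\<lambda>c. wedge_list (cs[k := c])) (T (cs ! k)))"
proof (induction cs)
  case (Cons c cs)
  then show ?case
    by (simp add: ext_derivation_mult ext_derivation_gen ext_extend_mult_right ext_extend_mult_left
        sum_distrib_left sum.lessThan_Suc_shift del: sum.lessThan_Suc)
qed (simp add: ext_derivation_1)

lemma ext_gen_wedge_commute:
  "ext_gen a * wedge_list cs = ext_scale ((- 1) ^ length cs) (wedge_list cs * ext_gen a)"
proof (induction cs)
  case (Cons c cs)
  have "ext_gen a * wedge_list (c # cs) = - (ext_gen c * (ext_gen a * wedge_list cs))"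
    using ext_gen_anticommute[of a c] by (simp flip: mult.assoc)
  also have "\<dots> = ext_scale ((- 1) ^ length (c # cs)) (wedge_list (c # cs) * ext_gen a)"
    unfolding Cons by (simp add: ext_scale_mult mult.assoc)
  finally show ?case .
qed simp

lemma wedge_list_exchange:
  "wedge_list (xs @ a # ys @ b # zs) = - wedge_list (xs @ b # ys @ a # zs)"
proof -
  have "ext_gen a * wedge_list ys * ext_gen b = - (ext_gen b * wedge_list ys * ext_gen a)"
    unfolding ext_gen_wedge_commute[of _ ys]
    using ext_gen_anticommute[of a b]
    by (simp add: ext_scale_mult mult.assoc)
  then have "wedge_list xs * (ext_gen a * wedge_list ys * ext_gen b) * wedge_list zs =
      - (wedge_list xs * (ext_gen b * wedge_list ys * ext_gen a) * wedge_list zs)" by simp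
  then show ?thesis by (simp add: mult.assoc)
qed

lemma ext_self_negative:
  fixes x :: "'a ext_alg" assumes "x = - x" shows "x = 0"
proof -
  have "ext_scale 2 x = x + x" using extv.scale_left_distrib[of 1 1 x] by simp
  also have "\<dots> = 0" using assms by (metis add.right_inverse)
  finally show ?thesis by (simp add: extv.scale_eq_0_iff)
qed

lemma wedge_list_repeated:
  assumes "\<not> distinct cs" shows "wedge_list cs = 0"
proof -
  obtain xs ys zs a where "cs = xs @ [a] @ ys @ [a] @ zs"
    using not_distinct_decomp[OF assms] by auto
  then have "cs = xs @ a # ys @ a # zs" by simp
  then show ?thesis using wedge_list_exchange[of xs a ys a zs] by (intro ext_self_negative) simp
qed

lemma map_upt_split:
  assumes "i < j" "j < n"
  shows "map f [0..<n] = map f [0..<i] @ f i # map f [Suc i..<j] @ f j # map f [Suc j..<n]"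
proof -
  have split: "[a..<c] = [a..<b] @ b # [Suc b..<c]" if "a \<le> b" "b < c" for a b c
    using that upt_add_eq_append[of a b "c - b"] by (simp add: upt_conv_Cons)
  have "[0..<n] = [0..<i] @ i # [Suc i..<j] @ j # [Suc j..<n]"
    using split[of 0 i n] split[of "Suc i" j n] assms by simp
  then show ?thesis by simp
qed

lemma wedge_list_transpose:
  assumes "a < n" "b < n" "a \<noteq> b"
  shows "wedge_list (map (\<lambda>k. f (transpose a b k)) [0..<n] @ zs) = - wedge_list (map f [0..<n] @ zs)"
proof -
  have *: "wedge_list (map (\<lambda>k. f (transpose a b k)) [0..<n] @ zs) = - wedge_list (map f [0..<n] @ zs)"
    if "a < b" "b < n" for a b
  proof -
    have "map (\<lambda>k. f (transpose a b k)) [0..<a] = map f [0..<a]"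
      "map (\<lambda>k. f (transpose a b k)) [Suc a..<b] = map f [Suc a..<b]"
      "map (\<lambda>k. f (transpose a b k)) [Suc b..<n] = map f [Suc b..<n]"
      using that by (auto simp: transpose_def)
    then have "map (\<lambda>k. f (transpose a b k)) [0..<n] @ zs =
      map f [0..<a] @ f b # map f [Suc a..<b] @ f a # (map f [Suc b..<n] @ zs)"
      using map_upt_split[OF that, of "\<lambda>k. f (transpose a b k)"] by simp
    moreover have "map f [0..<n] @ zs = map f [0..<a] @ f a # map f [Suc a..<b] @ f b # (map f [Suc b..<n] @ zs)"
      using map_upt_split[OF that, of f] by simp
    ultimately show ?thesis using wedge_list_exchange by metis
  qed
  show ?thesis
  proof (cases "a < b")
    case False
    then show ?thesis using *[of b a] assms by (simp add: transpose_commute)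
  qed (use * assms in blast)
qed

lemma wedge_list_permute:
  assumes "\<pi> permutes {..<n}"
  shows "wedge_list (map (\<lambda>k. f (\<pi> k)) [0..<n] @ zs) = ext_scale (of_int (sign \<pi>)) (wedge_list (map f [0..<n] @ zs))"
  using assms finite_lessThan[of n]
proof (induction arbitrary: f rule: permutes_induct)
  case id
  then show ?case by (simp add: sign_id)
next
  case (swap a b p)
  have "sign (transpose a b \<circ> p) = - sign p"
    using swap by (subst sign_compose)
      (auto simp: sign_swap_id permutes_imp_permutation[OF finite_lessThan] permutation_swap_id)
  then have "sign (\<lambda>k. transpose a b (p k)) = - sign p" by (simp add: comp_def)
  then show ?case
    using swap.IH[of "\<lambda>k. f (transpose a b k)"] wedge_list_transpose[of a n b f zs] swap.hyps
    by (simp add: comp_def)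
qed

section \<open>Particles over a filled layer\<close>

lemma ext_extend_swap:
  "ext_extend (\<lambda>q. ext_extend (\<lambda>a. X q a) p) f = ext_extend (\<lambda>a. ext_extend (\<lambda>q. X q a) f) p"
  unfolding ext_extend_def extv.scale_sum_right
  by (subst sum.swap) (simp add: mult.commute)

lemma ext_extend_fun_sum: "ext_extend (\<lambda>q. \<Sum>i\<in>A. X i q) f = (\<Sum>i\<in>A. ext_extend (X i) f)"
  unfolding ext_extend_def extv.scale_sum_right by (rule sum.swap)

lemma ext_extend_fun_add: "ext_extend (\<lambda>q. X q + Y q) f = ext_extend X f + ext_extend Y f"
  unfolding ext_extend_def by (simp add: extv.scale_right_distrib sum.distrib)

lemma ext_extend_fun_scale: "ext_extend (\<lambda>q. ext_scale c (X q)) f = ext_scale c (ext_extend X f)"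
  unfolding ext_extend_def by (simp add: extv.scale_sum_right mult.commute)

text \<open>The pairs that occur in \<open>v\<^sub>\<xi>\<close> for all \<open>r\<close> colours: \<open>s\<close> exponents below \<open>N\<close> for each colour.\<close>

definition layer :: "nat \<Rightarrow> nat \<Rightarrow> int \<Rightarrow> (nat \<times> int) list" where
  "layer r s N = [(j, i). j \<leftarrow> [0..<r], i \<leftarrow> [N - int s .. N - 1]]"

lemma set_layer: "set (layer r s N) = {..<r} \<times> {N - int s..N - 1}"
  by (auto simp: layer_def)

text \<open>
  The matrix entries of an operator, given by their coefficients at \<open>X\<^sup>a Y\<^sup>b\<close>.  On the basis vector of
  exponent \<open>i\<close>, the operator \<open>Y\<close> is the scalar \<open>i\<close>, and exponents that reach \<open>N\<close> are discarded.
\<close>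

definition acts_by :: "nat \<Rightarrow> int \<Rightarrow> (nat \<Rightarrow> nat \<Rightarrow> (nat \<times> nat \<Rightarrow>\<^sub>0 complex)) \<Rightarrow>
    (nat \<times> int \<Rightarrow> (nat \<times> int \<Rightarrow>\<^sub>0 complex)) \<Rightarrow> bool" where
  "acts_by r N pd T \<longleftrightarrow> (\<forall>j<r. \<forall>i<N. T (j, i) = (\<Sum>k<r. lin_ext (\<lambda>(a, b).
     if i + int a < N then single (k, i + int a) (of_int i ^ b) else 0) (pd k j)))"

text \<open>
  The \<open>n\<close> particles beside the layer initially occupy the exponents from \<open>base\<close> to \<open>base + n - 1\<close>, just below the
  exponents of the layer.
\<close>

locale wedge_module =
  fixes r n s :: nat and N :: int
begin

definition base :: int where "base = N - int s - int n"
definition z :: complex where "z = of_int base"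

definition state :: "nat list \<Rightarrow> nat list \<Rightarrow> wedge" where
  "state w q = wedge_list (map (\<lambda>k. (w ! k, base + int (q ! k))) [0..<n] @ layer r s N)"

text \<open>
  The effect of \<open>X\<^sup>a Y\<^sup>b\<close> on particle \<open>k\<close> in terms of the list of positions relative to \<open>base\<close>.  A particle
  that is pushed beyond its \<open>n\<close> positions hits the filled layer, or leaves the module, and gives zero.
\<close>

definition slot :: "nat \<Rightarrow> nat \<times> nat \<Rightarrow> (nat list \<Rightarrow>\<^sub>0 complex) \<Rightarrow> (nat list \<Rightarrow>\<^sub>0 complex)" where
  "slot k = (\<lambda>(a, b). lin_ext (\<lambda>q. if q ! k + a < n
     then single (q[k := q ! k + a]) ((z + of_nat (q ! k)) ^ b) else 0))"

definition layer_trace :: "(nat \<times> int \<Rightarrow> (nat \<times> int \<Rightarrow>\<^sub>0 complex)) \<Rightarrow> complex" where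
  "layer_trace T = (\<Sum>c\<leftarrow>layer r s N. lookup (T c) c)"

lemma wedge_list_hits_layer:
  assumes "c \<in> set (layer r s N)" "k < length cs"
  shows "wedge_list (cs[k := c]) * wedge_list (layer r s N) = 0"
proof -
  have "c \<in> set (cs[k := c])" using assms by (simp add: set_update_memI)
  then have "\<not> distinct (cs[k := c] @ layer r s N)" using assms by auto
  from wedge_list_repeated[OF this] show ?thesis by simp
qed

lemma acts_by_keys:
  assumes T: "acts_by r N pd T" and j: "j < r" "i < N" and c: "c \<in> keys (T (j, i))"
  shows "fst c < r \<and> i \<le> snd c \<and> snd c < N"
proof -
  have "keys (T (j, i)) \<subseteq> {c. fst c < r \<and> i \<le> snd c \<and> snd c < N}"
    unfolding T[unfolded acts_by_def, rule_format, OF j]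
    by (intro keys_sum_subset keys_lin_ext_subset) (auto split: if_splits)
  then show ?thesis using c by auto
qed

text \<open>
  Operators never lower an exponent, so a moved layer vector coincides with another vector of the layer
  unless it stays where it is.
\<close>

lemma derivation_layer:
  assumes T: "acts_by r N pd T"
  shows "ext_derivation T (wedge_list (layer r s N)) = ext_scale (layer_trace T) (wedge_list (layer r s N))"
proof -
  let ?L = "layer r s N"
  have "ext_extend (\<lambda>c. wedge_list (?L[k := c])) (T (?L ! k)) =
      ext_scale (lookup (T (?L ! k)) (?L ! k)) (wedge_list ?L)" if k: "k < length ?L" for k
  proof -
    obtain j i where ji: "?L ! k = (j, i)" by (cases "?L ! k")
    have L: "(j, i) \<in> set ?L" using k ji by (metis nth_mem)
    then have j: "j < r" "i < N" "N - int s \<le> i" by (auto simp: set_layer)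
    have "ext_extend (\<lambda>c. wedge_list (?L[k := c])) (T (j, i)) =
        ext_extend (\<lambda>c. if c = (j, i) then wedge_list ?L else 0) (T (j, i))"
    proof (rule ext_extend_cong)
      fix c assume c: "c \<in> keys (T (j, i))"
      show "wedge_list (?L[k := c]) = (if c = (j, i) then wedge_list ?L else 0)"
      proof (cases "c = (j, i)")
        case True
        then show ?thesis using ji by (metis list_update_id)
      next
        case False
        have "c \<in> set ?L" using acts_by_keys[OF T j(1,2) c] j(3) by (auto simp: set_layer mem_Times_iff)
        then obtain l where l: "l < length ?L" "?L ! l = c" by (metis in_set_conv_nth)
        then have "l \<noteq> k" using False ji by auto
        then have "(?L[k := c]) ! l = (?L[k := c]) ! k" using l k by simp
        then have "\<not> distinct (?L[k := c])"
          using \<open>l \<noteq> k\<close> l k nth_eq_iff_index_eq[of "?L[k := c]" l k] by auto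
        then show ?thesis using False by (simp add: wedge_list_repeated)
      qed
    qed
    also have "\<dots> = ext_scale (lookup (T (j, i)) (j, i)) (wedge_list ?L)"
    proof -
      have "ext_extend (\<lambda>c. if c = (j, i) then wedge_list ?L else 0) (T (j, i)) =
        (\<Sum>c\<in>keys (T (j, i)). if c = (j, i) then ext_scale (lookup (T (j, i)) (j, i)) (wedge_list ?L) else 0)"
        unfolding ext_extend_def by (intro sum.cong) auto
      then show ?thesis by (simp add: in_keys_iff)
    qed
    finally show ?thesis by (simp add: ji)
  qed
  then have "ext_derivation T (wedge_list ?L) =
      (\<Sum>k<length ?L. ext_scale (lookup (T (?L ! k)) (?L ! k)) (wedge_list ?L))"
    by (simp add: ext_derivation_wedge_list)
  then show ?thesis
    by (simp add: layer_trace_def sum_list_sum_nth atLeast0LessThan extv.scale_sum_left)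
qed

lemma derivation_state:
  assumes T: "acts_by r N pd T"
    and w: "length w = n" "set w \<subseteq> {..<r}" and q: "length q = n" "set q \<subseteq> {..<n}"
  shows "ext_derivation T (state w q) =
    (\<Sum>k<n. \<Sum>j<r. ext_extend (\<lambda>ab. ext_extend (state (w[k := j])) (slot k ab (single q 1))) (pd j (w ! k)))
    + ext_scale (layer_trace T) (state w q)"
proof -
  define f where "f k = (w ! k, base + int (q ! k))" for k
  let ?G = "map f [0..<n]" and ?L = "layer r s N"
  have st: "state w q = wedge_list ?G * wedge_list ?L" 
    by (simp add: state_def f_def[abs_def])
  have "ext_extend (\<lambda>c. wedge_list (?G[k := c])) (T (f k)) * wedge_list ?L =
     (\<Sum>j<r. ext_extend (\<lambda>ab. ext_extend (state (w[k := j])) (slot k ab (single q 1))) (pd j (w ! k)))"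
    if k: "k < n" for k
  proof -
    have "q ! k \<in> set q" "w ! k \<in> set w" using k q w by auto
    then have qk: "q ! k < n" and wk: "w ! k < r" using q w by auto
    let ?e = "base + int (q ! k)"
    have e: "?e < N" using qk by (simp add: base_def)
    let ?h = "\<lambda>c. wedge_list (?G[k := c]) * wedge_list ?L"
    have "T (f k) = (\<Sum>j<r. lin_ext (\<lambda>(a, b). if ?e + int a < N
        then single (j, ?e + int a) (of_int ?e ^ b) else 0) (pd j (w ! k)))"
      unfolding f_def using T[unfolded acts_by_def, rule_format, OF wk e] .
    then have "ext_extend ?h (T (f k)) = (\<Sum>j<r. ext_extend (\<lambda>ab. ext_extend ?h (case ab of (a, b) \<Rightarrow>
        if ?e + int a < N then single (j, ?e + int a) (of_int ?e ^ b) else 0)) (pd j (w ! k)))"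
      by (simp only: ext_extend_sum ext_extend_lin_ext)
    also have "\<dots> = (\<Sum>j<r. ext_extend (\<lambda>ab. ext_extend (state (w[k := j])) (slot k ab (single q 1))) (pd j (w ! k)))"
    proof (intro sum.cong refl ext_extend_cong)
      fix j :: nat and ab :: "nat \<times> nat" assume j: "j \<in> {..<r}"
      obtain a b where ab: "ab = (a, b)" by (cases ab)
      show "ext_extend ?h (case ab of (a, b) \<Rightarrow>
          if ?e + int a < N then single (j, ?e + int a) (of_int ?e ^ b) else 0) =
          ext_extend (state (w[k := j])) (slot k ab (single q 1))"
      proof (cases "q ! k + a < n")
        case True
        then have "?e + int a < N" by (simp add: base_def)
        moreover have "?G[k := (j, ?e + int a)] = map (\<lambda>l. ((w[k := j]) ! l, base + int ((q[k := q ! k + a]) ! l))) [0..<n]"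
          using w q k by (intro nth_equalityI) (auto simp: f_def nth_list_update)
        ultimately show ?thesis using True
          by (simp add: ab slot_def ext_extend_linear state_def z_def)
      next
        case False
        have "ext_scale (of_int ?e ^ b) (?h (j, ?e + int a)) = 0" if "?e + int a < N"
        proof -
          have "(j, ?e + int a) \<in> set ?L" using False that j by (auto simp: set_layer base_def)
          then show ?thesis using wedge_list_hits_layer[of "(j, ?e + int a)" k ?G] k by simp
        qed
        then show ?thesis using False by (simp add: ab slot_def ext_extend_linear)
      qed
    qed
    finally show ?thesis by (simp add: ext_extend_mult_right)
  qed
  then have "(\<Sum>k<n. ext_extend (\<lambda>c. wedge_list (?G[k := c])) (T (f k))) * wedge_list ?L =
    (\<Sum>k<n. \<Sum>j<r. ext_extend (\<lambda>ab. ext_extend (state (w[k := j])) (slot k ab (single q 1))) (pd j (w ! k)))"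
    by (simp add: sum_distrib_right)
  moreover have "ext_derivation T (wedge_list ?G) = (\<Sum>k<n. ext_extend (\<lambda>c. wedge_list (?G[k := c])) (T (f k)))"
    by (simp add: ext_derivation_wedge_list)
  ultimately show ?thesis
    by (simp add: st ext_derivation_mult derivation_layer[OF T] ext_scale_mult)
qed

lemma derivation_extend_state:
  assumes T: "acts_by r N pd T"
    and w: "length w = n" "set w \<subseteq> {..<r}"
    and f: "\<And>q. q \<in> keys f \<Longrightarrow> length q = n \<and> set q \<subseteq> {..<n}"
  shows "ext_derivation T (ext_extend (state w) f) =
    (\<Sum>k<n. \<Sum>j<r. ext_extend (\<lambda>ab. ext_extend (state (w[k := j])) (slot k ab f)) (pd j (w ! k)))
    + ext_scale (layer_trace T) (ext_extend (state w) f)"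
proof -
  have slot: "slot k ab f = lin_ext (\<lambda>q. slot k ab (single q 1)) f" for k ab
    by (cases ab) (simp add: slot_def)
  have "ext_derivation T (ext_extend (state w) f) = ext_extend (\<lambda>q.
    (\<Sum>k<n. \<Sum>j<r. ext_extend (\<lambda>ab. ext_extend (state (w[k := j])) (slot k ab (single q 1))) (pd j (w ! k)))
    + ext_scale (layer_trace T) (state w q)) f"
    unfolding ext_derivation_extend using derivation_state[OF T w] f by (intro ext_extend_cong) auto
  then show ?thesis
    by (simp only: ext_extend_fun_add ext_extend_fun_sum ext_extend_fun_scale
        ext_extend_swap[of _ "pd _ _" f] slot ext_extend_lin_ext)
qed

lemma slot_truncated_monom:
  assumes "k < n"
  shows "slot k (a, b) (truncated_monom n q) =
    pm_scale ((z + of_nat (q k)) ^ b) (truncated_monom n (q(k := q k + a)))"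
proof (cases "\<forall>l<n. q l < n")
  case True
  have upd: "(map q [0..<n])[k := q k + a] = map (q(k := q k + a)) [0..<n]"
    using assms by (intro nth_equalityI) (auto simp: nth_list_update)
  show ?thesis
    using True assms by (auto simp: truncated_monom_def slot_def upd)
next
  case False
  then have "\<not> (\<forall>l<n. (q(k := q k + a)) l < n)"
    by (metis add_lessD1 fun_upd_other fun_upd_same)
  then have "truncated_monom n q = 0" "truncated_monom n (q(k := q k + a)) = 0"
    using False by (simp_all only: truncated_monom_def if_False)
  then show ?thesis by (simp add: slot_def)
qed

lemma slot_linear: "slot k ab (sum f A) = (\<Sum>i\<in>A. slot k ab (f i))" "slot k ab (pm_scale c g) = pm_scale c (slot k ab g)"
  by (cases ab; simp add: slot_def lin_ext_sum lin_ext_scale)+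

lemma slot_vandermonde_orbit:
  assumes "k < n"
  shows "slot k (a, b) (vandermonde_orbit n z c d) =
    (\<Sum>t\<le>b. pm_scale (of_nat (b choose t) * of_nat (c k) ^ (b - t))
       (vandermonde_orbit n z (c(k := c k + a)) (d(k := d k + t))))"
proof -
  have "slot k (a, b) (vandermonde_orbit n z c d) = alternating n (c(k := c k + a))
      (\<lambda>\<sigma>. euler_power n z d \<sigma> * (z + of_nat (\<sigma> k + c k)) ^ b)"
    unfolding vandermonde_orbit_def alternating_def slot_linear
  proof (intro sum.cong refl)
    fix \<sigma> :: "nat \<Rightarrow> nat"
    have "(\<lambda>l. \<sigma> l + (c(k := c k + a)) l) = (\<lambda>l. \<sigma> l + c l)(k := \<sigma> k + c k + a)" by auto
    then show "pm_scale (of_int (sign \<sigma>) * euler_power n z d \<sigma>) (slot k (a, b) (truncated_monom n (\<lambda>k. \<sigma> k + c k))) =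
      pm_scale (of_int (sign \<sigma>) * (euler_power n z d \<sigma> * (z + of_nat (\<sigma> k + c k)) ^ b))
        (truncated_monom n (\<lambda>l. \<sigma> l + (c(k := c k + a)) l))"
      by (simp add: slot_truncated_monom[OF assms] mult.assoc)
  qed
  also have "\<dots> = alternating n (c(k := c k + a)) (\<lambda>\<sigma>. \<Sum>t\<le>b. (of_nat (b choose t) * of_nat (c k) ^ (b - t)) *
      euler_power n z (d(k := d k + t)) \<sigma>)"
  proof (rule alternating_cong)
    fix \<sigma> :: "nat \<Rightarrow> nat"
    let ?R = "\<Prod>j\<in>{..<n} - {k}. (z + of_nat (\<sigma> j)) ^ d j" and ?w = "z + of_nat (\<sigma> k)"
    have "(z + of_nat (\<sigma> k + c k)) ^ b = (\<Sum>t\<le>b. of_nat (b choose t) * ?w ^ t * of_nat (c k) ^ (b - t))"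
      using binomial_ring[of ?w "of_nat (c k)" b] by (simp add: add.assoc)
    moreover have "euler_power n z d \<sigma> = ?R * ?w ^ d k"
      using euler_power_upd[OF assms, of z d "d k"] by simp
    ultimately show "euler_power n z d \<sigma> * (z + of_nat (\<sigma> k + c k)) ^ b =
        (\<Sum>t\<le>b. of_nat (b choose t) * of_nat (c k) ^ (b - t) * euler_power n z (d(k := d k + t)) \<sigma>)"
      unfolding euler_power_upd[OF assms] by (simp add: sum_distrib_left power_add mult_ac)
  qed simp
  finally show ?thesis by (simp only: alternating_linear vandermonde_orbit_def)
qed

definition particles :: "nat list \<Rightarrow> (nat \<Rightarrow> nat) \<Rightarrow> (nat \<Rightarrow> nat) \<Rightarrow> wedge" where
  "particles w c d = ext_extend (state w) (vandermonde_orbit n z c d)"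

lemma keys_vandermonde_orbit:
  assumes "q \<in> keys (vandermonde_orbit n z c d)"
  shows "length q = n \<and> set q \<subseteq> {..<n}"
proof -
  have "keys (vandermonde_orbit n z c d) \<subseteq> {q. length q = n \<and> set q \<subseteq> {..<n}}"
    unfolding vandermonde_orbit_def alternating_def
    by (intro keys_sum_subset subset_trans[OF keys_pm_scale]) (auto simp: truncated_monom_def split: if_splits)
  then show ?thesis using assms by auto
qed

text \<open>
  The Euler factor acts on an already shifted exponent, \<open>(z + \<sigma> k + c k)\<^sup>b\<close>, whereas \<open>particles\<close> records
  powers of \<open>z + \<sigma> k\<close>; the binomial theorem converts one into the other.  The term \<open>t = b\<close> is the one
  of highest degree.
\<close>

theorem derivation_particles:
  assumes T: "acts_by r N pd T" and w: "length w = n" "set w \<subseteq> {..<r}"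
  shows "ext_derivation T (particles w c d) =
    (\<Sum>k<n. \<Sum>j<r. ext_extend (\<lambda>(a, b). \<Sum>t\<le>b. ext_scale (of_nat (b choose t) * of_nat (c k) ^ (b - t))
       (particles (w[k := j]) (c(k := c k + a)) (d(k := d k + t)))) (pd j (w ! k)))
    + ext_scale (layer_trace T) (particles w c d)"
proof -
  have "ext_extend (state w') (slot k ab (vandermonde_orbit n z c d)) =
    (case ab of (a, b) \<Rightarrow> \<Sum>t\<le>b. ext_scale (of_nat (b choose t) * of_nat (c k) ^ (b - t))
       (particles w' (c(k := c k + a)) (d(k := d k + t))))" if "k < n" for k w' ab
    using that by (cases ab) (simp add: slot_vandermonde_orbit ext_extend_sum ext_extend_linear particles_def)
  then show ?thesis
    unfolding particles_def[of w] by (subst derivation_extend_state[OF T w keys_vandermonde_orbit]) simp_all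
qed

end

section \<open>The filtration of the wedge module\<close>

interpretation xyv: vector_space xy_scale by (rule vector_space_xy_scale)

lemma lin_ext_lin_ext: "lin_ext \<phi> (lin_ext \<psi> p) = lin_ext (\<lambda>w. lin_ext \<phi> (\<psi> w)) p"
  by (induction p rule: pm_induct) (auto simp: lin_ext_add lin_ext_scale)

lemma laurent_act_sum:
  "laurent_act P 0 = 0" "laurent_act 0 f = 0"
  "laurent_act (sum g S) f = (\<Sum>x\<in>S. laurent_act (g x) f)"
proof -
  show "laurent_act P 0 = 0" by transfer (simp add: free_laurent_act_linear)
  show 0: "laurent_act 0 f = 0" using laurent_act_linear(3)[of 0 0 f] by simp
  show "laurent_act (sum g S) f = (\<Sum>x\<in>S. laurent_act (g x) f)"
    by (induction S rule: infinite_finite_induct) (simp_all add: laurent_act_linear 0)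
qed

lemma laurent_act_monom:
  "laurent_act (X_elem ^ a * Y_elem ^ b) (single i c) =
    single (i + int a) (c * of_int i ^ b)"
proof -
  have "laurent_act (Y_elem ^ b) (single i c) = single i (c * of_int i ^ b)" for c
    by (induction b arbitrary: c) (auto simp: laurent_act_1 laurent_act_mult laurent_act_generators mult_ac)
  moreover have "laurent_act (X_elem ^ a) (single i c) = single (i + int a) c" for c
    by (induction a) (auto simp: laurent_act_1 laurent_act_mult laurent_act_generators mult_single add_ac)
  ultimately show ?thesis by (simp add: laurent_act_mult)
qed

text \<open>The coefficients of an element in terms of the \<open>X\<^sup>a Y\<^sup>b\<close>, tested on Laurent monomials.\<close>

definition represents :: "(nat \<times> nat \<Rightarrow>\<^sub>0 complex) \<Rightarrow> xy_alg \<Rightarrow> bool" where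
  "represents p P \<longleftrightarrow> (\<forall>i. laurent_act P (single i 1) =
     lin_ext (\<lambda>(a, b). single (i + int a) (of_int i ^ b)) p)"

lemma represents_span:
  assumes "P \<in> xyv.span {X_elem ^ a * Y_elem ^ b | a b. b \<le> n}"
  shows "\<exists>p. represents p P \<and> keys p \<subseteq> {(a, b). b \<le> n}"
  using assms
proof (induction rule: xyv.span_induct_alt)
  case base
  show ?case by (rule exI[of _ 0]) (simp add: represents_def laurent_act_sum)
next
  case (step c x y)
  then obtain p a b where p: "represents p y" "keys p \<subseteq> {(a, b). b \<le> n}"
    and x: "x = X_elem ^ a * Y_elem ^ b" "b \<le> n" by blast
  let ?p = "single (a, b) c + p"
  have "represents ?p (xy_scale c x + y)"
    using p(1) by (simp add: represents_def x laurent_act_linear laurent_act_monom lin_ext_add)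
  moreover have "keys ?p \<subseteq> {(a, b). b \<le> n}"
    using p(2) x(2) keys_add[of "single (a, b) c" p] by (auto split: if_splits)
  ultimately show ?case by blast
qed

lemma represents_symbol_lift:
  "represents (\<Sum>a\<le>degree (coeff P b). single (a, b) (coeff (coeff P b) a)) (symbol_lift b P)"
  by (simp add: represents_def symbol_lift_def laurent_act_sum laurent_act_linear laurent_act_monom lin_ext_sum)

lemma acts_by_V_act:
  assumes "\<And>k j. k < r \<Longrightarrow> j < r \<Longrightarrow> represents (pd k j) (A $$ (k, j))"
  shows "acts_by r N pd (V_act r N A)"
  unfolding acts_by_def
proof (intro allI impI)
  fix j i assume ji: "j < r" "i < N"
  have "lin_ext (\<lambda>e. if e < N then single (k, e) 1 else 0) (laurent_act (A $$ (k, j)) (single i 1)) =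
      lin_ext (\<lambda>(a, b). if i + int a < N then single (k, i + int a) (of_int i ^ b) else 0) (pd k j)"
    if "k < r" for k
    unfolding assms[OF that ji(1), unfolded represents_def, rule_format] lin_ext_lin_ext
    by (rule arg_cong2[of _ _ _ _ lin_ext]) (auto simp: fun_eq_iff)
  then show "V_act r N A (j, i) = (\<Sum>k<r. lin_ext (\<lambda>(a, b). if i + int a < N
      then single (k, i + int a) (of_int i ^ b) else 0) (pd k j))"
    using ji by (simp add: V_act_def)
qed

lemma acts_by_filt_G:
  assumes "A \<in> filt_G r e"
  shows "\<exists>pd. acts_by r N pd (V_act r N A) \<and> (\<forall>k<r. \<forall>j<r. keys (pd k j) \<subseteq> {(a, b). b \<le> e})"
proof -
  have "\<forall>k j. \<exists>p. k < r \<longrightarrow> j < r \<longrightarrow> represents p (A $$ (k, j)) \<and> keys p \<subseteq> {(a, b). b \<le> e}"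
  proof (intro allI)
    fix k j
    show "\<exists>p. k < r \<longrightarrow> j < r \<longrightarrow> represents p (A $$ (k, j)) \<and> keys p \<subseteq> {(a, b). b \<le> e}"
    proof (cases "k < r \<and> j < r")
      case True
      then have "A $$ (k, j) \<in> xyv.span {X_elem ^ a * Y_elem ^ b | a b. b \<le> e}"
        using assms by (simp add: filt_G_def)
      from represents_span[OF this] show ?thesis by blast
    qed auto
  qed
  then obtain pd where "\<forall>k j. k < r \<longrightarrow> j < r \<longrightarrow> represents (pd k j) (A $$ (k, j)) \<and> keys (pd k j) \<subseteq> {(a, b). b \<le> e}"
    by metis
  then show ?thesis by (intro exI[of _ pd]) (auto intro: acts_by_V_act)
qed

context wedge_module
begin

definition valid_word :: "nat list \<Rightarrow> bool" where
  "valid_word w \<longleftrightarrow> length w = n \<and> set w \<subseteq> {..<r}"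

text \<open>The span of the particle states of \<open>y\<close>-degree less than \<open>m\<close>; it turns out to be \<open>filt_V_pred m\<close>.\<close>

definition level :: "nat \<Rightarrow> wedge set" where
  "level m = extv.span {particles w c d | w c d. valid_word w \<and> (\<Sum>k<n. d k) < m}"

lemma level_subspace: "extv.subspace (level m)"
  by (simp add: level_def)

lemma particles_in_level: "valid_word w \<Longrightarrow> (\<Sum>k<n. d k) < m \<Longrightarrow> particles w c d \<in> level m"
  unfolding level_def by (rule extv.span_base) blast

lemma level_mono: "m \<le> m' \<Longrightarrow> level m \<subseteq> level m'"
  unfolding level_def by (rule extv.span_mono) fastforce

lemma valid_word_update: "valid_word w \<Longrightarrow> j < r \<Longrightarrow> valid_word (w[k := j])"
  using set_update_subset_insert[of w k j] by (auto simp: valid_word_def)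

lemma valid_word_nth: "valid_word w \<Longrightarrow> k < n \<Longrightarrow> w ! k < r"
  by (metis in_mono lessThan_iff nth_mem valid_word_def)

lemma derivation_level:
  assumes T: "acts_by r N pd T" and pd: "\<And>k j. k < r \<Longrightarrow> j < r \<Longrightarrow> keys (pd k j) \<subseteq> {(a, b). b \<le> e}"
    and x: "x \<in> level m"
  shows "ext_derivation T x \<in> level (m + e)"
  using x unfolding level_def
proof (induction rule: extv.span_induct_alt)
  case base
  show ?case by (simp add: ext_derivation_linear extv.span_zero)
next
  case (step c0 x y)
  then obtain w c d where w: "valid_word w" and d: "(\<Sum>k<n. d k) < m" and x: "x = particles w c d" by blast
  have "ext_derivation T (particles w c d) \<in> level (m + e)"
    unfolding derivation_particles[OF T w[unfolded valid_word_def, THEN conjunct1] w[unfolded valid_word_def, THEN conjunct2]]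
  proof (intro extv.subspace_add extv.subspace_sum extv.subspace_scale level_subspace)
    show "particles w c d \<in> level (m + e)" using w d by (intro particles_in_level) auto
    fix k j assume kj: "k \<in> {..<n}" "j \<in> {..<r}"
    show "ext_extend (\<lambda>(a, b). \<Sum>t\<le>b. ext_scale (of_nat (b choose t) * of_nat (c k) ^ (b - t))
        (particles (w[k := j]) (c(k := c k + a)) (d(k := d k + t)))) (pd j (w ! k)) \<in> level (m + e)"
      unfolding level_def
    proof (rule ext_extend_in_span, unfold level_def[symmetric])
      fix ab assume ab: "ab \<in> keys (pd j (w ! k))"
      obtain a b where [simp]: "ab = (a, b)" by (cases ab)
      have b: "b \<le> e" using pd[of j "w ! k"] ab kj valid_word_nth[OF w, of k] by auto
      have "(\<Sum>l<n. (d(k := d k + t)) l) < m + e" if "t \<le> b" for t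
        using sum_upd[of k n d "d k + t"] kj d b that by simp
      then show "(case ab of (a, b) \<Rightarrow> \<Sum>t\<le>b. ext_scale (of_nat (b choose t) * of_nat (c k) ^ (b - t))
          (particles (w[k := j]) (c(k := c k + a)) (d(k := d k + t)))) \<in> level (m + e)"
        using w kj by (auto intro!: extv.subspace_sum extv.subspace_scale level_subspace particles_in_level
            valid_word_update simp del: fun_upd_apply)
    qed
  qed
  then show ?case
    using step(2) by (simp add: x ext_derivation_linear extv.subspace_add[OF level_subspace] extv.subspace_scale[OF level_subspace]
        flip: level_def)
qed

definition truncated_state :: "nat list \<Rightarrow> (nat \<Rightarrow> nat) \<Rightarrow> wedge" where
  "truncated_state w q = (if \<forall>k<n. q k < n then state w (map q [0..<n]) else 0)"

lemma particles_alt: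
  "particles w c d = (\<Sum>\<sigma> | \<sigma> permutes {..<n}. ext_scale (of_int (sign \<sigma>) * euler_power n z d \<sigma>)
     (truncated_state w (\<lambda>k. \<sigma> k + c k)))"
  unfolding particles_def vandermonde_orbit_def alternating_def ext_extend_sum ext_extend_linear
  by (intro sum.cong refl) (auto simp: truncated_monom_def truncated_state_def ext_extend_linear)

lemma truncated_state_permute:
  assumes \<pi>: "\<pi> permutes {..<n}"
  shows "truncated_state (map (\<lambda>k. w ! \<pi> k) [0..<n]) (\<lambda>k. q (\<pi> k)) =
    ext_scale (of_int (sign \<pi>)) (truncated_state w q)"
proof -
  have a: "(\<forall>k<n. q (\<pi> k) < n) \<longleftrightarrow> (\<forall>k<n. q k < n)"
    using permutes_in_image[OF \<pi>] permutes_image[OF \<pi>] by (metis (full_types) imageE lessThan_iff)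
  have b: "state (map (\<lambda>k. w ! \<pi> k) [0..<n]) (map (\<lambda>k. q (\<pi> k)) [0..<n]) =
      ext_scale (of_int (sign \<pi>)) (state w (map q [0..<n]))"
  proof -
    let ?f = "\<lambda>k. (w ! k, base + int (q k))"
    have e: "map (\<lambda>k. (map (\<lambda>k. w ! \<pi> k) [0..<n] ! k, base + int (map (\<lambda>k. q (\<pi> k)) [0..<n] ! k))) [0..<n] =
      map (\<lambda>k. ?f (\<pi> k)) [0..<n]"
      "map (\<lambda>k. (w ! k, base + int (map q [0..<n] ! k))) [0..<n] = map ?f [0..<n]" by simp_all
    show ?thesis unfolding state_def e by (rule wedge_list_permute[OF \<pi>])
  qed
  show ?thesis
    unfolding truncated_state_def a b
    by (simp only: if_distrib[of "ext_scale _"] extv.scale_zero_right)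
qed

text \<open>
  Permuting the particles changes the sign of the wedge product and, after reindexing the sum, the sign
  in front of the term.  The two signs cancel.
\<close>

lemma particles_permute:
  assumes \<pi>: "\<pi> permutes {..<n}"
  shows "particles (map (\<lambda>k. w ! \<pi> k) [0..<n]) (\<lambda>k. c (\<pi> k)) (\<lambda>k. d (\<pi> k)) = particles w c d"
proof -
  have "particles (map (\<lambda>k. w ! \<pi> k) [0..<n]) (\<lambda>k. c (\<pi> k)) (\<lambda>k. d (\<pi> k)) =
      (\<Sum>\<sigma> | \<sigma> permutes {..<n}. ext_scale (of_int (sign (\<sigma> \<circ> \<pi>)) * euler_power n z (\<lambda>k. d (\<pi> k)) (\<sigma> \<circ> \<pi>))
       (truncated_state (map (\<lambda>k. w ! \<pi> k) [0..<n]) (\<lambda>k. (\<sigma> \<circ> \<pi>) k + c (\<pi> k))))"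
    unfolding particles_alt by (rule sum_permutations_compose_right[OF \<pi>])
  also have "\<dots> = particles w c d"
    unfolding particles_alt
  proof (rule sum.cong[OF refl])
    fix \<sigma> assume "\<sigma> \<in> {\<sigma>. \<sigma> permutes {..<n}}"
    then have \<sigma>: "\<sigma> permutes {..<n}" by simp
    have "sign (\<sigma> \<circ> \<pi>) = sign \<sigma> * sign \<pi>"
      using \<sigma> \<pi> by (intro sign_compose permutes_imp_permutation[OF finite_lessThan])
    moreover have "euler_power n z (\<lambda>k. d (\<pi> k)) (\<sigma> \<circ> \<pi>) = euler_power n z d \<sigma>"
      unfolding euler_power_def comp_def
      using prod.permute[OF \<pi>, of "\<lambda>k. (z + of_nat (\<sigma> k)) ^ d k"] by (simp add: comp_def)
    moreover have "of_int (sign \<pi>) * of_int (sign \<pi>) = (1 :: complex)" by (simp add: sign_def)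
    ultimately show "ext_scale (of_int (sign (\<sigma> \<circ> \<pi>)) * euler_power n z (\<lambda>k. d (\<pi> k)) (\<sigma> \<circ> \<pi>))
       (truncated_state (map (\<lambda>k. w ! \<pi> k) [0..<n]) (\<lambda>k. (\<sigma> \<circ> \<pi>) k + c (\<pi> k))) =
       ext_scale (of_int (sign \<sigma>) * euler_power n z d \<sigma>) (truncated_state w (\<lambda>k. \<sigma> k + c k))"
      using truncated_state_permute[OF \<pi>, of w "\<lambda>k. \<sigma> k + c k"] by (simp add: mult_ac)
  qed
  finally show ?thesis .
qed

lemma particles_highest:
  "particles (replicate n 0) (\<lambda>_. 0) (\<lambda>_. 0) = ext_scale (fact n) (state (replicate n 0) [0..<n])"
proof -
  let ?w = "replicate n 0"
  have "particles ?w (\<lambda>_. 0) (\<lambda>_. 0) =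
      (\<Sum>\<sigma> | \<sigma> permutes {..<n}. ext_scale (of_int (sign \<sigma>)) (truncated_state ?w \<sigma>))"
    by (simp add: particles_alt euler_power_def)
  also have "\<dots> = (\<Sum>\<sigma> | \<sigma> permutes {..<n}. state ?w [0..<n])"
  proof (rule sum.cong[OF refl])
    fix \<sigma> assume "\<sigma> \<in> {\<sigma>. \<sigma> permutes {..<n}}"
    then have \<sigma>: "\<sigma> permutes {..<n}" by simp
    have w: "map (\<lambda>k. ?w ! \<sigma> k) [0..<n] = ?w"
      using permutes_in_image[OF \<sigma>] by (intro nth_equalityI) auto
    have "truncated_state ?w \<sigma> = ext_scale (of_int (sign \<sigma>)) (truncated_state ?w (\<lambda>k. k))"
      using truncated_state_permute[OF \<sigma>, of ?w "\<lambda>k. k"] by (simp only: w)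
    moreover have "of_int (sign \<sigma>) * of_int (sign \<sigma>) = (1 :: complex)" by (simp add: sign_def)
    ultimately show "ext_scale (of_int (sign \<sigma>)) (truncated_state ?w \<sigma>) = state ?w [0..<n]"
      by (simp add: truncated_state_def)
  qed
  also have "\<dots> = ext_scale (fact n) (state ?w [0..<n])"
    by (simp only: extv.sum_constant_scale card_permutations[OF refl finite_lessThan] card_lessThan of_nat_fact)
  finally show ?thesis .
qed

end

lemma wedge_act_linear:
  "wedge_act r N A (x + y) = wedge_act r N A x + wedge_act r N A y"
  "wedge_act r N A (ext_scale c x) = ext_scale c (wedge_act r N A x)"
  "wedge_act r N A 0 = 0"
  by (simp_all add: wedge_act_def ext_derivation_linear)

lemma v_xi_state:
  assumes "r \<ge> 1" "\<xi> = (n + s) # replicate (r - 1) s"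
  shows "v_xi r \<xi> N = wedge_module.state r n s N (replicate n 0) [0..<n]"
proof -
  have up: "[a..c] = [a..b - 1] @ [b..c]" if "a \<le> b" "b \<le> c + 1" for a b c :: int
  proof (cases "b \<le> c")
    case True
    then show ?thesis using upto_split1[of a b c] that by simp
  next
    case False
    then have "b = c + 1" using that by linarith
    then show ?thesis by simp
  qed
  have map_up: "[a..a + int m - 1] = map (\<lambda>k. a + int k) [0..<m]" for a m
  proof (induction m)
    case (Suc m)
    have "[a..a + int m] = [a..a + int m - 1] @ [a + int m]" by (rule upto_rec2) simp
    then show ?case using Suc by simp
  qed simp
  have r: "[0..<r] = 0 # [Suc 0..<r]" using assms(1) by (simp add: upt_conv_Cons)
  let ?b = "N - int s - int n"
  have row0: "[N - int (n + s)..N - 1] = map (\<lambda>k. ?b + int k) [0..<n] @ [N - int s..N - 1]"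
    using up[of ?b "N - int s" "N - 1"] map_up[of ?b n] by (simp add: algebra_simps)
  have "concat (map (\<lambda>j. map (\<lambda>i. ext_gen (j, i)) [N - int (\<xi> ! j)..N - 1]) [Suc 0..<r]) =
      concat (map (\<lambda>j. map (\<lambda>i. ext_gen (j, i)) [N - int s..N - 1]) [Suc 0..<r])"
    using assms by (intro arg_cong[where f = concat] map_cong refl) (auto simp: nth_Cons')
  then have "v_xi r \<xi> N = prod_list (map ext_gen (map (\<lambda>k. (0, ?b + int k)) [0..<n] @ layer r s N))"
    unfolding v_xi_def layer_def r using row0 assms(2)
    by (simp add: map_concat comp_def)
  then have vx: "v_xi r \<xi> N = wedge_list (map (\<lambda>k. (0, ?b + int k)) [0..<n] @ layer r s N)"
    by (simp only: wedge_list_def)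
  have e: "map (\<lambda>k. (replicate n 0 ! k, wedge_module.base n s N + int ([0..<n] ! k))) [0..<n] =
      map (\<lambda>k. (0, ?b + int k)) [0..<n]"
    by (auto simp: wedge_module.base_def)
  show ?thesis
    unfolding wedge_module.state_def e vx ..
qed

context wedge_module
begin

context
  fixes \<xi> :: "nat list"
  assumes r_pos: "r \<ge> 1" and \<xi>: "\<xi> = (n + s) # replicate (r - 1) s"
begin

lemma v_xi_particles: "v_xi r \<xi> N = ext_scale (1 / fact n) (particles (replicate n 0) (\<lambda>_. 0) (\<lambda>_. 0))"
  by (simp add: particles_highest v_xi_state[OF r_pos \<xi>])

lemma valid_replicate: "valid_word (replicate n 0)"
  using r_pos by (auto simp: valid_word_def)

lemma filt_V_subset_level: "filt_V r \<xi> N m \<subseteq> level (Suc m)"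
proof -
  have "foldr (wedge_act r N) as (v_xi r \<xi> N) \<in> level (Suc (sum_list ds))"
    if "list_all2 (\<lambda>a d. a \<in> filt_G r d) as ds" for as ds
    using that
  proof (induction as ds rule: list_all2_induct)
    case Nil
    show ?case
      using valid_replicate by (auto simp: v_xi_particles intro!: extv.subspace_scale level_subspace particles_in_level)
  next
    case (Cons a as d ds)
    obtain pd where pd: "acts_by r N pd (V_act r N a)"
      "\<forall>k<r. \<forall>j<r. keys (pd k j) \<subseteq> {(a, b). b \<le> d}"
      using acts_by_filt_G[OF Cons(1)] by blast
    then have "ext_derivation (V_act r N a) (foldr (wedge_act r N) as (v_xi r \<xi> N)) \<in> level (Suc (sum_list ds) + d)"
      using Cons.IH by (intro derivation_level) auto
    then show ?case by (simp add: wedge_act_def[symmetric] add.commute)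
  qed
  then have "foldr (wedge_act r N) as (v_xi r \<xi> N) \<in> level (Suc m)" if "as \<in> U_factors r m" for as
    using that level_mono by (auto simp: U_factors_def) (meson Suc_le_mono subsetD)
  then show ?thesis
    unfolding filt_V_def by (intro extv.span_minimal level_subspace) auto
qed

lemma filt_V_subspace: "extv.subspace (filt_V r \<xi> N m)"
  by (simp add: filt_V_def)

lemma filt_V_mono: "m \<le> m' \<Longrightarrow> filt_V r \<xi> N m \<subseteq> filt_V r \<xi> N m'"
  unfolding filt_V_def by (intro extv.span_mono image_mono) (auto simp: U_factors_def)

lemma wedge_act_filt_V:
  assumes A: "A \<in> filt_G r e" and x: "x \<in> filt_V r \<xi> N m"
  shows "wedge_act r N A x \<in> filt_V r \<xi> N (m + e)"
  using x unfolding filt_V_def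
proof (induction rule: extv.span_induct_alt)
  case base
  show ?case by (simp add: wedge_act_linear extv.span_zero)
next
  case (step c x y)
  then obtain as ds where as: "list_all2 (\<lambda>a d. a \<in> filt_G r d) as ds" "sum_list ds \<le> m"
    and x: "x = foldr (wedge_act r N) as (v_xi r \<xi> N)" by (auto simp: U_factors_def)
  have "list_all2 (\<lambda>a d. a \<in> filt_G r d) (A # as) (e # ds)" using as A by simp
  then have "A # as \<in> U_factors r (m + e)" using as(2) unfolding U_factors_def by force
  then have "wedge_act r N A x \<in> extv.span ((\<lambda>as. foldr (wedge_act r N) as (v_xi r \<xi> N)) ` U_factors r (m + e))"
    unfolding x by (intro extv.span_base) (rule image_eqI[of _ _ "A # as"], auto)
  then show ?case
    using step(2) by (simp add: wedge_act_linear extv.span_add extv.span_scale)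
qed

text \<open>
  Induction on the number \<open>t\<close> of particles that may have been moved or coloured.  To treat particle
  \<open>t\<close>, apply \<open>E\<^sub>i\<^sub>0 X\<^sup>a Y\<^sup>b\<close> to the word in which it is trivial.  The operator acts on all particles of
  colour \<open>0\<close>.  Its effects on the first \<open>t\<close> particles are known by induction, and the effects on the
  \<open>n - t\<close> trivial particles agree up to a permutation, so the wanted element appears \<open>n - t\<close> times.
\<close>

lemma particles_in_filt_V:
  "valid_word w \<Longrightarrow> t \<le> n \<Longrightarrow> (\<And>k. t \<le> k \<Longrightarrow> k < n \<Longrightarrow> w ! k = 0 \<and> c k = 0 \<and> d k = 0) \<Longrightarrow>
    particles w c d \<in> filt_V r \<xi> N (\<Sum>k<n. d k)"
proof (induction t arbitrary: w c d)
  case 0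
  have w: "w = replicate n 0" using 0 by (intro nth_equalityI) (auto simp: valid_word_def)
  have "v_xi r \<xi> N \<in> filt_V r \<xi> N (\<Sum>k<n. d k)"
    unfolding filt_V_def by (intro extv.span_base image_eqI[of _ _ "[]"]) (auto simp: U_factors_def)
  then have v: "ext_scale (fact n) (v_xi r \<xi> N) \<in> filt_V r \<xi> N (\<Sum>k<n. d k)"
    by (rule extv.subspace_scale[OF filt_V_subspace])
  have "particles w c d = particles w (\<lambda>_. 0) (\<lambda>_. 0)"
    unfolding particles_def using 0 by (intro arg_cong[where f = "ext_extend _"] local_to_vandermonde_orbit[unfolded local_to_def, rule_format]) auto
  also have "\<dots> = ext_scale (fact n) (v_xi r \<xi> N)" by (simp add: w v_xi_particles)
  finally show ?case using v by simp
next
  case (Suc t)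
  have t: "t < n" using Suc.prems by simp
  define i a b where "i = w ! t" and "a = c t" and "b = d t"
  define w0 c0 d0 where "w0 = w[t := 0]" and "c0 = c(t := 0)" and "d0 = d(t := 0)"
  let ?D = "\<Sum>k<n. d k"
  have ir: "i < r" using Suc.prems(1) t by (simp add: i_def valid_word_nth)
  have w0: "valid_word w0" using Suc.prems(1) r_pos unfolding w0_def by (intro valid_word_update) auto
  have lw: "length w = n" using Suc.prems(1) by (simp add: valid_word_def)
  have d0: "(\<Sum>k<n. d0 k) + b = ?D" using sum_upd[OF t, of d 0] by (simp add: d0_def b_def)
  have zero: "w0 ! k = 0 \<and> c0 k = 0 \<and> d0 k = 0" if "t \<le> k" "k < n" for k
    using that Suc.prems(3)[of k] lw by (auto simp: w0_def c0_def d0_def nth_list_update)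
  define A where "A = mat r r (\<lambda>(k, l). if k = i \<and> l = 0 then X_elem ^ a * Y_elem ^ b else 0)"
  define pd where "pd k j = (if k = i \<and> j = 0 then single (a, b) 1 else 0 :: nat \<times> nat \<Rightarrow>\<^sub>0 complex)" for k j :: nat
  have A_filt: "A \<in> filt_G r b"
    unfolding filt_G_def A_def by (auto intro!: xyv.span_base xyv.span_zero)
  have T: "acts_by r N pd (V_act r N A)"
    by (rule acts_by_V_act) (auto simp: A_def pd_def represents_def laurent_act_monom laurent_act_sum)
  have P0: "particles w0 c0 d0 \<in> filt_V r \<xi> N (\<Sum>k<n. d0 k)"
    using w0 zero t by (intro Suc.IH) auto
  then have P0': "particles w0 c0 d0 \<in> filt_V r \<xi> N ?D"
    using filt_V_mono[of "\<Sum>k<n. d0 k" ?D] d0 by auto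
  have "wedge_act r N A (particles w0 c0 d0) \<in> filt_V r \<xi> N ((\<Sum>k<n. d0 k) + b)"
    by (rule wedge_act_filt_V[OF A_filt P0])
  then have act_in: "wedge_act r N A (particles w0 c0 d0) \<in> filt_V r \<xi> N ?D" by (simp add: d0)
  define S where "S k = (\<Sum>s\<le>b. ext_scale (of_nat (b choose s) * of_nat (c0 k) ^ (b - s))
      (particles (w0[k := i]) (c0(k := c0 k + a)) (d0(k := d0 k + s))))" for k
  have "(\<Sum>j<r. ext_extend (\<lambda>(a, b). \<Sum>s\<le>b. ext_scale (of_nat (b choose s) * of_nat (c0 k) ^ (b - s))
       (particles (w0[k := j]) (c0(k := c0 k + a)) (d0(k := d0 k + s)))) (pd j (w0 ! k))) =
       (if w0 ! k = 0 then S k else 0)" for k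
  proof -
    have "(\<Sum>j<r. ext_extend (\<lambda>(a, b). \<Sum>s\<le>b. ext_scale (of_nat (b choose s) * of_nat (c0 k) ^ (b - s))
       (particles (w0[k := j]) (c0(k := c0 k + a)) (d0(k := d0 k + s)))) (pd j (w0 ! k))) =
       (\<Sum>j<r. if j = i then (if w0 ! k = 0 then S k else 0) else 0)"
      by (intro sum.cong refl) (auto simp: pd_def ext_extend_linear S_def simp del: fun_upd_apply)
    then show ?thesis using ir by simp
  qed
  then have act: "wedge_act r N A (particles w0 c0 d0) =
      (\<Sum>k<n. if w0 ! k = 0 then S k else 0) + ext_scale (layer_trace (V_act r N A)) (particles w0 c0 d0)"
    unfolding wedge_act_def using w0 by (subst derivation_particles[OF T]) (auto simp: valid_word_def)
  have "(\<Sum>k<n. if w0 ! k = 0 then S k else 0) \<in> filt_V r \<xi> N ?D"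
    using extv.subspace_diff[OF filt_V_subspace act_in extv.subspace_scale[OF filt_V_subspace P0', of "layer_trace (V_act r N A)"]]
    by (simp add: act)
  moreover have "(\<Sum>k<n. if w0 ! k = 0 then S k else 0) =
      (\<Sum>k<t. if w0 ! k = 0 then S k else 0) + (\<Sum>k=t..<n. if w0 ! k = 0 then S k else 0)"
    using t by (simp add: lessThan_atLeast0 sum.atLeastLessThan_concat)
  moreover have "(\<Sum>k<t. if w0 ! k = 0 then S k else 0) \<in> filt_V r \<xi> N ?D"
  proof (intro extv.subspace_sum filt_V_subspace)
    fix k assume k: "k \<in> {..<t}"
    have "particles (w0[k := i]) (c0(k := c0 k + a)) (d0(k := d0 k + s)) \<in> filt_V r \<xi> N ?D" if s: "s \<le> b" for s
    proof -
      have sum: "(\<Sum>l<n. (d0(k := d0 k + s)) l) \<le> ?D"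
        using sum_upd[of k n d0 "d0 k + s"] k t d0 s by simp
      have "particles (w0[k := i]) (c0(k := c0 k + a)) (d0(k := d0 k + s)) \<in>
          filt_V r \<xi> N (\<Sum>l<n. (d0(k := d0 k + s)) l)"
        using w0 ir zero k t by (intro Suc.IH) (auto intro: valid_word_update)
      then show ?thesis using filt_V_mono[OF sum] by blast
    qed
    then have "S k \<in> filt_V r \<xi> N ?D"
      unfolding S_def by (intro extv.subspace_sum extv.subspace_scale filt_V_subspace) auto
    then show "(if w0 ! k = 0 then S k else 0) \<in> filt_V r \<xi> N ?D"
      by (simp add: extv.subspace_0[OF filt_V_subspace])
  qed
  ultimately have upper: "(\<Sum>k=t..<n. if w0 ! k = 0 then S k else 0) \<in> filt_V r \<xi> N ?D"
    using extv.subspace_diff[OF filt_V_subspace] by fastforce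
  have "S k = particles w c d" if k: "t \<le> k" "k < n" for k
  proof -
    have "S k = (\<Sum>s\<le>b. if s = b then particles (w0[k := i]) (c0(k := a)) (d0(k := b)) else 0)"
      unfolding S_def using zero[OF k] by (intro sum.cong refl) (auto simp: power_0_left)
    then have "S k = particles (w0[k := i]) (c0(k := a)) (d0(k := b))" by simp
    also have "\<dots> = particles (map (\<lambda>l. w ! transpose t k l) [0..<n]) (\<lambda>l. c (transpose t k l)) (\<lambda>l. d (transpose t k l))"
    proof -
      have swap: "(f(t := 0))(k := f t) = (\<lambda>l. f (transpose t k l))" if "k \<noteq> t \<Longrightarrow> f k = 0" for f :: "nat \<Rightarrow> nat"
        using that by (cases "k = t") (auto simp: fun_eq_iff transpose_def)
      have "w0[k := i] = map (\<lambda>l. (((!) w)(t := 0, k := w ! t)) l) [0..<n]"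
        using lw by (intro nth_equalityI) (auto simp: w0_def nth_list_update i_def)
      also have "\<dots> = map (\<lambda>l. w ! transpose t k l) [0..<n]"
        using Suc.prems(3)[of k] k by (subst swap) auto
      finally have "w0[k := i] = map (\<lambda>l. w ! transpose t k l) [0..<n]" .
      moreover have "c0(k := a) = (\<lambda>l. c (transpose t k l))" "d0(k := b) = (\<lambda>l. d (transpose t k l))"
        unfolding c0_def a_def d0_def b_def
        by (intro swap; use Suc.prems(3)[of k] k in simp)+
      ultimately show ?thesis by simp
    qed
    also have "\<dots> = particles w c d"
      using t k by (intro particles_permute permutes_swap_id) auto
    finally show ?thesis .
  qed
  then have "(\<Sum>k=t..<n. if w0 ! k = 0 then S k else 0) = (\<Sum>k=t..<n. particles w c d)"
    using zero by (intro sum.cong refl) auto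
  then have "(\<Sum>k=t..<n. particles w c d) \<in> filt_V r \<xi> N ?D" using upper by (simp only:)
  then have "ext_scale (of_nat (n - t)) (particles w c d) \<in> filt_V r \<xi> N ?D"
    unfolding extv.sum_constant_scale card_atLeastLessThan .
  from extv.subspace_scale[OF filt_V_subspace this, of "1 / of_nat (n - t)"]
  have "ext_scale (1 / of_nat (n - t) * of_nat (n - t)) (particles w c d) \<in> filt_V r \<xi> N ?D"
    by (simp only: extv.scale_scale)
  moreover have "1 / of_nat (n - t) * of_nat (n - t) = (1 :: complex)"
    using t by (intro nonzero_eq_divide_eq[THEN iffD1]) auto
  ultimately show ?case by (simp only: extv.scale_one)
qed

theorem filt_V_eq_level: "filt_V r \<xi> N m = level (Suc m)" "filt_V_pred r \<xi> N m = level m"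
proof -
  show 1: "filt_V r \<xi> N m = level (Suc m)" for m
  proof
    show "level (Suc m) \<subseteq> filt_V r \<xi> N m"
      unfolding level_def
    proof (intro extv.span_minimal filt_V_subspace subsetI, clarify)
      fix w c d assume "valid_word w" and d: "(\<Sum>k<n. d k) < Suc m"
      then have "particles w c d \<in> filt_V r \<xi> N (\<Sum>k<n. d k)"
        by (intro particles_in_filt_V[of w n]) auto
      moreover have "filt_V r \<xi> N (\<Sum>k<n. d k) \<subseteq> filt_V r \<xi> N m"
        using d by (intro filt_V_mono) simp
      ultimately show "particles w c d \<in> filt_V r \<xi> N m" by blast
    qed
  qed (rule filt_V_subset_level)
  show "filt_V_pred r \<xi> N m = level m"
  proof (cases m)
    case 0
    have "level 0 = {0}" by (simp add: level_def)
    then show ?thesis by (simp add: filt_V_pred_def 0)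
  qed (simp add: filt_V_pred_def 1)
qed

end

end

section \<open>Separating the states of the wedge module\<close>

lemma lin_ext_swap:
  "lin_ext (\<lambda>a. lin_ext (\<lambda>b. \<phi> a b) q) p = lin_ext (\<lambda>b. lin_ext (\<lambda>a. \<phi> a b) p) q"
  unfolding lin_ext_def pm_scale_sum by (subst sum.swap) (simp add: mult.commute)

lemma lin_ext_cong: "(\<And>w. w \<in> keys p \<Longrightarrow> \<phi> w = \<psi> w) \<Longrightarrow> lin_ext \<phi> p = lin_ext \<psi> p"
  by (simp add: lin_ext_def)

text \<open>
  Linear maps on the degree \<open>M\<close> part of the exterior algebra come from antisymmetrised functions \<open>\<chi>\<close> of
  words.  They serve to prove that sums of wedge products are different from zero.
\<close>

definition antisymmetrize :: "nat \<Rightarrow> ('a list \<Rightarrow> ('t \<Rightarrow>\<^sub>0 complex)) \<Rightarrow> 'a list \<Rightarrow> ('t \<Rightarrow>\<^sub>0 complex)" where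
  "antisymmetrize M \<chi> u = (if length u = M then
     (\<Sum>\<pi> | \<pi> permutes {..<M}. pm_scale (of_int (sign \<pi>)) (\<chi> (map (\<lambda>k. u ! \<pi> k) [0..<M]))) else 0)"

lemma antisymmetrize_adjacent:
  "antisymmetrize M \<chi> (u @ a # b # v) = - antisymmetrize M \<chi> (u @ b # a # v)"
proof (cases "length (u @ a # b # v) = M")
  case True
  let ?l = "length u"
  let ?\<tau> = "transpose ?l (Suc ?l)"
  have \<tau>: "?\<tau> permutes {..<M}" using True by (intro permutes_swap_id) auto
  have nth: "(u @ a # b # v) ! ?\<tau> k = (u @ b # a # v) ! k" for k
    by (auto simp: transpose_def nth_append nth_Cons' )
  have "antisymmetrize M \<chi> (u @ b # a # v) =
      (\<Sum>\<pi> | \<pi> permutes {..<M}. pm_scale (of_int (sign \<pi>)) (\<chi> (map (\<lambda>k. (u @ a # b # v) ! (?\<tau> \<circ> \<pi>) k) [0..<M])))"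
    using True by (simp add: antisymmetrize_def nth)
  also have "\<dots> = (\<Sum>\<pi> | \<pi> permutes {..<M}. - pm_scale (of_int (sign (?\<tau> \<circ> \<pi>))) (\<chi> (map (\<lambda>k. (u @ a # b # v) ! (?\<tau> \<circ> \<pi>) k) [0..<M])))"
  proof (rule sum.cong[OF refl])
    fix \<pi> assume "\<pi> \<in> {\<pi>. \<pi> permutes {..<M}}"
    then have "sign (?\<tau> \<circ> \<pi>) = sign ?\<tau> * sign \<pi>"
      using \<tau> by (intro sign_compose permutes_imp_permutation[OF finite_lessThan]) auto
    then have s: "sign \<pi> = - sign (?\<tau> \<circ> \<pi>)" by (simp add: sign_swap_id)
    show "pm_scale (of_int (sign \<pi>)) (\<chi> (map (\<lambda>k. (u @ a # b # v) ! (?\<tau> \<circ> \<pi>) k) [0..<M])) =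
      - pm_scale (of_int (sign (?\<tau> \<circ> \<pi>))) (\<chi> (map (\<lambda>k. (u @ a # b # v) ! (?\<tau> \<circ> \<pi>) k) [0..<M]))"
      unfolding s by simp
  qed
  also have "\<dots> = - (\<Sum>\<pi> | \<pi> permutes {..<M}. pm_scale (of_int (sign \<pi>)) (\<chi> (map (\<lambda>k. (u @ a # b # v) ! \<pi> k) [0..<M])))"
    unfolding sum_negf by (subst setum_permutations_compose_left[OF \<tau>]) (rule refl)
  finally show ?thesis using True by (simp add: antisymmetrize_def)
qed (simp add: antisymmetrize_def)

text \<open>An antisymmetric bilinear map vanishes on the pair of \<open>v\<close> with itself.\<close>

lemma antisymmetrize_ideal:
  assumes "p \<in> two_sided_ideal ext_relations"
  shows "lin_ext (\<lambda>u. antisymmetrize M \<chi> (letters u)) p = 0"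
  using assms
proof induction
  case (step x s a b)
  let ?\<psi> = "\<lambda>u. antisymmetrize M \<chi> (letters u)"
  obtain v where s: "s = degree_one v * degree_one v" using step(2) by (auto simp: ext_relations_def)
  have "lin_ext ?\<psi> (a * s * b) = 0"
  proof (induction a rule: pm_induct)
    case (single u c)
    show ?case
    proof (induction b rule: pm_induct)
      case (single u' c')
      let ?B = "\<lambda>v v'. lin_ext (\<lambda>i. lin_ext (\<lambda>j. pm_scale (c * c') (antisymmetrize M \<chi> (letters u @ i # j # letters u'))) v') v"
      have B: "lin_ext ?\<psi> (single u c * (degree_one v * degree_one v') * single u' c') = ?B v v'" for v v'
      proof (induction v rule: pm_induct)
        case (single i d)
        show ?case
        proof (induction v' rule: pm_induct)
          case (single j e)
          show ?case
            by (simp add: degree_one_def letter_def mult_single mult_ac)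
        qed (simp_all add: degree_one_def lin_ext_add algebra_simps pm_scale_add_right)
      qed (simp_all add: degree_one_def lin_ext_add algebra_simps)
      have "?B v v = lin_ext (\<lambda>j. lin_ext (\<lambda>i. pm_scale (c * c') (antisymmetrize M \<chi> (letters u @ i # j # letters u'))) v) v"
        by (rule lin_ext_swap)
      also have "\<dots> = lin_ext (\<lambda>j. lin_ext (\<lambda>i. pm_scale (-1) (pm_scale (c * c') (antisymmetrize M \<chi> (letters u @ j # i # letters u')))) v) v"
        by (subst antisymmetrize_adjacent) simp
      also have "\<dots> = - ?B v v" by (simp only: lin_ext_fun_scale) simp
      finally have "?B v v = - ?B v v" .
      then have "?B v v = 0" by (simp add: poly_mapping_eq_iff fun_eq_iff eq_neg_iff_add_eq_0 lookup_uminus)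
      then show ?case by (simp only: s B)
    qed (simp_all add: lin_ext_add algebra_simps)
  qed (simp_all add: lin_ext_add algebra_simps)
  then show ?case using step by (simp add: lin_ext_add)
qed simp

lift_definition wedge_functional :: "nat \<Rightarrow> ('a list \<Rightarrow> ('t \<Rightarrow>\<^sub>0 complex)) \<Rightarrow> 'a ext_alg \<Rightarrow> ('t \<Rightarrow>\<^sub>0 complex)"
  is "\<lambda>M \<chi> p. lin_ext (\<lambda>u. antisymmetrize M \<chi> (letters u)) p"
proof -
  fix M :: nat and \<chi> :: "'a list \<Rightarrow> ('t \<Rightarrow>\<^sub>0 complex)" and p q :: "'a free_alg"
  assume "ideal_cong ext_relations p q"
  then have "lin_ext (\<lambda>u. antisymmetrize M \<chi> (letters u)) (p - q) = 0"
    unfolding ideal_cong_def by (rule antisymmetrize_ideal)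
  then show "lin_ext (\<lambda>u. antisymmetrize M \<chi> (letters u)) p = lin_ext (\<lambda>u. antisymmetrize M \<chi> (letters u)) q"
    by (simp add: lin_ext_diff)
qed

lemma wedge_functional_linear:
  "wedge_functional M \<chi> (x + y) = wedge_functional M \<chi> x + wedge_functional M \<chi> y"
  "wedge_functional M \<chi> (ext_scale c x) = pm_scale c (wedge_functional M \<chi> x)"
  "wedge_functional M \<chi> 0 = 0"
  by (transfer; simp add: lin_ext_add lin_ext_scale)+

lemma wedge_functional_sum: "wedge_functional M \<chi> (sum f A) = (\<Sum>i\<in>A. wedge_functional M \<chi> (f i))"
  by (induction A rule: infinite_finite_induct) (auto simp: wedge_functional_linear)

lemma wedge_functional_wedge_list: "wedge_functional M \<chi> (wedge_list u) = antisymmetrize M \<chi> u"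
proof -
  have "wedge_list u = abs_ext_alg (single (FMon u) 1)"
  proof (induction u)
    case Nil
    show ?case by (simp add: one_ext_alg_def zero_free_monoid_def[symmetric])
  next
    case (Cons a u)
    have "abs_ext_alg (single (FMon (a # u)) 1) = ext_gen a * abs_ext_alg (single (FMon u) 1)"
      by (simp add: ext_gen.abs_eq times_ext_alg.abs_eq letter_def mult_single plus_free_monoid_def)
    then show ?case by (simp add: Cons)
  qed
  then show ?thesis by (simp add: wedge_functional.abs_eq)
qed

context wedge_module
begin

text \<open>
  Reads off the positions of the particles from a wedge product of the form of \<open>state w q\<close>, if the colours
  are those of the given word.
\<close>

definition read_state :: "nat list \<Rightarrow> (nat \<times> int) list \<Rightarrow> (nat list \<Rightarrow>\<^sub>0 complex)" where
  "read_state w u = (if drop n u = layer r s N \<and> map fst (take n u) = w \<and>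
      (\<forall>k<n. base \<le> snd (u ! k) \<and> snd (u ! k) < base + int n)
    then single (map (\<lambda>k. nat (snd (u ! k) - base)) [0..<n]) 1 else 0)"

definition component :: "nat list \<Rightarrow> wedge \<Rightarrow> (nat list \<Rightarrow>\<^sub>0 complex)" where
  "component w = wedge_functional (n + length (layer r s N)) (read_state w)"

lemma component_linear:
  "component w (x + y) = component w x + component w y"
  "component w (ext_scale c x) = pm_scale c (component w x)"
  "component w 0 = 0"
  "component w (sum f A) = (\<Sum>i\<in>A. component w (f i))"
  by (simp_all add: component_def wedge_functional_linear wedge_functional_sum)

lemma distinct_layer: "distinct (layer r s N)"
proof -
  have "distinct (concat (map (\<lambda>j. map (Pair j) [N - int s..N - 1]) js))" if "distinct js" for js :: "nat list"
    using that by (induction js) (auto simp: distinct_map inj_on_def)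
  then show ?thesis by (simp add: layer_def)
qed

text \<open>
  The letters of the layer are distinct and differ from those of the particles, so only the permutations
  that fix the layer contribute.
\<close>

lemma component_state:
  assumes w: "length w = n" and w': "length w' = n" and q: "\<And>k. k < n \<Longrightarrow> q k < n"
  shows "component w (state w' (map q [0..<n])) = (\<Sum>\<pi> | \<pi> permutes {..<n}.
    pm_scale (of_int (sign \<pi>)) (if map (\<lambda>k. w' ! \<pi> k) [0..<n] = w
      then truncated_monom n (\<lambda>k. q (\<pi> k)) else 0))"
proof -
  let ?L = "layer r s N"
  let ?M = "n + length ?L"
  let ?G = "map (\<lambda>k. (w' ! k, base + int (q k))) [0..<n]"
  let ?u = "?G @ ?L"
  have G: "?u ! k = (w' ! k, base + int (q k))" if "k < n" for k using that by (simp add: nth_append)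
  have L: "?u ! k = ?L ! (k - n)" if "\<not> k < n" for k using that by (simp add: nth_append)
  have low: "snd (?u ! k) < base + int n" if "k < n" for k using q[OF that] by (simp add: G[OF that])
  have high: "base + int n \<le> snd (?u ! k)" if "\<not> k < n" "k < ?M" for k
  proof -
    have "?L ! (k - n) \<in> set ?L" using that by (intro nth_mem) auto
    then show ?thesis using L[OF that(1)] by (auto simp: set_layer base_def)
  qed
  have "component w (state w' (map q [0..<n])) = antisymmetrize ?M (read_state w) ?u"
  proof -
    have e: "map (\<lambda>k. (w' ! k, base + int (map q [0..<n] ! k))) [0..<n] = ?G" by simp
    show ?thesis unfolding component_def state_def e by (rule wedge_functional_wedge_list)
  qed
  also have "\<dots> = (\<Sum>\<pi> | \<pi> permutes {..<?M}. pm_scale (of_int (sign \<pi>)) (read_state w (map (\<lambda>k. ?u ! \<pi> k) [0..<?M])))"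
    by (simp add: antisymmetrize_def)
  also have "\<dots> = (\<Sum>\<pi> | \<pi> permutes {..<n}. pm_scale (of_int (sign \<pi>)) (read_state w (map (\<lambda>k. ?u ! \<pi> k) [0..<?M])))"
  proof (rule sum.mono_neutral_right)
    show "{\<pi>. \<pi> permutes {..<n}} \<subseteq> {\<pi>. \<pi> permutes {..<?M}}"
      by (auto intro: permutes_subset)
    show "\<forall>\<pi>\<in>{\<pi>. \<pi> permutes {..<?M}} - {\<pi>. \<pi> permutes {..<n}}.
        pm_scale (of_int (sign \<pi>)) (read_state w (map (\<lambda>k. ?u ! \<pi> k) [0..<?M])) = 0"
    proof
      fix \<pi> assume \<pi>: "\<pi> \<in> {\<pi>. \<pi> permutes {..<?M}} - {\<pi>. \<pi> permutes {..<n}}"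
      have "read_state w (map (\<lambda>k. ?u ! \<pi> k) [0..<?M]) = 0"
      proof (rule ccontr)
        assume "read_state w (map (\<lambda>k. ?u ! \<pi> k) [0..<?M]) \<noteq> 0"
        then have d: "drop n (map (\<lambda>k. ?u ! \<pi> k) [0..<?M]) = ?L" by (simp add: read_state_def split: if_splits)
        have fixed: "\<pi> k = k" if k: "\<not> k < n" "k < ?M" for k
        proof -
          have "?u ! \<pi> k = drop n (map (\<lambda>k. ?u ! \<pi> k) [0..<?M]) ! (k - n)" using k by simp
          then have e: "?u ! \<pi> k = ?u ! k" unfolding d using L[OF k(1)] by simp
          have p: "\<pi> k < ?M" using permutes_in_image[of \<pi> "{..<?M}" k] \<pi> k by simp
          have "\<not> \<pi> k < n" using low[of "\<pi> k"] high[OF k] e by auto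
          then have "?L ! (\<pi> k - n) = ?L ! (k - n)" "\<pi> k - n < length ?L" "k - n < length ?L"
            using e p k L by auto
          then have "\<pi> k - n = k - n" using distinct_layer nth_eq_iff_index_eq by blast
          then show ?thesis using k \<open>\<not> \<pi> k < n\<close> by simp
        qed
        have "\<pi> permutes {..<n}"
        proof (rule permutes_superset[of \<pi> "{..<?M}"])
          show "\<pi> permutes {..<?M}" using \<pi> by simp
          show "\<And>k. k \<in> {..<?M} - {..<n} \<Longrightarrow> \<pi> k = k" using fixed by simp
        qed
        then show False using \<pi> by simp
      qed
      then show "pm_scale (of_int (sign \<pi>)) (read_state w (map (\<lambda>k. ?u ! \<pi> k) [0..<?M])) = 0" by simp
    qed
  qed (simp add: finite_permutations)
  also have "\<dots> = (\<Sum>\<pi> | \<pi> permutes {..<n}.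
    pm_scale (of_int (sign \<pi>)) (if map (\<lambda>k. w' ! \<pi> k) [0..<n] = w
      then truncated_monom n (\<lambda>k. q (\<pi> k)) else 0))"
  proof (rule sum.cong[OF refl])
    fix \<pi> assume "\<pi> \<in> {\<pi>. \<pi> permutes {..<n}}"
    then have \<pi>: "\<pi> permutes {..<n}" by simp
    have in_n: "\<pi> k < n" if "k < n" for k using permutes_in_image[OF \<pi>, of k] that by simp
    have out: "\<pi> k = k" if "\<not> k < n" for k using \<pi> that by (auto simp: permutes_def)
    let ?m = "map (\<lambda>k. ?u ! \<pi> k) [0..<?M]"
    have 1: "drop n ?m = ?L"
      by (intro nth_equalityI) (auto simp: out L)
    have 2: "map fst (take n ?m) = map (\<lambda>k. w' ! \<pi> k) [0..<n]"
      by (intro nth_equalityI) (auto simp: G in_n)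
    have 3: "\<forall>k<n. base \<le> snd (?m ! k) \<and> snd (?m ! k) < base + int n"
      using G in_n q by simp
    have 4: "map (\<lambda>k. nat (snd (?m ! k) - base)) [0..<n] = map (\<lambda>k. q (\<pi> k)) [0..<n]"
      using G in_n by auto
    have "read_state w ?m = (if map (\<lambda>k. w' ! \<pi> k) [0..<n] = w
      then truncated_monom n (\<lambda>k. q (\<pi> k)) else 0)"
      unfolding read_state_def 1 2 4 truncated_monom_def using 3 in_n q by simp
    then show "pm_scale (of_int (sign \<pi>)) (read_state w ?m) =
       pm_scale (of_int (sign \<pi>)) (if map (\<lambda>k. w' ! \<pi> k) [0..<n] = w
      then truncated_monom n (\<lambda>k. q (\<pi> k)) else 0)" by (rule arg_cong)
  qed
  finally show ?thesis .
qed

lemma component_truncated_state: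
  assumes w: "length w = n" and w': "length w' = n"
  shows "component w (truncated_state w' q) = (\<Sum>\<pi> | \<pi> permutes {..<n}.
    pm_scale (of_int (sign \<pi>)) (if map (\<lambda>k. w' ! \<pi> k) [0..<n] = w
      then truncated_monom n (\<lambda>k. q (\<pi> k)) else 0))"
proof (cases "\<forall>k<n. q k < n")
  case True
  then show ?thesis unfolding truncated_state_def using component_state[OF w w', of q] by simp
next
  case False
  have "truncated_monom n (\<lambda>k. q (\<pi> k)) = 0" if \<pi>: "\<pi> permutes {..<n}" for \<pi>
  proof -
    obtain k where k: "k < n" "\<not> q k < n" using False by auto
    then obtain l where "l < n" "\<pi> l = k" using permutes_image[OF \<pi>] by (metis imageE lessThan_iff)
    then show ?thesis using k by (auto simp: truncated_monom_def)
  qed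
  then have "(\<Sum>\<pi> | \<pi> permutes {..<n}. pm_scale (of_int (sign \<pi>)) (if map (\<lambda>k. w' ! \<pi> k) [0..<n] = w
      then truncated_monom n (\<lambda>k. q (\<pi> k)) else 0)) = 0"
    by (intro sum.neutral) simp
  moreover have "truncated_state w' q = 0" using False by (simp only: truncated_state_def if_False)
  ultimately show ?thesis by (simp only: component_linear)
qed

theorem component_particles:
  assumes w: "length w = n" and w': "length w' = n"
  shows "component w (particles w' c d) = (\<Sum>\<pi> | \<pi> permutes {..<n}.
    (if map (\<lambda>k. w' ! \<pi> k) [0..<n] = w then vandermonde_orbit n z (\<lambda>k. c (\<pi> k)) (\<lambda>k. d (\<pi> k)) else 0))"
proof -
  let ?P = "{\<pi>. \<pi> permutes {..<n}}"
  let ?e = "\<lambda>\<pi>. map (\<lambda>k. w' ! \<pi> k) [0..<n] = w"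
  have "component w (particles w' c d) = (\<Sum>\<sigma>\<in>?P. \<Sum>\<pi>\<in>?P.
    pm_scale (of_int (sign \<sigma>) * euler_power n z d \<sigma> * of_int (sign \<pi>))
      (if ?e \<pi> then truncated_monom n (\<lambda>k. \<sigma> (\<pi> k) + c (\<pi> k)) else 0))"
    by (simp only: particles_alt component_linear component_truncated_state[OF w w'] pm_scale_sum pm_scale_simps(4))
  also have "\<dots> = (\<Sum>\<pi>\<in>?P. \<Sum>\<sigma>\<in>?P.
    pm_scale (of_int (sign \<sigma>) * euler_power n z d \<sigma> * of_int (sign \<pi>))
      (if ?e \<pi> then truncated_monom n (\<lambda>k. \<sigma> (\<pi> k) + c (\<pi> k)) else 0))"
    by (rule sum.swap)
  also have "\<dots> = (\<Sum>\<pi>\<in>?P. (if ?e \<pi> then vandermonde_orbit n z (\<lambda>k. c (\<pi> k)) (\<lambda>k. d (\<pi> k)) else 0))"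
  proof (rule sum.cong[OF refl])
    fix \<pi> assume "\<pi> \<in> ?P"
    then have \<pi>: "\<pi> permutes {..<n}" by simp
    have "(\<Sum>\<sigma>\<in>?P. pm_scale (of_int (sign \<sigma>) * euler_power n z d \<sigma> * of_int (sign \<pi>))
        (truncated_monom n (\<lambda>k. \<sigma> (\<pi> k) + c (\<pi> k)))) =
      (\<Sum>\<sigma>\<in>?P. pm_scale (of_int (sign (\<sigma> \<circ> \<pi>)) * euler_power n z (\<lambda>k. d (\<pi> k)) (\<sigma> \<circ> \<pi>))
        (truncated_monom n (\<lambda>k. (\<sigma> \<circ> \<pi>) k + c (\<pi> k))))"
    proof (rule sum.cong[OF refl])
      fix \<sigma> assume "\<sigma> \<in> ?P"
      then have \<sigma>: "\<sigma> permutes {..<n}" by simp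
      have "sign (\<sigma> \<circ> \<pi>) = sign \<sigma> * sign \<pi>"
        using \<sigma> \<pi> by (intro sign_compose permutes_imp_permutation[OF finite_lessThan])
      moreover have "euler_power n z (\<lambda>k. d (\<pi> k)) (\<sigma> \<circ> \<pi>) = euler_power n z d \<sigma>"
        unfolding euler_power_def comp_def
        using prod.permute[OF \<pi>, of "\<lambda>k. (z + of_nat (\<sigma> k)) ^ d k"] by (simp add: comp_def)
      ultimately show "pm_scale (of_int (sign \<sigma>) * euler_power n z d \<sigma> * of_int (sign \<pi>))
        (truncated_monom n (\<lambda>k. \<sigma> (\<pi> k) + c (\<pi> k))) =
        pm_scale (of_int (sign (\<sigma> \<circ> \<pi>)) * euler_power n z (\<lambda>k. d (\<pi> k)) (\<sigma> \<circ> \<pi>))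
        (truncated_monom n (\<lambda>k. (\<sigma> \<circ> \<pi>) k + c (\<pi> k)))"
        by (simp add: mult_ac)
    qed
    also have "\<dots> = vandermonde_orbit n z (\<lambda>k. c (\<pi> k)) (\<lambda>k. d (\<pi> k))"
      unfolding vandermonde_orbit_def alternating_def
      by (rule sum_permutations_compose_right[OF \<pi>, symmetric])
    finally show "(\<Sum>\<sigma>\<in>?P. pm_scale (of_int (sign \<sigma>) * euler_power n z d \<sigma> * of_int (sign \<pi>))
      (if ?e \<pi> then truncated_monom n (\<lambda>k. \<sigma> (\<pi> k) + c (\<pi> k)) else 0)) =
      (if ?e \<pi> then vandermonde_orbit n z (\<lambda>k. c (\<pi> k)) (\<lambda>k. d (\<pi> k)) else 0)"
      by simp
  qed
  finally show ?thesis .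
qed

lemma component_level:
  assumes "x \<in> level m" "length w = n"
  shows "component w x \<in> orbit_filtration n z m"
  using assms(1) unfolding level_def
proof (induction rule: extv.span_induct_alt)
  case base
  show ?case by (simp add: component_linear orbit_filtration_def pm.span_zero)
next
  case (step a x y)
  then obtain w' c d where w': "valid_word w'" and d: "(\<Sum>k<n. d k) < m" and x: "x = particles w' c d" by blast
  have "component w x \<in> orbit_filtration n z m"
    unfolding x component_particles[OF assms(2) w'[unfolded valid_word_def, THEN conjunct1]]
  proof (intro pm.subspace_sum orbit_filtration_subspace)
    fix \<pi> assume "\<pi> \<in> {\<pi>. \<pi> permutes {..<n}}"
    then have "(\<Sum>k<n. d (\<pi> k)) = (\<Sum>k<n. d k)" using sum.permute[of \<pi> "{..<n}" d] by (simp add: comp_def)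
    then have "vandermonde_orbit n z (\<lambda>k. c (\<pi> k)) (\<lambda>k. d (\<pi> k)) \<in> orbit_filtration n z m"
      unfolding orbit_filtration_def using d
      by (intro pm.span_base CollectI exI[of _ "\<lambda>k. c (\<pi> k)"] exI[of _ "\<lambda>k. d (\<pi> k)"]) simp
    then show "(if map (\<lambda>k. w' ! \<pi> k) [0..<n] = w then vandermonde_orbit n z (\<lambda>k. c (\<pi> k)) (\<lambda>k. d (\<pi> k)) else 0)
       \<in> orbit_filtration n z m" by (simp add: pm.subspace_0[OF orbit_filtration_subspace])
  qed
  then show ?case using step(2)
    by (simp add: component_linear pm.subspace_add[OF orbit_filtration_subspace]
        pm.subspace_scale[OF orbit_filtration_subspace])
qed

end

section \<open>Words of letters\<close>

type_synonym xy_letter = "nat \<times> nat \<times> nat"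

text \<open>The derivation of the tensor algebra that extends \<open>T\<close>, on a word.\<close>

definition leibniz :: "('a \<Rightarrow> ('a \<Rightarrow>\<^sub>0 complex)) \<Rightarrow> 'a list \<Rightarrow> ('a list \<Rightarrow>\<^sub>0 complex)" where
  "leibniz T u = (\<Sum>k<length u. lin_ext (\<lambda>c. single (u[k := c]) 1) (T (u ! k)))"

lemma lin_ext_leibniz:
  "lin_ext \<phi> (leibniz T u) = (\<Sum>k<length u. lin_ext (\<lambda>c. \<phi> (u[k := c])) (T (u ! k)))"
  by (simp add: leibniz_def lin_ext_sum lin_ext_lin_ext)

text \<open>
  When \<open>S\<close> and \<open>T\<close> act at different positions they commute, so only the terms with both at the
  same position survive in the commutator.
\<close>

lemma leibniz_bracket:
  assumes U: "\<And>a. a \<in> set u \<Longrightarrow> U a = lin_ext S (T a) - lin_ext T (S a)"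
  shows "leibniz U u = lin_ext (leibniz S) (leibniz T u) - lin_ext (leibniz T) (leibniz S u)"
proof -
  define D where "D S T k = lin_ext (\<lambda>e. single (u[k := e]) (1 :: complex)) (lin_ext S (T (u ! k)))"
    for S T :: "'a \<Rightarrow> ('a \<Rightarrow>\<^sub>0 complex)" and k
  define H where "H S T k l = lin_ext (\<lambda>c. lin_ext (\<lambda>e. single (u[k := c, l := e]) (1 :: complex)) (S (u ! l))) (T (u ! k))"
    for S T :: "'a \<Rightarrow> ('a \<Rightarrow>\<^sub>0 complex)" and k l
  have exp: "lin_ext (leibniz S) (leibniz T u) = (\<Sum>k<length u. \<Sum>l<length u. if l = k then D S T k else H S T k l)" for S T
  proof -
    have "lin_ext (\<lambda>c. leibniz S (u[k := c])) (T (u ! k)) =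
        (\<Sum>l<length u. if l = k then D S T k else H S T k l)" if k: "k < length u" for k
    proof -
      have "lin_ext (\<lambda>c. leibniz S (u[k := c])) (T (u ! k)) =
          (\<Sum>l<length u. lin_ext (\<lambda>c. lin_ext (\<lambda>e. single (u[k := c, l := e]) 1) (S (u[k := c] ! l))) (T (u ! k)))"
        unfolding leibniz_def length_list_update lin_ext_def pm_scale_sum by (rule sum.swap)
      also have "\<dots> = (\<Sum>l<length u. if l = k then D S T k else H S T k l)"
        using k by (intro sum.cong refl) (auto simp: D_def H_def lin_ext_lin_ext)
      finally show ?thesis .
    qed
    then show ?thesis unfolding lin_ext_leibniz by (intro sum.cong refl) auto
  qed
  have "H S T k l = H T S l k" if "k \<noteq> l" for k l
  proof -
    have "u[k := c, l := e] = u[l := e, k := c]" for c e using that by (rule list_update_swap)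
    then show ?thesis unfolding H_def by (subst lin_ext_swap) simp
  qed
  then have "(\<Sum>k<length u. \<Sum>l<length u. if l = k then D S T k else H S T k l) =
      (\<Sum>k<length u. \<Sum>l<length u. if l = k then D S T k else H T S l k)"
    by (intro sum.cong refl) auto
  also have "\<dots> = (\<Sum>k<length u. \<Sum>l<length u. if l = k then D S T k else H T S k l)"
    by (subst sum.swap) (intro sum.cong refl, auto)
  finally have "lin_ext (leibniz S) (leibniz T u) - lin_ext (leibniz T) (leibniz S u) =
      (\<Sum>k<length u. \<Sum>l<length u. (if l = k then D S T k else H T S k l) - (if l = k then D T S k else H T S k l))"
    unfolding exp by (simp only: sum_subtractf)
  also have "\<dots> = (\<Sum>k<length u. \<Sum>l<length u. if l = k then D S T k - D T S k else 0)"
    by (intro sum.cong refl) auto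
  also have "\<dots> = (\<Sum>k<length u. D S T k - D T S k)" by simp
  also have "\<dots> = leibniz U u"
    unfolding leibniz_def by (intro sum.cong refl) (simp add: U D_def lin_ext_diff)
  finally show ?thesis by simp
qed

lemma leibniz_linear:
  assumes "\<And>a. a \<in> set u \<Longrightarrow> U a = pm_scale c (S a) + pm_scale d (T a)"
  shows "leibniz U u = pm_scale c (leibniz S u) + pm_scale d (leibniz T u)"
  unfolding leibniz_def pm_scale_sum sum.distrib[symmetric]
  by (intro sum.cong refl) (simp add: assms lin_ext_add lin_ext_scale)

text \<open>The vector \<open>e\<^sub>i x\<^sup>\<alpha> y\<^sup>\<beta> P\<close> as a combination of letters.\<close>

definition letter_poly :: "nat \<Rightarrow> nat \<Rightarrow> nat \<Rightarrow> poly_xy \<Rightarrow> (xy_letter \<Rightarrow>\<^sub>0 complex)" where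
  "letter_poly i \<alpha> \<beta> P = (\<Sum>b\<le>degree P. \<Sum>a\<le>degree (coeff P b).
     single (i, \<alpha> + a, \<beta> + b) (coeff (coeff P b) a))"

lemma letter_action_poly: "letter_action r A (i, \<alpha>, \<beta>) = (\<Sum>i'<r. letter_poly i' \<alpha> \<beta> (A $$ (i', i)))"
  by (simp add: letter_action_def letter_poly_def)

lemma lookup_letter_poly:
  "lookup (letter_poly i \<alpha> \<beta> P) (i', a, b) =
    (if i' = i \<and> \<alpha> \<le> a \<and> \<beta> \<le> b then coeff (coeff P (b - \<beta>)) (a - \<alpha>) else 0)"
proof (cases "i' = i \<and> \<alpha> \<le> a \<and> \<beta> \<le> b")
  case True
  then have "lookup (letter_poly i \<alpha> \<beta> P) (i', a, b) =
     (\<Sum>b'\<le>degree P. \<Sum>a'\<le>degree (coeff P b'). if a' = a - \<alpha> then (if b' = b - \<beta> then coeff (coeff P b') (a - \<alpha>) else 0) else 0)"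
    unfolding letter_poly_def lookup_sum lookup_single when_def by (intro sum.cong refl) auto
  also have "\<dots> = (\<Sum>b'\<le>degree P. if b' = b - \<beta> then coeff (coeff P (b - \<beta>)) (a - \<alpha>) else 0)"
    by (intro sum.cong refl) (auto simp: coeff_eq_0)
  also have "\<dots> = coeff (coeff P (b - \<beta>)) (a - \<alpha>)" by (auto simp: coeff_eq_0)
  finally show ?thesis using True by simp
next
  case False
  then show ?thesis
    unfolding letter_poly_def lookup_sum lookup_single when_def by (auto intro!: sum.neutral)
qed

lemma letter_poly_linear:
  "letter_poly i \<alpha> \<beta> (P + Q) = letter_poly i \<alpha> \<beta> P + letter_poly i \<alpha> \<beta> Q"
  "letter_poly i \<alpha> \<beta> (P - Q) = letter_poly i \<alpha> \<beta> P - letter_poly i \<alpha> \<beta> Q"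
  "letter_poly i \<alpha> \<beta> ([:[:c:]:] * P) = pm_scale c (letter_poly i \<alpha> \<beta> P)"
  "letter_poly i \<alpha> \<beta> 0 = 0"
  by (rule poly_mapping_eqI; clarify; simp add: lookup_letter_poly lookup_add lookup_minus)+

lemma letter_poly_sum: "letter_poly i \<alpha> \<beta> (sum f A) = (\<Sum>x\<in>A. letter_poly i \<alpha> \<beta> (f x))"
  by (induction A rule: infinite_finite_induct) (auto simp: letter_poly_linear)

lemma letter_poly_xy_monom: "letter_poly i \<alpha> \<beta> (P * xy_monom a b) = letter_poly i (\<alpha> + a) (\<beta> + b) P"
proof -
  have "letter_poly i \<alpha> \<beta> (xy_monom a b * P) = letter_poly i (\<alpha> + a) (\<beta> + b) P"
    by (rule poly_mapping_eqI, clarify)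
       (auto simp: lookup_letter_poly xy_monom_def coeff_monom_mult)
  then show ?thesis by (simp add: mult.commute)
qed

lemma letter_action_letter_poly:
  "lin_ext (letter_action r A) (letter_poly k \<alpha> \<beta> P) = (\<Sum>i<r. letter_poly i \<alpha> \<beta> (A $$ (i, k) * P))"
proof -
  have 1: "letter_poly k \<alpha> \<beta> (xy_monom a b) = single (k, \<alpha> + a, \<beta> + b) 1" for a b
    using letter_poly_xy_monom[of k \<alpha> \<beta> 1 a b] by (simp add: letter_poly_def)
  have "lin_ext (letter_action r A) (letter_poly k \<alpha> \<beta> P) =
      (\<Sum>b\<le>degree P. \<Sum>a\<le>degree (coeff P b). pm_scale (coeff (coeff P b) a)
        (lin_ext (letter_action r A) (letter_poly k \<alpha> \<beta> (xy_monom a b))))"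
    by (rule poly_xy_linear_expand) (simp_all only: letter_poly_linear lin_ext_add lin_ext_scale)
  moreover have "(\<Sum>i<r. letter_poly i \<alpha> \<beta> (A $$ (i, k) * P)) =
      (\<Sum>b\<le>degree P. \<Sum>a\<le>degree (coeff P b). pm_scale (coeff (coeff P b) a)
        (\<Sum>i<r. letter_poly i \<alpha> \<beta> (A $$ (i, k) * xy_monom a b)))"
    by (rule poly_xy_linear_expand)
       (simp_all only: distrib_left letter_poly_linear sum.distrib mult.left_commute[of _ "[:[:_:]:]"] pm_scale_sum)
  ultimately show ?thesis
    by (simp add: 1 letter_action_poly letter_poly_xy_monom)
qed

lemma letter_action_mult:
  assumes "A \<in> carrier_mat r r" "B \<in> carrier_mat r r" "fst l < r"
  shows "lin_ext (letter_action r A) (letter_action r B l) = letter_action r (A * B) l"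
proof -
  obtain j \<alpha> \<beta> where l: "l = (j, \<alpha>, \<beta>)" by (cases l) auto
  have "lin_ext (letter_action r A) (letter_action r B l) =
      (\<Sum>k<r. \<Sum>i<r. letter_poly i \<alpha> \<beta> (A $$ (i, k) * B $$ (k, j)))"
    by (simp add: l letter_action_poly lin_ext_sum letter_action_letter_poly)
  also have "\<dots> = (\<Sum>i<r. letter_poly i \<alpha> \<beta> ((A * B) $$ (i, j)))"
    using assms by (subst sum.swap)
      (simp add: l letter_poly_sum[symmetric] scalar_prod_def atLeast0LessThan)
  finally show ?thesis by (simp add: l letter_action_poly)
qed

lemma letter_action_linear:
  assumes "A \<in> carrier_mat r r" "B \<in> carrier_mat r r" "fst l < r"
  shows "letter_action r (A + B) l = letter_action r A l + letter_action r B l"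
    "letter_action r (A - B) l = letter_action r A l - letter_action r B l"
    "letter_action r ([:[:c:]:] \<cdot>\<^sub>m A) l = pm_scale c (letter_action r A l)"
proof -
  obtain j \<alpha> \<beta> where l: "l = (j, \<alpha>, \<beta>)" by (cases l) auto
  have j: "j < r" using assms(3) l by simp
  have "letter_poly i \<alpha> \<beta> ((A + B) $$ (i, j)) = letter_poly i \<alpha> \<beta> (A $$ (i, j)) + letter_poly i \<alpha> \<beta> (B $$ (i, j))"
    "letter_poly i \<alpha> \<beta> ((A - B) $$ (i, j)) = letter_poly i \<alpha> \<beta> (A $$ (i, j)) - letter_poly i \<alpha> \<beta> (B $$ (i, j))"
    "letter_poly i \<alpha> \<beta> (([:[:c:]:] \<cdot>\<^sub>m A) $$ (i, j)) = pm_scale c (letter_poly i \<alpha> \<beta> (A $$ (i, j)))"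
    if "i < r" for i
    using assms that j by (simp_all add: letter_poly_linear(1,2) letter_poly_linear(3)[symmetric])
  then show "letter_action r (A + B) l = letter_action r A l + letter_action r B l"
    "letter_action r (A - B) l = letter_action r A l - letter_action r B l"
    "letter_action r ([:[:c:]:] \<cdot>\<^sub>m A) l = pm_scale c (letter_action r A l)"
    unfolding l letter_action_poly sum.distrib[symmetric] sum_subtractf[symmetric] pm_scale_sum
    by (auto intro!: sum.cong)
qed

lemma letter_action_keys:
  "l' \<in> keys (letter_action r A l) \<Longrightarrow> fst l' < r"
proof -
  assume l': "l' \<in> keys (letter_action r A l)"
  obtain i \<alpha> \<beta> where l: "l = (i, \<alpha>, \<beta>)" by (cases l) auto
  have "keys (letter_action r A l) \<subseteq> {l'. fst l' < r}"
    unfolding l letter_action_def prod.case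
    by (intro keys_sum_subset) (auto split: if_splits)
  then show ?thesis using l' by auto
qed

definition letter_words :: "nat \<Rightarrow> nat \<Rightarrow> xy_letter list set" where
  "letter_words r n = {u. length u = n \<and> (\<forall>l\<in>set u. fst l < r)}"

definition word_space :: "nat \<Rightarrow> nat \<Rightarrow> (xy_letter list \<Rightarrow>\<^sub>0 complex) set" where
  "word_space r n = {z. keys z \<subseteq> letter_words r n}"

definition constant_trace :: "nat \<Rightarrow> poly_xy mat \<Rightarrow> complex" where
  "constant_trace r A = (\<Sum>j<r. coeff (coeff (A $$ (j, j)) 0) 0)"

text \<open>The action on the tensor power, twisted by the character \<open>s tr A(0, 0)\<close>.\<close>

definition word_action :: "nat \<Rightarrow> nat \<Rightarrow> poly_xy mat \<Rightarrow> (xy_letter list \<Rightarrow>\<^sub>0 complex) \<Rightarrow> (xy_letter list \<Rightarrow>\<^sub>0 complex)" where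
  "word_action r s A z = lin_ext (leibniz (letter_action r A)) z + pm_scale (of_nat s * constant_trace r A) z"

lemma word_space_subspace: "pm.subspace (word_space r n)"
proof (rule pm.subspaceI)
  fix x y :: "xy_letter list \<Rightarrow>\<^sub>0 complex" assume "x \<in> word_space r n" "y \<in> word_space r n"
  then show "x + y \<in> word_space r n" using keys_add[of x y] by (auto simp: word_space_def)
next
  fix c and x :: "xy_letter list \<Rightarrow>\<^sub>0 complex" assume "x \<in> word_space r n"
  then show "pm_scale c x \<in> word_space r n" by (auto simp: word_space_def in_keys_iff)
qed (simp add: word_space_def)

lemma single_in_word_space: "u \<in> letter_words r n \<Longrightarrow> single u c \<in> word_space r n"
  by (simp add: word_space_def)

lemma word_space_induct [consumes 1, case_names zero single add]:
  assumes "z \<in> word_space r n" "P 0" "\<And>u c. u \<in> letter_words r n \<Longrightarrow> P (single u c)"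
    "\<And>x y. x \<in> word_space r n \<Longrightarrow> y \<in> word_space r n \<Longrightarrow> P x \<Longrightarrow> P y \<Longrightarrow> P (x + y)"
  shows "P z"
proof -
  have *: "z = (\<Sum>k\<in>keys z. single k (lookup z k))"
    by (rule poly_mapping_eqI)
       (auto simp: lookup_sum lookup_single when_def in_keys_iff sum.delta)
  let ?g = "\<lambda>S. \<Sum>k\<in>S. single k (lookup z k)"
  have "?g S \<in> word_space r n \<and> P (?g S)" if "finite S" "S \<subseteq> letter_words r n" for S
    using that
  proof induction
    case empty
    show ?case using assms(2) by (simp add: pm.subspace_0[OF word_space_subspace])
  next
    case (insert x F)
    then show ?case
      by (simp add: assms(3,4) single_in_word_space pm.subspace_add[OF word_space_subspace])
  qed
  from this[of "keys z"] show ?thesis using assms(1) * by (simp add: word_space_def)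
qed

lemma letter_words_update:
  "u \<in> letter_words r n \<Longrightarrow> fst l < r \<Longrightarrow> u[k := l] \<in> letter_words r n"
  using set_update_subset_insert[of u k l] by (auto simp: letter_words_def)

lemma leibniz_in_word_space:
  assumes u: "u \<in> letter_words r n"
  shows "leibniz (letter_action r A) u \<in> word_space r n"
  unfolding leibniz_def
proof (intro pm.subspace_sum word_space_subspace)
  fix k
  show "lin_ext (\<lambda>c. single (u[k := c]) 1) (letter_action r A (u ! k)) \<in> word_space r n"
    unfolding lin_ext_def
    by (intro pm.subspace_sum pm.subspace_scale word_space_subspace single_in_word_space
        letter_words_update[OF u] letter_action_keys)
qed

lemma word_action_in_word_space:
  assumes "z \<in> word_space r n"
  shows "word_action r s A z \<in> word_space r n"
proof -
  have "lin_ext (leibniz (letter_action r A)) z \<in> word_space r n"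
    unfolding lin_ext_def using assms
    by (intro pm.subspace_sum pm.subspace_scale word_space_subspace leibniz_in_word_space)
       (auto simp: word_space_def)
  then show ?thesis
    unfolding word_action_def using assms
    by (intro pm.subspace_add pm.subspace_scale word_space_subspace)
qed

lemma word_action_linear:
  "word_action r s A (x + y) = word_action r s A x + word_action r s A y"
  "word_action r s A (pm_scale c x) = pm_scale c (word_action r s A x)"
  "word_action r s A 0 = 0"
  by (simp_all add: word_action_def lin_ext_add lin_ext_scale pm_scale_add_right mult.commute)

lemma lin_ext_cong_space:
  assumes "z \<in> word_space r n" "\<And>u. u \<in> letter_words r n \<Longrightarrow> \<phi> u = \<psi> u"
  shows "lin_ext \<phi> z = lin_ext \<psi> z"
  using assms by (intro lin_ext_cong) (auto simp: word_space_def)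

lemma lin_ext_fun_diff: "lin_ext (\<lambda>w. \<phi> w - \<psi> w) p = lin_ext \<phi> p - lin_ext \<psi> p"
  by (simp add: lin_ext_def pm_scale_diff_right sum_subtractf)

lemma constant_trace_linear:
  assumes "A \<in> carrier_mat r r" "B \<in> carrier_mat r r"
  shows "constant_trace r (A + B) = constant_trace r A + constant_trace r B"
    "constant_trace r ([:[:c:]:] \<cdot>\<^sub>m A) = c * constant_trace r A"
    "constant_trace r (A * B - B * A) = 0"
proof -
  show "constant_trace r (A + B) = constant_trace r A + constant_trace r B"
    using assms by (simp add: constant_trace_def sum.distrib)
  show "constant_trace r ([:[:c:]:] \<cdot>\<^sub>m A) = c * constant_trace r A"
    using assms by (simp add: constant_trace_def sum_distrib_left)
  have tr: "constant_trace r (A * B) = (\<Sum>j<r. \<Sum>k<r. coeff (coeff (A $$ (j, k)) 0) 0 * coeff (coeff (B $$ (k, j)) 0) 0)"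
    if "A \<in> carrier_mat r r" "B \<in> carrier_mat r r" for A B
    using that by (simp add: constant_trace_def scalar_prod_def atLeast0LessThan coeff_sum coeff_mult)
  have "constant_trace r (A * B) = constant_trace r (B * A)"
    unfolding tr[OF assms] tr[OF assms(2,1)] by (subst sum.swap) (simp add: mult.commute)
  moreover have "constant_trace r (A * B - B * A) = constant_trace r (A * B) - constant_trace r (B * A)"
    using assms by (simp add: constant_trace_def sum_subtractf)
  ultimately show "constant_trace r (A * B - B * A) = 0" by simp
qed

lemma word_action_add:
  assumes A: "A \<in> carrier_mat r r" "B \<in> carrier_mat r r" and z: "z \<in> word_space r n"
  shows "word_action r s (A + B) z = word_action r s A z + word_action r s B z"
proof -
  have "leibniz (letter_action r (A + B)) u = pm_scale 1 (leibniz (letter_action r A) u) + pm_scale 1 (leibniz (letter_action r B) u)"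
    if "u \<in> letter_words r n" for u
    using that A by (intro leibniz_linear) (auto simp: letter_action_linear letter_words_def)
  then have "lin_ext (leibniz (letter_action r (A + B))) z =
      lin_ext (\<lambda>u. leibniz (letter_action r A) u + leibniz (letter_action r B) u) z"
    by (intro lin_ext_cong_space[OF z]) simp
  then show ?thesis
    by (simp add: word_action_def lin_ext_fun_add constant_trace_linear[OF A] pm_scale_add_left distrib_left)
qed

lemma word_action_scale:
  assumes A: "A \<in> carrier_mat r r" and z: "z \<in> word_space r n"
  shows "word_action r s ([:[:c:]:] \<cdot>\<^sub>m A) z = pm_scale c (word_action r s A z)"
proof -
  have "letter_action r ([:[:c:]:] \<cdot>\<^sub>m A) l = pm_scale c (letter_action r A l)" if "fst l < r" for l
    using letter_action_linear(3)[OF A A that] .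
  then have "leibniz (letter_action r ([:[:c:]:] \<cdot>\<^sub>m A)) u = pm_scale c (leibniz (letter_action r A) u) + pm_scale 0 (leibniz (letter_action r A) u)"
    if "u \<in> letter_words r n" for u
    using that by (intro leibniz_linear) (auto simp: letter_words_def)
  then have "lin_ext (leibniz (letter_action r ([:[:c:]:] \<cdot>\<^sub>m A))) z =
      lin_ext (\<lambda>u. pm_scale c (leibniz (letter_action r A) u)) z"
    by (intro lin_ext_cong_space[OF z]) simp
  then show ?thesis
    by (simp only: word_action_def lin_ext_fun_scale constant_trace_linear(2)[OF A A] pm_scale_add_right pm_scale_simps(4) mult.left_commute)
qed

lemma word_action_bracket:
  assumes A: "A \<in> carrier_mat r r" "B \<in> carrier_mat r r" and z: "z \<in> word_space r n"
  shows "word_action r s (A * B - B * A) z = word_action r s A (word_action r s B z) - word_action r s B (word_action r s A z)"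
proof -
  let ?a = "letter_action r A" and ?b = "letter_action r B"
  have carrier: "A * B \<in> carrier_mat r r" "B * A \<in> carrier_mat r r" using A by auto
  have "leibniz (letter_action r (A * B - B * A)) u = lin_ext (leibniz ?a) (leibniz ?b u) - lin_ext (leibniz ?b) (leibniz ?a u)"
    if "u \<in> letter_words r n" for u
  proof (rule leibniz_bracket)
    fix l assume "l \<in> set u"
    then have l: "fst l < r" using that by (auto simp: letter_words_def)
    show "letter_action r (A * B - B * A) l = lin_ext ?a (?b l) - lin_ext ?b (?a l)"
      unfolding letter_action_mult[OF A l] letter_action_mult[OF A(2,1) l]
      by (rule letter_action_linear(2)[OF carrier l])
  qed
  then have "lin_ext (leibniz (letter_action r (A * B - B * A))) z =
      lin_ext (\<lambda>u. lin_ext (leibniz ?a) (leibniz ?b u) - lin_ext (leibniz ?b) (leibniz ?a u)) z"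
    by (intro lin_ext_cong_space[OF z]) simp
  also have "\<dots> = lin_ext (leibniz ?a) (lin_ext (leibniz ?b) z) - lin_ext (leibniz ?b) (lin_ext (leibniz ?a) z)"
    by (simp only: lin_ext_fun_diff lin_ext_lin_ext)
  finally show ?thesis
    by (simp only: word_action_def lin_ext_add lin_ext_scale constant_trace_linear(3)[OF A])
       (simp add: pm_scale_add_right mult.commute algebra_simps)
qed

section \<open>Relations between words\<close>

lemma finite_words: "finite {w :: nat list. length w = n \<and> set w \<subseteq> {..<r}}"
  using finite_lists_length_eq[of "{..<r}" n] by (simp add: conj_commute)

definition word_degree :: "xy_letter list \<Rightarrow> nat" where
  "word_degree u = (\<Sum>k<length u. snd (snd (u ! k)))"

definition permuted :: "(nat \<Rightarrow> nat) \<Rightarrow> 'a list \<Rightarrow> 'a list" where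
  "permuted \<pi> u = map (\<lambda>k. u ! \<pi> k) [0..<length u]"

lemma mset_permuted:
  assumes "\<pi> permutes {..<length u}" shows "mset (permuted \<pi> u) = mset u"
proof -
  have "image_mset ((!) u) (image_mset \<pi> (mset_set {..<length u})) = image_mset ((!) u) (mset_set {..<length u})"
    using assms by (simp add: image_mset_mset_set permutes_inj_on permutes_image)
  then have "mset (permuted \<pi> u) = image_mset ((!) u) (mset_set {..<length u})"
    by (simp add: permuted_def image_mset.compositionality comp_def atLeast0LessThan)
  also have "\<dots> = mset (map ((!) u) [0..<length u])" by (simp add: atLeast0LessThan)
  finally show ?thesis by (simp add: map_nth)
qed

context wedge_module
begin

definition word_particles :: "xy_letter list \<Rightarrow> wedge" where
  "word_particles u = particles (map fst u) (\<lambda>k. fst (snd (u ! k))) (\<lambda>k. snd (snd (u ! k)))"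

definition graded_part :: "nat \<Rightarrow> (xy_letter list \<Rightarrow>\<^sub>0 complex) \<Rightarrow> wedge" where
  "graded_part m = ext_extend (\<lambda>u. if word_degree u = m then word_particles u else 0)"

lemma component_extend: "component w (ext_extend \<phi> p) = lin_ext (\<lambda>u. component w (\<phi> u)) p"
  by (simp add: ext_extend_def lin_ext_def component_linear)

text \<open>
  For every word \<open>w\<close> of colours, collect the exponents of those permuted words of \<open>x\<close> that have the colours
  \<open>w\<close> into a polynomial \<open>f w\<close>.  Its value on the Vandermonde vector is the component of the graded part
  of \<open>x\<close> at \<open>w\<close>, which lies in lower degree.  So \<open>orbit_kernel_vanishing\<close> applies to the restriction of
  \<open>\<Theta>\<close> to the colours \<open>w\<close>.  As \<open>\<Theta>\<close> is symmetric, summing over \<open>w\<close> gives \<open>n!\<close> times the value of \<open>\<Theta>\<close>.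
\<close>

lemma word_relation_in_degree:
  fixes \<Theta> :: "xy_letter list \<Rightarrow> ('t \<Rightarrow>\<^sub>0 complex)"
  assumes perm: "\<And>u u'. mset u = mset u' \<Longrightarrow> \<Theta> u = \<Theta> u'"
    and sums: "\<And>u \<alpha> \<beta>. u \<in> letter_words r n \<Longrightarrow> \<alpha> + \<beta> > 0 \<Longrightarrow>
      (\<Sum>k<n. \<Theta> (u[k := (case u ! k of (i, a, b) \<Rightarrow> (i, a + \<alpha>, b + \<beta>))])) = 0"
    and x: "x \<in> word_space r n" and low: "graded_part m x \<in> level m"
  shows "lin_ext (\<lambda>u. if word_degree u = m then \<Theta> u else 0) x = 0"
proof -
  let ?P = "{\<pi>. \<pi> permutes {..<n}}"
  define f where "f w = lin_ext (\<lambda>u. if word_degree u = m then (\<Sum>\<pi>\<in>?P.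
      if permuted \<pi> (map fst u) = w then monomial n (\<lambda>k. fst (snd (u ! \<pi> k))) (\<lambda>k. snd (snd (u ! \<pi> k))) else 0) else 0) x" for w
  define \<theta> where "\<theta> w c d = \<Theta> (map (\<lambda>k. (w ! k, c k, d k)) [0..<n])" for w and c d :: "nat \<Rightarrow> nat"
  have len: "length u = n" if "u \<in> letter_words r n" for u using that by (simp add: letter_words_def)
  have eval: "evaluate \<phi> (f w) = lin_ext (\<lambda>u. if word_degree u = m then (\<Sum>\<pi>\<in>?P.
      if permuted \<pi> (map fst u) = w then \<phi> (\<lambda>k. fst (snd (u ! \<pi> k))) (\<lambda>k. snd (snd (u ! \<pi> k))) else 0) else 0) x"
    if "local_to n \<phi>" for \<phi> :: "(nat \<Rightarrow> nat) \<Rightarrow> (nat \<Rightarrow> nat) \<Rightarrow> ('s \<Rightarrow>\<^sub>0 complex)" and w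
  proof -
    have "evaluate \<phi> (f w) = lin_ext (\<lambda>u. evaluate \<phi> (if word_degree u = m then (\<Sum>\<pi>\<in>?P.
      if permuted \<pi> (map fst u) = w then monomial n (\<lambda>k. fst (snd (u ! \<pi> k))) (\<lambda>k. snd (snd (u ! \<pi> k))) else 0) else 0)) x"
      unfolding f_def evaluate_def lin_ext_lin_ext ..
    then show ?thesis
      by (simp only: if_distrib[of "evaluate \<phi>"] evaluate_linear evaluate_monomial[OF that])
  qed
  have vanish: "lin_ext (\<lambda>u. if word_degree u = m then (\<Sum>\<pi>\<in>?P.
      if permuted \<pi> (map fst u) = w then \<Theta> u else 0) else 0) x = 0" if w: "valid_word w" for w
  proof -
    have lw: "length w = n" using w by (simp add: valid_word_def)
    have loc: "local_to n (\<theta> w)"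
    proof -
      have "map (\<lambda>k. (w ! k, c k, d k)) [0..<n] = map (\<lambda>k. (w ! k, c' k, d' k)) [0..<n]"
        if "\<forall>k<n. c k = c' k \<and> d k = d' k" for c d c' d' :: "nat \<Rightarrow> nat" using that by simp
      then show ?thesis unfolding local_to_def \<theta>_def by (intro allI impI arg_cong[where f = \<Theta>])
    qed
    have "evaluate (\<theta> w) (f w) = 0"
    proof (rule orbit_kernel_vanishing[OF loc, where m = m and z = z])
      fix c d :: "nat \<Rightarrow> nat" and \<alpha> \<beta> :: nat assume ab: "\<alpha> + \<beta> > 0"
      let ?u = "map (\<lambda>k. (w ! k, c k, d k)) [0..<n]"
      have "?u \<in> letter_words r n" using w valid_word_nth by (auto simp: letter_words_def)
      from sums[OF this ab]
      have "(\<Sum>k<n. \<Theta> (?u[k := (case ?u ! k of (i, a, b) \<Rightarrow> (i, a + \<alpha>, b + \<beta>))])) = 0" .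
      moreover have "?u[k := (case ?u ! k of (i, a, b) \<Rightarrow> (i, a + \<alpha>, b + \<beta>))] =
          map (\<lambda>l. (w ! l, (c(k := c k + \<alpha>)) l, (d(k := d k + \<beta>)) l)) [0..<n]" if "k < n" for k
        using that by (intro nth_equalityI) (auto simp: nth_list_update)
      ultimately show "(\<Sum>k<n. \<theta> w (c(k := c k + \<alpha>)) (d(k := d k + \<beta>))) = 0"
        unfolding \<theta>_def by simp
    next
      show "f w \<in> pm.span {monomial n c d | c d. (\<Sum>k<n. d k) = m}"
        unfolding f_def lin_ext_def
      proof (intro pm.span_sum pm.span_scale)
        fix u assume "u \<in> keys x"
        then have u: "length u = n" using x by (auto simp: word_space_def letter_words_def)
        have "monomial n (\<lambda>k. fst (snd (u ! \<pi> k))) (\<lambda>k. snd (snd (u ! \<pi> k))) \<in>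
            pm.span {monomial n c d | c d. (\<Sum>k<n. d k) = m}"
          if "word_degree u = m" "\<pi> permutes {..<n}" for \<pi>
        proof -
          have "(\<Sum>k<n. snd (snd (u ! \<pi> k))) = m"
            using that u sum.permute[OF that(2), of "\<lambda>k. snd (snd (u ! k))"] by (simp add: word_degree_def comp_def)
          then show ?thesis
            by (intro pm.span_base CollectI exI[of _ "\<lambda>k. fst (snd (u ! \<pi> k))"] exI[of _ "\<lambda>k. snd (snd (u ! \<pi> k))"]) simp
        qed
        then show "(if word_degree u = m then (\<Sum>\<pi>\<in>?P.
      if permuted \<pi> (map fst u) = w then monomial n (\<lambda>k. fst (snd (u ! \<pi> k))) (\<lambda>k. snd (snd (u ! \<pi> k))) else 0) else 0)
          \<in> pm.span {monomial n c d | c d. (\<Sum>k<n. d k) = m}"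
          by (auto intro!: pm.span_sum pm.span_zero)
      qed
    next
      have "evaluate (vandermonde_orbit n z) (f w) = component w (graded_part m x)"
        unfolding eval[OF local_to_vandermonde_orbit] graded_part_def component_extend
      proof (rule lin_ext_cong_space[OF \<open>x \<in> word_space r n\<close>])
        fix u assume "u \<in> letter_words r n"
        then have u: "length u = n" by (rule len)
        have "permuted \<pi> (map fst u) = map (\<lambda>k. map fst u ! \<pi> k) [0..<n]" for \<pi> by (simp add: permuted_def u)
        then show "(if word_degree u = m then (\<Sum>\<pi>\<in>?P. if permuted \<pi> (map fst u) = w
            then vandermonde_orbit n z (\<lambda>k. fst (snd (u ! \<pi> k))) (\<lambda>k. snd (snd (u ! \<pi> k))) else 0) else 0) =
          component w (if word_degree u = m then word_particles u else 0)"
          by (simp add: component_linear word_particles_def component_particles[OF lw] u)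
      qed
      then show "evaluate (vandermonde_orbit n z) (f w) \<in> orbit_filtration n z m"
        using component_level[OF low lw] by simp
    qed
    moreover have "evaluate (\<theta> w) (f w) = lin_ext (\<lambda>u. if word_degree u = m then (\<Sum>\<pi>\<in>?P.
      if permuted \<pi> (map fst u) = w then \<Theta> u else 0) else 0) x"
      unfolding eval[OF loc]
    proof (rule lin_ext_cong_space[OF x], rule if_cong[OF refl _ refl], rule sum.cong[OF refl], rule if_cong[OF refl _ refl])
      fix u \<pi> assume "u \<in> letter_words r n" and \<pi>: "\<pi> \<in> ?P" and w: "permuted \<pi> (map fst u) = w"
      then have u: "length u = n" by (simp add: len)
      have "map (\<lambda>k. (w ! k, fst (snd (u ! \<pi> k)), snd (snd (u ! \<pi> k)))) [0..<n] = permuted \<pi> u"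
        using w[symmetric] u permutes_in_image[of \<pi> "{..<n}"] \<pi> by (intro nth_equalityI) (auto simp: permuted_def)
      then show "\<theta> w (\<lambda>k. fst (snd (u ! \<pi> k))) (\<lambda>k. snd (snd (u ! \<pi> k))) = \<Theta> u"
        unfolding \<theta>_def using \<pi> u by (simp add: perm[OF mset_permuted])
    qed
    ultimately show ?thesis by simp
  qed
  let ?V = "{w :: nat list. length w = n \<and> set w \<subseteq> {..<r}}"
  have "0 = (\<Sum>w\<in>?V. lin_ext (\<lambda>u. if word_degree u = m then (\<Sum>\<pi>\<in>?P.
      if permuted \<pi> (map fst u) = w then \<Theta> u else 0) else 0) x)"
    using vanish by (intro sum.neutral[symmetric]) (auto simp: valid_word_def)
  also have "\<dots> = lin_ext (\<lambda>u. \<Sum>w\<in>?V. if word_degree u = m then (\<Sum>\<pi>\<in>?P.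
      if permuted \<pi> (map fst u) = w then \<Theta> u else 0) else 0) x"
    unfolding lin_ext_def pm_scale_sum by (rule sum.swap)
  also have "\<dots> = lin_ext (\<lambda>u. pm_scale (fact n) (if word_degree u = m then \<Theta> u else 0)) x"
  proof (rule lin_ext_cong_space[OF x])
    fix u assume u: "u \<in> letter_words r n"
    have "(\<Sum>w\<in>?V. \<Sum>\<pi>\<in>?P. if permuted \<pi> (map fst u) = w then \<Theta> u else 0) =
        (\<Sum>\<pi>\<in>?P. \<Sum>w\<in>?V. if permuted \<pi> (map fst u) = w then \<Theta> u else 0)" by (rule sum.swap)
    also have "\<dots> = (\<Sum>\<pi>\<in>?P. \<Theta> u)"
    proof (rule sum.cong[OF refl])
      fix \<pi> assume \<pi>: "\<pi> \<in> ?P"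
      have "permuted \<pi> (map fst u) \<in> ?V"
      proof -
        have "set (permuted \<pi> (map fst u)) = set (map fst u)"
          using mset_permuted[of \<pi> "map fst u"] \<pi> len[OF u] by (metis length_map mem_Collect_eq set_mset_mset)
        then show ?thesis using u by (auto simp: permuted_def letter_words_def)
      qed
      then show "(\<Sum>w\<in>?V. if permuted \<pi> (map fst u) = w then \<Theta> u else 0) = \<Theta> u"
        using finite_words by (simp add: sum.delta)
    qed
    also have "\<dots> = pm_scale (fact n) (\<Theta> u)"
      by (simp only: pm.sum_constant_scale card_permutations[OF refl finite_lessThan] card_lessThan of_nat_fact)
    finally show "(\<Sum>w\<in>?V. if word_degree u = m then (\<Sum>\<pi>\<in>?P.
      if permuted \<pi> (map fst u) = w then \<Theta> u else 0) else 0) =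
      pm_scale (fact n) (if word_degree u = m then \<Theta> u else 0)" by simp
  qed
  finally show ?thesis by (simp add: lin_ext_fun_scale)
qed

text \<open>
  A relation between words that holds in \<open>V(\<xi>)\<close> holds for every symmetric function of words that kills the
  power sums.
\<close>

theorem word_relation:
  fixes \<Theta> :: "xy_letter list \<Rightarrow> ('t \<Rightarrow>\<^sub>0 complex)"
  assumes perm: "\<And>u u'. mset u = mset u' \<Longrightarrow> \<Theta> u = \<Theta> u'"
    and sums: "\<And>u \<alpha> \<beta>. u \<in> letter_words r n \<Longrightarrow> \<alpha> + \<beta> > 0 \<Longrightarrow>
      (\<Sum>k<n. \<Theta> (u[k := (case u ! k of (i, a, b) \<Rightarrow> (i, a + \<alpha>, b + \<beta>))])) = 0"
    and x: "x \<in> word_space r n" and low: "\<And>m. graded_part m x \<in> level m"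
  shows "lin_ext \<Theta> x = 0"
proof -
  let ?D = "word_degree ` keys x"
  have "lin_ext \<Theta> x = lin_ext (\<lambda>u. \<Sum>m\<in>?D. if word_degree u = m then \<Theta> u else 0) x"
    by (rule lin_ext_cong) (simp add: sum.delta)
  also have "\<dots> = (\<Sum>m\<in>?D. lin_ext (\<lambda>u. if word_degree u = m then \<Theta> u else 0) x)"
    unfolding lin_ext_def pm_scale_sum by (rule sum.swap)
  also have "\<dots> = 0"
    by (intro sum.neutral ballI word_relation_in_degree[OF perm sums x low])
  finally show ?thesis .
qed

end

section \<open>The associated graded action on words\<close>

lemma ext_extend_leibniz:
  "ext_extend \<phi> (leibniz T u) = (\<Sum>k<length u. ext_extend (\<lambda>c. \<phi> (u[k := c])) (T (u ! k)))"
  by (simp add: leibniz_def ext_extend_sum ext_extend_lin_ext ext_extend_linear)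

context wedge_module
begin

lemma graded_part_linear:
  "graded_part m 0 = 0" "graded_part m (x + y) = graded_part m x + graded_part m y"
  "graded_part m (pm_scale c x) = ext_scale c (graded_part m x)"
  "graded_part m (x - y) = graded_part m x - graded_part m y"
  "graded_part m (single u c) = (if word_degree u = m then ext_scale c (word_particles u) else 0)"
  by (simp_all add: graded_part_def ext_extend_linear ext_extend_diff)

lemma word_degree_update:
  assumes "k < length u" "u ! k = (i, \<alpha>, \<beta>)"
  shows "word_degree (u[k := (j, \<gamma>, \<beta> + b)]) = word_degree u + b"
proof -
  have "word_degree (u[k := (j, \<gamma>, \<beta> + b)]) = (\<Sum>l<length u. ((\<lambda>l. snd (snd (u ! l)))(k := \<beta> + b)) l)"
    unfolding word_degree_def length_list_update by (intro sum.cong refl) (auto simp: nth_list_update)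
  then show ?thesis
    using sum_upd[OF assms(1), of "\<lambda>l. snd (snd (u ! l))" "\<beta> + b"] assms(2) by (simp add: word_degree_def)
qed

lemma particles_local:
  "(\<And>k. k < n \<Longrightarrow> c k = c' k \<and> d k = d' k) \<Longrightarrow> particles w c d = particles w c' d'"
  unfolding particles_def
  by (intro arg_cong[where f = "ext_extend _"] local_to_vandermonde_orbit[unfolded local_to_def, rule_format]) auto

lemma word_particles_update:
  assumes "length u = n" "k < n"
  shows "word_particles (u[k := (j, \<gamma>, \<delta>)]) = particles ((map fst u)[k := j])
    ((\<lambda>l. fst (snd (u ! l)))(k := \<gamma>)) ((\<lambda>l. snd (snd (u ! l)))(k := \<delta>))"
  unfolding word_particles_def map_update fst_conv
  by (rule particles_local) (use assms in \<open>auto simp: nth_list_update\<close>)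

lemma valid_word_letters: "u \<in> letter_words r n \<Longrightarrow> valid_word (map fst u)"
  by (auto simp: letter_words_def valid_word_def)

lemma word_particles_in_level: "u \<in> letter_words r n \<Longrightarrow> word_degree u < m \<Longrightarrow> word_particles u \<in> level m"
  unfolding word_particles_def
  by (intro particles_in_level valid_word_letters) (auto simp: word_degree_def letter_words_def)

text \<open>Each of the \<open>s\<close> exponents of the layer contributes the constant terms of the diagonal entries.\<close>

lemma layer_trace_symbol_0:
  assumes A: "A \<in> carrier_mat r r"
  shows "layer_trace (V_act r N (map_mat (symbol_lift 0) A)) = of_nat s * constant_trace r A"
proof -
  let ?pd = "\<lambda>k j. \<Sum>a\<le>degree (coeff (A $$ (k, j)) 0). single (a, 0 :: nat) (coeff (coeff (A $$ (k, j)) 0) a)"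
  have T: "acts_by r N ?pd (V_act r N (map_mat (symbol_lift 0) A))"
    using A by (intro acts_by_V_act) (simp add: represents_symbol_lift)
  have "lookup (V_act r N (map_mat (symbol_lift 0) A) (j, i)) (j, i) = coeff (coeff (A $$ (j, j)) 0) 0"
    if ji: "j < r" "i < N" for j i
  proof -
    have "lookup (V_act r N (map_mat (symbol_lift 0) A) (j, i)) (j, i) =
        (\<Sum>k<r. \<Sum>a\<le>degree (coeff (A $$ (k, j)) 0). coeff (coeff (A $$ (k, j)) 0) a *
          lookup (if i + int a < N then single (k, i + int a) 1 else 0) (j, i))"
      unfolding T[unfolded acts_by_def, rule_format, OF ji]
      by (simp add: lookup_sum lin_ext_sum cong: if_cong)
    also have "\<dots> = (\<Sum>k<r. \<Sum>a\<le>degree (coeff (A $$ (k, j)) 0). if a = 0 then (if k = j then coeff (coeff (A $$ (k, j)) 0) 0 else 0) else 0)"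
      using ji by (intro sum.cong refl) (auto simp: lookup_single when_def)
    also have "\<dots> = coeff (coeff (A $$ (j, j)) 0) 0" using ji by simp
    finally show ?thesis .
  qed
  then have "layer_trace (V_act r N (map_mat (symbol_lift 0) A)) =
      (\<Sum>(j, i)\<in>{..<r} \<times> {N - int s..N - 1}. coeff (coeff (A $$ (j, j)) 0) 0)"
    unfolding layer_trace_def sum_list_distinct_conv_sum_set[OF distinct_layer] set_layer
    by (intro sum.cong refl) auto
  also have "\<dots> = of_nat s * constant_trace r A"
    by (simp add: sum.cartesian_product[symmetric] constant_trace_def sum_distrib_left)
  finally show ?thesis .
qed

text \<open>The terms \<open>t = b\<close> of \<open>derivation_particles\<close> for the part of \<open>A\<close> of degree \<open>b\<close> in \<open>y\<close>.\<close>

definition leading_part :: "poly_xy mat \<Rightarrow> nat \<Rightarrow> xy_letter list \<Rightarrow> wedge" where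
  "leading_part A b u = (\<Sum>k<n. \<Sum>j<r. \<Sum>a\<le>degree (coeff (A $$ (j, fst (u ! k))) b).
     ext_scale (coeff (coeff (A $$ (j, fst (u ! k))) b) a)
       (word_particles (u[k := (j, fst (snd (u ! k)) + a, snd (snd (u ! k)) + b)])))"

lemma graded_part_leibniz:
  assumes u: "u \<in> letter_words r n"
  shows "graded_part m (leibniz (letter_action r A) u) =
    (if word_degree u \<le> m then leading_part A (m - word_degree u) u else 0)"
proof -
  have n: "length u = n" using u by (simp add: letter_words_def)
  let ?P = "\<lambda>k j. A $$ (j, fst (u ! k))"
  let ?F = "\<lambda>k j b. \<Sum>a\<le>degree (coeff (?P k j) b). ext_scale (coeff (coeff (?P k j) b) a)
       (word_particles (u[k := (j, fst (snd (u ! k)) + a, snd (snd (u ! k)) + b)]))"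
  have "ext_extend (\<lambda>c. if word_degree (u[k := c]) = m then word_particles (u[k := c]) else 0) (letter_action r A (u ! k)) =
      (\<Sum>j<r. if word_degree u \<le> m then ?F k j (m - word_degree u) else 0)" if k: "k < n" for k
  proof -
    obtain i \<alpha> \<beta> where uk: "u ! k = (i, \<alpha>, \<beta>)" by (cases "u ! k") auto
    have "ext_extend (\<lambda>c. if word_degree (u[k := c]) = m then word_particles (u[k := c]) else 0) (letter_action r A (u ! k)) =
        (\<Sum>j<r. \<Sum>b\<le>degree (?P k j). \<Sum>a\<le>degree (coeff (?P k j) b). ext_scale (coeff (coeff (?P k j) b) a)
           (if word_degree u + b = m then word_particles (u[k := (j, \<alpha> + a, \<beta> + b)]) else 0))"
      using k n uk by (simp add: letter_action_def ext_extend_sum ext_extend_linear word_degree_update[OF _ uk])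
    also have "\<dots> = (\<Sum>j<r. if word_degree u \<le> m then ?F k j (m - word_degree u) else 0)"
    proof (rule sum.cong[OF refl])
      fix j
      have "(\<Sum>b\<le>degree (?P k j). \<Sum>a\<le>degree (coeff (?P k j) b). ext_scale (coeff (coeff (?P k j) b) a)
           (if word_degree u + b = m then word_particles (u[k := (j, \<alpha> + a, \<beta> + b)]) else 0)) =
         (\<Sum>b\<le>degree (?P k j). if b = m - word_degree u then (if word_degree u \<le> m then ?F k j (m - word_degree u) else 0) else 0)"
        by (intro sum.cong refl) (auto simp: uk intro!: sum.neutral)
      also have "\<dots> = (if word_degree u \<le> m then ?F k j (m - word_degree u) else 0)"
        by (auto simp: coeff_eq_0)
      finally show "(\<Sum>b\<le>degree (?P k j). \<Sum>a\<le>degree (coeff (?P k j) b). ext_scale (coeff (coeff (?P k j) b) a)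
           (if word_degree u + b = m then word_particles (u[k := (j, \<alpha> + a, \<beta> + b)]) else 0)) = \<dots>" .
    qed
    finally show ?thesis .
  qed
  then have "graded_part m (leibniz (letter_action r A) u) =
      (\<Sum>k<n. \<Sum>j<r. if word_degree u \<le> m then ?F k j (m - word_degree u) else 0)"
    unfolding graded_part_def ext_extend_leibniz n by (intro sum.cong refl) simp
  then show ?thesis by (simp add: leading_part_def)
qed

text \<open>
  The terms \<open>t < b\<close> of \<open>derivation_particles\<close> have lower degree, and for \<open>b > 0\<close> so has the multiple of
  the vector itself that comes from the layer.
\<close>

lemma wedge_act_word_particles:
  assumes A: "A \<in> carrier_mat r r" and u: "u \<in> letter_words r n"
  shows "wedge_act r N (map_mat (symbol_lift b) A) (word_particles u) -
    (leading_part A b u + (if b = 0 then ext_scale (of_nat s * constant_trace r A) (word_particles u) else 0))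
    \<in> level (word_degree u + b)"
proof -
  let ?T = "V_act r N (map_mat (symbol_lift b) A)"
  let ?c = "\<lambda>k. fst (snd (u ! k))" and ?d = "\<lambda>k. snd (snd (u ! k))" and ?w = "map fst u"
  let ?P = "\<lambda>k j. A $$ (j, fst (u ! k))"
  have n: "length u = n" using u by (simp add: letter_words_def)
  have w: "valid_word ?w" using u by (rule valid_word_letters)
  define pd where "pd k j = (\<Sum>a\<le>degree (coeff (A $$ (k, j)) b). single (a, b) (coeff (coeff (A $$ (k, j)) b) a))" for k j
  have T: "acts_by r N pd ?T"
    using A by (intro acts_by_V_act) (simp add: represents_symbol_lift pd_def)
  define p where "p k j a t = particles (?w[k := j]) (?c(k := ?c k + a)) (?d(k := ?d k + t))" for k j a t
  define R where "R k j a = (\<Sum>t<b. ext_scale (of_nat (b choose t) * of_nat (?c k) ^ (b - t)) (p k j a t))" for k j a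
  have expand: "ext_extend (\<lambda>(a, b). \<Sum>t\<le>b. ext_scale (of_nat (b choose t) * of_nat (?c k) ^ (b - t))
       (particles (?w[k := j]) (?c(k := ?c k + a)) (?d(k := ?d k + t)))) (pd j (?w ! k)) =
     (\<Sum>a\<le>degree (coeff (?P k j) b). ext_scale (coeff (coeff (?P k j) b) a)
       (word_particles (u[k := (j, ?c k + a, ?d k + b)]))) +
     (\<Sum>a\<le>degree (coeff (?P k j) b). ext_scale (coeff (coeff (?P k j) b) a) (R k j a))"
    if k: "k < n" for k j
  proof -
    have top: "p k j a b = word_particles (u[k := (j, ?c k + a, ?d k + b)])" for a
      unfolding p_def word_particles_update[OF n k] ..
    have "{..b} = insert b {..<b}" by auto
    then have sp: "(\<Sum>t\<le>b. ext_scale (of_nat (b choose t) * of_nat (?c k) ^ (b - t)) (p k j a t)) =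
        word_particles (u[k := (j, ?c k + a, ?d k + b)]) + R k j a" for a
      unfolding R_def by (simp add: top)
    have "ext_extend (\<lambda>(a, b). \<Sum>t\<le>b. ext_scale (of_nat (b choose t) * of_nat (?c k) ^ (b - t)) (p k j a t)) (pd j (?w ! k)) =
      (\<Sum>a\<le>degree (coeff (?P k j) b). ext_scale (coeff (coeff (?P k j) b) a)
       (word_particles (u[k := (j, ?c k + a, ?d k + b)]) + R k j a))"
      using k n by (simp add: pd_def ext_extend_sum ext_extend_linear sp)
    then show ?thesis unfolding p_def[symmetric] by (simp add: extv.scale_right_distrib sum.distrib)
  qed
  let ?R = "\<Sum>k<n. \<Sum>j<r. \<Sum>a\<le>degree (coeff (?P k j) b). ext_scale (coeff (coeff (?P k j) b) a) (R k j a)"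
  have eq: "wedge_act r N (map_mat (symbol_lift b) A) (word_particles u) =
      leading_part A b u + (\<Sum>k<n. \<Sum>j<r. \<Sum>a\<le>degree (coeff (?P k j) b). ext_scale (coeff (coeff (?P k j) b) a) (R k j a)) +
      ext_scale (layer_trace ?T) (word_particles u)"
    unfolding wedge_act_def word_particles_def[of u] leading_part_def
    using w expand by (subst derivation_particles[OF T]) (auto simp: valid_word_def sum.distrib)
  have "(\<Sum>k<n. \<Sum>j<r. \<Sum>a\<le>degree (coeff (?P k j) b). ext_scale (coeff (coeff (?P k j) b) a) (R k j a)) \<in> level (word_degree u + b)"
  proof (intro extv.subspace_sum extv.subspace_scale level_subspace)
    fix k j a assume kj: "k \<in> {..<n}" "j \<in> {..<r}"
    have "p k j a t \<in> level (word_degree u + b)" if "t < b" for t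
      unfolding p_def
    proof (rule particles_in_level)
      show "valid_word (?w[k := j])" using w kj by (intro valid_word_update) auto
      show "(\<Sum>l<n. (?d(k := ?d k + t)) l) < word_degree u + b"
        using sum_upd[of k n ?d "?d k + t"] kj that by (simp add: word_degree_def n)
    qed
    then show "R k j a \<in> level (word_degree u + b)"
      unfolding R_def by (intro extv.subspace_sum extv.subspace_scale level_subspace) auto
  qed
  moreover have "ext_scale (layer_trace ?T) (word_particles u) -
      (if b = 0 then ext_scale (of_nat s * constant_trace r A) (word_particles u) else 0) \<in> level (word_degree u + b)"
  proof (cases "b = 0")
    case True
    then show ?thesis by (simp add: layer_trace_symbol_0[OF A] extv.subspace_0[OF level_subspace])
  next
    case False
    then show ?thesis using u by (auto intro!: extv.subspace_scale level_subspace word_particles_in_level)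
  qed
  ultimately have "?R + (ext_scale (layer_trace ?T) (word_particles u) -
      (if b = 0 then ext_scale (of_nat s * constant_trace r A) (word_particles u) else 0)) \<in> level (word_degree u + b)"
    by (intro extv.subspace_add[OF level_subspace])
  then show ?thesis unfolding eq by (simp add: add.assoc add_diff_eq)
qed

end

lemma letter_poly_monom: "letter_poly k \<alpha> \<beta> (xy_monom a b) = single (k, \<alpha> + a, \<beta> + b) 1"
  using letter_poly_xy_monom[of k \<alpha> \<beta> 1 a b] by (simp add: letter_poly_def)

lemma letter_action_E:
  assumes "i < r" "fst l < r"
  shows "letter_action r (E_tensor r i j P) l = (if fst l = j then letter_poly i (fst (snd l)) (snd (snd l)) P else 0)"
proof -
  obtain k \<alpha> \<beta> where l: "l = (k, \<alpha>, \<beta>)" by (cases l) auto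
  have "letter_action r (E_tensor r i j P) l = (\<Sum>i'<r. if i' = i then (if k = j then letter_poly i \<alpha> \<beta> P else 0) else 0)"
    unfolding l letter_action_poly using assms l
    by (intro sum.cong refl) (auto simp: E_tensor_def letter_poly_linear)
  then show ?thesis using assms l by simp
qed

text \<open>The argument of \<open>particles_in_filt_V\<close>, in terms of words.\<close>

lemma word_space_generated:
  assumes T: "pm.subspace T" and r: "r \<ge> 1"
    and act: "\<And>A x. A \<in> carrier_mat r r \<Longrightarrow> x \<in> T \<Longrightarrow> x \<in> word_space r n \<Longrightarrow> word_action r s A x \<in> T"
    and perm: "\<And>u \<pi>. u \<in> letter_words r n \<Longrightarrow> \<pi> permutes {..<n} \<Longrightarrow>
      single (permuted \<pi> u) 1 - single u 1 \<in> T"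
    and start: "single (replicate n (0, 0, 0)) 1 \<in> T"
  shows "word_space r n \<subseteq> T"
proof -
  have word: "single u 1 \<in> T"
    if "u \<in> letter_words r n" "t \<le> n" "\<And>k. t \<le> k \<Longrightarrow> k < n \<Longrightarrow> u ! k = (0, 0, 0)" for u t
    using that
  proof (induction t arbitrary: u)
    case 0
    then have "u = replicate n (0, 0, 0)" by (intro nth_equalityI) (auto simp: letter_words_def)
    then show ?case using start by simp
  next
    case (Suc t)
    have t: "t < n" using Suc.prems by simp
    have lu: "length u = n" using Suc.prems by (simp add: letter_words_def)
    obtain i a b where ut: "u ! t = (i, a, b)" by (cases "u ! t") auto
    have "u ! t \<in> set u" using t lu by simp
    then have i: "i < r" using Suc.prems(1) ut by (auto simp: letter_words_def)
    define u0 where "u0 = u[t := (0, 0, 0)]"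
    have u0: "u0 \<in> letter_words r n" unfolding u0_def using Suc.prems r by (intro letter_words_update) auto
    have zero: "u0 ! k = (0, 0, 0)" if "t \<le> k" "k < n" for k
      using that Suc.prems(3)[of k] lu by (auto simp: u0_def nth_list_update)
    have u0T: "single u0 1 \<in> T" using u0 zero t by (intro Suc.IH) auto
    let ?A = "E_tensor r i 0 (xy_monom a b)"
    let ?G = "\<lambda>k. if fst (u0 ! k) = 0 then
      single (u0[k := (i, fst (snd (u0 ! k)) + a, snd (snd (u0 ! k)) + b)]) (1 :: complex) else 0"
    have letters: "fst (u0 ! k) < r" if "k < n" for k
      using u0 that by (auto simp: letter_words_def)
    have "word_action r s ?A (single u0 1) \<in> T"
      using u0T u0 by (intro act single_in_word_space) (auto simp: E_tensor_def)
    moreover have "word_action r s ?A (single u0 1) =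
        (\<Sum>k<n. ?G k) + pm_scale (of_nat s * constant_trace r ?A) (single u0 1)"
    proof -
      have "leibniz (letter_action r ?A) u0 = (\<Sum>k<length u0. ?G k)"
        unfolding leibniz_def
        using u0 letters i by (intro sum.cong refl) (auto simp: letter_words_def letter_action_E letter_poly_monom)
      then show ?thesis using u0 by (simp add: word_action_def letter_words_def)
    qed
    ultimately have "(\<Sum>k<n. ?G k) \<in> T"
      using pm.subspace_diff[OF T _ pm.subspace_scale[OF T u0T, of "of_nat s * constant_trace r ?A"]]
      by fastforce
    moreover have "(\<Sum>k<n. ?G k) = (\<Sum>k<t. ?G k) + (\<Sum>k=t..<n. ?G k)"
      using t by (simp add: lessThan_atLeast0 sum.atLeastLessThan_concat)
    moreover have "(\<Sum>k<t. ?G k) \<in> T"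
    proof (intro pm.subspace_sum T)
      fix k assume k: "k \<in> {..<t}"
      have "single (u0[k := (i, fst (snd (u0 ! k)) + a, snd (snd (u0 ! k)) + b)]) 1 \<in> T"
        using u0 i zero k t by (intro Suc.IH letter_words_update) auto
      then show "?G k \<in> T" using pm.subspace_0[OF T] by simp
    qed
    ultimately have upper: "(\<Sum>k=t..<n. ?G k) \<in> T" using pm.subspace_diff[OF T] by fastforce
    have "?G k - single u 1 \<in> T" if k: "k \<in> {t..<n}" for k
    proof -
      have "u0[k := (i, a, b)] = permuted (transpose t k) u"
        using k lu ut Suc.prems(3)[of k] t
        by (intro nth_equalityI) (auto simp: u0_def permuted_def nth_list_update transpose_def)
      then have "?G k = single (permuted (transpose t k) u) 1" using zero k by simp
      then show ?thesis
        using k t Suc.prems(1) by (simp only:) (intro perm permutes_swap_id, auto)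
    qed
    then have "(\<Sum>k=t..<n. ?G k - single u 1) \<in> T" by (intro pm.subspace_sum T)
    then have "(\<Sum>k=t..<n. ?G k) - pm_scale (of_nat (n - t)) (single u 1) \<in> T"
      unfolding sum_subtractf pm.sum_constant_scale card_atLeastLessThan .
    from pm.subspace_diff[OF T upper this] have "pm_scale (of_nat (n - t)) (single u 1) \<in> T"
      by simp
    from pm.subspace_scale[OF T this, of "1 / of_nat (n - t)"] show ?case using t by simp
  qed
  show ?thesis
  proof
    fix x assume "x \<in> word_space r n"
    then show "x \<in> T"
    proof (induction rule: word_space_induct)
      case (single u c)
      have "single u 1 \<in> T" using single by (intro word[of u n]) auto
      from pm.subspace_scale[OF T this, of c] show ?case by simp
    qed (auto intro: pm.subspace_0[OF T] pm.subspace_add[OF T])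
  qed
qed

context wedge_module
begin

lemma word_particles_permuted:
  assumes "u \<in> letter_words r n" "\<pi> permutes {..<n}"
  shows "word_particles (permuted \<pi> u) = word_particles u" "word_degree (permuted \<pi> u) = word_degree u"
proof -
  have n: "length u = n" using assms by (simp add: letter_words_def)
  have w: "map fst (permuted \<pi> u) = map (\<lambda>k. map fst u ! \<pi> k) [0..<n]"
    using n permutes_in_image[OF assms(2)] by (auto simp: permuted_def)
  have "word_particles (permuted \<pi> u) = particles (map (\<lambda>k. map fst u ! \<pi> k) [0..<n])
      (\<lambda>k. fst (snd (u ! \<pi> k))) (\<lambda>k. snd (snd (u ! \<pi> k)))"
    unfolding word_particles_def w by (rule particles_local) (simp add: permuted_def n)
  also have "\<dots> = word_particles u" unfolding word_particles_def by (rule particles_permute[OF assms(2)])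
  finally show "word_particles (permuted \<pi> u) = word_particles u" .
  show "word_degree (permuted \<pi> u) = word_degree u"
    using sum.permute[OF assms(2), of "\<lambda>k. snd (snd (u ! k))"]
    by (simp add: word_degree_def permuted_def n comp_def)
qed

theorem graded_part_action:
  assumes A: "A \<in> carrier_mat r r" and x: "x \<in> word_space r n"
  shows "(\<Sum>b\<le>m. wedge_act r N (map_mat (symbol_lift b) A) (graded_part (m - b) x)) -
    graded_part m (word_action r s A x) \<in> level m"
  using x
proof (induction rule: word_space_induct)
  case zero
  show ?case by (simp add: word_action_linear graded_part_linear wedge_act_linear extv.subspace_0[OF level_subspace])
next
  case (add x y)
  from extv.subspace_add[OF level_subspace add.IH] show ?case
    by (simp add: word_action_linear graded_part_linear wedge_act_linear sum.distrib algebra_simps)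
next
  case (single u c)
  let ?D = "\<lambda>b. wedge_act r N (map_mat (symbol_lift b) A)"
  let ?d = "word_degree u"
  have "(\<Sum>b\<le>m. ?D b (graded_part (m - b) (single u c))) =
      (\<Sum>b\<le>m. if b = m - ?d then (if ?d \<le> m then ext_scale c (?D (m - ?d) (word_particles u)) else 0) else 0)"
    by (intro sum.cong refl) (auto simp: graded_part_linear wedge_act_linear)
  then have 1: "(\<Sum>b\<le>m. ?D b (graded_part (m - b) (single u c))) =
      (if ?d \<le> m then ext_scale c (?D (m - ?d) (word_particles u)) else 0)" by simp
  have 2: "graded_part m (word_action r s A (single u c)) =
      (if ?d \<le> m then ext_scale c (leading_part A (m - ?d) u +
        (if m - ?d = 0 then ext_scale (of_nat s * constant_trace r A) (word_particles u) else 0)) else 0)"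
    by (auto simp: word_action_def graded_part_linear graded_part_leibniz[OF single] extv.scale_right_distrib mult.commute)
  show ?case
  proof (cases "?d \<le> m")
    case True
    have "ext_scale c (?D (m - ?d) (word_particles u) - (leading_part A (m - ?d) u +
        (if m - ?d = 0 then ext_scale (of_nat s * constant_trace r A) (word_particles u) else 0))) \<in> level (?d + (m - ?d))"
      by (intro extv.subspace_scale level_subspace wedge_act_word_particles A single)
    then show ?thesis unfolding 1 2 using True by (simp add: extv.scale_right_diff_distrib)
  next
    case False
    then show ?thesis unfolding 1 2 by (simp add: extv.subspace_0[OF level_subspace])
  qed
qed

lemma graded_part_in_level: "x \<in> word_space r n \<Longrightarrow> graded_part m x \<in> level (Suc m)"
  unfolding graded_part_def ext_extend_def word_space_def
  by (intro extv.subspace_sum extv.subspace_scale level_subspace)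
     (auto intro!: word_particles_in_level extv.subspace_0[OF level_subspace])

lemma graded_part_surj:
  assumes "y \<in> level (Suc m)"
  shows "\<exists>x \<in> word_space r n. (\<forall>k. k \<noteq> m \<longrightarrow> graded_part k x = 0) \<and> y - graded_part m x \<in> level m"
  using assms unfolding level_def[of "Suc m"]
proof (induction rule: extv.span_induct_alt)
  case base
  show ?case
    by (intro bexI[of _ 0]) (auto simp: graded_part_linear extv.subspace_0[OF level_subspace] pm.subspace_0[OF word_space_subspace])
next
  case (step a p y)
  then obtain w c d where w: "valid_word w" and d: "(\<Sum>k<n. d k) < Suc m" and p: "p = particles w c d" by blast
  obtain x where x: "x \<in> word_space r n" "\<And>k. k \<noteq> m \<Longrightarrow> graded_part k x = 0" "y - graded_part m x \<in> level m"
    using step.IH by blast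
  let ?u = "map (\<lambda>k. (w ! k, c k, d k)) [0..<n]"
  have u: "?u \<in> letter_words r n" using w valid_word_nth by (auto simp: letter_words_def)
  have deg: "word_degree ?u = (\<Sum>k<n. d k)" by (simp add: word_degree_def)
  have up: "word_particles ?u = p"
  proof -
    have "map fst ?u = w" using w by (intro nth_equalityI) (auto simp: valid_word_def)
    then show ?thesis unfolding word_particles_def p by (simp only:) (rule particles_local, simp)
  qed
  show ?case
  proof (cases "word_degree ?u = m")
    case True
    show ?thesis
    proof (intro bexI[of _ "single ?u a + x"] conjI allI impI)
      show "single ?u a + x \<in> word_space r n"
        by (intro pm.subspace_add word_space_subspace single_in_word_space u x)
    qed (use x True in \<open>simp_all add: graded_part_linear up\<close>)
  next
    case False
    then have "p \<in> level m" unfolding p using w d deg by (intro particles_in_level) auto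
    then have "ext_scale a p + (y - graded_part m x) \<in> level m"
      by (intro extv.subspace_add extv.subspace_scale level_subspace x(3))
    then show ?thesis using x by (intro bexI[of _ x]) (simp_all add: add_diff_eq)
  qed
qed

text \<open>These words suffice to span \<open>V(\<xi>)\<close>, which gives finite dimension.\<close>

definition reduced_words :: "xy_letter list set" where
  "reduced_words = {u \<in> letter_words r n. set u \<subseteq> {..<r} \<times> {..<n} \<times> {..<n}}"

lemma finite_reduced_words: "finite reduced_words"
  by (rule finite_subset[OF _ finite_lists_length_eq[of "{..<r} \<times> {..<n} \<times> {..<n}" n]])
     (auto simp: reduced_words_def letter_words_def)

lemma particles_truncated:
  assumes "k < n" "n \<le> c k" shows "particles w c d = 0"
proof -
  have "vandermonde_orbit n z c d = 0"
    unfolding vandermonde_orbit_def alternating_def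
    using assms by (intro sum.neutral) (auto simp: truncated_monom_def)
  then show ?thesis by (simp add: particles_def ext_extend_linear)
qed

text \<open>
  The Euler operator has the \<open>n\<close> eigenvalues \<open>z, \<dots>, z + n - 1\<close> on the initial positions, so its \<open>n\<close>-th power is a
  combination of lower powers.
\<close>

lemma particles_high_power:
  assumes w: "valid_word w" and k: "k < n" "n \<le> d k"
  shows "particles w c d \<in> level (\<Sum>k<n. d k)"
proof -
  \<comment> \<open>the polynomial whose roots are the values of the Euler operator on the initial positions\<close>
  define q :: "complex poly" where "q = (\<Prod>i<n. [:- (z + of_nat i), 1:])"
  have q_monic: "lead_coeff q = 1" unfolding q_def by (simp add: lead_coeff_prod)
  have q_deg: "degree q = n" unfolding q_def by (subst degree_prod_eq_sum_degree) auto
  have root: "poly q (z + of_nat i) = 0" if "i < n" for i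
    using that by (auto simp: q_def poly_prod prod_zero_iff)
  have pow: "(z + of_nat i) ^ d k = (\<Sum>t<n. - coeff q t * (z + of_nat i) ^ (d k - n + t))" if i: "i < n" for i
  proof -
    let ?y = "z + of_nat i"
    have "0 = (\<Sum>t\<le>n. coeff q t * ?y ^ t)" using root[OF i] by (simp add: poly_altdef q_deg)
    also have "\<dots> = ?y ^ n + (\<Sum>t<n. coeff q t * ?y ^ t)"
      using q_monic by (simp add: q_deg lessThan_Suc_atMost[symmetric])
    finally have "?y ^ n = - (\<Sum>t<n. coeff q t * ?y ^ t)" by (simp add: eq_neg_iff_add_eq_0)
    then have "?y ^ (d k - n) * ?y ^ n = (\<Sum>t<n. - coeff q t * (?y ^ (d k - n) * ?y ^ t))"
      by (simp add: sum_distrib_left sum_negf mult.left_commute)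
    then show ?thesis using k by (simp flip: power_add)
  qed
  have "vandermonde_orbit n z c d = (\<Sum>t<n. pm_scale (- coeff q t) (vandermonde_orbit n z c (d(k := d k - n + t))))"
    unfolding vandermonde_orbit_def alternating_linear(3,4)[symmetric]
  proof (rule alternating_cong[OF refl])
    fix \<sigma> assume "\<sigma> permutes {..<n}"
    then have "\<sigma> k < n" using k permutes_in_image[of \<sigma> "{..<n}" k] by simp
    note pow = pow[OF this]
    have e: "euler_power n z d \<sigma> = (\<Prod>j\<in>{..<n} - {k}. (z + of_nat (\<sigma> j)) ^ d j) * (z + of_nat (\<sigma> k)) ^ d k"
      using euler_power_upd[OF k(1), of z d "d k" \<sigma>] by simp
    show "euler_power n z d \<sigma> = (\<Sum>t<n. - coeff q t * euler_power n z (d(k := d k - n + t)) \<sigma>)"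
      unfolding euler_power_upd[OF k(1)] e pow sum_distrib_left by (simp only: mult.left_commute)
  qed
  then have "particles w c d = (\<Sum>t<n. ext_scale (- coeff q t) (particles w c (d(k := d k - n + t))))"
    by (simp only: particles_def ext_extend_sum ext_extend_linear)
  also have "\<dots> \<in> level (\<Sum>k<n. d k)"
  proof (intro extv.subspace_sum extv.subspace_scale level_subspace particles_in_level w)
    fix t assume "t \<in> {..<n}"
    then show "(\<Sum>l<n. (d(k := d k - n + t)) l) < (\<Sum>k<n. d k)"
      using sum_upd[OF k(1), of d "d k - n + t"] k by simp
  qed
  finally show ?thesis .
qed

lemma word_particles_not_reduced:
  assumes u: "u \<in> letter_words r n" "u \<notin> reduced_words"
  shows "word_particles u \<in> level (word_degree u)"
proof -
  have n: "length u = n" using u by (simp add: letter_words_def)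
  obtain l where l: "l \<in> set u" "l \<notin> {..<r} \<times> {..<n} \<times> {..<n}" using u by (auto simp: reduced_words_def)
  then obtain k where k: "k < n" "u ! k = l" using n by (metis in_set_conv_nth)
  have "fst l < r" using u(1) l(1) by (auto simp: letter_words_def)
  then have "n \<le> fst (snd (u ! k)) \<or> n \<le> snd (snd (u ! k))" using l(2) k by (cases l) auto
  then show ?thesis
  proof
    assume "n \<le> fst (snd (u ! k))"
    then have "word_particles u = 0" unfolding word_particles_def using k by (intro particles_truncated)
    then show ?thesis by (simp add: extv.subspace_0[OF level_subspace])
  next
    assume "n \<le> snd (snd (u ! k))"
    then show ?thesis using particles_high_power[OF valid_word_letters[OF u(1)] k(1), of "\<lambda>k. snd (snd (u ! k))"]
      by (simp add: word_particles_def word_degree_def n)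
  qed
qed

lemma power_sum_in_level:
  assumes "valid_word w" "\<alpha> + \<beta> > 0"
  shows "(\<Sum>k<n. particles w (c(k := c k + \<alpha>)) (d(k := d k + \<beta>))) \<in> level ((\<Sum>k<n. d k) + \<beta>)"
proof -
  have "ext_extend (state w) x \<in> level m" if "x \<in> orbit_filtration n z m" for x m
    using that unfolding orbit_filtration_def
  proof (induction rule: pm.span_induct_alt)
    case base
    show ?case by (simp add: ext_extend_linear extv.subspace_0[OF level_subspace])
  next
    case (step a p y)
    then obtain c d where "p = vandermonde_orbit n z c d" "(\<Sum>k<n. d k) < m" by blast
    then have "ext_extend (state w) p \<in> level m"
      using particles_in_level[OF assms(1)] by (simp add: particles_def)
    then show ?case using step(2)
      by (simp add: ext_extend_linear extv.subspace_add[OF level_subspace] extv.subspace_scale[OF level_subspace])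
  qed
  from this[OF orbit_power_sum_in_filtration] show ?thesis
    using assms by (simp add: particles_def ext_extend_sum)
qed

end

section \<open>Modules presented by words\<close>

lemma permuted_letter_words:
  assumes "u \<in> letter_words r n" "\<pi> permutes {..<n}"
  shows "permuted \<pi> u \<in> letter_words r n"
proof -
  have "mset (permuted \<pi> u) = mset u" using assms by (intro mset_permuted) (simp add: letter_words_def)
  then have "set (permuted \<pi> u) = set u" "length (permuted \<pi> u) = length u"
    by (auto dest: mset_eq_setD mset_eq_length)
  then show ?thesis using assms(1) by (simp add: letter_words_def)
qed

definition word_map :: "nat \<Rightarrow> nat \<Rightarrow> nat \<Rightarrow> 'v gxy_module \<Rightarrow> ((xy_letter list \<Rightarrow>\<^sub>0 complex) \<Rightarrow> 'v) \<Rightarrow> bool" where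
  "word_map r n s M X \<longleftrightarrow>
     X 0 = \<zero>\<^bsub>M\<^esub> \<and>
     (\<forall>x\<in>word_space r n. X x \<in> carrier M) \<and>
     (\<forall>x\<in>word_space r n. \<forall>y\<in>word_space r n. X (x + y) = X x \<oplus>\<^bsub>M\<^esub> X y) \<and>
     (\<forall>c. \<forall>x\<in>word_space r n. X (pm_scale c x) = c \<odot>\<^bsub>M\<^esub> X x) \<and>
     (\<forall>A\<in>carrier_mat r r. \<forall>x\<in>word_space r n. X (word_action r s A x) = act M A (X x))"

definition presents :: "nat \<Rightarrow> nat \<Rightarrow> nat \<Rightarrow> 'v gxy_module \<Rightarrow> ((xy_letter list \<Rightarrow>\<^sub>0 complex) \<Rightarrow> 'v) \<Rightarrow> bool" where
  "presents r n s M X \<longleftrightarrow> word_map r n s M X \<and> carrier M = X ` word_space r n"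

lemma word_mapD:
  assumes "word_map r n s M X"
  shows "X 0 = \<zero>\<^bsub>M\<^esub>" "\<And>x. x \<in> word_space r n \<Longrightarrow> X x \<in> carrier M"
    "\<And>x y. x \<in> word_space r n \<Longrightarrow> y \<in> word_space r n \<Longrightarrow> X (x + y) = X x \<oplus>\<^bsub>M\<^esub> X y"
    "\<And>c x. x \<in> word_space r n \<Longrightarrow> X (pm_scale c x) = c \<odot>\<^bsub>M\<^esub> X x"
    "\<And>A x. A \<in> carrier_mat r r \<Longrightarrow> x \<in> word_space r n \<Longrightarrow> X (word_action r s A x) = act M A (X x)"
  using assms by (auto simp: word_map_def)

lemma word_space_closed:
  "0 \<in> word_space r n"
  "x \<in> word_space r n \<Longrightarrow> y \<in> word_space r n \<Longrightarrow> x + y \<in> word_space r n"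
  "x \<in> word_space r n \<Longrightarrow> y \<in> word_space r n \<Longrightarrow> x - y \<in> word_space r n"
  "x \<in> word_space r n \<Longrightarrow> pm_scale c x \<in> word_space r n"
  using word_space_subspace
  by (auto intro: pm.subspace_0 pm.subspace_add pm.subspace_diff pm.subspace_scale)

lemma vectorspace_class_ringI:
  fixes M :: "(complex, 'v, 'm) module_scheme" (structure)
  assumes "\<zero> \<in> carrier M"
    and "\<And>x y. x \<in> carrier M \<Longrightarrow> y \<in> carrier M \<Longrightarrow> x \<oplus> y \<in> carrier M"
    and "\<And>c x. x \<in> carrier M \<Longrightarrow> c \<odot> x \<in> carrier M"
    and "\<And>x y z. x \<in> carrier M \<Longrightarrow> y \<in> carrier M \<Longrightarrow> z \<in> carrier M \<Longrightarrow> x \<oplus> y \<oplus> z = x \<oplus> (y \<oplus> z)"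
    and "\<And>x y. x \<in> carrier M \<Longrightarrow> y \<in> carrier M \<Longrightarrow> x \<oplus> y = y \<oplus> x"
    and "\<And>x. x \<in> carrier M \<Longrightarrow> \<zero> \<oplus> x = x"
    and "\<And>x. x \<in> carrier M \<Longrightarrow> (-1) \<odot> x \<oplus> x = \<zero>"
    and "\<And>c d x. x \<in> carrier M \<Longrightarrow> (c + d) \<odot> x = c \<odot> x \<oplus> d \<odot> x"
    and "\<And>c x y. x \<in> carrier M \<Longrightarrow> y \<in> carrier M \<Longrightarrow> c \<odot> (x \<oplus> y) = c \<odot> x \<oplus> c \<odot> y"
    and "\<And>c d x. x \<in> carrier M \<Longrightarrow> (c * d) \<odot> x = c \<odot> (d \<odot> x)"
    and "\<And>x. x \<in> carrier M \<Longrightarrow> 1 \<odot> x = x"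
  shows "vectorspace class_ring M"
proof -
  have "abelian_group M"
  proof (rule abelian_groupI)
    show "\<exists>y\<in>carrier M. y \<oplus> x = \<zero>" if "x \<in> carrier M" for x
      using assms(3,7)[OF that] by blast
  qed (use assms in auto)
  then have "Module.module class_ring M"
    using class_cring.cring_axioms assms(3,8-11) by (intro Module.module.intro Module.module_axioms.intro) (auto simp: class_ring_simps)
  then show ?thesis by (intro vectorspace.intro class_field)
qed

text \<open>
  The module axioms are inherited from the word space through the surjection \<open>X\<close>.
\<close>

lemma presents_is_gxy_module:
  fixes M :: "'v gxy_module" (structure)
  assumes P: "presents r n s M X"
  shows "is_gxy_module r M"
proof -
  have X: "word_map r n s M X" and im: "\<And>v. v \<in> carrier M \<Longrightarrow> \<exists>x\<in>word_space r n. v = X x"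
    using P by (auto simp: presents_def)
  note X = word_mapD[OF X]
  note cl = word_space_closed word_action_in_word_space
  have vs: "vectorspace class_ring M"
  proof (rule vectorspace_class_ringI)
    show "\<zero> \<in> carrier M" using X(1) X(2)[of 0] cl by simp
    fix x assume x: "x \<in> carrier M"
    then obtain a where a: "a \<in> word_space r n" "x = X a" using im by blast
    show "c \<odot> x \<in> carrier M" for c using a by (simp add: X(2) cl flip: X(4))
    show "\<zero> \<oplus> x = x" using a by (simp add: cl flip: X(1,3))
    show "(-1) \<odot> x \<oplus> x = \<zero>"
    proof -
      have "pm_scale (-1) a + a = 0" using pm_scale_add_left[of "-1" 1 a] by simp
      moreover have "(-1) \<odot> x \<oplus> x = X (pm_scale (-1) a + a)"
        using a by (simp only: X(3)[OF cl(4)] X(4))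
      ultimately show ?thesis by (simp only: X(1))
    qed
    show "(c + d) \<odot> x = c \<odot> x \<oplus> d \<odot> x" for c d
      using a by (simp add: cl pm_scale_add_left flip: X(3,4))
    show "(c * d) \<odot> x = c \<odot> (d \<odot> x)" for c d
      using a by (simp add: cl flip: X(4))
    show "1 \<odot> x = x" using a by (simp add: cl flip: X(4))
    fix y assume y: "y \<in> carrier M"
    then obtain b where b: "b \<in> word_space r n" "y = X b" using im by blast
    show "x \<oplus> y \<in> carrier M" using a b by (simp add: X(2) cl flip: X(3))
    show "x \<oplus> y = y \<oplus> x" using a b by (simp add: cl add.commute flip: X(3))
    show "c \<odot> (x \<oplus> y) = c \<odot> x \<oplus> c \<odot> y" for c
      using a b by (simp add: cl pm_scale_add_right flip: X(3,4))
    fix z assume "z \<in> carrier M"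
    then obtain c where c: "c \<in> word_space r n" "z = X c" using im by blast
    show "x \<oplus> y \<oplus> z = x \<oplus> (y \<oplus> z)" using a b c by (simp add: cl add.assoc flip: X(3))
  qed
  interpret vectorspace class_ring M by (rule vs)
  have minus: "X (x - y) = X x \<ominus> X y" if "x \<in> word_space r n" "y \<in> word_space r n" for x y
  proof -
    have "X (x - y) \<oplus> X y = X x" using that by (simp add: cl flip: X(3))
    then show ?thesis using that X(2) cl by (metis M.minus_closed M.minus_eq M.add.inv_solve_right)
  qed
  show ?thesis
    unfolding is_gxy_module_def
  proof (intro conjI vs ballI allI)
    fix A :: "poly_xy mat" assume A: "A \<in> carrier_mat r r"
    show "act M A \<in> LinearCombinations.module_hom class_ring M M"
      unfolding LinearCombinations.module_hom_def
    proof (intro CollectI conjI allI impI Pi_I)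
      fix v assume "v \<in> carrier M"
      then obtain x where x: "x \<in> word_space r n" "v = X x" using im by blast
      then show "act M A v \<in> carrier M" by (simp add: X(2) cl A flip: X(5))
    next
      fix v w assume "v \<in> carrier M \<and> w \<in> carrier M"
      then obtain x y where xy: "x \<in> word_space r n" "v = X x" "y \<in> word_space r n" "w = X y" using im by blast
      then show "act M A (v \<oplus> w) = act M A v \<oplus> act M A w"
        using X(5)[OF A, of "x + y"] by (simp add: X(3) cl word_action_linear X(5)[OF A])
    next
      fix c :: complex and v assume "c \<in> carrier class_ring \<and> v \<in> carrier M"
      then obtain x where x: "x \<in> word_space r n" "v = X x" using im by blast
      then show "act M A (c \<odot> v) = c \<odot> act M A v"
        using X(5)[OF A, of "pm_scale c x"] by (simp add: X(4) cl word_action_linear X(5)[OF A])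
    qed
    show "act M ([:[:c:]:] \<cdot>\<^sub>m A) v = c \<odot> act M A v" if v: "v \<in> carrier M" for c :: complex and v
    proof -
      obtain x where x: "x \<in> word_space r n" "v = X x" using im v by blast
      have cA: "[:[:c:]:] \<cdot>\<^sub>m A \<in> carrier_mat r r" using A by simp
      have "act M ([:[:c:]:] \<cdot>\<^sub>m A) v = X (pm_scale c (word_action r s A x))"
        unfolding x(2) X(5)[OF cA x(1), symmetric] word_action_scale[OF A x(1)] ..
      also have "\<dots> = c \<odot> act M A v"
        unfolding x(2) X(5)[OF A x(1), symmetric] by (rule X(4)[OF cl(5)[OF x(1)]])
      finally show ?thesis .
    qed
    fix B :: "poly_xy mat" and v assume B: "B \<in> carrier_mat r r" and "v \<in> carrier M"
    then obtain x where x: "x \<in> word_space r n" "v = X x" using im by blast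
    show "act M (A + B) v = act M A v \<oplus> act M B v"
      unfolding x(2) X(5)[OF A x(1), symmetric] X(5)[OF B x(1), symmetric] X(3)[OF cl(5)[OF x(1)] cl(5)[OF x(1)], symmetric]
        word_action_add[OF A B x(1), symmetric] using A B by (intro X(5)[symmetric] x) simp
    have AB: "A * B - B * A \<in> carrier_mat r r" using A B by (intro minus_carrier_mat) auto
    have "act M (A * B - B * A) v = X (word_action r s A (word_action r s B x) - word_action r s B (word_action r s A x))"
      using X(5)[OF AB x(1)] x by (simp add: word_action_bracket[OF A B x(1)])
    then show "act M (A * B - B * A) v = act M A (act M B v) \<ominus> act M B (act M A v)"
      using x by (simp add: minus cl X(5)[OF A] X(5)[OF B])
  qed
qed

lemma presents_hom:
  assumes P: "presents r n s V X" and Y: "word_map r n s M Y" and M: "is_gxy_module r M"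
    and ker: "\<And>x. x \<in> word_space r n \<Longrightarrow> X x = \<zero>\<^bsub>V\<^esub> \<Longrightarrow> Y x = \<zero>\<^bsub>M\<^esub>"
  shows "\<exists>f\<in>gxy_hom r V M. \<forall>x\<in>word_space r n. f (X x) = Y x"
proof -
  have X: "word_map r n s V X" and im: "carrier V = X ` word_space r n"
    using P by (auto simp: presents_def)
  note X = word_mapD[OF X]
  note Y = word_mapD[OF Y]
  note cl = word_space_closed word_action_in_word_space
  interpret V: vectorspace class_ring V
    using presents_is_gxy_module[OF P] by (simp add: is_gxy_module_def)
  interpret M: vectorspace class_ring M using M by (simp add: is_gxy_module_def)
  have eq: "Y x = Y y" if xy: "x \<in> word_space r n" "y \<in> word_space r n" "X x = X y" for x y
  proof -
    have "X (x - y) \<oplus>\<^bsub>V\<^esub> X y = \<zero>\<^bsub>V\<^esub> \<oplus>\<^bsub>V\<^esub> X y" using xy by (simp add: cl X(2) flip: X(3))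
    then have "X (x - y) = \<zero>\<^bsub>V\<^esub>" using xy by (simp add: cl X(2))
    then have "Y (x - y) = \<zero>\<^bsub>M\<^esub>" using xy by (intro ker) (simp_all add: cl)
    moreover have "Y (x - y) \<oplus>\<^bsub>M\<^esub> Y y = Y x" using xy by (simp add: cl flip: Y(3))
    ultimately show ?thesis using xy by (simp add: Y(2))
  qed
  define f where "f v = Y (SOME x. x \<in> word_space r n \<and> X x = v)" for v
  have f: "f (X x) = Y x" if x: "x \<in> word_space r n" for x
  proof -
    have "(SOME y. y \<in> word_space r n \<and> X y = X x) \<in> word_space r n \<and> X (SOME y. y \<in> word_space r n \<and> X y = X x) = X x"
      using x by (intro someI[of "\<lambda>y. y \<in> word_space r n \<and> X y = X x" x]) simp
    then show ?thesis unfolding f_def using eq x by blast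
  qed
  have "f \<in> gxy_hom r V M"
    unfolding gxy_hom_def LinearCombinations.module_hom_def im
  proof (intro CollectI conjI allI impI ballI Pi_I)
    show "v \<in> X ` word_space r n \<Longrightarrow> f v \<in> carrier M" for v by (auto simp: f Y(2))
    show "v \<in> X ` word_space r n \<and> w \<in> X ` word_space r n \<Longrightarrow> f (v \<oplus>\<^bsub>V\<^esub> w) = f v \<oplus>\<^bsub>M\<^esub> f w" for v w
      by (auto simp: f Y(3) cl simp flip: X(3))
    show "c \<in> carrier class_ring \<and> v \<in> X ` word_space r n \<Longrightarrow> f (c \<odot>\<^bsub>V\<^esub> v) = c \<odot>\<^bsub>M\<^esub> f v" for c :: complex and v
      by (auto simp: f Y(4) cl simp flip: X(4))
    show "A \<in> carrier_mat r r \<Longrightarrow> v \<in> X ` word_space r n \<Longrightarrow> f (act V A v) = act M A (f v)" for A v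
      by (auto simp: f Y(5) cl simp flip: X(5))
  qed
  then show ?thesis using f by blast
qed

lemma presents_generated:
  fixes M :: "'v gxy_module" (structure)
  assumes P: "presents r n s M X" and r: "r \<ge> 1"
    and perm: "\<And>u \<pi>. u \<in> letter_words r n \<Longrightarrow> \<pi> permutes {..<n} \<Longrightarrow>
      X (single (permuted \<pi> u) 1 - single u 1) = \<zero>"
    and a: "a \<noteq> 0"
  shows "gxy_generated_by r M (X (single (replicate n (0, 0, 0)) a))"
  unfolding gxy_generated_by_def
proof (intro allI impI)
  have X: "word_map r n s M X" and im: "carrier M = X ` word_space r n"
    using P by (auto simp: presents_def)
  note X = word_mapD[OF X]
  note cl = word_space_closed word_action_in_word_space
  fix S assume S: "VectorSpace.subspace class_ring S M \<and> X (single (replicate n (0, 0, 0)) a) \<in> S \<and>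
    (\<forall>A\<in>carrier_mat r r. \<forall>u\<in>S. act M A u \<in> S)"
  then have "submodule class_ring S M" by (simp add: subspace_def)
  then interpret submodule class_ring S M .
  have high: "replicate n (0, 0, 0) \<in> letter_words r n" using r by (auto simp: letter_words_def)
  let ?T = "{x \<in> word_space r n. X x \<in> S}"
  have "word_space r n \<subseteq> ?T"
  proof (rule word_space_generated[OF _ r, where s = s])
    show "pm.subspace ?T"
      by (rule pm.subspaceI) (auto simp: cl X(1,3) X(4) class_ring_simps intro!: smult_closed)
    show "word_action r s A x \<in> ?T" if "A \<in> carrier_mat r r" "x \<in> ?T" "x \<in> word_space r n" for A x
      using that S by (auto simp: cl X(5))
    show "single (permuted \<pi> u) 1 - single u 1 \<in> ?T"
      if "u \<in> letter_words r n" "\<pi> permutes {..<n}" for u \<pi>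
      using that by (simp add: cl single_in_word_space perm permuted_letter_words)
    have "(1 / a) \<odot> X (single (replicate n (0, 0, 0)) a) \<in> S"
      using S by (intro smult_closed) (simp_all add: class_ring_simps)
    moreover have "(1 / a) \<odot> X (single (replicate n (0, 0, 0)) a) =
        X (pm_scale (1 / a) (single (replicate n (0, 0, 0)) a))"
      by (rule X(4)[symmetric]) (rule single_in_word_space[OF high])
    ultimately show "single (replicate n (0, 0, 0)) 1 \<in> ?T"
      using a high by (simp add: single_in_word_space)
  qed
  then show "S = carrier M" using subset by (auto simp: im)
qed

lemma presents_fin_dim:
  assumes P: "presents r n s M X" and R: "finite R" "R \<subseteq> letter_words r n"
    and zero: "\<And>u. u \<in> letter_words r n \<Longrightarrow> u \<notin> R \<Longrightarrow> X (single u 1) = \<zero>\<^bsub>M\<^esub>"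
  shows "vectorspace.fin_dim class_ring M"
proof -
  have X: "word_map r n s M X" and im: "carrier M = X ` word_space r n"
    using P by (auto simp: presents_def)
  note X = word_mapD[OF X]
  interpret vectorspace class_ring M
    using presents_is_gxy_module[OF P] by (simp add: is_gxy_module_def)
  let ?A = "(\<lambda>u. X (single u 1)) ` R"
  have A: "?A \<subseteq> carrier M" using R by (auto intro!: X(2) single_in_word_space)
  have sub: "submodule class_ring (span ?A) M" by (rule span_is_submodule[OF A])
  interpret S: submodule class_ring "span ?A" M by (rule sub)
  have "X x \<in> span ?A" if "x \<in> word_space r n" for x
    using that
  proof (induction rule: word_space_induct)
    case zero
    show ?case by (simp add: X(1))
  next
    case (single u c)
    have "X (single u 1) \<in> span ?A"
    proof (cases "u \<in> R")
      case True
      then show ?thesis using in_own_span[OF A] by blast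
    next
      case False
      then show ?thesis using single by (simp add: zero)
    qed
    moreover have "X (single u c) = c \<odot>\<^bsub>M\<^esub> X (single u 1)"
      using X(4)[OF single_in_word_space[OF single], of c 1] by simp
    ultimately show ?case by (simp add: class_ring_simps S.smult_closed)
  next
    case (add x y)
    then show ?case by (simp add: X(3))
  qed
  then have "span ?A = carrier M" using S.subset by (auto simp: im)
  then show ?thesis unfolding fin_dim_def using A R by blast
qed

section \<open>The associated graded module is presented by words\<close>

lemma coset_eq_iff:
  assumes "extv.subspace S"
  shows "x +o S = y +o S \<longleftrightarrow> x - y \<in> S"
proof
  assume "x +o S = y +o S"
  moreover have "x \<in> x +o S" using extv.subspace_0[OF assms] by (auto simp: elt_set_plus_def)
  ultimately show "x - y \<in> S" by (auto simp: elt_set_plus_def)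
next
  assume d: "x - y \<in> S"
  show "x +o S = y +o S"
  proof (intro equalityI subsetI)
    fix z assume "z \<in> x +o S"
    then obtain t where "t \<in> S" "z = y + ((x - y) + t)" by (auto simp: elt_set_plus_def)
    then show "z \<in> y +o S" using extv.subspace_add[OF assms d] unfolding elt_set_plus_def by blast
  next
    fix z assume "z \<in> y +o S"
    then obtain t where "t \<in> S" "z = x + (t - (x - y))" by (auto simp: elt_set_plus_def)
    then show "z \<in> x +o S" using extv.subspace_diff[OF assms _ d] unfolding elt_set_plus_def by blast
  qed
qed

lemma coset_absorb:
  assumes S: "extv.subspace S" and T: "T \<subseteq> S" "0 \<in> T"
  shows "(x +o T) + S = x +o S"
proof (intro equalityI subsetI)
  fix z assume "z \<in> (x +o T) + S"
  then obtain t u where "t \<in> T" "u \<in> S" "z = x + (t + u)" by (auto simp: elt_set_plus_def set_plus_def add.assoc)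
  then show "z \<in> x +o S" using extv.subspace_add[OF S, of t u] T unfolding elt_set_plus_def by blast
next
  fix z assume "z \<in> x +o S"
  then obtain u where "u \<in> S" "z = x + 0 + u" by (auto simp: elt_set_plus_def)
  then show "z \<in> (x +o T) + S" using T unfolding elt_set_plus_def set_plus_def by blast
qed

lemma coset_add:
  assumes "extv.subspace S" shows "(x +o S) + (y +o S) = (x + y) +o S"
proof -
  have "(x +o S) + (y +o S) = y +o ((x +o S) + S)" by (rule set_plus_rearrange4)
  also have "(x +o S) + S = x +o S" using assms by (intro coset_absorb) (auto intro: extv.subspace_0)
  finally show ?thesis by (simp add: set_plus_rearrange2 add.commute)
qed

lemma coset_image:
  assumes D: "\<And>x y. D (x + y) = D x + D y"
  shows "D ` (x +o T) = D x +o D ` T"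
proof -
  have "x +o T = (\<lambda>t. x + t) ` T" "D x +o D ` T = (\<lambda>t. D x + D t) ` T"
    by (auto simp: elt_set_plus_def)
  then show ?thesis by (simp add: image_image D)
qed

lemma coset_sum_absorb:
  assumes S: "extv.subspace S" and I: "finite I" and T: "\<And>b. b \<in> I \<Longrightarrow> T b \<subseteq> S \<and> 0 \<in> T b"
  shows "(\<Sum>b\<in>I. y b +o T b) + S = (\<Sum>b\<in>I. y b) +o S"
  using I T
proof (induction I)
  case empty
  show ?case by (auto simp: elt_set_plus_def set_plus_def set_zero)
next
  case (insert b I)
  have "(\<Sum>b\<in>insert b I. y b +o T b) + S = (y b +o T b) + ((\<Sum>b\<in>I. y b +o T b) + S)"
    using insert.hyps by (simp add: add.assoc)
  also have "\<dots> = (\<Sum>b\<in>I. y b) +o ((y b +o T b) + S)"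
    using insert by (simp add: set_plus_rearrange4)
  also have "(y b +o T b) + S = y b +o S" using insert.prems by (intro coset_absorb[OF S]) auto
  finally show ?case using insert.hyps by (simp add: set_plus_rearrange2 add.commute)
qed

context wedge_module
begin

definition graded_class :: "(xy_letter list \<Rightarrow>\<^sub>0 complex) \<Rightarrow> nat \<Rightarrow> wedge set" where
  "graded_class x = (\<lambda>m. graded_part m x +o level m)"

text \<open>The factor makes the word represent \<open>v\<^sub>\<xi>\<close> itself; without it, it is \<open>n!\<close> times as large on both sides.\<close>

definition highest_word :: "xy_letter list \<Rightarrow>\<^sub>0 complex" where
  "highest_word = single (replicate n (0, 0, 0)) (1 / fact n)"

lemma graded_part_sum: "graded_part m (sum f I) = (\<Sum>i\<in>I. graded_part m (f i))"
  by (induction I rule: infinite_finite_induct) (auto simp: graded_part_linear)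

lemma graded_class_0: "graded_class 0 = level"
  by (simp add: graded_class_def graded_part_linear fun_eq_iff)

lemma graded_class_eq_iff: "graded_class x = graded_class y \<longleftrightarrow> (\<forall>m. graded_part m (x - y) \<in> level m)"
  by (simp add: graded_class_def fun_eq_iff coset_eq_iff[OF level_subspace] graded_part_linear)

text \<open>
  Surjectivity uses that every coset of the filtration has a representative that is a combination of words of
  the right degree (\<open>graded_part_surj\<close>); equivariance is \<open>graded_part_action\<close>.
\<close>

theorem V_module_presented:
  assumes r: "r \<ge> 1" and \<xi>: "\<xi> = (n + s) # replicate (r - 1) s"
  shows "presents r n s (V_module r \<xi> N) graded_class"
  unfolding presents_def word_map_def
proof (intro conjI ballI allI)
  note filt = filt_V_eq_level[OF r \<xi>]
  let ?V = "V_module r \<xi> N"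
  have carrier: "carrier ?V = {f. (\<forall>m. \<exists>u\<in>level (Suc m). f m = u +o level m) \<and> finite {m. f m \<noteq> level m}}"
    by (simp add: V_module_def filt)
  show 0: "graded_class 0 = \<zero>\<^bsub>?V\<^esub>" by (simp add: graded_class_0 V_module_def filt)
  show closed: "graded_class x \<in> carrier ?V" if x: "x \<in> word_space r n" for x
    unfolding carrier
  proof (intro CollectI conjI allI)
    show "\<exists>u\<in>level (Suc m). graded_class x m = u +o level m" for m
      using graded_part_in_level[OF x] by (auto simp: graded_class_def)
    have "graded_part m x = 0" if "m \<notin> word_degree ` keys x" for m
    proof -
      have "graded_part m x = ext_extend (\<lambda>_. 0) x"
        unfolding graded_part_def using that by (intro ext_extend_cong) auto
      then show ?thesis by (simp add: ext_extend_def)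
    qed
    then have "{m. graded_class x m \<noteq> level m} \<subseteq> word_degree ` keys x"
      by (auto simp: graded_class_def)
    then show "finite {m. graded_class x m \<noteq> level m}" by (rule finite_subset) simp
  qed
  show "graded_class (x + y) = graded_class x \<oplus>\<^bsub>?V\<^esub> graded_class y" for x y
    by (simp add: graded_class_def V_module_def coset_add[OF level_subspace] graded_part_linear)
  show "graded_class (pm_scale c x) = c \<odot>\<^bsub>?V\<^esub> graded_class x" for c x
  proof -
    have "ext_scale c ` (y +o level m) + level m = ext_scale c y +o level m" for y m
      unfolding coset_image[of "ext_scale c", OF extv.scale_right_distrib]
      by (intro coset_absorb level_subspace)
         (auto intro!: extv.subspace_scale[OF level_subspace] image_eqI[of _ _ 0] extv.subspace_0[OF level_subspace])
    then show ?thesis by (simp add: graded_class_def V_module_def filt graded_part_linear)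
  qed
  show "graded_class (word_action r s A x) = act ?V A (graded_class x)"
    if A: "A \<in> carrier_mat r r" and x: "x \<in> word_space r n" for A x
  proof
    fix m
    let ?D = "\<lambda>b. wedge_act r N (map_mat (symbol_lift b) A)"
    have D: "?D b ` level (m - b) \<subseteq> level m" if b: "b \<le> m" for b
    proof -
      define pd where "pd k j = (\<Sum>a\<le>degree (coeff (A $$ (k, j)) b). single (a, b) (coeff (coeff (A $$ (k, j)) b) a))" for k j
      have T: "acts_by r N pd (V_act r N (map_mat (symbol_lift b) A))"
        using A by (intro acts_by_V_act) (simp add: represents_symbol_lift pd_def)
      have "keys (pd k j) \<subseteq> {(a, c). c \<le> b}" for k j
        unfolding pd_def by (intro keys_sum_subset) (auto split: if_splits)
      then have "ext_derivation (V_act r N (map_mat (symbol_lift b) A)) y \<in> level (m - b + b)" if "y \<in> level (m - b)" for y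
        using that by (intro derivation_level[OF T]) auto
      then show ?thesis using b by (auto simp: wedge_act_def)
    qed
    have "act ?V A (graded_class x) m = (\<Sum>b\<in>{..m}. ?D b ` (graded_part (m - b) x +o level (m - b))) + level m"
      by (simp add: V_module_def filt graded_class_def)
    also have "\<dots> = (\<Sum>b\<in>{..m}. ?D b (graded_part (m - b) x) +o ?D b ` level (m - b)) + level m"
      by (simp only: coset_image[of "?D _", OF wedge_act_linear(1)])
    also have "\<dots> = (\<Sum>b\<le>m. ?D b (graded_part (m - b) x)) +o level m"
    proof (rule coset_sum_absorb[OF level_subspace finite_atMost], intro conjI)
      show "?D b ` level (m - b) \<subseteq> level m" if "b \<in> {..m}" for b using D that by simp
      show "0 \<in> ?D b ` level (m - b)" for b
        by (rule image_eqI[of _ _ 0]) (simp_all add: wedge_act_linear extv.subspace_0[OF level_subspace])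
    qed
    also have "\<dots> = graded_part m (word_action r s A x) +o level m"
      unfolding coset_eq_iff[OF level_subspace] by (rule graded_part_action[OF A x])
    finally show "graded_class (word_action r s A x) m = act ?V A (graded_class x) m"
      by (simp add: graded_class_def)
  qed
  show "carrier ?V = graded_class ` word_space r n"
  proof
    show "graded_class ` word_space r n \<subseteq> carrier ?V" using closed by blast
    show "carrier ?V \<subseteq> graded_class ` word_space r n"
    proof
      fix f assume "f \<in> carrier ?V"
      then have f: "\<forall>m. \<exists>u\<in>level (Suc m). f m = u +o level m" and fin: "finite {m. f m \<noteq> level m}" (is "finite ?F")
        by (auto simp: carrier)
      obtain u where u: "\<And>m. u m \<in> level (Suc m)" "\<And>m. f m = u m +o level m" using f by metis
      have "\<forall>m. \<exists>x\<in>word_space r n. (\<forall>k. k \<noteq> m \<longrightarrow> graded_part k x = 0) \<and> u m - graded_part m x \<in> level m"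
        using graded_part_surj u(1) by blast
      then obtain y where y: "\<And>m. y m \<in> word_space r n" "\<And>m k. k \<noteq> m \<Longrightarrow> graded_part k (y m) = 0"
        "\<And>m. u m - graded_part m (y m) \<in> level m" by metis
      define x where "x = (\<Sum>m\<in>?F. y m)"
      have "graded_part k x = (if k \<in> ?F then graded_part k (y k) else 0)" for k
      proof -
        have "graded_part k x = (\<Sum>m\<in>?F. if m = k then graded_part k (y k) else 0)"
          unfolding x_def graded_part_sum by (intro sum.cong refl) (auto simp: y(2))
        then show ?thesis using fin by (simp add: sum.delta)
      qed
      then have "f k = graded_part k x +o level k" for k
        using u(2)[of k] y(3)[of k] by (cases "k \<in> ?F") (auto simp: coset_eq_iff[OF level_subspace])
      then have "f = graded_class x" by (auto simp: graded_class_def)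
      moreover have "x \<in> word_space r n" unfolding x_def by (intro pm.subspace_sum word_space_subspace y)
      ultimately show "f \<in> graded_class ` word_space r n" by blast
    qed
  qed
qed

text \<open>The kernel of the map from the word space onto \<open>V(\<xi>)\<close>.\<close>

definition relations :: "(xy_letter list \<Rightarrow>\<^sub>0 complex) set" where
  "relations = {x \<in> word_space r n. \<forall>m. graded_part m x \<in> level m}"

lemma relations_subspace: "pm.subspace relations"
  by (rule pm.subspaceI)
     (auto simp: relations_def graded_part_linear word_space_closed
       intro: extv.subspace_0[OF level_subspace] extv.subspace_add[OF level_subspace] extv.subspace_scale[OF level_subspace])

lemma highest_letters: "r \<ge> 1 \<Longrightarrow> replicate n (0, 0, 0) \<in> letter_words r n"
  by (auto simp: letter_words_def)

lemma power_sum_relation: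
  assumes r: "r \<ge> 1" and ab: "\<alpha> + \<beta> > 0"
  shows "(\<Sum>k<n. single ((replicate n (0, 0, 0))[k := (0, \<alpha>, \<beta>)]) 1) \<in> relations"
  unfolding relations_def
proof (intro CollectI conjI allI)
  let ?u = "replicate n (0, 0, 0) :: xy_letter list"
  have u: "?u \<in> letter_words r n" using r by (rule highest_letters)
  show "(\<Sum>k<n. single (?u[k := (0, \<alpha>, \<beta>)]) 1) \<in> word_space r n"
    using r u by (intro pm.subspace_sum word_space_subspace single_in_word_space letter_words_update) auto
  fix m
  have deg: "word_degree (?u[k := (0, \<alpha>, \<beta>)]) = \<beta>" if "k < n" for k
    using word_degree_update[of k ?u 0 0 0 0 \<alpha> \<beta>] that by (simp add: word_degree_def)
  have "(\<Sum>k<n. word_particles (?u[k := (0, \<alpha>, \<beta>)])) =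
      (\<Sum>k<n. particles (replicate n 0) ((\<lambda>_. 0)(k := 0 + \<alpha>)) ((\<lambda>_. 0)(k := 0 + \<beta>)))"
  proof (rule sum.cong[OF refl])
    fix k assume k: "k \<in> {..<n}"
    have "(replicate n 0)[k := 0] = replicate n (0 :: nat)" using k by (simp add: list_update_same_conv)
    then show "word_particles (?u[k := (0, \<alpha>, \<beta>)]) = particles (replicate n 0) ((\<lambda>_. 0)(k := 0 + \<alpha>)) ((\<lambda>_. 0)(k := 0 + \<beta>))"
      using k by (simp only: word_particles_update[of ?u k] length_replicate lessThan_iff map_replicate fst_conv)
        (rule particles_local, auto)
  qed
  also have "\<dots> \<in> level ((\<Sum>k<n. 0) + \<beta>)"
    using r ab by (intro power_sum_in_level) (auto simp: valid_word_def)
  finally have "(\<Sum>k<n. word_particles (?u[k := (0, \<alpha>, \<beta>)])) \<in> level \<beta>" by simp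
  moreover have "graded_part m (\<Sum>k<n. single (?u[k := (0, \<alpha>, \<beta>)]) 1) =
      (if m = \<beta> then (\<Sum>k<n. word_particles (?u[k := (0, \<alpha>, \<beta>)])) else 0)"
    by (auto simp: graded_part_sum graded_part_linear deg intro!: sum.neutral)
  ultimately show "graded_part m (\<Sum>k<n. single (?u[k := (0, \<alpha>, \<beta>)]) 1) \<in> level m"
    by (simp add: extv.subspace_0[OF level_subspace])
qed

lemma constant_trace_E:
  assumes "i < r" "j < r"
  shows "constant_trace r (E_tensor r i j P) = (if i = j then coeff (coeff P 0) 0 else 0)"
proof -
  have "constant_trace r (E_tensor r i j P) = (\<Sum>k<r. if k = i then (if i = j then coeff (coeff P 0) 0 else 0) else 0)"
    unfolding constant_trace_def E_tensor_def by (intro sum.cong refl) auto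
  then show ?thesis using assms by simp
qed

text \<open>
  Only \<open>E\<^sub>0\<^sub>0 P\<close> acts on the letters of the highest word.  The constant term of \<open>P\<close> gives the factor \<open>n\<close>, and
  the other terms give power sums, which are relations.
\<close>

lemma weight_relation:
  assumes r: "r \<ge> 1" and i: "i < r" and \<xi>: "\<xi> = (n + s) # replicate (r - 1) s"
  shows "word_action r s (E_tensor r i i P) highest_word -
    pm_scale (of_nat (\<xi> ! i) * coeff (coeff P 0) 0) highest_word \<in> relations"
proof -
  let ?u = "replicate n (0, 0, 0) :: xy_letter list"
  let ?E = "E_tensor r i i P"
  let ?h = "single ?u (1 :: complex)"
  let ?c = "\<lambda>a b. coeff (coeff P b) a"
  have main: "lin_ext (leibniz (letter_action r ?E)) ?h - pm_scale (if i = 0 then of_nat n * ?c 0 0 else 0) ?h \<in> relations"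
  proof (cases "i = 0")
    case True
    let ?S = "\<lambda>a b. \<Sum>k<n. single (?u[k := (0, a, b)]) (1 :: complex)"
    have "leibniz (letter_action r ?E) ?u = (\<Sum>k<n. lin_ext (\<lambda>c. single (?u[k := c]) 1) (letter_poly 0 0 0 P))"
      unfolding leibniz_def length_replicate using True r
      by (intro sum.cong refl arg_cong2[of _ _ _ _ lin_ext]) (simp add: letter_action_E)
    also have "\<dots> = (\<Sum>k<n. \<Sum>b\<le>degree P. \<Sum>a\<le>degree (coeff P b). pm_scale (?c a b) (single (?u[k := (0, a, b)]) 1))"
      by (simp add: letter_poly_def lin_ext_sum)
    also have "\<dots> = (\<Sum>b\<le>degree P. \<Sum>a\<le>degree (coeff P b). pm_scale (?c a b) (?S a b))"
      unfolding pm_scale_sum by (rule trans[OF sum.swap], rule sum.cong[OF refl], rule sum.swap)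
    finally have 1: "lin_ext (leibniz (letter_action r ?E)) ?h =
        (\<Sum>b\<le>degree P. \<Sum>a\<le>degree (coeff P b). pm_scale (?c a b) (?S a b))" by simp
    have 2: "pm_scale (of_nat n * ?c 0 0) ?h = (\<Sum>b\<le>degree P. \<Sum>a\<le>degree (coeff P b).
        pm_scale (?c a b) (if a = 0 then (if b = 0 then pm_scale (of_nat n) ?h else 0) else 0))"
    proof -
      have "(\<Sum>b\<le>degree P. \<Sum>a\<le>degree (coeff P b).
        pm_scale (?c a b) (if a = 0 then (if b = 0 then pm_scale (of_nat n) ?h else 0) else 0)) =
        (\<Sum>b\<le>degree P. \<Sum>a\<le>degree (coeff P b). if a = 0 then (if b = 0 then pm_scale (of_nat n * ?c 0 0) ?h else 0) else 0)"
        by (intro sum.cong refl) (auto simp: mult.commute)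
      also have "\<dots> = pm_scale (of_nat n * ?c 0 0) ?h" by (simp add: sum.delta)
      finally show ?thesis by (rule sym)
    qed
    have "?S a b - (if a = 0 then (if b = 0 then pm_scale (of_nat n) ?h else 0) else 0) \<in> relations" for a b
    proof (cases "a = 0 \<and> b = 0")
      case True
      have "?S 0 0 = (\<Sum>k<n. ?h)"
        by (intro sum.cong refl) (simp add: list_update_same_conv[THEN iffD2])
      then have "?S 0 0 = pm_scale (of_nat n) ?h" by (simp only: pm.sum_constant_scale card_lessThan)
      then show ?thesis using True by (simp add: pm.subspace_0[OF relations_subspace])
    next
      case False
      then show ?thesis using power_sum_relation[OF r, of a b] by auto
    qed
    then have "(\<Sum>b\<le>degree P. \<Sum>a\<le>degree (coeff P b). pm_scale (?c a b) (?S a b)) - pm_scale (of_nat n * ?c 0 0) ?h \<in> relations"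
      unfolding 2 sum_subtractf[symmetric] pm_scale_diff_right[symmetric]
      by (intro pm.subspace_sum pm.subspace_scale relations_subspace)
    then show ?thesis by (simp only: 1 if_P[OF True])
  next
    case False
    have "leibniz (letter_action r ?E) ?u = 0"
      unfolding leibniz_def using False i by (intro sum.neutral) (auto simp: letter_action_E)
    then show ?thesis using False by (simp add: pm.subspace_0[OF relations_subspace])
  qed
  have "of_nat (\<xi> ! i) * ?c 0 0 = (if i = 0 then of_nat n * ?c 0 0 else 0) + of_nat s * constant_trace r ?E"
    using i \<xi> by (simp add: constant_trace_E nth_Cons' algebra_simps)
  then have "word_action r s ?E ?h - pm_scale (of_nat (\<xi> ! i) * ?c 0 0) ?h =
      lin_ext (leibniz (letter_action r ?E)) ?h - pm_scale (if i = 0 then of_nat n * ?c 0 0 else 0) ?h"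
    unfolding word_action_def by (simp only: pm_scale_add_left add_diff_cancel_right)
  then have "word_action r s ?E ?h - pm_scale (of_nat (\<xi> ! i) * ?c 0 0) ?h \<in> relations" using main by simp
  from pm.subspace_scale[OF relations_subspace this, of "1 / fact n"]
  have "word_action r s ?E (pm_scale (1 / fact n) ?h) - pm_scale (of_nat (\<xi> ! i) * ?c 0 0) (pm_scale (1 / fact n) ?h) \<in> relations"
    by (simp only: pm_scale_diff_right word_action_linear(2) pm_scale_simps(4) mult.commute[of "1 / fact n"])
  moreover have "pm_scale (1 / fact n) ?h = highest_word" by (simp add: highest_word_def)
  ultimately show ?thesis by (simp only:)
qed

theorem presented_weyl_candidate:
  fixes M :: "'v gxy_module" (structure)
  assumes r: "r \<ge> 1" and \<xi>: "\<xi> = (n + s) # replicate (r - 1) s"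
    and P: "presents r n s M X"
    and ker: "\<And>x. x \<in> relations \<Longrightarrow> X x = \<zero>"
  shows "weyl_candidate r \<xi> M (X highest_word)"
proof -
  have WM: "word_map r n s M X" and im: "carrier M = X ` word_space r n"
    using P by (auto simp: presents_def)
  note X = word_mapD[OF WM]
  note cl = word_space_closed word_action_in_word_space
  have hw: "highest_word \<in> word_space r n"
    unfolding highest_word_def by (intro single_in_word_space highest_letters r)
  have gxy: "is_gxy_module r M" by (rule presents_is_gxy_module[OF P])
  interpret vectorspace class_ring M using gxy by (simp add: is_gxy_module_def)
  have eq: "X x = X y" if "x \<in> word_space r n" "y \<in> word_space r n" "x - y \<in> relations" for x y
  proof -
    have "X (x - y) \<oplus> X y = X x" using that by (simp add: cl flip: X(3))
    then show ?thesis using ker[OF that(3)] that by (simp add: X(2))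
  qed
  have E: "E_tensor r i j Q \<in> carrier_mat r r" for i j Q by (simp add: E_tensor_def)
  show ?thesis
    unfolding weyl_candidate_def
  proof (intro conjI allI impI gxy)
    show "fin_dim"
    proof (rule presents_fin_dim[OF P finite_reduced_words])
      show "reduced_words \<subseteq> letter_words r n" by (auto simp: reduced_words_def)
      show "X (single u 1) = \<zero>" if "u \<in> letter_words r n" "u \<notin> reduced_words" for u
        using that word_particles_not_reduced[OF that]
        by (intro ker) (auto simp: relations_def graded_part_linear single_in_word_space extv.subspace_0[OF level_subspace])
    qed
    show "X highest_word \<in> carrier M" by (rule X(2)[OF hw])
    show "gxy_generated_by r M (X highest_word)"
      unfolding highest_word_def
    proof (rule presents_generated[OF P r])
      fix u \<pi> assume u: "u \<in> letter_words r n" and \<pi>: "\<pi> permutes {..<n}"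
      have "permuted \<pi> u \<in> letter_words r n" using u \<pi> by (rule permuted_letter_words)
      then show "X (single (permuted \<pi> u) 1 - single u 1) = \<zero>"
        using word_particles_permuted[OF u \<pi>] u
        by (intro ker) (simp add: relations_def graded_part_linear cl single_in_word_space extv.subspace_0[OF level_subspace])
    qed simp
    show "act M (E_tensor r i i Q) (X highest_word) = (of_nat (\<xi> ! i) * poly (poly Q 0) 0) \<odot> X highest_word"
      if i: "i < r" for i Q
    proof -
      have "X (word_action r s (E_tensor r i i Q) highest_word) = X (pm_scale (of_nat (\<xi> ! i) * coeff (coeff Q 0) 0) highest_word)"
        using weight_relation[OF r i \<xi>] hw by (intro eq cl)
      then show ?thesis by (simp only: X(5)[OF E hw] X(4)[OF hw] poly_0_coeff_0)
    qed
    show "act M (E_tensor r i j Q) (X highest_word) = \<zero>" if "i < j \<and> j < r" for i j Q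
    proof -
      have "leibniz (letter_action r (E_tensor r i j Q)) (replicate n (0, 0, 0)) = 0"
        unfolding leibniz_def using that by (intro sum.neutral) (auto simp: letter_action_E)
      then have "word_action r s (E_tensor r i j Q) highest_word = 0"
        using that by (simp add: word_action_def highest_word_def constant_trace_E)
      then show ?thesis using X(5)[OF E hw, of i j Q] X(1) by simp
    qed
  qed
qed

end

section \<open>Finite-dimensional highest weight modules\<close>

lemma eigenvectors_independent:
  fixes h :: "('k \<Rightarrow>\<^sub>0 complex) \<Rightarrow> ('k \<Rightarrow>\<^sub>0 complex)"
  assumes h: "\<And>p q. h (p + q) = h p + h q" "\<And>a p. h (pm_scale a p) = pm_scale a (h p)"
    and eig: "\<And>k. k \<in> K \<Longrightarrow> h (x k) = pm_scale (c k) (x k)" and nz: "\<And>k. k \<in> K \<Longrightarrow> x k \<noteq> 0"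
    and inj: "inj_on c K" and fin: "finite K" and sum: "(\<Sum>k\<in>K. pm_scale (a k) (x k)) = 0" and k: "k \<in> K"
  shows "a k = 0"
  using fin eig nz inj sum k
proof (induction K arbitrary: a k)
  case (insert j K)
  have h0: "h 0 = 0" using h(2)[of 0 0] by simp
  have h_sum: "h (sum g I) = (\<Sum>i\<in>I. h (g i))" for g :: "'a \<Rightarrow> ('k \<Rightarrow>\<^sub>0 complex)" and I
    by (induction I rule: infinite_finite_induct) (auto simp: h0 h)
  have 1: "pm_scale (a j) (x j) + (\<Sum>k\<in>K. pm_scale (a k) (x k)) = 0" using insert.hyps insert.prems(4) by simp
  then have "h (pm_scale (a j) (x j) + (\<Sum>k\<in>K. pm_scale (a k) (x k))) = 0" by (simp add: h0)
  then have 2: "pm_scale (a j * c j) (x j) + (\<Sum>k\<in>K. pm_scale (a k * c k) (x k)) = 0"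
    using insert.prems(1) by (simp add: h h_sum)
  have "pm_scale (c j) (pm_scale (a j) (x j) + (\<Sum>k\<in>K. pm_scale (a k) (x k))) = 0" unfolding 1 by simp
  then have 3: "pm_scale (a j * c j) (x j) + (\<Sum>k\<in>K. pm_scale (a k * c j) (x k)) = 0"
    by (simp add: pm_scale_add_right pm_scale_sum mult.commute)
  have "(\<Sum>k\<in>K. pm_scale (a k * (c k - c j)) (x k)) = (\<Sum>k\<in>K. pm_scale (a k * c k) (x k)) - (\<Sum>k\<in>K. pm_scale (a k * c j) (x k))"
    by (simp add: right_diff_distrib pm.scale_left_diff_distrib sum_subtractf)
  also have "\<dots> = 0" using trans[OF 2 3[symmetric]] by (simp only: add_left_cancel diff_self)
  finally have *: "(\<Sum>k\<in>K. pm_scale (a k * (c k - c j)) (x k)) = 0" .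
  have zero: "a k = 0" if "k \<in> K" for k
  proof -
    have "a k * (c k - c j) = 0"
      using insert.prems(1,2,3) that by (intro insert.IH[OF _ _ _ *]) auto
    moreover have "c k \<noteq> c j" using insert.prems(3) insert.hyps that by (auto simp: inj_on_def)
    ultimately show ?thesis by simp
  qed
  then have "pm_scale (a j) (x j) = 0" using 1 by simp
  then have "a j = 0" using insert.prems(2)[of j] pm.scale_eq_0_iff by auto
  then show ?case using zero insert.prems(5) by auto
qed simp

lemma finitely_many_eigenvalues:
  fixes h :: "('k \<Rightarrow>\<^sub>0 complex) \<Rightarrow> ('k \<Rightarrow>\<^sub>0 complex)" and x :: "nat \<Rightarrow> _"
  assumes h: "\<And>p q. h (p + q) = h p + h q" "\<And>a p. h (pm_scale a p) = pm_scale a (h p)"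
    and eig: "\<And>k. h (x k) = pm_scale (c k) (x k)" and inj: "inj c"
    and B: "finite B" "\<And>k. x k \<in> pm.span B"
  shows "finite {k. x k \<noteq> 0}"
proof -
  let ?K = "{k. x k \<noteq> 0}"
  have injx: "inj_on x ?K"
  proof (rule inj_onI)
    fix k l assume kl: "k \<in> ?K" "l \<in> ?K" "x k = x l"
    then have "pm_scale (c k - c l) (x k) = 0" using eig[of k] eig[of l] by (simp add: pm.scale_left_diff_distrib)
    then have "c k = c l" using kl pm.scale_eq_0_iff by auto
    then show "k = l" using inj by (simp add: inj_eq)
  qed
  have "pm.independent (x ` ?K)"
  proof
    assume "pm.dependent (x ` ?K)"
    then obtain T u where T: "finite T" "T \<subseteq> x ` ?K" "(\<Sum>v\<in>T. pm_scale (u v) v) = 0" "\<exists>v\<in>T. u v \<noteq> 0"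
      unfolding pm.dependent_explicit by blast
    obtain L where L: "L \<subseteq> ?K" "T = x ` L" using T(2) by (metis subset_imageE)
    have injL: "inj_on x L" using injx L(1) by (rule inj_on_subset)
    have "finite L" using T(1) L(2) injL by (simp add: finite_image_iff)
    moreover have "(\<Sum>k\<in>L. pm_scale (u (x k)) (x k)) = 0" using T(3) by (simp add: L(2) sum.reindex[OF injL])
    ultimately have "u (x k) = 0" if "k \<in> L" for k
      using L(1) that inj
      by (intro eigenvectors_independent[where a = "\<lambda>k. u (x k)" and K = L and x = x and c = c, OF h eig]) (auto intro: inj_on_subset)
    then show False using T(4) L(2) by auto
  qed
  then have "finite (x ` ?K)" using B pm.independent_span_bound[of B "x ` ?K"] by auto
  then show ?thesis using injx by (simp add: finite_image_iff)
qed

text \<open>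
  If \<open>f\<^sup>n\<^sup>+\<^sup>1 v\<close> were different from zero, then by the usual formula
  \<open>e f\<^sup>k\<^sup>+\<^sup>1 v = (k + 1) (n - k) f\<^sup>k v\<close> all further powers would be so too, and \<open>h\<close> would have infinitely many
  eigenvalues.
\<close>

lemma sl2_lowering_power:
  fixes e f h :: "('k \<Rightarrow>\<^sub>0 complex) \<Rightarrow> ('k \<Rightarrow>\<^sub>0 complex)"
  assumes e: "\<And>a p. e (pm_scale a p) = pm_scale a (e p)"
    and f: "\<And>a p. f (pm_scale a p) = pm_scale a (f p)"
    and h: "\<And>p q. h (p + q) = h p + h q" "\<And>a p. h (pm_scale a p) = pm_scale a (h p)"
    and ef: "\<And>p. e (f p) = f (e p) + h p" and hf: "\<And>p. h (f p) = f (h p) - pm_scale 2 (f p)"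
    and ev: "e v = 0" and hv: "h v = pm_scale (of_nat n) v"
    and B: "finite B" "v \<in> pm.span B" "\<And>p. f p \<in> pm.span B"
  shows "(f ^^ Suc n) v = 0"
proof -
  have hk: "h ((f ^^ k) v) = pm_scale (of_nat n - 2 * of_nat k) ((f ^^ k) v)" for k
  proof (induction k)
    case (Suc k)
    then show ?case by (simp add: hf f algebra_simps flip: pm.scale_left_diff_distrib)
  qed (simp add: hv)
  have ek: "e ((f ^^ Suc k) v) = pm_scale (of_nat (Suc k) * (of_nat n - of_nat k)) ((f ^^ k) v)" for k
  proof (induction k)
    case 0
    have "f 0 = 0" using f[of 0 0] by simp
    then show ?case by (simp add: ef ev hv)
  next
    case (Suc k)
    have "e ((f ^^ Suc (Suc k)) v) = f (e ((f ^^ Suc k) v)) + h ((f ^^ Suc k) v)" by (simp add: ef)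
    also have "\<dots> = pm_scale (of_nat (Suc k) * (of_nat n - of_nat k) + (of_nat n - 2 * of_nat (Suc k))) ((f ^^ Suc k) v)"
      unfolding Suc.IH f hk pm_scale_add_left by simp
    also have "of_nat (Suc k) * (of_nat n - of_nat k) + (of_nat n - 2 * of_nat (Suc k)) = (of_nat (Suc (Suc k)) * (of_nat n - of_nat (Suc k)) :: complex)"
      by (simp add: algebra_simps)
    finally show ?case .
  qed
  show ?thesis
  proof (rule ccontr)
    assume nz: "(f ^^ Suc n) v \<noteq> 0"
    have "(f ^^ (Suc n + k)) v \<noteq> 0" for k
    proof (induction k)
      case (Suc k)
      have "(of_nat (Suc (Suc n + k)) * (of_nat n - of_nat (Suc n + k)) :: complex) \<noteq> 0"
        by (simp flip: of_nat_Suc add: of_nat_eq_iff del: of_nat_add)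
      then show ?case using ek[of "Suc n + k"] Suc e[of 0 0] pm.scale_eq_0_iff by (auto simp del: funpow.simps)
    qed (use nz in simp)
    then have "{Suc n..} \<subseteq> {k. (f ^^ k) v \<noteq> 0}" by (auto dest!: le_Suc_ex simp del: funpow.simps)
    moreover have "finite {k. (f ^^ k) v \<noteq> 0}"
    proof (rule finitely_many_eigenvalues[OF h hk _ B(1)])
      show "inj (\<lambda>k. of_nat n - 2 * of_nat k :: complex)" by (auto simp: inj_def)
      show "(f ^^ k) v \<in> pm.span B" for k by (cases k) (simp_all add: B)
    qed
    ultimately show False using infinite_Ici[of "Suc n"] finite_subset by blast
  qed
qed

context current_rep
begin

lemma act_expand:
  assumes A: "A \<in> carrier_mat r r"
  shows "act A p = (\<Sum>(i, j)\<in>{..<r} \<times> {..<r}. act (E_tensor r i j (A $$ (i, j))) p)"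
proof -
  have zero: "act (0\<^sub>m r r) p = 0" using act_scale[of "0\<^sub>m r r" 0 p] by simp
  let ?M = "\<lambda>S. mat r r (\<lambda>ij. if ij \<in> S then A $$ ij else 0)"
  have "act (?M S) p = (\<Sum>(i, j)\<in>S. act (E_tensor r i j (A $$ (i, j))) p)"
    if "finite S" "S \<subseteq> {..<r} \<times> {..<r}" for S
    using that
  proof (induction S)
    case empty
    have "?M {} = 0\<^sub>m r r" by (intro eq_matI) auto
    then show ?case by (simp add: zero)
  next
    case (insert ij S)
    obtain i j where ij: "ij = (i, j)" by (cases ij)
    have "?M (insert ij S) = E_tensor r i j (A $$ (i, j)) + ?M S"
      using insert.hyps by (intro eq_matI) (auto simp: E_tensor_def ij)
    then have "act (?M (insert ij S)) p = act (E_tensor r i j (A $$ (i, j))) p + act (?M S) p"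
      by (simp add: act_add E_tensor_def)
    then show ?case using insert by (simp add: ij)
  qed
  from this[of "{..<r} \<times> {..<r}"] have "act (?M ({..<r} \<times> {..<r})) p = (\<Sum>(i, j)\<in>{..<r} \<times> {..<r}. act (E_tensor r i j (A $$ (i, j))) p)" by simp
  moreover have "?M ({..<r} \<times> {..<r}) = A" using A by (intro eq_matI) auto
  ultimately show ?thesis by simp
qed

lemma act_E_zero: "act (E_tensor r i j 0) p = 0"
proof -
  have "[:[:0:]:] \<cdot>\<^sub>m E_tensor r i j 0 = E_tensor r i j 0" by (intro eq_matI) auto
  then show ?thesis using act_scale[of "E_tensor r i j 0" 0 p] by simp
qed

text \<open>
  Two entries \<open>j < i\<close> give a triple \<open>E\<^sub>j\<^sub>i, E\<^sub>i\<^sub>j, E\<^sub>j\<^sub>j - E\<^sub>i\<^sub>i\<close> as in \<open>sl2_lowering_power\<close>.  For \<open>j = 0\<close> the weight is \<open>n\<close>.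
  For \<open>j > 0\<close> it is zero, so \<open>E\<^sub>i\<^sub>j\<close> kills \<open>v\<close>, and hence so does \<open>E\<^sub>i\<^sub>j P\<close>, the commutator of \<open>E\<^sub>i\<^sub>i P\<close> and \<open>E\<^sub>i\<^sub>j\<close>.
\<close>

lemma finite_dimensional_highest_weight:
  assumes r: "r \<ge> 1" and B: "finite B" "v \<in> pm.span B" "\<And>A p. A \<in> carrier_mat r r \<Longrightarrow> act A p \<in> pm.span B"
    and upper: "\<And>i j P. i < j \<Longrightarrow> j < r \<Longrightarrow> act (E_tensor r i j P) v = 0"
    and diag: "\<And>i P. i < r \<Longrightarrow> act (E_tensor r i i P) v = pm_scale ((if i = 0 then of_nat n else 0) * poly (poly P 0) 0) v"
  shows "highest_weight_rep r act n v"
proof -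
  have lowering: "(act (E_tensor r i j 1) ^^ Suc m) v = 0"
    if ij: "j < i" "i < r" and m: "of_nat m = (if j = 0 then of_nat n else 0 :: complex)" for i j m
  proof (rule sl2_lowering_power[where e = "act (E_tensor r j i 1)" and B = B and
        h = "\<lambda>p. act (E_tensor r j j 1) p - act (E_tensor r i i 1) p"])
    let ?E = "\<lambda>i j. E_tensor r i j 1"
    have jr: "j < r" using ij by simp
    have bracket: "act (?E a b) (act (?E c d) p) = act (?E c d) (act (?E a b) p) + act (?E a b * ?E c d - ?E c d * ?E a b) p"
      for a b c d p by (simp add: act_bracket)
    note E_tensor_mult [simp] act_diff [simp] act_E_zero [simp]
    show "act (?E j i) (act (?E i j) p) = act (?E i j) (act (?E j i) p) + (act (?E j j) p - act (?E i i) p)" for p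
      unfolding bracket[of j i] using ij jr by simp
    have "act (?E j j) (act (?E i j) p) = act (?E i j) (act (?E j j) p) - act (?E i j) p" for p
      unfolding bracket[of j j] using ij jr by simp
    moreover have "act (?E i i) (act (?E i j) p) = act (?E i j) (act (?E i i) p) + act (?E i j) p" for p
      unfolding bracket[of i i] using ij jr by simp
    moreover have "pm_scale 2 p = p + p" for p :: "'k \<Rightarrow>\<^sub>0 complex"
      using pm_scale_add_left[of 1 1 p] by simp
    ultimately show "act (?E j j) (act (?E i j) p) - act (?E i i) (act (?E i j) p) =
        act (?E i j) (act (?E j j) p - act (?E i i) p) - pm_scale 2 (act (?E i j) p)" for p
      by (simp add: act_diff_vec)
    show "act (?E j j) v - act (?E i i) v = pm_scale (of_nat m) v"
      using diag[OF jr] diag[OF ij(2)] ij m by simp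
    show "act (?E j i) v = 0" using upper ij by simp
  qed (use B in \<open>auto simp: act_scale_vec act_add_vec pm_scale_diff_right\<close>)
  have lower: "act (E_tensor r i j P) v = 0" if ij: "j < i" "i < r" "j \<noteq> 0" for i j P
  proof -
    have f: "act (E_tensor r i j 1) v = 0" using lowering[OF ij(1,2), of 0] ij by simp
    have "E_tensor r i i P * E_tensor r i j 1 - E_tensor r i j 1 * E_tensor r i i P = E_tensor r i j P"
      using ij by (intro eq_matI) (auto simp: E_tensor_mult)
    then have "act (E_tensor r i j P) v = act (E_tensor r i i P) (act (E_tensor r i j 1) v) - act (E_tensor r i j 1) (act (E_tensor r i i P) v)"
      using act_bracket[of "E_tensor r i i P" "E_tensor r i j 1" v] by simp
    then show ?thesis using f diag[of i P] ij act_0 by simp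
  qed
  show ?thesis
  proof
    show "act A v = 0" if A: "A \<in> carrier_mat r r" "\<And>i. i < r \<Longrightarrow> A $$ (i, 0) = 0" for A
      unfolding act_expand[OF A(1)]
    proof (rule sum.neutral, clarify)
      fix i j assume "i < r" "j < r"
      then show "act (E_tensor r i j (A $$ (i, j))) v = 0"
        using act_E_zero[of i 0 v] diag[of i "A $$ (i, i)"] A(2)[of i] upper[of i j] lower[of j i]
        by (cases "j = 0"; cases i j rule: linorder_cases) auto
    qed
  qed (use r diag lowering[of 0 1 n] in auto)
qed

end

theorem fin_dim_coordinates:
  fixes M :: "(complex, 'v, 'm) module_scheme" (structure)
  assumes vs: "vectorspace class_ring M" and fd: "vectorspace.fin_dim class_ring M"
  shows "\<exists>d h. bij_betw h (carrier M) (carrier_vec d) \<and>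
    (\<forall>v\<in>carrier M. \<forall>w\<in>carrier M. h (v \<oplus> w) = h v + h w) \<and>
    (\<forall>c. \<forall>v\<in>carrier M. h (c \<odot> v) = c \<cdot>\<^sub>v h v)"
proof -
  interpret vectorspace class_ring M by (rule vs)
  obtain B where B: "finite B" "basis B" using finite_basis_exists[OF fd] by blast
  have li: "lin_indpt B" and gen: "gen_set B" and BM: "B \<subseteq> carrier M" using B(2) by (auto simp: basis_def)
  obtain f where f: "bij_betw f B {..<card B}" using ex_bij_betw_finite_nat[OF B(1)] by (auto simp: atLeast0LessThan)
  let ?d = "card B"
  define G where "G x = lincomb (\<lambda>b. x $ f b) B" for x :: "complex vec"
  have idx: "f b < ?d" if "b \<in> B" for b using f that by (auto simp: bij_betw_def)
  have G_closed: "G x \<in> carrier M" for x unfolding G_def using BM by (intro lincomb_closed) (auto simp: class_ring_simps)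
  have cong: "lincomb a B = lincomb b B" if "\<And>v. v \<in> B \<Longrightarrow> a v = b v" for a b :: "'v \<Rightarrow> complex"
    using that BM by (intro lincomb_cong) (auto simp: class_ring_simps)
  have G_add: "G (x + y) = G x \<oplus> G y" if "x \<in> carrier_vec ?d" "y \<in> carrier_vec ?d" for x y
  proof -
    have "G (x + y) = lincomb (\<lambda>b. x $ f b \<oplus>\<^bsub>class_ring\<^esub> y $ f b) B"
      unfolding G_def using that idx by (intro cong) (simp add: class_ring_simps)
    also have "\<dots> = G x \<oplus> G y"
      unfolding G_def by (intro lincomb_sum B(1) BM) (auto simp: class_ring_simps)
    finally show ?thesis .
  qed
  have G_scale: "G (c \<cdot>\<^sub>v x) = c \<odot> G x" if "x \<in> carrier_vec ?d" for c x
  proof -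
    have "G (c \<cdot>\<^sub>v x) = lincomb (\<lambda>b. c \<otimes>\<^bsub>class_ring\<^esub> x $ f b) B"
      unfolding G_def using that idx by (intro cong) (simp add: class_ring_simps)
    also have "\<dots> = c \<odot> G x"
      unfolding G_def by (intro lincomb_smult BM) (auto simp: class_ring_simps)
    finally show ?thesis .
  qed
  have inj: "inj_on G (carrier_vec ?d)"
  proof (rule inj_onI)
    fix x y assume x: "x \<in> carrier_vec ?d" and y: "y \<in> carrier_vec ?d" and eq: "G x = G y"
    have "G (x + (-1) \<cdot>\<^sub>v y) = G y \<oplus> (-1) \<odot> G y"
      using x y by (simp add: G_add G_scale eq)
    also have "\<dots> = \<zero>"
    proof -
      have "y + (-1) \<cdot>\<^sub>v y = 0 \<cdot>\<^sub>v y" using y by (intro eq_vecI) auto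
      then have "G y \<oplus> (-1) \<odot> G y = 0 \<odot> G y"
        using G_add[OF y, of "(-1) \<cdot>\<^sub>v y"] G_scale[OF y, of "-1"] G_scale[OF y, of 0] y by simp
      then show ?thesis using smult_l_null[OF G_closed[of y]] by (simp add: class_ring_simps)
    qed
    finally have z: "lincomb (\<lambda>b. (x + (-1) \<cdot>\<^sub>v y) $ f b) B = \<zero>" by (simp add: G_def)
    have coord: "(x + (-1) \<cdot>\<^sub>v y) $ f b = 0" if b: "b \<in> B" for b
    proof (rule ccontr)
      assume "(x + (-1) \<cdot>\<^sub>v y) $ f b \<noteq> 0"
      then have "lin_dep B"
        using z b by (intro lin_dep_crit[OF B(1) subset_refl _ b]) (auto simp: class_ring_simps)
      then show False using li by simp
    qed
    have "x $ i = y $ i" if i: "i < ?d" for i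
    proof -
      obtain b where b: "b \<in> B" "i = f b" using f i by (auto simp: bij_betw_def)
      show ?thesis using coord[OF b(1)] x y i by (simp add: b(2)[symmetric])
    qed
    then show "x = y" using x y by (intro eq_vecI) auto
  qed
  have surj: "G ` carrier_vec ?d = carrier M"
  proof (intro equalityI subsetI)
    fix v assume "v \<in> carrier M"
    then obtain a where a: "lincomb a B = v" using finite_in_span[OF B(1) BM] gen by blast
    have inv: "inv_into B f (f b) = b" if "b \<in> B" for b using f that by (auto simp: bij_betw_def)
    have "G (vec ?d (\<lambda>i. a (inv_into B f i))) = v"
      unfolding G_def a[symmetric] by (intro cong) (simp add: idx inv)
    then show "v \<in> G ` carrier_vec ?d" by (metis imageI vec_carrier)
  qed (use G_closed in auto)
  define h where "h = inv_into (carrier_vec ?d) G"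
  have bij: "bij_betw G (carrier_vec ?d) (carrier M)" using inj surj by (simp add: bij_betw_def)
  have h: "h v \<in> carrier_vec ?d" "G (h v) = v" if "v \<in> carrier M" for v
    using that surj unfolding h_def by (auto intro: inv_into_into f_inv_into_f)
  have hG: "h (G x) = x" if "x \<in> carrier_vec ?d" for x using that inj by (simp add: h_def)
  have "h (v \<oplus> w) = h v + h w" if "v \<in> carrier M" "w \<in> carrier M" for v w
    using hG[of "h v + h w"] h that by (simp add: G_add)
  moreover have "h (c \<odot> v) = c \<cdot>\<^sub>v h v" if "v \<in> carrier M" for c v
    using hG[of "c \<cdot>\<^sub>v h v"] h that by (simp add: G_scale)
  moreover have "bij_betw h (carrier M) (carrier_vec ?d)" unfolding h_def by (rule bij_betw_inv_into[OF bij])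
  ultimately show ?thesis by blast
qed

context highest_weight_rep
begin

lemma act_word_values:
  assumes A: "A \<in> carrier_mat r r" and x: "x \<in> word_space r n"
  shows "act A (lin_ext word_value x) = lin_ext word_value (lin_ext (leibniz (letter_action r A)) x)"
proof -
  have "act A (lin_ext word_value x) = lin_ext (\<lambda>u. act A (word_value u)) x"
    by (simp add: lin_ext_def act_sum_vec[OF A] act_scale_vec[OF A])
  also have "\<dots> = lin_ext (\<lambda>u. lin_ext word_value (leibniz (letter_action r A) u)) x"
    using A by (intro lin_ext_cong_space[OF x]) (auto simp: act_word_value lin_ext_leibniz letter_words_def)
  finally show ?thesis by (simp add: lin_ext_lin_ext)
qed

lemma word_value_highest: "word_value (replicate n (0, 0, 0)) = pm_scale (fact n) v"
proof -
  have "(\<Prod>t<n. of_nat n - of_nat t :: complex) = fact n"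
  proof -
    have "(\<Prod>t<n. of_nat n - of_nat t :: complex) = (\<Prod>t<n. of_nat (n - t))"
      by (intro prod.cong refl) (simp add: of_nat_diff)
    also have "\<dots> = of_nat (\<Prod>t<n. n - t)" by simp
    also have "(\<Prod>t<n. n - t) = fact n" by (simp add: fact_prod_rev atLeast0LessThan)
    finally show ?thesis by simp
  qed
  then show ?thesis
    using normal_prod_E00[of "replicate n 1"]
    by (simp add: word_value_def monom_mat_def xy_monom_0 map_replicate)
qed

end

context wedge_module
begin

text \<open>
  Choose coordinates \<open>E\<close> with left inverse \<open>F\<close>, subtract the character \<open>s tr A(0, 0)\<close>, and send words to
  normally ordered products.
\<close>

theorem candidate_word_map:
  fixes M :: "'v gxy_module" (structure)
  assumes r: "r \<ge> 1" and \<xi>: "\<xi> = (n + s) # replicate (r - 1) s" and cand: "weyl_candidate r \<xi> M m"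
  shows "\<exists>Y. word_map r n s M Y \<and> Y highest_word = m \<and> (\<forall>x\<in>relations. Y x = \<zero>)"
proof -
  have gxy: "is_gxy_module r M" and m: "m \<in> carrier M"
    and diag: "\<And>P i. i < r \<Longrightarrow> act M (E_tensor r i i P) m = (of_nat (\<xi> ! i) * poly (poly P 0) 0) \<odot> m"
    and upper: "\<And>P i j. i < j \<Longrightarrow> j < r \<Longrightarrow> act M (E_tensor r i j P) m = \<zero>"
    and fd: "vectorspace.fin_dim class_ring M"
    using cand by (auto simp: weyl_candidate_def)
  have vs: "vectorspace class_ring M" using gxy by (simp add: is_gxy_module_def)
  interpret vectorspace class_ring M by (rule vs)
  have hom: "act M A \<in> LinearCombinations.module_hom class_ring M M"
    and act_plus: "B \<in> carrier_mat r r \<Longrightarrow> v \<in> carrier M \<Longrightarrow> act M (A + B) v = act M A v \<oplus> act M B v"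
    and act_smult: "v \<in> carrier M \<Longrightarrow> act M ([:[:c:]:] \<cdot>\<^sub>m A) v = c \<odot> act M A v"
    and act_comm: "B \<in> carrier_mat r r \<Longrightarrow> v \<in> carrier M \<Longrightarrow>
      act M (A * B - B * A) v = act M A (act M B v) \<ominus> act M B (act M A v)"
    if "A \<in> carrier_mat r r" for A B v c
    using gxy that by (auto simp: is_gxy_module_def)
  have closed: "act M A v \<in> carrier M" if "A \<in> carrier_mat r r" "v \<in> carrier M" for A v
    using hom[OF that(1)] that(2) by (auto simp: LinearCombinations.module_hom_def)
  have smult_M: "c \<odot> v \<in> carrier M" if "v \<in> carrier M" for c v
    using that by (intro smult_closed) (simp_all add: class_ring_simps)
  obtain d h where h: "bij_betw h (carrier M) (carrier_vec d)"
    and h_add: "\<And>v w. v \<in> carrier M \<Longrightarrow> w \<in> carrier M \<Longrightarrow> h (v \<oplus> w) = h v + h w"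
    and h_scale: "\<And>c v. v \<in> carrier M \<Longrightarrow> h (c \<odot> v) = c \<cdot>\<^sub>v h v"
    using fin_dim_coordinates[OF vs fd] by metis
  have h_carrier: "h v \<in> carrier_vec d" if "v \<in> carrier M" for v using h that by (auto simp: bij_betw_def)
  define E where "E v = (\<Sum>i<d. single i (h v $ i))" for v
  define F where "F p = inv_into (carrier M) h (vec d (lookup p))" for p :: "nat \<Rightarrow>\<^sub>0 complex"
  have F_carrier: "F p \<in> carrier M" for p
    unfolding F_def using h by (intro inv_into_into) (auto simp: bij_betw_def)
  have hF: "h (F p) = vec d (lookup p)" for p
    unfolding F_def using h by (intro f_inv_into_f) (auto simp: bij_betw_def)
  have h_inj: "v = w" if "h v = h w" "v \<in> carrier M" "w \<in> carrier M" for v w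
    using h that by (auto simp: bij_betw_def inj_on_def)
  have lookup_E: "lookup (E v) i = (if i < d then h v $ i else 0)" for v i
    by (simp add: E_def lookup_sum lookup_single when_def)
  have FE: "F (E v) = v" if "v \<in> carrier M" for v
    using that h_carrier[OF that] by (intro h_inj F_carrier) (auto simp: hF lookup_E)
  have E_add: "E (v \<oplus> w) = E v + E w" if "v \<in> carrier M" "w \<in> carrier M" for v w
    using h_carrier[OF that(1)] h_carrier[OF that(2)] that
    by (intro poly_mapping_eqI) (simp add: lookup_E lookup_add h_add)
  have E_scale: "E (c \<odot> v) = pm_scale c (E v)" if "v \<in> carrier M" for c v
    using h_carrier[OF that] that by (intro poly_mapping_eqI) (simp add: lookup_E h_scale)
  have F_add: "F (p + q) = F p \<oplus> F q" for p q
    using F_carrier by (intro h_inj) (auto simp: h_add hF lookup_add intro!: eq_vecI)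
  have F_scale: "F (pm_scale c p) = c \<odot> F p" for c p
    using F_carrier smult_M by (intro h_inj) (auto simp: h_scale hF intro!: eq_vecI)
  have F_0: "F 0 = \<zero>"
    using F_scale[of 0 0] smult_l_null[OF F_carrier[of 0]] by (simp add: class_ring_simps)
  have E_0: "E \<zero> = 0" using E_scale[of "\<zero>" 0] smult_l_null[of "\<zero>"] by (simp add: class_ring_simps)
  have E_minus: "E (v \<ominus> w) = E v - E w" if "v \<in> carrier M" "w \<in> carrier M" for v w
  proof -
    have "v \<ominus> w \<oplus> w = v" using that by (simp add: M.minus_eq M.a_assoc M.l_neg)
    then have "E v = E (v \<ominus> w) + E w" using E_add[of "v \<ominus> w" w] that by simp
    then show ?thesis by simp
  qed
  \<comment> \<open>the twist that makes \<open>(n, 0, \<dots>, 0)\<close> the highest weight\<close>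
  define \<rho> where "\<rho> A p = E (act M A (F p)) - pm_scale (of_nat s * constant_trace r A) (E (F p))" for A p
  have act_lin: "act M A (v \<oplus> w) = act M A v \<oplus> act M A w"
    "act M A (c \<odot> v) = c \<odot> act M A v"
    if "A \<in> carrier_mat r r" "v \<in> carrier M" "w \<in> carrier M" for A v w c
    using hom[OF that(1)] that by (auto simp: LinearCombinations.module_hom_def class_ring_simps)
  note closed_simps = closed F_carrier smult_M act_lin FE E_add E_scale F_add F_scale
  interpret \<rho>: current_rep r \<rho>
  proof
    fix A :: "poly_xy mat" assume A: "A \<in> carrier_mat r r"
    show "\<rho> A (p + q) = \<rho> A p + \<rho> A q" for p q
      using A by (simp add: \<rho>_def closed_simps pm_scale_add_right)
    show "\<rho> A (pm_scale c p) = pm_scale c (\<rho> A p)" for c p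
      using A act_lin(2)[OF A F_carrier F_carrier] by (simp add: \<rho>_def closed F_carrier F_scale E_scale pm_scale_diff_right mult_ac)
    show "\<rho> ([:[:c:]:] \<cdot>\<^sub>m A) p = pm_scale c (\<rho> A p)" for c p
      unfolding \<rho>_def act_smult[OF A F_carrier] constant_trace_linear(2)[OF A A]
      by (simp add: closed[OF A F_carrier] E_scale pm_scale_diff_right mult_ac)
    fix B :: "poly_xy mat" assume B: "B \<in> carrier_mat r r"
    show "\<rho> (A + B) p = \<rho> A p + \<rho> B p" for p
      unfolding \<rho>_def act_plus[OF A B F_carrier] constant_trace_linear(1)[OF A B]
      by (simp add: closed[OF A F_carrier] closed[OF B F_carrier] E_add pm_scale_add_left distrib_left)
    show "\<rho> (A * B - B * A) p = \<rho> A (\<rho> B p) - \<rho> B (\<rho> A p)" for p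
    proof -
      have tw: "\<rho> A p = E (act M A (F p)) + pm_scale (- (of_nat s * constant_trace r A)) (E (F p))" for A p
        by (simp add: \<rho>_def)
      have exp: "\<rho> A (\<rho> B p) = E (act M A (act M B (F p))) + (pm_scale (- (of_nat s * constant_trace r B)) (E (act M A (F p)))
          + pm_scale (- (of_nat s * constant_trace r A)) (E (act M B (F p)))) +
          pm_scale (of_nat s * constant_trace r A * (of_nat s * constant_trace r B)) (E (F p))"
        if A: "A \<in> carrier_mat r r" and B: "B \<in> carrier_mat r r" for A B
      proof -
        have F\<rho>: "F (\<rho> B p) = act M B (F p) \<oplus> (- (of_nat s * constant_trace r B)) \<odot> F p"
          unfolding tw[of B] F_add F_scale FE[OF closed[OF B F_carrier]] FE[OF F_carrier] ..
        have c: "act M B (F p) \<in> carrier M" "F p \<in> carrier M" "act M A (act M B (F p)) \<in> carrier M" "act M A (F p) \<in> carrier M"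
          using A B by (simp_all add: closed F_carrier)
        show ?thesis
          unfolding tw[of A] F\<rho> act_lin(1)[OF A c(1) smult_M[OF c(2)]] act_lin(2)[OF A c(2) c(2)]
            E_add[OF c(3) smult_M[OF c(4)]] E_add[OF c(1) smult_M[OF c(2)]] E_scale[OF c(2)] E_scale[OF c(4)]
          by (simp add: pm_scale_add_right algebra_simps)
      qed
      have "\<rho> (A * B - B * A) p = E (act M A (act M B (F p))) - E (act M B (act M A (F p)))"
        unfolding \<rho>_def act_comm[OF A B F_carrier] constant_trace_linear(3)[OF A B]
        using A B by (simp add: E_minus closed F_carrier)
      then show ?thesis unfolding exp[OF A B] exp[OF B A] by (simp add: mult.commute)
    qed
  qed
  have \<xi>_nth: "\<xi> ! i = (if i = 0 then n + s else s)" if "i < r" for i using that \<xi> by (simp add: nth_Cons')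
  have range: "E v \<in> pm.span ((\<lambda>i. single i 1) ` {..<d})" for v
  proof -
    have "E v = (\<Sum>i<d. pm_scale (h v $ i) (single i 1))" by (simp add: E_def)
    then show ?thesis by (simp only:) (intro pm.span_sum pm.span_scale pm.span_base, auto)
  qed
  have hw: "highest_weight_rep r \<rho> n (E m)"
  proof (rule \<rho>.finite_dimensional_highest_weight[OF r])
    show "finite ((\<lambda>i. single i (1 :: complex)) ` {..<d})" by simp
    show "E m \<in> pm.span ((\<lambda>i. single i 1) ` {..<d})" by (rule range)
    show "\<rho> A p \<in> pm.span ((\<lambda>i. single i 1) ` {..<d})" for A p
      unfolding \<rho>_def by (intro pm.span_diff pm.span_scale range)
    show "\<rho> (E_tensor r i j P) (E m) = 0" if "i < j" "j < r" for i j P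
      using that by (simp add: \<rho>_def FE[OF m] upper E_0 constant_trace_E)
    show "\<rho> (E_tensor r i i P) (E m) = pm_scale ((if i = 0 then of_nat n else 0) * poly (poly P 0) 0) (E m)" if "i < r" for i P
      using that by (simp add: \<rho>_def FE[OF m] diag E_scale[OF m] constant_trace_E \<xi>_nth poly_0_coeff_0
          flip: pm.scale_left_diff_distrib) (simp add: algebra_simps)
  qed
  interpret highest_weight_rep r \<rho> n "E m" by (rule hw)
  define Y where "Y x = F (lin_ext word_value x)" for x
  have "word_map r n s M Y"
    unfolding word_map_def
  proof (intro conjI ballI allI)
    show "Y 0 = \<zero>" by (simp add: Y_def F_0)
    show "Y x \<in> carrier M" for x by (simp add: Y_def F_carrier)
    show "Y (x + y) = Y x \<oplus> Y y" for x y by (simp add: Y_def lin_ext_add F_add)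
    show "Y (pm_scale c x) = c \<odot> Y x" for c x by (simp add: Y_def lin_ext_scale F_scale)
    fix A :: "poly_xy mat" and x assume A: "A \<in> carrier_mat r r" and x: "x \<in> word_space r n"
    let ?w = "lin_ext word_value x"
    have "E (act M A (F ?w)) = \<rho> A ?w + pm_scale (of_nat s * constant_trace r A) (E (F ?w))" by (simp add: \<rho>_def)
    then have "F (E (act M A (F ?w))) = F (\<rho> A ?w) \<oplus> (of_nat s * constant_trace r A) \<odot> F (E (F ?w))"
      by (simp only: F_add F_scale)
    then have "act M A (Y x) = F (\<rho> A ?w) \<oplus> (of_nat s * constant_trace r A) \<odot> F ?w"
      by (simp only: FE[OF closed[OF A F_carrier]] FE[OF F_carrier] Y_def)
    then show "Y (word_action r s A x) = act M A (Y x)"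
      by (simp add: Y_def word_action_def lin_ext_add lin_ext_scale F_add F_scale act_word_values[OF A x])
  qed
  moreover have "Y highest_word = m"
    by (simp add: Y_def highest_word_def word_value_highest FE[OF m])
  moreover have "Y x = \<zero>" if x: "x \<in> relations" for x
  proof -
    have "lin_ext word_value x = 0"
    proof (rule word_relation)
      show "word_value u = word_value u'" if "mset u = mset u'" for u u' using that by (rule word_value_mset)
      show "(\<Sum>k<n. word_value (u[k := (case u ! k of (i, a, b) \<Rightarrow> (i, a + \<alpha>, b + \<beta>))])) = 0"
        if "u \<in> letter_words r n" "\<alpha> + \<beta> > 0" for u \<alpha> \<beta>
        using that by (intro word_value_power_sum) (auto simp: letter_words_def)
    qed (use x in \<open>auto simp: relations_def\<close>)
    then show ?thesis by (simp add: Y_def F_0)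
  qed
  ultimately show ?thesis by blast
qed

end

section \<open>Weyl modules\<close>

lemma gxy_hom_comp: "f \<in> gxy_hom r M N \<Longrightarrow> g \<in> gxy_hom r N L \<Longrightarrow> g \<circ> f \<in> gxy_hom r M L"
  by (auto simp: gxy_hom_def LinearCombinations.module_hom_def Pi_iff)

text \<open>The fixed vectors form a submodule.\<close>

lemma gxy_hom_fixing_generator:
  fixes M :: "'v gxy_module" (structure)
  assumes M: "is_gxy_module r M" and gen: "gxy_generated_by r M v" and v: "v \<in> carrier M"
    and f: "f \<in> gxy_hom r M M" "f v = v" and u: "u \<in> carrier M"
  shows "f u = u"
proof -
  interpret vectorspace class_ring M using M by (simp add: is_gxy_module_def)
  have f': "f (x \<oplus> y) = f x \<oplus> f y" "f (c \<odot> x) = c \<odot> f x" "A \<in> carrier_mat r r \<Longrightarrow> f (act M A x) = act M A (f x)"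
    if "x \<in> carrier M" "y \<in> carrier M" for x y c A
    using f(1) that by (auto simp: gxy_hom_def LinearCombinations.module_hom_def class_ring_simps)
  have smult: "c \<odot> x \<in> carrier M" if "x \<in> carrier M" for c x
    using that by (intro smult_closed) (simp_all add: class_ring_simps)
  let ?S = "{x \<in> carrier M. f x = x}"
  have zero: "f \<zero> = \<zero>"
  proof -
    have z: "0 \<odot> x = \<zero>" if "x \<in> carrier M" for x
      using smult_l_null[OF that] by (simp add: class_ring_simps)
    have "f \<zero> \<in> carrier M" using f(1) by (auto simp: gxy_hom_def LinearCombinations.module_hom_def Pi_iff)
    then show ?thesis using f'(2)[of "\<zero>" "\<zero>" 0] z by simp
  qed
  have "submodule class_ring ?S M"
    by unfold_locales (use zero in \<open>auto simp: f' smult class_ring_simps intro: module_axioms\<close>)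
  then have "VectorSpace.subspace class_ring ?S M" using M by (simp add: subspace_def is_gxy_module_def)
  moreover have "act M A x \<in> ?S" if "A \<in> carrier_mat r r" "x \<in> ?S" for A x
    using M that by (auto simp: f' is_gxy_module_def LinearCombinations.module_hom_def Pi_iff)
  ultimately have "?S = carrier M" using gen v f(2) unfolding gxy_generated_by_def by blast
  then show ?thesis using u by blast
qed

lemma gxy_isomorphicI:
  assumes M: "weyl_candidate r \<xi> M v" and N: "weyl_candidate r \<xi> N w"
    and f: "f \<in> gxy_hom r M N" "f v = w" and g: "g \<in> gxy_hom r N M" "g w = v"
  shows "gxy_isomorphic r M N"
proof -
  have M': "is_gxy_module r M" "gxy_generated_by r M v" "v \<in> carrier M"
    and N': "is_gxy_module r N" "gxy_generated_by r N w" "w \<in> carrier N"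
    using M N by (auto simp: weyl_candidate_def)
  have gf: "g (f u) = u" if "u \<in> carrier M" for u
    using gxy_hom_fixing_generator[OF M' gxy_hom_comp[OF f(1) g(1)] _ that] f(2) g(2) by simp
  have fg: "f (g u) = u" if "u \<in> carrier N" for u
    using gxy_hom_fixing_generator[OF N' gxy_hom_comp[OF g(1) f(1)] _ that] f(2) g(2) by simp
  have "f \<in> carrier M \<rightarrow> carrier N" "g \<in> carrier N \<rightarrow> carrier M"
    using f(1) g(1) by (auto simp: gxy_hom_def LinearCombinations.module_hom_def)
  then have "bij_betw f (carrier M) (carrier N)" using gf fg by (intro bij_betwI[of f _ _ g]) auto
  then show ?thesis using M'(1) N'(1) f(1) by (auto simp: gxy_isomorphic_def)
qed

lemma presents_transport:
  assumes P: "presents r n s V X" and fd: "vectorspace.fin_dim class_ring V"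
  shows "\<exists>(V' :: complex vec gxy_module) X'. presents r n s V' X' \<and>
    (\<forall>x\<in>word_space r n. X' x = \<zero>\<^bsub>V'\<^esub> \<longleftrightarrow> X x = \<zero>\<^bsub>V\<^esub>)"
proof -
  have X: "word_map r n s V X" and im: "carrier V = X ` word_space r n"
    using P by (auto simp: presents_def)
  note X = word_mapD[OF X]
  interpret vectorspace class_ring V
    using presents_is_gxy_module[OF P] by (simp add: is_gxy_module_def)
  obtain d h where h: "bij_betw h (carrier V) (carrier_vec d)"
    and h_add: "\<And>v w. v \<in> carrier V \<Longrightarrow> w \<in> carrier V \<Longrightarrow> h (v \<oplus>\<^bsub>V\<^esub> w) = h v + h w"
    and h_scale: "\<And>c v. v \<in> carrier V \<Longrightarrow> h (c \<odot>\<^bsub>V\<^esub> v) = c \<cdot>\<^sub>v h v"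
    using fin_dim_coordinates[OF vectorspace_axioms fd] by metis
  define V' :: "complex vec gxy_module" where
    "V' = \<lparr>carrier = carrier_vec d, mult = undefined, one = undefined, zero = 0\<^sub>v d, add = (+), smult = (\<cdot>\<^sub>v),
       act = (\<lambda>A v. h (act V A (inv_into (carrier V) h v)))\<rparr>"
  have hc: "h v \<in> carrier_vec d" if "v \<in> carrier V" for v using h that by (auto simp: bij_betw_def)
  have hi: "inv_into (carrier V) h (h v) = v" if "v \<in> carrier V" for v using h that by (auto simp: bij_betw_def)
  have h0: "h \<zero>\<^bsub>V\<^esub> = 0\<^sub>v d"
  proof -
    have "0 \<odot>\<^bsub>V\<^esub> \<zero>\<^bsub>V\<^esub> = \<zero>\<^bsub>V\<^esub>" using smult_l_null[of "\<zero>\<^bsub>V\<^esub>"] by (simp add: class_ring_simps)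
    then have "h \<zero>\<^bsub>V\<^esub> = 0 \<cdot>\<^sub>v h \<zero>\<^bsub>V\<^esub>" using h_scale[of "\<zero>\<^bsub>V\<^esub>" 0] by simp
    also have "\<dots> = 0\<^sub>v d" using hc[of "\<zero>\<^bsub>V\<^esub>"] by (intro eq_vecI) auto
    finally show ?thesis .
  qed
  have "presents r n s V' (h \<circ> X)"
    unfolding presents_def word_map_def
  proof (intro conjI ballI allI)
    show "carrier V' = (h \<circ> X) ` word_space r n"
      using h by (simp add: V'_def bij_betw_def im image_comp)
  qed (simp_all add: V'_def X h0 hc hi h_add h_scale)
  moreover have "(h \<circ> X) x = \<zero>\<^bsub>V'\<^esub> \<longleftrightarrow> X x = \<zero>\<^bsub>V\<^esub>" if "x \<in> word_space r n" for x
    using inj_on_eq_iff[OF bij_betw_imp_inj_on[OF h] X(2)[OF that], of "\<zero>\<^bsub>V\<^esub>"] h0 by (simp add: V'_def)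
  ultimately show ?thesis by blast
qed

lemma (in wedge_module) presented_universal:
  assumes r: "r \<ge> 1" and \<xi>: "\<xi> = (n + s) # replicate (r - 1) s"
    and P: "presents r n s V X" and ker: "\<And>x. x \<in> word_space r n \<Longrightarrow> X x = \<zero>\<^bsub>V\<^esub> \<Longrightarrow> x \<in> relations"
    and M: "weyl_candidate r \<xi> M m"
  shows "\<exists>f\<in>gxy_hom r V M. f (X highest_word) = m"
proof -
  obtain Y where Y: "word_map r n s M Y" "Y highest_word = m" "\<forall>x\<in>relations. Y x = \<zero>\<^bsub>M\<^esub>"
    using candidate_word_map[OF r \<xi> M] by blast
  have "\<exists>f\<in>gxy_hom r V M. \<forall>x\<in>word_space r n. f (X x) = Y x"
    using M ker Y(3) by (intro presents_hom[OF P Y(1)]) (auto simp: weyl_candidate_def)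
  moreover have "highest_word \<in> word_space r n"
    unfolding highest_word_def by (intro single_in_word_space highest_letters r)
  ultimately show ?thesis using Y(2) by metis
qed

theorem theorem3:
  fixes r n s :: nat and N :: int and \<xi> :: "nat list"
  assumes "r \<ge> 1"
    and "\<xi> = (n + s) # replicate (r - 1) s"
  shows "(\<exists>(W :: complex vec gxy_module) v. is_weyl_module r \<xi> W v) \<and>
    (\<forall>(W :: 'w gxy_module) v. is_weyl_module r \<xi> W v \<longrightarrow>
       gxy_isomorphic r W (V_module r \<xi> N))"
proof -
  interpret wedge_module r n s N .
  let ?V = "V_module r \<xi> N"
  have V: "presents r n s ?V graded_class" by (rule V_module_presented[OF assms])
  have kerV: "graded_class x = \<zero>\<^bsub>?V\<^esub> \<longleftrightarrow> x \<in> relations" if "x \<in> word_space r n" for x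
  proof -
    have "graded_class 0 = \<zero>\<^bsub>?V\<^esub>" using V by (simp add: presents_def word_map_def)
    then show ?thesis using that graded_class_eq_iff[of x 0] by (simp add: relations_def)
  qed
  have rel: "x \<in> word_space r n" if "x \<in> relations" for x using that by (simp add: relations_def)
  have cV: "weyl_candidate r \<xi> ?V (graded_class highest_word)"
    using kerV rel by (intro presented_weyl_candidate[OF assms V]) simp
  then have "vectorspace.fin_dim class_ring ?V" by (simp add: weyl_candidate_def)
  then obtain V' :: "complex vec gxy_module" and X' where V': "presents r n s V' X'"
    and "\<forall>x\<in>word_space r n. X' x = \<zero>\<^bsub>V'\<^esub> \<longleftrightarrow> graded_class x = \<zero>\<^bsub>?V\<^esub>"
    using presents_transport[OF V] by blast
  then have kerV': "X' x = \<zero>\<^bsub>V'\<^esub> \<longleftrightarrow> x \<in> relations" if "x \<in> word_space r n" for x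
    using that kerV by simp
  have cV': "weyl_candidate r \<xi> V' (X' highest_word)"
    using kerV' rel by (intro presented_weyl_candidate[OF assms V']) simp
  have "\<exists>f\<in>gxy_hom r V' M. f (X' highest_word) = m" if "weyl_candidate r \<xi> M m"
    for M :: "complex vec gxy_module" and m
    by (rule presented_universal[OF assms V' _ that]) (simp add: kerV')
  then have "is_weyl_module r \<xi> V' (X' highest_word)"
    using cV' by (simp add: is_weyl_module_def)
  moreover have "gxy_isomorphic r W ?V" if weyl: "is_weyl_module r \<xi> W w" for W :: "'w gxy_module" and w
  proof -
    have cW: "weyl_candidate r \<xi> W w" using weyl by (simp add: is_weyl_module_def)
    obtain f where f: "f \<in> gxy_hom r W V'" "f w = X' highest_word"
      using weyl cV' by (auto simp: is_weyl_module_def)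
    obtain e where e: "e \<in> gxy_hom r V' ?V" "e (X' highest_word) = graded_class highest_word"
      using presented_universal[OF assms V' _ cV] kerV' by auto
    obtain g where g: "g \<in> gxy_hom r ?V W" "g (graded_class highest_word) = w"
      using presented_universal[OF assms V _ cW] kerV by auto
    show ?thesis
    proof (rule gxy_isomorphicI[OF cW cV])
      show "e \<circ> f \<in> gxy_hom r W ?V" by (rule gxy_hom_comp[OF f(1) e(1)])
      show "(e \<circ> f) w = graded_class highest_word" by (simp add: f e)
    qed (rule g)+
  qed
  ultimately show ?thesis by blast
qed

end
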